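(* Let $s>-1/4$. Then there is $b>1/2$ such that the following holds. For all $\phi\in H^s(\mathbb{T})$ and $\psi\in H^{s-1}(\mathbb{T})$, there exist $T=T(\|\phi\|_{H^s},\|\psi\|_{H^{s-1}})>0$ and a unique solution $u$ of the periodic initial value problem $$u_{tt}-u_{xx}+u_{xxxx}+(u^2)_{xx}=0,\quad x\in\mathbb{T},\ t>0,\qquad u(0,x)=\phi(x),\quad u_t(0,x)=\psi_x(x),$$ such that $$u\in C([0,T]:H^s(\mathbb{T}))\cap X_{s,b}.$$ Moreover, given $T'\in(0,T)$ there exists $R=R(T')>0$ such that, setting $$W=\{(\tilde\phi,\tilde\psi)\in H^s(\mathbb{T})\times H^{s-1}(\mathbb{T}):\ \|\tilde\phi-\phi\|_{H^s(\mathbb{T})}^2+\|\tilde\psi-\psi\|_{H^{s-1}(\mathbb{T})}^2<R\},$$ the solution map $$S:W\to C([0,T']:H^s(\mathbb{T}))\cap X_{s,b},\qquad (\tilde\phi,\tilde\psi)\mapsto u(t)$$ (where $u$ is the solution with data $u(0)=\tilde\phi$, $u_t(0)=\tilde\psi_x$) is Lipschitz. In addition, if $(\phi,\psi)\in H^{s'}(\mathbb{T})\times H^{s'-1}(\mathbb{T})$ with $s'>s$, then, in the same interval $[0,T]$ with $T=T(\|\phi\|_{H^s},\|\psi\|_{H^{s-1}})$, the periodic initial value problem with data $u(0)=\phi$, $u_t(0)=\psi_x$ has a unique solution $u$ such that $$u\in C([0,T]:H^{s'}(\mathbb{T}))\cap X_{s',b},$$ and, given $T'\in(0,T)$, there exists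 $R'=R'(T')>0$ such that, setting $$W'=\{(\tilde\phi,\tilde\psi)\in H^{s'}(\mathbb{T})\times H^{s'-1}(\mathbb{T}):\ \|\tilde\phi-\phi\|_{H^{s'}(\mathbb{T})}^2+\|\tilde\psi-\psi\|_{H^{s'-1}(\mathbb{T})}^2<R'\},$$ the solution map $$W'\to C([0,T']:H^{s'}(\mathbb{T}))\cap X_{s',b},\qquad (\tilde\phi,\tilde\psi)\mapsto u(t)$$ (where $u$ is the solution with data $u(0)=\tilde\phi$, $u_t(0)=\tilde\psi_x$) is Lipschitz.
   Context: $\mathbb{T}$ is the one-dimensional torus, $\langle y\rangle=1+|y|$, $\gamma(n)=\sqrt{n^2+n^4}$ for $n\in\mathbb{Z}$, and $H^s(\mathbb{T})$ is the Sobolev space with norm $\|f\|_{H^s(\mathbb{T})}=\|\langle n\rangle^s\widehat f(n)\|_{\ell^2_n}$. Let $\mathcal{Y}$ be the space of functions $F:\mathbb{T}\times\mathbb{R}\to\mathbb{C}$ such that $F(x,\cdot)$ belongs to the Schwartz space $S(\mathbb{R})$ for each $x\in\mathbb{T}$ and $F(\cdot,t)\in C^\infty(\mathbb{T})$ for each $t\in\mathbb{R}$. For $s,b\in\mathbb{R}$, $X_{s,b}$ is the completion of $\mathcal{Y}$ with respect to the norm $$\|F\|_{X_{s,b}}=\left\|\langle|\tau|-\gamma(n)\rangle^{b}\langle n\rangle^{s}\widetilde{F}(\tau,n)\right\|_{\ell^2_nL^2_\tau},$$ where $\sim$ denotes the space-time Fourier transform with dual variables $(\tau,n)\in\mathbb{R}\times\mathbb{Z}$.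 For a function $u$ defined on a time interval $[0,T]$, membership in $X_{s,b}$ means that $u$ is the restriction to $[0,T]$ of an element of $X_{s,b}$ (with the corresponding restriction norm, the infimum of $X_{s,b}$-norms of extensions). Solutions are understood in the sense of the Duhamel integral equation on $[0,T]$: $$u(t)=V_c(t)\phi+V_s(t)\psi_x-\int_0^tV_s(t-t')(u^2)_{xx}(t')\,dt',$$ where, on the Fourier side in $x$, $V_c(t)$ is multiplication by $\tfrac12\left(e^{it\gamma(n)}+e^{-it\gamma(n)}\right)$ and $V_s(t)$ is multiplication by $\tfrac{1}{2i\gamma(n)}\left(e^{it\gamma(n)}-e^{-it\gamma(n)}\right)$ (the value at $n=0$ is irrelevant, since $V_s$ is only applied to functions with zero mean, to which it contributes nothing at $n=0$). For $s<0$ the nonlinear term is understood through the convolution $\widetilde u*\widetilde u$ for an extension of $u$ in $X_{s,b}$. *)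

theory Defs
  imports "HOL-Analysis.Analysis"
begin

text \<open>
  The torus is \<open>\<real> / 2\<pi>\<int>\<close>, with \<open>\<hat>f(n) = (1/2\<pi>) \<integral>\<^sub>0\<^bsup>2\<pi>\<^esup> f(x) e\<^bsup>-inx\<^esup> dx\<close>.
  Since Sobolev exponents may be negative, a distribution on the torus is represented by its
  sequence of Fourier coefficients, of type \<open>int \<Rightarrow> complex\<close>.  A time-dependent one is a function
  \<open>u :: real \<Rightarrow> int \<Rightarrow> complex\<close>, where \<open>u t n\<close> is the \<open>n\<close>-th Fourier coefficient in \<open>x\<close> at time \<open>t\<close>.
\<close>

definition bracket :: "real \<Rightarrow> real" where
  "bracket y = 1 + \<bar>y\<bar>"

definition gam :: "int \<Rightarrow> real" where
  "gam n = sqrt (real_of_int n ^ 2 + real_of_int n ^ 4)"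


section \<open>Sobolev spaces on the torus\<close>

definition Hs :: "real \<Rightarrow> (int \<Rightarrow> complex) set" where
  "Hs s = {f. (\<lambda>n. (bracket (real_of_int n) powr s * cmod (f n))\<^sup>2) summable_on UNIV}"

definition Hs_norm :: "real \<Rightarrow> (int \<Rightarrow> complex) \<Rightarrow> real" where
  "Hs_norm s f = sqrt (\<Sum>\<^sub>\<infinity>n. (bracket (real_of_int n) powr s * cmod (f n))\<^sup>2)"

text \<open>The space \<open>C([0,T] : H\<^sup>s)\<close>; only the values of \<open>u\<close> on \<open>[0,T]\<close> matter.\<close>

definition C_Hs :: "real \<Rightarrow> real \<Rightarrow> (real \<Rightarrow> int \<Rightarrow> complex) set" where
  "C_Hs s T = {u. (\<forall>t\<in>{0..T}. u t \<in> Hs s) \<and>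
     (\<forall>t\<in>{0..T}. ((\<lambda>t'. Hs_norm s (\<lambda>n. u t' n - u t n)) \<longlongrightarrow> 0) (at t within {0..T}))}"

definition C_Hs_norm :: "real \<Rightarrow> real \<Rightarrow> (real \<Rightarrow> int \<Rightarrow> complex) \<Rightarrow> real" where
  "C_Hs_norm s T u = (SUP t\<in>{0..T}. Hs_norm s (u t))"


section \<open>The spaces \<open>X\<^sub>s\<^sub>,\<^sub>b\<close>\<close>

text \<open>\<open>D k\<close> is the \<open>k\<close>-th derivative of \<open>f\<close> (and is determined by \<open>f\<close>).\<close>

definition derivatives :: "(real \<Rightarrow> complex) \<Rightarrow> (nat \<Rightarrow> real \<Rightarrow> complex) \<Rightarrow> bool" where
  "derivatives f D \<longleftrightarrow>
     D 0 = f \<and> (\<forall>k x. (D k has_vector_derivative D (Suc k) x) (at x))"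

definition smooth :: "(real \<Rightarrow> complex) \<Rightarrow> bool" where
  "smooth f \<longleftrightarrow> (\<exists>D. derivatives f D)"

definition schwartz :: "(real \<Rightarrow> complex) \<Rightarrow> bool" where
  "schwartz f \<longleftrightarrow>
     (\<exists>D. derivatives f D \<and> (\<forall>j k. bounded (range (\<lambda>t. complex_of_real (t ^ j) * D k t))))"

text \<open>Functions \<open>F x t\<close> on \<open>\<T> \<times> \<real>\<close>, i.e. \<open>2\<pi>\<close>-periodic in \<open>x\<close>.\<close>

definition Yspace :: "(real \<Rightarrow> real \<Rightarrow> complex) set" where
  "Yspace = {F. (\<forall>x t. F (x + 2 * pi) t = F x t) \<and>
     (\<forall>x. schwartz (F x)) \<and> (\<forall>t. smooth (\<lambda>x. F x t))}"

definition st_fourier :: "(real \<Rightarrow> real \<Rightarrow> complex) \<Rightarrow> int \<Rightarrow> real \<Rightarrow> complex" where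
  "st_fourier F n \<tau> = complex_of_real (1 / (2 * pi)) *
     (LINT p:({0..2*pi} \<times> UNIV)|lborel.
        exp (- \<i> * complex_of_real (real_of_int n * fst p + \<tau> * snd p)) * F (fst p) (snd p))"

definition Xsb_normsq :: "real \<Rightarrow> real \<Rightarrow> (int \<Rightarrow> real \<Rightarrow> complex) \<Rightarrow> ennreal" where
  "Xsb_normsq s b G = (\<integral>\<^sup>+n. (\<integral>\<^sup>+\<tau>. ennreal
      ((bracket (\<bar>\<tau>\<bar> - gam n) powr b * bracket (real_of_int n) powr s * cmod (G n \<tau>))\<^sup>2)
      \<partial>lborel) \<partial>count_space UNIV)"

definition Xsb_norm :: "real \<Rightarrow> real \<Rightarrow> (int \<Rightarrow> real \<Rightarrow> complex) \<Rightarrow> real" where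
  "Xsb_norm s b G = sqrt (enn2real (Xsb_normsq s b G))"

text \<open>
  The completion of \<open>Yspace\<close> in the \<open>X\<^sub>s\<^sub>,\<^sub>b\<close> norm, realised through the space-time Fourier transform
  as the closure of the transforms of \<open>Yspace\<close> in the (complete) weighted \<open>\<ell>\<^sup>2\<^sub>n L\<^sup>2\<^sub>\<tau>\<close> space.
  The separate smoothness conditions in \<open>Yspace\<close> do not make \<open>F\<close> integrable on \<open>\<T> \<times> \<real>\<close>; only
  those \<open>F\<close> that are, and whose norm is finite, can be used for the completion.
  An element \<open>G\<close> is the transform \<open>\<tilde>u(\<tau>,n) = G n \<tau>\<close>, up to equality for almost every \<open>\<tau>\<close>.
\<close>

definition Xsb :: "real \<Rightarrow> real \<Rightarrow> (int \<Rightarrow> real \<Rightarrow> complex) set" where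
  "Xsb s b = {G. (\<forall>n. G n \<in> borel_measurable lborel) \<and> Xsb_normsq s b G < \<infinity> \<and>
     (\<forall>\<epsilon>>0. \<exists>F\<in>Yspace. set_integrable lborel ({0..2*pi} \<times> UNIV) (\<lambda>p. F (fst p) (snd p)) \<and>
        Xsb_normsq s b (st_fourier F) < \<infinity> \<and>
        Xsb_normsq s b (\<lambda>n \<tau>. G n \<tau> - st_fourier F n \<tau>) < ennreal \<epsilon>)}"

text \<open>
  Inverse Fourier transform in time.  For \<open>b > 1/2\<close> and \<open>G \<in> Xsb s b\<close> each \<open>G n\<close> is in \<open>L\<^sup>1\<close> by
  Cauchy-Schwarz, so the integral converges absolutely for every \<open>t\<close> and the element of
  \<open>X\<^sub>s\<^sub>,\<^sub>b\<close> is a genuine function of time.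
\<close>

definition time_slice :: "(int \<Rightarrow> real \<Rightarrow> complex) \<Rightarrow> real \<Rightarrow> int \<Rightarrow> complex" where
  "time_slice G t n =
     complex_of_real (1 / (2 * pi)) * (LINT \<tau>|lborel. exp (\<i> * complex_of_real (t * \<tau>)) * G n \<tau>)"

definition extensions ::
    "real \<Rightarrow> real \<Rightarrow> real \<Rightarrow> (real \<Rightarrow> int \<Rightarrow> complex) \<Rightarrow> (int \<Rightarrow> real \<Rightarrow> complex) set" where
  "extensions s b T u = {G \<in> Xsb s b. \<forall>t\<in>{0..T}. u t = time_slice G t}"

definition XsbT :: "real \<Rightarrow> real \<Rightarrow> real \<Rightarrow> (real \<Rightarrow> int \<Rightarrow> complex) set" where
  "XsbT s b T = {u. extensions s b T u \<noteq> {}}"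

definition XsbT_norm :: "real \<Rightarrow> real \<Rightarrow> real \<Rightarrow> (real \<Rightarrow> int \<Rightarrow> complex) \<Rightarrow> real" where
  "XsbT_norm s b T u = (INF G\<in>extensions s b T u. Xsb_norm s b G)"


section \<open>The Duhamel equation\<close>

definition Vc :: "real \<Rightarrow> int \<Rightarrow> complex" where
  "Vc t n = (exp (\<i> * complex_of_real (t * gam n)) + exp (- \<i> * complex_of_real (t * gam n))) / 2"

text \<open>At \<open>n = 0\<close> this is \<open>0\<close>, by division by zero; it is only applied to zero-mean functions.\<close>

definition Vs :: "real \<Rightarrow> int \<Rightarrow> complex" where
  "Vs t n = (exp (\<i> * complex_of_real (t * gam n)) - exp (- \<i> * complex_of_real (t * gam n)))
     / (2 * \<i> * complex_of_real (gam n))"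

definition dx :: "(int \<Rightarrow> complex) \<Rightarrow> int \<Rightarrow> complex" where
  "dx f n = \<i> * of_int n * f n"

text \<open>Fourier coefficients of \<open>f\<^sup>2\<close>, for \<open>f \<in> L\<^sup>2\<close>.\<close>

definition square :: "(int \<Rightarrow> complex) \<Rightarrow> int \<Rightarrow> complex" where
  "square f n = (\<Sum>\<^sub>\<infinity>m. f m * f (n - m))"

text \<open>
  Space-time Fourier transform of the square of the element of \<open>X\<^sub>s\<^sub>,\<^sub>b\<close> with transform \<open>G\<close>;
  the factor \<open>1/2\<pi>\<close> comes from the normalisation of the transform in time.
\<close>

definition st_square :: "(int \<Rightarrow> real \<Rightarrow> complex) \<Rightarrow> int \<Rightarrow> real \<Rightarrow> complex" where
  "st_square G n \<tau> = complex_of_real (1 / (2 * pi)) *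
     (\<Sum>\<^sub>\<infinity>m. LINT \<sigma>|lborel. G m \<sigma> * G (n - m) (\<tau> - \<sigma>))"

text \<open>
  The integral \<open>\<integral>\<^sub>0\<^sup>t V\<^sub>s(t-t') (u\<^sup>2)\<^sub>x\<^sub>x(t') dt'\<close>.  For \<open>s \<ge> 0\<close> the slices \<open>u(t')\<close> are in \<open>L\<^sup>2\<close> and the
  square is the pointwise one.  For \<open>s < 0\<close> the space-time distribution \<open>u\<^sup>2\<close> is defined by its
  transform \<open>st_square G\<close>, where \<open>G\<close> is an extension of \<open>u\<close>, and the operator
  \<open>f \<mapsto> \<integral>\<^sub>0\<^sup>t V\<^sub>s(t-t') f(t') dt'\<close> is applied to each of its time frequencies \<open>e\<^bsup>it'\<tau>\<^esup>\<close>: for fixed \<open>n\<close>,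
  \<open>u\<^sup>2\<close> need not be a function of time, but the kernel decays like \<open>1/\<langle>|\<tau>|-\<gamma>(n)\<rangle>\<close> and the integral
  over \<open>\<tau>\<close> converges absolutely for \<open>s > -1/4\<close>, \<open>b > 1/2\<close>, \<open>n \<noteq> 0\<close>.
\<close>

definition duhamel_integral ::
    "real \<Rightarrow> (real \<Rightarrow> int \<Rightarrow> complex) \<Rightarrow> (int \<Rightarrow> real \<Rightarrow> complex) \<Rightarrow> real \<Rightarrow> int \<Rightarrow> complex" where
  "duhamel_integral s u G t n =
     (if s \<ge> 0 then
        (LINT t':{0..t}|lborel. Vs (t - t') n * dx (dx (square (u t'))) n)
      else
        complex_of_real (1 / (2 * pi)) *
        (LINT \<tau>|lborel.
           (LINT t':{0..t}|lborel. Vs (t - t') n * exp (\<i> * complex_of_real (t' * \<tau>)))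
           * dx (dx (\<lambda>k. st_square G k \<tau>)) n))"

text \<open>Solutions on \<open>[0,T]\<close> with data \<open>u(0) = \<phi>\<close>, \<open>u\<^sub>t(0) = \<psi>\<^sub>x\<close> in the class \<open>C([0,T] : H\<^sup>s) \<inter> X\<^sub>s\<^sub>,\<^sub>b\<close>.\<close>

definition solution ::
    "real \<Rightarrow> real \<Rightarrow> real \<Rightarrow> (int \<Rightarrow> complex) \<Rightarrow> (int \<Rightarrow> complex) \<Rightarrow> (real \<Rightarrow> int \<Rightarrow> complex) \<Rightarrow> bool"
  where
  "solution s b T \<phi> \<psi> u \<longleftrightarrow> u \<in> C_Hs s T \<inter> XsbT s b T \<and>
     (\<exists>G\<in>extensions s b T u. \<forall>t\<in>{0..T}. \<forall>n.
        u t n = Vc t n * \<phi> n + Vs t n * dx \<psi> n - duhamel_integral s u G t n)"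

definition unique_solution ::
    "real \<Rightarrow> real \<Rightarrow> real \<Rightarrow> (int \<Rightarrow> complex) \<Rightarrow> (int \<Rightarrow> complex) \<Rightarrow> bool" where
  "unique_solution s b T \<phi> \<psi> \<longleftrightarrow>
     (\<exists>u. solution s b T \<phi> \<psi> u \<and> (\<forall>v. solution s b T \<phi> \<psi> v \<longrightarrow> (\<forall>t\<in>{0..T}. v t = u t)))"

definition data_distsq :: "real \<Rightarrow> (int \<Rightarrow> complex) \<times> (int \<Rightarrow> complex) \<Rightarrow>
    (int \<Rightarrow> complex) \<times> (int \<Rightarrow> complex) \<Rightarrow> real" where
  "data_distsq s d e = (Hs_norm s (\<lambda>n. fst d n - fst e n))\<^sup>2
                     + (Hs_norm (s - 1) (\<lambda>n. snd d n - snd e n))\<^sup>2"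

definition data_nbhd :: "real \<Rightarrow> (int \<Rightarrow> complex) \<times> (int \<Rightarrow> complex) \<Rightarrow> real \<Rightarrow>
    ((int \<Rightarrow> complex) \<times> (int \<Rightarrow> complex)) set" where
  "data_nbhd s d R = {e \<in> Hs s \<times> Hs (s - 1). data_distsq s e d < R}"

text \<open>
  The solution map from \<open>W\<close> to \<open>C([0,T] : H\<^sup>s) \<inter> X\<^sub>s\<^sub>,\<^sub>b\<close> is well defined and Lipschitz.  The target
  carries the sum of the two norms.
\<close>

definition lipschitz_solution_map :: "real \<Rightarrow> real \<Rightarrow> real \<Rightarrow>
    ((int \<Rightarrow> complex) \<times> (int \<Rightarrow> complex)) set \<Rightarrow> bool" where
  "lipschitz_solution_map s b T W \<longleftrightarrow>
     (\<forall>d\<in>W. unique_solution s b T (fst d) (snd d)) \<and>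
     (\<exists>L\<ge>0. \<forall>d\<in>W. \<forall>e\<in>W. \<forall>u v.
        solution s b T (fst d) (snd d) u \<longrightarrow> solution s b T (fst e) (snd e) v \<longrightarrow>
        C_Hs_norm s T (\<lambda>t n. u t n - v t n) + XsbT_norm s b T (\<lambda>t n. u t n - v t n)
          \<le> L * sqrt (data_distsq s d e))"

end

theory Submission
  imports Defs "HOL-Probability.Characteristic_Functions"
begin

text \<open>
  Work on the Fourier side in space and time.  Since \<open>\<gamma>(n) = n\<^sup>2 + O(1)\<close>, the weight
  \<open>\<langle>|\<tau>| - \<gamma>(n)\<rangle>\<close> is comparable to \<open>\<langle>|\<tau>| - n\<^sup>2\<rangle>\<close>, and the Duhamel kernel has symbol
  \<open>n\<^sup>2 / \<gamma>(n)\<close>, which is bounded: the two derivatives of the nonlinearity cost nothing.  Everything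
  then rests on the bilinear estimate \<open>\<parallel>u v\<parallel>\<^bsub>s,-a\<^esub> \<le> C \<parallel>u\<parallel>\<^bsub>s,b\<^esub> \<parallel>v\<parallel>\<^bsub>s,b\<^esub>\<close> with \<open>1/4 < a < 1/2 < b\<close>
  and \<open>a + b < 1\<close> (\<open>bilinear_estimate\<close>).  It holds because the three modulations cannot
  be small together: on the parabolas \<open>\<tau> = \<plusminus>n\<^sup>2\<close> the resonance function factors into a product of
  two frequencies, and such a product pays for the negative powers \<open>\<langle>n\<rangle>\<^bsup>s\<^esup>\<close> as long as
  \<open>-s < a/2 < 1/4\<close>.  What is left are sums over integer frequencies of powers of brackets of
  quadratic polynomials, which are bounded uniformly.

  The room \<open>a + b < 1\<close> yields a factor \<open>\<delta>\<^bsup>1-a-b\<^esup>\<close> for the Duhamel operator cut off to times of size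
  \<open>\<delta>\<close>, so that a Picard iteration converges on a ball (\<open>local_theory\<close>).  The fixed point satisfies
  the Duhamel equation mode by mode (\<open>fixed_slice\<close>), and both forms of the nonlinearity, the
  pointwise square for \<open>s \<ge> 0\<close> and the space-time convolution for \<open>s < 0\<close>, reduce to the same sum
  over pairs of spatial modes (\<open>duhamel_integral_modes\<close>).  Uniqueness in the whole class follows by
  applying the estimates on short intervals one after the other to the difference of two
  solutions (\<open>difference_vanishes\<close>).

  For persistence of regularity on the same interval the estimates are proved for all weights
  \<open>\<langle>n\<rangle>\<^bsup>-\<rho>\<^esup> om n\<close> with \<open>om\<close> submultiplicative, with constants independent of \<open>om\<close>.  The weight
  \<open>\<langle>n\<rangle>\<^bsup>s\<^esup> \<langle>n/K\<rangle>\<^bsup>s'-s\<^esup>\<close> is of this form, is equivalent to the weight of \<open>H\<^bsup>s'\<^esup>\<close>, and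
  for large \<open>K\<close> gives the data nearly the norm they have in \<open>H\<^sup>s\<close>.  So the existence time
  is governed by the \<open>H\<^sup>s\<close> norm alone (\<open>wellposed\<close>).  The completion in the definition of
  \<open>X\<^sub>s\<^sub>,\<^sub>b\<close> contains every measurable function of finite norm (\<open>Xsb_density\<close>), by
  regularisation with Gaussians.
\<close>

abbreviation cor :: "real => complex" where
 "cor == complex_of_real"

abbreviation bmeas where "bmeas == borel_measurable borel"

abbreviation nnint where "nnint f == nn_integral lborel f"

abbreviation nsum where "nsum f == nn_integral (count_space UNIV) f"

section \<open>Brackets\<close>

lemma bracket_ge_1 [simp]: "bracket x >= 1"
 by (simp add: bracket_def)

lemma bracket_pos [simp]: "bracket x > 0"
 by (simp add: bracket_def)

lemma bracket_nonzero [simp]: "bracket x \<noteq> 0"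
 by (simp add: bracket_def)

lemma bracket_nonneg [simp]: "bracket x >= 0"
 by (simp add: bracket_def)

lemma bracket_minus [simp]: "bracket (- x) = bracket x"
 by (simp add: bracket_def)

lemma bracket_minus_commute: "bracket (x - y) = bracket (y - x)"
 by (simp add: bracket_def abs_minus_commute)

lemma bracket_measurable [measurable]: "bracket \<in> bmeas"
 unfolding bracket_def by measurable

lemma bracket_add_le_mult: "bracket (x + y) <= bracket x * bracket y"
proof -
 have "\<bar>x + y\<bar> <= \<bar>x\<bar> + \<bar>y\<bar>" "0 <= \<bar>x\<bar> * \<bar>y\<bar>" by auto
 then have "1 + \<bar>x + y\<bar> <= 1 + \<bar>x\<bar> + \<bar>y\<bar> + \<bar>x\<bar> * \<bar>y\<bar>" by linarith
 then show ?thesis unfolding bracket_def by (simp add: ring_distribs)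
qed

lemma bracket_le_2_times:
 assumes "\<bar>x - y\<bar> <= 1"
 shows "bracket x <= 2 * bracket y"
proof -
 have "\<bar>x\<bar> <= 1 + \<bar>y\<bar>" using assms by (smt (verit))
 then show ?thesis unfolding bracket_def by (smt (verit))
qed

lemma gam_nonneg [simp]: "gam n >= 0"
 by (simp add: gam_def)

lemma gam_0 [simp]: "gam 0 = 0"
 by (simp add: gam_def)

lemma gam_ge_square: "(real_of_int n)\<^sup>2 <= gam n"
 unfolding gam_def by (rule real_le_rsqrt) (simp add: power_mult[symmetric] flip: power_mult)

lemma gam_le_square: "gam n <= (real_of_int n)\<^sup>2 + 1"
 unfolding gam_def by (rule real_le_lsqrt) (auto simp: power2_eq_square algebra_simps power4_eq_xxxx)

lemma gam_pos: "n \<noteq> 0 ==> gam n > 0"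
 using gam_ge_square[of n] by (smt (verit, best) of_int_eq_0_iff zero_less_power2)

lemma bracket_le_gam: "bracket (\<bar>\<tau>\<bar> - (real_of_int n)\<^sup>2) <= 2 * bracket (\<bar>\<tau>\<bar> - gam n)"
 by (rule bracket_le_2_times) (use gam_ge_square[of n] gam_le_square[of n] in auto)

section \<open>Integrals and sums of powers of brackets\<close>

definition bracket_integral :: "real => ennreal" where
 "bracket_integral p = (nnint (%x. ennreal (bracket x powr (- p))))"

lemma nn_integral_lborel_translate:
 fixes f :: "real => ennreal"
 assumes [measurable]: "f \<in> bmeas"
 shows "(nnint (%x. f (x - a))) = (nnint (%x. f x))"
 using nn_integral_real_affine[of f 1 "-a"] by (simp add: ac_simps)

lemma nn_integral_lborel_reflect:
 fixes f :: "real => ennreal"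
 assumes [measurable]: "f \<in> bmeas"
 shows "(nnint (%x. f (a - x))) = (nnint (%x. f x))"
 using nn_integral_real_affine[of f "-1" a] by (simp add: ac_simps)

lemma bracket_integral_translate:
 "(nnint (%x. ennreal (bracket (x - a) powr (- p)))) = bracket_integral p"
 unfolding bracket_integral_def
 by (rule nn_integral_lborel_translate[of "%x. ennreal (bracket x powr (- p))"]) measurable

lemma bracket_integral_finite:
 assumes "p > 1"
 shows "bracket_integral p < \<infinity>"
proof -
 let ?F = "%x::real. - ((1 + x) powr (1 - p)) / (p - 1)"
 have 1: "(nnint (%x. ennreal ((1 + x) powr (- p)) * indicator {0..} x)) = ennreal (0 - ?F 0)"
 proof (rule nn_integral_FTC_atLeast)
  show "(?F has_real_derivative (1 + x) powr (- p)) (at x)" if "0 <= x" for x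
  proof -
   have "(?F has_real_derivative - ((1 - p) * (1 + x) powr (1 - p - 1) * (0 + 1)) / (p - 1)) (at x)"
    using that assms by (auto intro!: derivative_eq_intros)
   moreover have "- ((1 - p) * (1 + x) powr (1 - p - 1) * (0 + 1)) / (p - 1) = (1 + x) powr (- p)"
   proof -
    have "1 - p - 1 = - p" "1 - p = - (p - 1)" by simp_all
    then have "- ((1 - p) * (1 + x) powr (1 - p - 1) * (0 + 1)) = (p - 1) * (1 + x) powr (- p)"
     by (metis add_0 minus_mult_left minus_minus mult.right_neutral)
    then show ?thesis using assms by simp
   qed
   ultimately show ?thesis by simp
  qed
  show "(?F \<longlongrightarrow> 0) at_top"
  proof -
   have "((%x. (1 + x) powr (1 - p)) \<longlongrightarrow> 0) at_top"
    using assms by (intro tendsto_neg_powr filterlim_tendsto_add_at_top[OF tendsto_const] filterlim_ident) auto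
   then have "((%x. - ((1 + x) powr (1 - p)) / (p - 1)) \<longlongrightarrow> - 0 / (p - 1)) at_top"
    by (intro tendsto_intros) (use assms in auto)
   then show ?thesis by simp
  qed
 qed auto
 have fin: "(nnint (%x. ennreal (bracket x powr (- p)) * indicator {0..} x)) < \<infinity>"
 proof -
  have "(nnint (%x. ennreal (bracket x powr (- p)) * indicator {0..} x))
    = (nnint (%x. ennreal ((1 + x) powr (- p)) * indicator {0..} x))"
   by (intro nn_integral_cong) (auto simp: bracket_def split: split_indicator)
  with 1 show ?thesis by simp
 qed
 have refl: "(nnint (%x. ennreal (bracket x powr (- p)) * indicator {0..} (- x)))
   = (nnint (%x. ennreal (bracket x powr (- p)) * indicator {0..} x))"
  using nn_integral_lborel_reflect[of "%x. ennreal (bracket x powr (- p)) * indicator {0..} x" 0]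
  by simp
 have "bracket_integral p <= (nnint (%x. ennreal (bracket x powr (- p)) * indicator {0..} x
   + ennreal (bracket x powr (- p)) * indicator {0..} (- x)))"
  unfolding bracket_integral_def
  by (intro nn_integral_mono) (auto split: split_indicator)
 also have "... = (nnint (%x. ennreal (bracket x powr (- p)) * indicator {0..} x))
   + (nnint (%x. ennreal (bracket x powr (- p)) * indicator {0..} (- x)))"
  by (rule nn_integral_add) measurable
 also have "... < \<infinity>" using fin unfolding refl by simp
 finally show ?thesis .
qed

lemma bracket_sum_le:
 assumes "p >= 0"
 shows "(nsum (%n. ennreal (bracket (real_of_int n - x0) powr (- p))))
  <= ennreal (2 powr p) * bracket_integral p"
proof -
 let ?f = "%x. ennreal (2 powr p) * ennreal (bracket (x - x0) powr (- p))"
 let ?I = "%(n::int) x::real. indicator {of_int n..<of_int n + 1} x :: ennreal"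
 have "(nsum (%n. ennreal (bracket (real_of_int n - x0) powr (- p))))
   <= (nsum (%n. (nnint (%x. ?f x * ?I n x))))"
 proof (rule nn_integral_mono)
  fix n :: int
  have "ennreal (bracket (real_of_int n - x0) powr (- p))
    = (nnint (%x. ennreal (bracket (real_of_int n - x0) powr (- p)) * ?I n x))"
   by (subst nn_integral_cmult_indicator) auto
  also have "... <= (nnint (%x. ?f x * ?I n x))"
  proof (intro nn_integral_mono)
   fix x :: real
   have "bracket (x - x0) powr p <= 2 powr p * bracket (of_int n - x0) powr p" if "of_int n <= x" "x < of_int n + 1"
   proof -
    have "bracket (x - x0) <= 2 * bracket (of_int n - x0)"
     using that by (intro bracket_le_2_times) auto
    then have "bracket (x - x0) powr p <= (2 * bracket (of_int n - x0)) powr p"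
     using assms by (intro powr_mono2) auto
    then show ?thesis by (simp add: powr_mult)
   qed
   then have "bracket (of_int n - x0) powr (- p) <= 2 powr p * bracket (x - x0) powr (- p)"
    if "of_int n <= x" "x < of_int n + 1"
    using that by (simp add: powr_minus divide_simps mult.commute)
   then show "ennreal (bracket (real_of_int n - x0) powr (- p)) * ?I n x <= ?f x * ?I n x"
    by (auto split: split_indicator simp flip: ennreal_mult)
  qed
  finally show "ennreal (bracket (real_of_int n - x0) powr (- p)) <= (nnint (%x. ?f x * ?I n x))" .
 qed
 also have "... = (nnint (%x. (nsum (%n. ?f x * ?I n x))))"
  by (subst nn_integral_count_space_nn_integral) auto
 also have "... = (nnint (%x. ?f x))"
 proof (intro nn_integral_cong)
  fix x :: real
  have "(nsum (%n. ?I n x)) = (nsum (%n. indicator {\<lfloor>x\<rfloor>} n))"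
  proof (intro nn_integral_cong)
   fix n :: int
   have "(of_int n <= x \<and> x < of_int n + 1) \<longleftrightarrow> n = \<lfloor>x\<rfloor>"
    by (metis floor_eq_iff)
   then show "?I n x = indicator {\<lfloor>x\<rfloor>} n"
    by (auto simp: indicator_def)
  qed
  then have "(nsum (%n. ?I n x)) = 1" by simp
  then show "(nsum (%n. ?f x * ?I n x)) = ?f x"
   by (subst nn_integral_cmult) auto
 qed
 also have "... = ennreal (2 powr p) * bracket_integral p"
  by (subst nn_integral_cmult) (auto simp: bracket_integral_translate)
 finally show ?thesis .
qed

text \<open>One of the two factors has its bracket at least half of \<open>\<langle>\<alpha> - \<beta>\<rangle>\<close>; what is then left of
 the product is at most \<open>\<langle>x - \<alpha>\<rangle>\<^bsup>-q\<^esup> + \<langle>x - \<beta>\<rangle>\<^bsup>-q\<^esup>\<close> by Young's inequality.\<close>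

lemma bracket_powr_Young:
 assumes "0 <= p" "0 <= r" "X >= 1" "Y >= 1"
 shows "X powr (- p) * Y powr (- r) <= X powr (- (p + r)) + Y powr (- (p + r :: real))"
proof (cases "X <= Y")
 case True
 then have "Y powr (- r) <= X powr (- r)" using assms by (intro powr_mono2') auto
 then have "X powr (- p) * Y powr (- r) <= X powr (- p) * X powr (- r)" by (intro mult_left_mono) auto
 also have "... = X powr (- (p + r))" by (simp flip: powr_add)
 finally show ?thesis by (smt (verit) powr_ge_zero)
next
 case False
 then have "X powr (- p) <= Y powr (- p)" using assms by (intro powr_mono2') auto
 then have "X powr (- p) * Y powr (- r) <= Y powr (- p) * Y powr (- r)" by (intro mult_right_mono) auto
 also have "... = Y powr (- (p + r))" by (simp flip: powr_add)
 finally show ?thesis by (smt (verit) powr_ge_zero)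
qed

text \<open>At each point one of the two brackets is at least comparable to the distance of the
 centres, which gives the decay in that distance.\<close>

lemma bracket_convolution_le:
 assumes "0 <= p" "p <= q"
 shows "(nnint (%x. ennreal (bracket (x - \<alpha>) powr (- p) * bracket (x - \<beta>) powr (- q))))
   <= ennreal (3 * 2 powr p * bracket (\<alpha> - \<beta>) powr (- p)) * bracket_integral q"
proof -
 let ?c = "2 powr p * bracket (\<alpha> - \<beta>) powr (- p)"
 have pw: "bracket (x - \<alpha>) powr (- p) * bracket (x - \<beta>) powr (- q)
   <= ?c * (2 * bracket (x - \<beta>) powr (- q) + bracket (x - \<alpha>) powr (- q))" for x
 proof -
  have half: "y powr (- p) <= ?c" if "bracket (\<alpha> - \<beta>) <= 2 * y" "y >= 1" for y
  proof -
   have "(2 * y) powr (- p) <= bracket (\<alpha> - \<beta>) powr (- p)"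
    using that assms by (intro powr_mono2') auto
   then show ?thesis using that by (simp add: powr_mult powr_minus field_simps)
  qed
  have tri: "bracket (\<alpha> - \<beta>) <= bracket (x - \<alpha>) + bracket (x - \<beta>)"
   unfolding bracket_def by linarith
  consider "bracket (\<alpha> - \<beta>) <= 2 * bracket (x - \<alpha>)" | "bracket (\<alpha> - \<beta>) <= 2 * bracket (x - \<beta>)"
   using tri by linarith
  then show ?thesis
  proof cases
   case 1
   have "bracket (x - \<alpha>) powr (- p) * bracket (x - \<beta>) powr (- q) <= ?c * bracket (x - \<beta>) powr (- q)"
    by (intro mult_right_mono half 1) auto
   also have "... <= ?c * (2 * bracket (x - \<beta>) powr (- q) + bracket (x - \<alpha>) powr (- q))"
    by (intro mult_left_mono) auto
   finally show ?thesis .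
  next
   case 2
   have "bracket (x - \<alpha>) powr (- p) * bracket (x - \<beta>) powr (- q)
     = bracket (x - \<beta>) powr (- p) * (bracket (x - \<alpha>) powr (- p) * bracket (x - \<beta>) powr (- (q - p)))"
    by (simp flip: powr_add)
   also have "... <= ?c * (bracket (x - \<alpha>) powr (- (p + (q - p))) + bracket (x - \<beta>) powr (- (p + (q - p))))"
    by (intro mult_mono half 2 bracket_powr_Young) (use assms in auto)
   also have "... <= ?c * (2 * bracket (x - \<beta>) powr (- q) + bracket (x - \<alpha>) powr (- q))"
    by (intro mult_left_mono) auto
   finally show ?thesis .
  qed
 qed
 have "(nnint (%x. ennreal (bracket (x - \<alpha>) powr (- p) * bracket (x - \<beta>) powr (- q))))
   <= (nnint (%x. ennreal (?c * (2 * bracket (x - \<beta>) powr (- q) + bracket (x - \<alpha>) powr (- q)))))"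
  by (intro nn_integral_mono ennreal_leI pw)
 also have "... = (nnint (%x. ennreal ?c * (2 * ennreal (bracket (x - \<beta>) powr (- q)) + ennreal (bracket (x - \<alpha>) powr (- q)))))"
  proof (intro nn_integral_cong)
  fix x
  have "ennreal (?c * (2 * A + B)) = ennreal ?c * (2 * ennreal A + ennreal B)"
   if "A >= 0" "B >= 0" for A B
   using that by (simp only: ennreal_mult'[of ?c] ennreal_mult'[of 2] ennreal_plus ennreal_numeral mult_nonneg_nonneg
     powr_ge_zero zero_le_numeral)
  then show "ennreal (?c * (2 * bracket (x - \<beta>) powr (- q) + bracket (x - \<alpha>) powr (- q)))
    = ennreal ?c * (2 * ennreal (bracket (x - \<beta>) powr (- q)) + ennreal (bracket (x - \<alpha>) powr (- q)))"
   by simp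
 qed
 also have "... = ennreal ?c * (2 * bracket_integral q + bracket_integral q)"
  by (subst nn_integral_cmult; simp add: nn_integral_add nn_integral_cmult bracket_integral_translate)
 also have "... = ennreal (3 * 2 powr p * bracket (\<alpha> - \<beta>) powr (- p)) * bracket_integral q"
 proof -
  have "2 * bracket_integral q + bracket_integral q = 3 * bracket_integral q"
   using distrib_right[of 2 1 "bracket_integral q"] by simp
  then have "ennreal ?c * (2 * bracket_integral q + bracket_integral q) = (ennreal ?c * 3) * bracket_integral q"
   by (simp add: mult.assoc)
  also have "ennreal ?c * 3 = ennreal (?c * 3)"
   by (subst ennreal_mult) auto
  finally show ?thesis by (simp add: ac_simps)
 qed
 finally show ?thesis .
qed

section \<open>Convolution estimates of Schur type on \<open>\<int> \<times> \<real>\<close>\<close>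

abbreviation nint2 :: "(int => real => ennreal) => ennreal" where
 "nint2 f \<equiv> (nsum (%n. (nnint (%\<tau>. f n \<tau>))))"

lemma borel_measurable_nn_integral_count_space_int [measurable (raw)]:
 fixes F :: "int => 'a => ennreal"
 assumes "!!m. F m \<in> borel_measurable M"
 shows "(%x. nsum (%m. F m x)) \<in> borel_measurable M"
proof -
 have "(%x. \<Sum>i. F (from_nat_into UNIV i) x) \<in> borel_measurable M"
  using assms by measurable
 moreover have "(nsum (%m. F m x)) = (\<Sum>i. F (from_nat_into UNIV i) x)" for x
 proof -
  have "bij_betw (from_nat_into (UNIV :: int set)) UNIV UNIV"
   by (rule bij_betw_from_nat_into) (auto simp: infinite_UNIV_int)
  then have "(nsum (%m. F m x)) = (nsum (%i. F (from_nat_into UNIV i) x))"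
   by (rule nn_integral_bij_count_space[symmetric])
  also have "... = (\<Sum>i. F (from_nat_into UNIV i) x)"
   by (rule nn_integral_count_space_nat)
  finally show ?thesis .
 qed
 ultimately show ?thesis by simp
qed

lemma nint2_eq_product:
 assumes [measurable]: "!!m. f m \<in> bmeas"
 shows "nint2 f = (\<integral>\<^sup>+p. f (fst p) (snd p) \<partial>(count_space UNIV \<Otimes>\<^sub>M lborel))"
proof -
 have "(%p. f (fst p) (snd p)) \<in> borel_measurable (count_space UNIV \<Otimes>\<^sub>M lborel)"
  by (rule measurable_pair_measure_countable1) (auto simp: countableI_type)
 from lborel.nn_integral_fst[OF this] show ?thesis by simp
qed

lemma nint2_Cauchy_Schwarz:
 assumes [measurable]: "!!m. f m \<in> bmeas" "!!m. g m \<in> bmeas"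
 shows "(nint2 (%m \<mu>. f m \<mu> * g m \<mu>))\<^sup>2 <= nint2 (%m \<mu>. (f m \<mu>)\<^sup>2) * nint2 (%m \<mu>. (g m \<mu>)\<^sup>2)"
proof -
 have [measurable]: "(%p. h (fst p) (snd p)) \<in> borel_measurable (count_space UNIV \<Otimes>\<^sub>M lborel)"
  if "!!m. h m \<in> bmeas" for h :: "int => real => ennreal"
  using that by (intro measurable_pair_measure_countable1) (auto simp: countableI_type)
 show ?thesis
  by (simp add: nint2_eq_product) (rule Cauchy_Schwarz_nn_integral; measurable)
qed

lemma nint2_cmult:
 assumes [measurable]: "!!m. f m \<in> bmeas"
 shows "nint2 (%m \<mu>. c * f m \<mu>) = c * nint2 f"
 by (simp add: nn_integral_cmult)

lemma nint2_add:
 assumes [measurable]: "!!m. f m \<in> bmeas" "!!m. g m \<in> bmeas"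
 shows "nint2 (%m \<mu>. f m \<mu> + g m \<mu>) = nint2 f + nint2 g"
 by (simp add: nn_integral_add)

lemma nint2_mono:
 assumes "!!m \<mu>. f m \<mu> <= g m \<mu>"
 shows "nint2 f <= nint2 g"
 by (intro nn_integral_mono assms)

lemma nint2_swap:
 fixes k :: "int => real => int => real => ennreal"
 assumes [measurable]: "!!n m. (%(\<tau>, \<mu>). k n \<tau> m \<mu>) \<in> borel_measurable (borel \<Otimes>\<^sub>M borel)"
 shows "nint2 (%n \<tau>. nint2 (%m \<mu>. k n \<tau> m \<mu>)) = nint2 (%m \<mu>. nint2 (%n \<tau>. k n \<tau> m \<mu>))"
proof -
 have "nint2 (%n \<tau>. nint2 (%m \<mu>. k n \<tau> m \<mu>))
   = (nsum (%n. nsum (%m. nnint (%\<tau>. nnint (%\<mu>. k n \<tau> m \<mu>)))))"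
  by (intro nn_integral_cong nn_integral_count_space_nn_integral) auto
 also have "... = (nsum (%m. nsum (%n. nnint (%\<tau>. nnint (%\<mu>. k n \<tau> m \<mu>)))))"
  by (rule nn_integral_count_space_nn_integral) auto
 also have "... = (nsum (%m. nsum (%n. nnint (%\<mu>. nnint (%\<tau>. k n \<tau> m \<mu>)))))"
  by (intro nn_integral_cong lborel_pair.Fubini') measurable
 also have "... = nint2 (%m \<mu>. nint2 (%n \<tau>. k n \<tau> m \<mu>))"
  by (intro nn_integral_cong nn_integral_count_space_nn_integral[symmetric]) auto
 finally show ?thesis .
qed

lemma nint2_translate:
 assumes [measurable]: "!!m. f m \<in> bmeas"
 shows "nint2 (%n \<tau>. f (n - m) (\<tau> - \<mu>)) = nint2 f"
proof -
 have "nint2 (%n \<tau>. f (n - m) (\<tau> - \<mu>)) = (nsum (%n. (nnint (%\<tau>. f (n - m) \<tau>))))"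
  by (intro nn_integral_cong nn_integral_lborel_translate) auto
 also have "... = nint2 f"
  by (rule nn_integral_bij_count_space[of "%n. n - m" UNIV UNIV "%n. nnint (%\<tau>. f n \<tau>)"])
    (auto intro!: bij_betwI[of _ _ _ "%n. n + m"])
 finally show ?thesis .
qed

lemma nint2_reflect:
 assumes [measurable]: "!!m. f m \<in> bmeas"
 shows "nint2 (%m \<mu>. f (n - m) (\<tau> - \<mu>)) = nint2 f"
proof -
 have "nint2 (%m \<mu>. f (n - m) (\<tau> - \<mu>)) = (nsum (%m. (nnint (%\<mu>. f (n - m) \<mu>))))"
  by (intro nn_integral_cong nn_integral_lborel_reflect) auto
 also have "... = nint2 f"
  by (rule nn_integral_bij_count_space[of "%m. n - m" UNIV UNIV "%n. nnint (%\<tau>. f n \<tau>)"])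
    (auto intro!: bij_betwI[of _ _ _ "%m. n - m"])
 finally show ?thesis .
qed

lemma Schur_bound_output:
 fixes K :: "int => real => int => real => ennreal"
 assumes K [measurable]: "!!n m. (%(\<tau>, \<mu>). K n \<tau> m \<mu>) \<in> borel_measurable (borel \<Otimes>\<^sub>M borel)"
  and f [measurable]: "!!m. f m \<in> bmeas"
  and g [measurable]: "!!m. g m \<in> bmeas"
  and S: "!!n \<tau>. nint2 (%m \<mu>. (K n \<tau> m \<mu>)\<^sup>2) <= S"
 shows "nint2 (%n \<tau>. (nint2 (%m \<mu>. K n \<tau> m \<mu> * (f m \<mu> * g (n - m) (\<tau> - \<mu>))))\<^sup>2)
  <= S * (nint2 (%n \<tau>. (f n \<tau>)\<^sup>2) * nint2 (%n \<tau>. (g n \<tau>)\<^sup>2))"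
proof -
 have "nint2 (%n \<tau>. (nint2 (%m \<mu>. K n \<tau> m \<mu> * (f m \<mu> * g (n - m) (\<tau> - \<mu>))))\<^sup>2)
   <= nint2 (%n \<tau>. S * nint2 (%m \<mu>. (f m \<mu> * g (n - m) (\<tau> - \<mu>))\<^sup>2))"
 proof (rule nint2_mono)
  fix n \<tau>
  have [measurable]: "K n \<tau> m \<in> bmeas" for m
   using measurable_compose[OF _ K[of n m], of "%\<mu>. (\<tau>, \<mu>)" borel] by simp
  have "(nint2 (%m \<mu>. K n \<tau> m \<mu> * (f m \<mu> * g (n - m) (\<tau> - \<mu>))))\<^sup>2
    <= nint2 (%m \<mu>. (K n \<tau> m \<mu>)\<^sup>2) * nint2 (%m \<mu>. (f m \<mu> * g (n - m) (\<tau> - \<mu>))\<^sup>2)"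
   by (rule nint2_Cauchy_Schwarz) auto
  also have "... <= S * nint2 (%m \<mu>. (f m \<mu> * g (n - m) (\<tau> - \<mu>))\<^sup>2)"
   by (intro mult_right_mono S) auto
  finally show "(nint2 (%m \<mu>. K n \<tau> m \<mu> * (f m \<mu> * g (n - m) (\<tau> - \<mu>))))\<^sup>2
    <= S * nint2 (%m \<mu>. (f m \<mu> * g (n - m) (\<tau> - \<mu>))\<^sup>2)" .
 qed
 also have "... = S * nint2 (%n \<tau>. nint2 (%m \<mu>. (f m \<mu> * g (n - m) (\<tau> - \<mu>))\<^sup>2))"
  by (rule nint2_cmult) measurable
 also have "nint2 (%n \<tau>. nint2 (%m \<mu>. (f m \<mu> * g (n - m) (\<tau> - \<mu>))\<^sup>2))
   = nint2 (%m \<mu>. nint2 (%n \<tau>. (f m \<mu> * g (n - m) (\<tau> - \<mu>))\<^sup>2))"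
  by (rule nint2_swap) measurable
 also have "... = nint2 (%m \<mu>. (f m \<mu>)\<^sup>2 * nint2 (%n \<tau>. (g n \<tau>)\<^sup>2))"
  using nint2_translate[of "%n \<tau>. (g n \<tau>)\<^sup>2"]
  by (simp add: power_mult_distrib nn_integral_cmult)
 also have "... = nint2 (%n \<tau>. (f n \<tau>)\<^sup>2) * nint2 (%n \<tau>. (g n \<tau>)\<^sup>2)"
  by (simp add: nn_integral_multc)
 finally show ?thesis .
qed

lemma nint2_square_le_by_duality:
 assumes [measurable]: "!!n. T n \<in> bmeas"
  and dual: "!!h. (!!n. h n \<in> bmeas) ==>
   (nint2 (%n \<tau>. h n \<tau> * T n \<tau>))\<^sup>2 <= C * nint2 (%n \<tau>. (h n \<tau>)\<^sup>2)"
 shows "nint2 (%n \<tau>. (T n \<tau>)\<^sup>2) <= C"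
proof -
 define h :: "nat => int => real => ennreal" where
  "h j n \<tau> = min (T n \<tau>) (of_nat j) * (indicator {- int j..int j} n * indicator {- real j..real j} \<tau>)" for j n \<tau>
 have [measurable]: "h j n \<in> bmeas" for j n
  unfolding h_def by measurable
 have mono: "h i n \<tau> <= h j n \<tau>" if "i <= j" for i j n \<tau>
  unfolding h_def using that
  by (intro mult_mono) (auto split: split_indicator simp: min_le_iff_disj)
 have h_le: "h j n \<tau> <= T n \<tau>" for j n \<tau>
  unfolding h_def by (auto split: split_indicator)
 have bound: "nint2 (%n \<tau>. (h j n \<tau>)\<^sup>2) <= C" for j
 proof -
  let ?H = "nint2 (%n \<tau>. (h j n \<tau>)\<^sup>2)"
  have "?H <= nint2 (%n \<tau>. ((of_nat j)\<^sup>2 * indicator {- int j..int j} n) * indicator {- real j..real j} \<tau>)"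
  proof (intro nint2_mono)
   fix n \<tau>
   have "min (T n \<tau>) (of_nat j) ^ 2 <= (of_nat j)\<^sup>2" by (intro power_mono) auto
   then show "(h j n \<tau>)\<^sup>2 <= ((of_nat j)\<^sup>2 * indicator {- int j..int j} n) * indicator {- real j..real j} \<tau>"
    unfolding h_def by (auto split: split_indicator)
  qed
  also have "... = (of_nat j)\<^sup>2 * emeasure (count_space UNIV) {- int j..int j} * ennreal (2 * real j)"
   by (simp add: nn_integral_cmult nn_integral_multc mult.assoc)
  also have "... < \<infinity>"
   by (simp add: ennreal_mult_less_top power_less_top_ennreal ennreal_of_nat_eq_real_of_nat)
  finally have fin: "?H < \<infinity>" .
  have "?H\<^sup>2 <= (nint2 (%n \<tau>. h j n \<tau> * T n \<tau>))\<^sup>2"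
   unfolding power2_eq_square[of "h j _ _"] by (intro power_mono nint2_mono mult_left_mono h_le) auto
  also have "... <= C * ?H" by (rule dual) auto
  finally have le: "?H * ?H <= C * ?H" by (simp add: power2_eq_square)
  show ?thesis
  proof (cases "?H = 0")
   case False
   then show ?thesis using le fin
    by (metis ennreal_mult_less_top ennreal_mult_strict_right_mono infinity_ennreal_def leD leI not_gr_zero)
  qed simp
 qed
 have SUP_h: "(SUP j. (h j n \<tau>)\<^sup>2) = (T n \<tau>)\<^sup>2" for n \<tau>
 proof (rule antisym)
  show "(SUP j. (h j n \<tau>)\<^sup>2) <= (T n \<tau>)\<^sup>2"
   by (intro SUP_least power_mono h_le) auto
  obtain j0 where j0: "\<bar>n\<bar> <= int j0" "\<bar>\<tau>\<bar> <= real j0"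
  proof -
   obtain j1 where "\<bar>\<tau>\<bar> <= real j1" using real_arch_simple by blast
   then show ?thesis using that[of "max j1 (nat \<bar>n\<bar>)"] by auto
  qed
  have hj: "h j n \<tau> = min (T n \<tau>) (of_nat j)" if "j >= j0" for j
  proof -
   have "n \<in> {- int j..int j}" "\<tau> \<in> {- real j..real j}" using j0 that by auto
   then show ?thesis unfolding h_def by simp
  qed
  have lim: "(%j. min (T n \<tau>) (of_nat j)) \<longlonglongrightarrow> T n \<tau>"
  proof -
   have "(%j. min (T n \<tau>) (of_nat j)) \<longlonglongrightarrow> min (T n \<tau>) top"
    by (intro tendsto_min tendsto_const of_nat_tendsto_top_ennreal)
   then show ?thesis by simp
  qed
  have "(%j. (h j n \<tau>)\<^sup>2) \<longlonglongrightarrow> (T n \<tau>)\<^sup>2"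
  proof (rule Lim_transform_eventually)
   show "(%j. (min (T n \<tau>) (of_nat j))\<^sup>2) \<longlonglongrightarrow> (T n \<tau>)\<^sup>2"
    unfolding power2_eq_square by (intro tendsto_mult_ennreal lim) auto
   show "\<forall>\<^sub>F j in sequentially. (min (T n \<tau>) (of_nat j))\<^sup>2 = (h j n \<tau>)\<^sup>2"
    using eventually_ge_at_top[of j0] by eventually_elim (simp add: hj)
  qed
  then show "(T n \<tau>)\<^sup>2 <= (SUP j. (h j n \<tau>)\<^sup>2)"
   by (rule LIMSEQ_le_const2) (intro exI[of _ 0] allI impI SUP_upper UNIV_I)
 qed
 have "nint2 (%n \<tau>. (T n \<tau>)\<^sup>2) = (nsum (%n. (nnint (%\<tau>. (SUP j. (h j n \<tau>)\<^sup>2)))))"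
  by (simp add: SUP_h)
 also have "... = (nsum (%n. (SUP j. nnint (%\<tau>. (h j n \<tau>)\<^sup>2))))"
  by (intro nn_integral_cong nn_integral_monotone_convergence_SUP)
    (auto simp: incseq_def le_fun_def intro!: power_mono mono)
 also have "... = (SUP j. nint2 (%n \<tau>. (h j n \<tau>)\<^sup>2))"
  by (intro nn_integral_monotone_convergence_SUP)
    (auto simp: incseq_def le_fun_def intro!: power_mono mono nn_integral_mono)
 also have "... <= C" by (intro SUP_least bound)
 finally show ?thesis .
qed

lemma Schur_bound_input:
 fixes K :: "int => real => int => real => ennreal"
 assumes K [measurable]: "!!n m. (%(\<tau>, \<mu>). K n \<tau> m \<mu>) \<in> borel_measurable (borel \<Otimes>\<^sub>M borel)"
  and f [measurable]: "!!m. f m \<in> bmeas"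
  and g [measurable]: "!!m. g m \<in> bmeas"
  and S: "!!m \<mu>. nint2 (%n \<tau>. (K n \<tau> m \<mu>)\<^sup>2) <= S"
 shows "nint2 (%n \<tau>. (nint2 (%m \<mu>. K n \<tau> m \<mu> * (f m \<mu> * g (n - m) (\<tau> - \<mu>))))\<^sup>2)
  <= S * (nint2 (%n \<tau>. (f n \<tau>)\<^sup>2) * nint2 (%n \<tau>. (g n \<tau>)\<^sup>2))"
proof (rule nint2_square_le_by_duality)
 show "(%\<tau>. nint2 (%m \<mu>. K n \<tau> m \<mu> * (f m \<mu> * g (n - m) (\<tau> - \<mu>)))) \<in> bmeas" for n
  by measurable
 fix h :: "int => real => ennreal"
 assume h [measurable]: "!!n. h n \<in> bmeas"
 let ?F = "nint2 (%n \<tau>. (f n \<tau>)\<^sup>2)" and ?G = "nint2 (%n \<tau>. (g n \<tau>)\<^sup>2)"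
  and ?H = "nint2 (%n \<tau>. (h n \<tau>)\<^sup>2)"
 have [measurable]: "K n \<tau> m \<in> bmeas" "(%\<tau>. K n \<tau> m \<mu>) \<in> bmeas" for n \<tau> m \<mu>
  using measurable_compose[OF _ K[of n m], of "%\<mu>. (\<tau>, \<mu>)" borel]
   measurable_compose[OF _ K[of n m], of "%\<tau>. (\<tau>, \<mu>)" borel] by simp_all
 have "nint2 (%n \<tau>. h n \<tau> * nint2 (%m \<mu>. K n \<tau> m \<mu> * (f m \<mu> * g (n - m) (\<tau> - \<mu>))))
   = nint2 (%n \<tau>. nint2 (%m \<mu>. h n \<tau> * (K n \<tau> m \<mu> * (f m \<mu> * g (n - m) (\<tau> - \<mu>)))))"
  by (simp add: nn_integral_cmult)
 also have "... = nint2 (%m \<mu>. nint2 (%n \<tau>. h n \<tau> * (K n \<tau> m \<mu> * (f m \<mu> * g (n - m) (\<tau> - \<mu>)))))"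
  by (rule nint2_swap) measurable
 also have "... = nint2 (%m \<mu>. nint2 (%n \<tau>. f m \<mu> * (K n \<tau> m \<mu> * (h n \<tau> * g (n - m) (\<tau> - \<mu>)))))"
  by (simp add: ac_simps)
 also have "... = nint2 (%m \<mu>. f m \<mu> * nint2 (%n \<tau>. K n \<tau> m \<mu> * (h n \<tau> * g (n - m) (\<tau> - \<mu>))))"
  by (simp add: nn_integral_cmult)
 finally have "(nint2 (%n \<tau>. h n \<tau> * nint2 (%m \<mu>. K n \<tau> m \<mu> * (f m \<mu> * g (n - m) (\<tau> - \<mu>)))))\<^sup>2
   = (nint2 (%m \<mu>. f m \<mu> * nint2 (%n \<tau>. K n \<tau> m \<mu> * (h n \<tau> * g (n - m) (\<tau> - \<mu>)))))\<^sup>2" by simp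
 also have "... <= ?F * nint2 (%m \<mu>. (nint2 (%n \<tau>. K n \<tau> m \<mu> * (h n \<tau> * g (n - m) (\<tau> - \<mu>))))\<^sup>2)"
  by (rule nint2_Cauchy_Schwarz) measurable
 also have "... <= ?F * nint2 (%m \<mu>. S * nint2 (%n \<tau>. (h n \<tau> * g (n - m) (\<tau> - \<mu>))\<^sup>2))"
 proof (intro mult_left_mono nint2_mono)
  fix m \<mu>
  have "(nint2 (%n \<tau>. K n \<tau> m \<mu> * (h n \<tau> * g (n - m) (\<tau> - \<mu>))))\<^sup>2
    <= nint2 (%n \<tau>. (K n \<tau> m \<mu>)\<^sup>2) * nint2 (%n \<tau>. (h n \<tau> * g (n - m) (\<tau> - \<mu>))\<^sup>2)"
   by (rule nint2_Cauchy_Schwarz) auto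
  also have "... <= S * nint2 (%n \<tau>. (h n \<tau> * g (n - m) (\<tau> - \<mu>))\<^sup>2)"
   by (intro mult_right_mono S) auto
  finally show "(nint2 (%n \<tau>. K n \<tau> m \<mu> * (h n \<tau> * g (n - m) (\<tau> - \<mu>))))\<^sup>2
    <= S * nint2 (%n \<tau>. (h n \<tau> * g (n - m) (\<tau> - \<mu>))\<^sup>2)" .
 qed auto
 also have "nint2 (%m \<mu>. S * nint2 (%n \<tau>. (h n \<tau> * g (n - m) (\<tau> - \<mu>))\<^sup>2))
   = S * nint2 (%m \<mu>. nint2 (%n \<tau>. (h n \<tau> * g (n - m) (\<tau> - \<mu>))\<^sup>2))"
  by (rule nint2_cmult) measurable
 also have "nint2 (%m \<mu>. nint2 (%n \<tau>. (h n \<tau> * g (n - m) (\<tau> - \<mu>))\<^sup>2))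
   = nint2 (%n \<tau>. nint2 (%m \<mu>. (h n \<tau> * g (n - m) (\<tau> - \<mu>))\<^sup>2))"
  by (rule nint2_swap) measurable
 also have "... = nint2 (%n \<tau>. (h n \<tau>)\<^sup>2 * ?G)"
  using nint2_reflect[of "%n \<tau>. (g n \<tau>)\<^sup>2"]
  by (simp add: power_mult_distrib nn_integral_cmult)
 also have "... = ?H * ?G"
  by (simp add: nn_integral_multc)
 also have "?F * (S * (?H * ?G)) = S * (?F * ?G) * ?H" by (simp add: ac_simps)
 finally show "(nint2 (%n \<tau>. h n \<tau> * nint2 (%m \<mu>. K n \<tau> m \<mu> * (f m \<mu> * g (n - m) (\<tau> - \<mu>)))))\<^sup>2
   <= S * (?F * ?G) * ?H" .
qed

section \<open>Uniform bounds for the lattice sums of the bilinear estimate\<close>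

lemma powr_neg_le_of_le_mult:
 assumes "p >= 0" "c > 0" "y > 0" "y <= c * x"
 shows "x powr (- p) <= c powr p * y powr (- p :: real)"
proof -
 have "x > 0" using assms by (smt (verit) mult_nonneg_nonpos2 mult_nonneg_nonpos)
 have "(c * x) powr (- p) <= y powr (- p)" using assms by (intro powr_mono2') auto
 then have "c powr (- p) * x powr (- p) <= y powr (- p)"
  using assms \<open>x > 0\<close> by (simp add: powr_mult)
 then have "c powr p * (c powr (- p) * x powr (- p)) <= c powr p * y powr (- p)"
  by (intro mult_left_mono) auto
 then show ?thesis using assms by (simp add: mult.assoc[symmetric] flip: powr_add)
qed

lemma ennreal_mult_plus:
 assumes "c >= 0" "A >= 0" "B >= 0"
 shows "ennreal (c * (A + B)) = ennreal c * (ennreal A + ennreal B)"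
 using assms by (metis add_nonneg_nonneg ennreal_mult ennreal_plus)

lemma bracket_sum_finite:
 assumes "p > 1"
 shows "ennreal (2 powr p) * bracket_integral p < \<infinity>"
 using bracket_integral_finite[OF assms] by (simp add: ennreal_mult_less_top)

lemma bracket_linear_ge:
 assumes "\<bar>x\<bar> >= 1"
 shows "bracket (y - c / (2 * x)) <= bracket (2 * x * y - c)"
proof -
 have "2 * x * y - c = 2 * x * (y - c / (2 * x))" using assms by (auto simp: field_simps)
 then have "\<bar>2 * x * y - c\<bar> = (2 * \<bar>x\<bar>) * \<bar>y - c / (2 * x)\<bar>" by (simp add: abs_mult)
 moreover have "1 * \<bar>y - c / (2 * x)\<bar> <= (2 * \<bar>x\<bar>) * \<bar>y - c / (2 * x)\<bar>"
  using assms by (intro mult_right_mono) auto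
 ultimately show ?thesis unfolding bracket_def by simp
qed

lemma bracket_linear_sum_le:
 assumes "p >= 0" "\<bar>x\<bar> >= 1"
 shows "(nsum (%n. ennreal (bracket (2 * x * real_of_int n - c) powr (- p))))
  <= ennreal (2 powr p) * bracket_integral p"
proof -
 have "(nsum (%n. ennreal (bracket (2 * x * real_of_int n - c) powr (- p))))
   <= (nsum (%n. ennreal (bracket (real_of_int n - c / (2 * x)) powr (- p))))"
  by (intro nn_integral_mono ennreal_leI powr_mono2' bracket_linear_ge) (use assms in auto)
 also have "... <= ennreal (2 powr p) * bracket_integral p"
  using assms(1) by (rule bracket_sum_le)
 finally show ?thesis .
qed

text \<open>After completing the square the argument is \<open>(j\<^sup>2 - d) / 2\<close> with \<open>j = 2x - m\<close>, and
 \<open>|j\<^sup>2 - d| >= (|j| - e)\<^sup>2\<close> for \<open>e\<close> the root of the positive part of \<open>d\<close>.  A quadratic phase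
 therefore gains twice the decay of a linear one.\<close>

lemma bracket_quadratic_le:
 assumes "p >= 0"
 obtains e where "!!x. bracket (x\<^sup>2 + (x - m)\<^sup>2 - c) powr (- p)
  <= 4 powr p * (bracket (x - (m + e) / 2) powr (- (2 * p)) + bracket (x - (m - e) / 2) powr (- (2 * p)))"
proof -
 define d where "d = 2 * c - m\<^sup>2"
 define e where "e = sqrt (max 0 d)"
 have e: "e >= 0" "e\<^sup>2 = max 0 d" by (auto simp: e_def)
 have "bracket (x\<^sup>2 + (x - m)\<^sup>2 - c) powr (- p)
  <= 4 powr p * (bracket (x - (m + e) / 2) powr (- (2 * p)) + bracket (x - (m - e) / 2) powr (- (2 * p)))" for x
 proof -
  define j where "j = 2 * x - m"
  define u where "u = \<bar>\<bar>j\<bar> - e\<bar>"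
  have eq: "x\<^sup>2 + (x - m)\<^sup>2 - c = (j\<^sup>2 - d) / 2"
   unfolding j_def d_def by (simp add: power2_eq_square field_simps)
  have ju: "u\<^sup>2 <= \<bar>j\<^sup>2 - d\<bar>"
  proof (cases "d >= 0")
   case True
   have "\<bar>j\<^sup>2 - e\<^sup>2\<bar> = u * (\<bar>j\<bar> + e)"
   proof -
    have "j\<^sup>2 - e\<^sup>2 = (\<bar>j\<bar> - e) * (\<bar>j\<bar> + e)" by (simp add: power2_eq_square algebra_simps)
    then show ?thesis using e(1) by (simp add: u_def abs_mult)
   qed
   moreover have "u * u <= u * (\<bar>j\<bar> + e)"
    by (intro mult_left_mono) (use e(1) in \<open>auto simp: u_def\<close>)
   ultimately show ?thesis using True e(2) by (simp add: power2_eq_square)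
  next
   case False
   then have "e = 0" by (simp add: e_def)
   then show ?thesis using False by (simp add: u_def)
  qed
  have "bracket u * bracket u <= 4 * bracket (x\<^sup>2 + (x - m)\<^sup>2 - c)"
  proof -
   have "2 * u <= u\<^sup>2 + 1" using sum_squares_bound[of u 1] by simp
   moreover have "u >= 0" by (simp add: u_def)
   ultimately show ?thesis using ju unfolding eq bracket_def
    by (simp add: power2_eq_square algebra_simps)
  qed
  then have "bracket (x\<^sup>2 + (x - m)\<^sup>2 - c) powr (- p) <= 4 powr p * (bracket u * bracket u) powr (- p)"
   by (intro powr_neg_le_of_le_mult) (use assms in auto)
  also have "(bracket u * bracket u) powr (- p) = bracket u powr (- (2 * p))"
   by (simp add: powr_mult flip: powr_add)
  also have "... <= bracket (x - (m + e) / 2) powr (- (2 * p)) + bracket (x - (m - e) / 2) powr (- (2 * p))"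
  proof -
   have "bracket (x - (m + e) / 2) <= bracket u \<or> bracket (x - (m - e) / 2) <= bracket u"
   proof -
    have "\<bar>x - (m + e) / 2\<bar> <= \<bar>j - e\<bar>" "\<bar>x - (m - e) / 2\<bar> <= \<bar>- j - e\<bar>"
    proof -
     have "x - (m + e) / 2 = (j - e) / 2" "x - (m - e) / 2 = - ((- j - e) / 2)"
      unfolding j_def by (auto simp: field_simps)
     then show "\<bar>x - (m + e) / 2\<bar> <= \<bar>j - e\<bar>" "\<bar>x - (m - e) / 2\<bar> <= \<bar>- j - e\<bar>"
      by (simp_all only: abs_minus_cancel abs_divide) simp_all
    qed
    then show ?thesis unfolding bracket_def u_def by (cases "j >= 0") auto
   qed
   then have "bracket u powr (- (2 * p)) <= bracket (x - (m + e) / 2) powr (- (2 * p))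
     \<or> bracket u powr (- (2 * p)) <= bracket (x - (m - e) / 2) powr (- (2 * p))"
    using assms by (auto intro!: powr_mono2')
   then show ?thesis by (smt (verit) powr_ge_zero)
  qed
  finally show ?thesis by simp
 qed
 then show ?thesis using that by blast
qed

definition quadratic_sum_bound :: "real => ennreal" where
 "quadratic_sum_bound p = ennreal (4 powr p) * (2 * (ennreal (2 powr (2 * p)) * bracket_integral (2 * p)))"

lemma quadratic_sum_bound_finite: "p > 1 / 2 ==> quadratic_sum_bound p < \<infinity>"
 unfolding quadratic_sum_bound_def
 using bracket_sum_finite[of "2 * p"] by (simp add: ennreal_mult_less_top)

lemma bracket_quadratic_sum_le:
 assumes "p >= 0"
 shows "(nsum (%n. ennreal (bracket ((real_of_int n)\<^sup>2 + (real_of_int n - m)\<^sup>2 - c) powr (- p))))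
  <= quadratic_sum_bound p"
proof -
 obtain e where e: "!!x. bracket (x\<^sup>2 + (x - m)\<^sup>2 - c) powr (- p)
  <= 4 powr p * (bracket (x - (m + e) / 2) powr (- (2 * p)) + bracket (x - (m - e) / 2) powr (- (2 * p)))"
  using bracket_quadratic_le[OF assms, of m c] by blast
 have "(nsum (%n. ennreal (bracket ((real_of_int n)\<^sup>2 + (real_of_int n - m)\<^sup>2 - c) powr (- p))))
  <= (nsum (%n. ennreal (4 powr p) * (ennreal (bracket (real_of_int n - (m + e) / 2) powr (- (2 * p)))
     + ennreal (bracket (real_of_int n - (m - e) / 2) powr (- (2 * p))))))"
 proof (intro nn_integral_mono)
  fix n :: int
  show "ennreal (bracket ((real_of_int n)\<^sup>2 + (real_of_int n - m)\<^sup>2 - c) powr (- p))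
   <= ennreal (4 powr p) * (ennreal (bracket (real_of_int n - (m + e) / 2) powr (- (2 * p)))
     + ennreal (bracket (real_of_int n - (m - e) / 2) powr (- (2 * p))))"
   using ennreal_leI[OF e[of "real_of_int n"]]
   by (subst ennreal_mult_plus[symmetric]) auto
 qed
 also have "... = ennreal (4 powr p) *
   ((nsum (%n. ennreal (bracket (real_of_int n - (m + e) / 2) powr (- (2 * p)))))
    + (nsum (%n. ennreal (bracket (real_of_int n - (m - e) / 2) powr (- (2 * p))))))"
  by (simp add: nn_integral_cmult nn_integral_add)
 also have "... <= ennreal (4 powr p) * (ennreal (2 powr (2 * p)) * bracket_integral (2 * p)
   + ennreal (2 powr (2 * p)) * bracket_integral (2 * p))"
  by (intro mult_left_mono add_mono bracket_sum_le) (use assms in auto)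
 also have "... = quadratic_sum_bound p"
  unfolding quadratic_sum_bound_def
  by (simp only: mult_2[of "ennreal (2 powr (2 * p)) * bracket_integral (2 * p)"])
 finally show ?thesis .
qed

section \<open>Resonances\<close>

definition modulation :: "int => real => real" where
 "modulation n \<tau> = bracket (\<bar>\<tau>\<bar> - (real_of_int n)\<^sup>2)"

lemma modulation_ge_1 [simp]: "modulation n \<tau> >= 1"
 and modulation_pos [simp]: "modulation n \<tau> > 0"
 and modulation_nonneg [simp]: "modulation n \<tau> >= 0"
 and modulation_nonzero [simp]: "modulation n \<tau> \<noteq> 0"
 by (simp_all add: modulation_def)

lemma modulation_measurable [measurable]: "modulation n \<in> bmeas"
 unfolding modulation_def by measurable

lemma modulation_branch:
 obtains e where "e \<in> {1, -1}" "modulation n \<tau> = bracket (\<tau> - e * (real_of_int n)\<^sup>2)"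
proof (cases "\<tau> >= 0")
 case True
 then show ?thesis using that[of 1] by (simp add: modulation_def)
next
 case False
 then have "\<bar>\<bar>\<tau>\<bar> - (real_of_int n)\<^sup>2\<bar> = \<bar>\<tau> - (-1) * (real_of_int n)\<^sup>2\<bar>" by arith
 then show ?thesis using that[of "-1"] by (simp add: modulation_def bracket_def)
qed

text \<open>For the four essentially different choices of signs the resonance function equals
 \<open>2mk\<close>, \<open>2kn\<close>, \<open>2mn\<close> and \<open>m\<^sup>2 + k\<^sup>2 + n\<^sup>2\<close> in absolute value.  In the first and the third case
 it also controls \<open>k\<close> or \<open>n\<close>, which is what makes the linear lattice sums converge.\<close>

lemma resonance:
 fixes m k n e0 e1 e2 :: real
 assumes n: "n = m + k" and nz: "\<bar>m\<bar> >= 1" "\<bar>k\<bar> >= 1" "\<bar>n\<bar> >= 1"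
  and sgn: "e0 \<in> {1, -1}" "e1 \<in> {1, -1}" "e2 \<in> {1, -1}"
 defines "R \<equiv> \<bar>e1 * m\<^sup>2 + e2 * k\<^sup>2 - e0 * n\<^sup>2\<bar>"
 shows "bracket m * bracket k / bracket n <= 2 * R\<^sup>2" "R >= 1"
  "e0 = e2 ==> bracket k <= R \<or> bracket n <= R"
proof -
 define x y z where "x = \<bar>m\<bar>" "y = \<bar>k\<bar>" "z = \<bar>n\<bar>"
 have xyz: "x >= 1" "y >= 1" "z >= 1" using nz by (auto simp: x_y_z_def)
 have br: "bracket m = 1 + x" "bracket k = 1 + y" "bracket n = 1 + z"
  by (auto simp: x_y_z_def bracket_def)
 have tri: "x <= y + z" "y <= x + z" using n by (auto simp: x_y_z_def)
 have twice: "1 + t <= 2 * t * w" if "t >= 1" "w >= 1" for t w :: real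
 proof -
  have "2 * t * 1 <= 2 * t * w" using that by (intro mult_left_mono) auto
  with that(1) show ?thesis by linarith
 qed
 have prod_ge: "1 <= t * w" if "t >= 1" "w >= 1" for t w :: real
  using mult_mono[of 1 t 1 w] that by simp
 have drop: "(1 + x) * (1 + y) / (1 + z) <= (1 + x) * (1 + y)"
  using frac_le[of "(1 + x) * (1 + y)" "(1 + x) * (1 + y)" 1 "1 + z"] xyz by simp
 have both: "(1 + x) * (1 + y) <= 4 * (x * y)"
  using mult_mono[of "1 + x" "2 * x" "1 + y" "2 * y"] xyz by simp
 have le_sq: "t <= t\<^sup>2" if "t >= 1" for t :: real
  using that by (simp add: self_le_power)
 have goal: "(1 + x) * (1 + y) / (1 + z) <= 2 * R\<^sup>2 \<and> R >= 1 \<and> (e0 = e2 \<longrightarrow> 1 + y <= R \<or> 1 + z <= R)"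
 proof -
  consider (a) "e1 = e0" "e2 = e0" | (b) "e1 = e0" "e2 = - e0" | (c) "e1 = - e0" "e2 = e0"
   | (d) "e1 = - e0" "e2 = - e0" using sgn by auto
  then show ?thesis
  proof cases
   case a
   have "e1 * m\<^sup>2 + e2 * k\<^sup>2 - e0 * n\<^sup>2 = - e0 * (2 * m * k)"
    unfolding n a by (simp add: power2_eq_square algebra_simps)
   then have R: "R = 2 * x * y" unfolding R_def using sgn by (auto simp: abs_mult x_y_z_def)
   have "R >= 1" using prod_ge[of x y] xyz R by simp
   moreover have "(1 + x) * (1 + y) / (1 + z) <= 2 * R" using drop both R by simp
   moreover have "1 + y <= R" using twice[of y x] xyz R by (simp add: ac_simps)
   ultimately show ?thesis using le_sq[of R] by simp
  next
   case b
   have "e1 * m\<^sup>2 + e2 * k\<^sup>2 - e0 * n\<^sup>2 = - e0 * (2 * k * n)"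
    unfolding n b by (simp add: power2_eq_square algebra_simps)
   then have R: "R = 2 * y * z" unfolding R_def using sgn by (auto simp: abs_mult x_y_z_def)
   have "R >= 1" using prod_ge[of y z] xyz R by simp
   moreover have "(1 + x) * (1 + y) / (1 + z) <= 2 * R\<^sup>2"
   proof -
    have "1 + x <= (1 + y) * (1 + z)" using tri xyz prod_ge[of y z] by (simp add: algebra_simps)
    then have "(1 + x) * (1 + y) <= ((1 + y) * (1 + z)) * (1 + y)" using xyz by (intro mult_right_mono) auto
    then have "(1 + x) * (1 + y) / (1 + z) <= (1 + y) * (1 + y)" using xyz by (simp add: divide_simps ac_simps)
    also have "... <= R * R" using twice[of y z] xyz R by (intro mult_mono) auto
    finally show ?thesis using zero_le_square[of R] unfolding power2_eq_square by linarith
   qed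
   moreover have "e0 \<noteq> e2" using b sgn by auto
   ultimately show ?thesis by simp
  next
   case c
   have "e1 * m\<^sup>2 + e2 * k\<^sup>2 - e0 * n\<^sup>2 = - e0 * (2 * m * n)"
    unfolding n c by (simp add: power2_eq_square algebra_simps)
   then have R: "R = 2 * x * z" unfolding R_def using sgn by (auto simp: abs_mult x_y_z_def)
   have "R >= 1" using prod_ge[of x z] xyz R by simp
   moreover have "(1 + x) * (1 + y) / (1 + z) <= 2 * R\<^sup>2"
   proof -
    have "1 + y <= (1 + x) * (1 + z)" using tri xyz prod_ge[of x z] by (simp add: algebra_simps)
    then have "(1 + x) * (1 + y) <= (1 + x) * ((1 + x) * (1 + z))" using xyz by (intro mult_left_mono) auto
    then have "(1 + x) * (1 + y) / (1 + z) <= (1 + x) * (1 + x)" using xyz by (simp add: divide_simps ac_simps)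
    also have "... <= R * R" using twice[of x z] xyz R by (intro mult_mono) auto
    finally show ?thesis using zero_le_square[of R] unfolding power2_eq_square by linarith
   qed
   moreover have "1 + z <= R" using twice[of z x] xyz R by (simp add: ac_simps)
   ultimately show ?thesis by simp
  next
   case d
   have "e1 * m\<^sup>2 + e2 * k\<^sup>2 - e0 * n\<^sup>2 = - e0 * (m\<^sup>2 + k\<^sup>2 + n\<^sup>2)"
    unfolding d by (simp add: algebra_simps)
   then have R: "R = x\<^sup>2 + y\<^sup>2 + z\<^sup>2"
    unfolding R_def using sgn by (auto simp: abs_mult x_y_z_def)
   have "1 <= x\<^sup>2" using xyz by simp
   then have "R >= 1" using R by (simp add: add_increasing2)
   moreover have "(1 + x) * (1 + y) / (1 + z) <= 2 * R"
   proof -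
    have "2 * (x * y) <= x\<^sup>2 + y\<^sup>2" using sum_squares_bound[of x y] by simp
    moreover have "0 <= z\<^sup>2" by simp
    ultimately have "4 * (x * y) <= 2 * R" unfolding R distrib_left by linarith
    then show ?thesis using order_trans[OF drop both] by (rule order_trans[rotated])
   qed
   moreover have "e0 \<noteq> e2" using d sgn by auto
   ultimately show ?thesis using le_sq[of R] by simp
  qed
 qed
 show "bracket m * bracket k / bracket n <= 2 * R\<^sup>2" "R >= 1"
  "e0 = e2 ==> bracket k <= R \<or> bracket n <= R"
  using goal by (auto simp: br)
qed

section \<open>The bilinear estimate\<close>

lemma powr_neg_square: "(x powr (- y))\<^sup>2 = x powr (- (2 * y :: real))"
 by (simp add: power2_eq_square flip: powr_add)

locale exponents =
 fixes \<rho> a b :: real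
 assumes rho_pos: "0 < \<rho>" and rho_a: "2 * \<rho> < a" and a_gt: "1 / 4 < a" and a_less: "a < 1 / 2"
  and b_gt: "1 / 2 < b" and ab: "a + b < 1"

begin

definition kap :: real where "kap = b - 2 * \<rho>"

lemma a_pos: "a > 0" and b_pos: "b > 0" and kap_pos: "kap > 0" and ab_less: "a < b"
 and two_rho_le: "2 * \<rho> <= a" and kap_a: "2 * a + 2 * kap > 1"
 using rho_pos rho_a a_gt a_less b_gt unfolding kap_def right_diff_distrib by linarith+

definition freq_weight :: "int => int => real" where
 "freq_weight n m = (bracket (of_int m) * bracket (of_int (n - m)) / bracket (of_int n)) powr \<rho>"

definition ker :: "int => real => int => real => real" where
 "ker n \<tau> m \<mu> = (if n = 0 then 0 else
   modulation n \<tau> powr (- a) * freq_weight n m *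
   (modulation m \<mu> powr (- b) * modulation (n - m) (\<tau> - \<mu>) powr (- b)))"

definition input_dominant :: "int => real => int => real => bool" where
 "input_dominant n \<tau> m \<mu> \<longleftrightarrow> n \<noteq> 0 \<and> m \<noteq> 0 \<and> n \<noteq> m \<and>
   modulation n \<tau> <= modulation m \<mu> \<and> modulation (n - m) (\<tau> - \<mu>) <= modulation m \<mu>"

lemma freq_weight_nonneg [simp]: "freq_weight n m >= 0"
 by (simp add: freq_weight_def)

lemma freq_weight_reflect: "freq_weight n (n - m) = freq_weight n m"
 by (simp add: freq_weight_def mult.commute)

lemma ker_nonneg [simp]: "ker n \<tau> m \<mu> >= 0"
 by (simp add: ker_def)

lemma ker_reflect: "ker n \<tau> (n - m) (\<tau> - \<mu>) = ker n \<tau> m \<mu>"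
 by (simp add: ker_def freq_weight_reflect mult.commute)

lemma resonance_bounds:
 assumes nz: "n \<noteq> 0" "m \<noteq> 0" "n \<noteq> m"
  and L: "modulation n \<tau> <= L" "modulation m \<mu> <= L" "modulation (n - m) (\<tau> - \<mu>) <= L"
 obtains R e0 e2 where "1 <= R" "R <= 3 * L" "freq_weight n m <= 2 powr \<rho> * R powr (2 * \<rho>)"
  "e0 \<in> {1, -1}" "e2 \<in> {1, -1}" "modulation n \<tau> = bracket (\<tau> - e0 * (of_int n)\<^sup>2)"
  "modulation (n - m) (\<tau> - \<mu>) = bracket (\<tau> - \<mu> - e2 * (of_int (n - m))\<^sup>2)"
  "e0 = e2 ==> bracket (of_int (n - m)) <= R \<or> bracket (of_int n) <= R"
proof -
 obtain e0 where e0: "e0 \<in> {1, -1}" "modulation n \<tau> = bracket (\<tau> - e0 * (of_int n)\<^sup>2)"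
  by (rule modulation_branch)
 obtain e1 where e1: "e1 \<in> {1, -1}" "modulation m \<mu> = bracket (\<mu> - e1 * (of_int m)\<^sup>2)"
  by (rule modulation_branch)
 obtain e2 where e2: "e2 \<in> {1, -1}"
  "modulation (n - m) (\<tau> - \<mu>) = bracket (\<tau> - \<mu> - e2 * (of_int (n - m))\<^sup>2)"
  by (rule modulation_branch)
 define R where "R = \<bar>e1 * (of_int m)\<^sup>2 + e2 * (of_int (n - m))\<^sup>2 - e0 * (of_int n)\<^sup>2\<bar>"
 have abs1: "\<bar>real_of_int k\<bar> >= 1" if "k \<noteq> 0" for k
  using that by linarith
 note res = resonance[of "of_int n" "of_int m" "of_int (n - m)" e0 e1 e2, folded R_def]
 have R: "bracket (of_int m) * bracket (of_int (n - m)) / bracket (of_int n) <= 2 * R\<^sup>2" "R >= 1"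
  "e0 = e2 ==> bracket (of_int (n - m)) <= R \<or> bracket (of_int n) <= R"
  by (rule res; use nz e0(1) e1(1) e2(1) abs1[of n] abs1[of m] abs1[of "n - m"] in simp)+
 have "R <= \<bar>\<tau> - e0 * (of_int n)\<^sup>2\<bar> + \<bar>\<mu> - e1 * (of_int m)\<^sup>2\<bar> + \<bar>\<tau> - \<mu> - e2 * (of_int (n - m))\<^sup>2\<bar>"
  unfolding R_def by arith
 also have "... <= 3 * L" using L unfolding e0 e1 e2 bracket_def by linarith
 finally have RL: "R <= 3 * L" .
 have "freq_weight n m <= (2 * R\<^sup>2) powr \<rho>"
  unfolding freq_weight_def using R(1) rho_pos by (intro powr_mono2) auto
 also have "... = 2 powr \<rho> * R powr (2 * \<rho>)"
  using R(2) by (simp add: powr_mult powr_powr flip: powr_numeral)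
 finally have "freq_weight n m <= 2 powr \<rho> * R powr (2 * \<rho>)" .
 then show ?thesis using that[OF R(2) RL _ e0(1) e2(1) e0(2) e2(2) R(3)] by simp
qed

text \<open>The exponent \<open>2 \<rho>\<close> of the resonance is at most \<open>a\<close>: this is the place where \<open>s > -1/4\<close> is
 used.\<close>

lemma ker_le_output:
 assumes "\<not> input_dominant n \<tau> m \<mu>" "\<not> input_dominant n \<tau> (n - m) (\<tau> - \<mu>)"
 shows "ker n \<tau> m \<mu> <= (2 powr \<rho> * 3 powr a) * (modulation m \<mu> powr (- b) * modulation (n - m) (\<tau> - \<mu>) powr (- b))"
proof -
 have ge1: "1 <= 2 powr \<rho> * 3 powr a"
  using mult_mono[of 1 "2 powr \<rho>" 1 "3 powr a"] rho_pos a_pos by (simp add: ge_one_powr_ge_zero)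
 have "modulation n \<tau> powr (- a) * freq_weight n m <= 2 powr \<rho> * 3 powr a" if n: "n \<noteq> 0"
 proof (cases "m = 0 \<or> n = m")
  case True
  then have "freq_weight n m = 1" by (auto simp: freq_weight_def bracket_def)
  moreover have "modulation n \<tau> powr (- a) <= 1"
   using powr_mono[of "-a" 0 "modulation n \<tau>"] a_pos by (simp split: if_splits)
  ultimately show ?thesis using ge1 by simp
 next
  case False
  then have m: "m \<noteq> 0" "n \<noteq> m" by auto
  from False have L: "modulation m \<mu> <= modulation n \<tau>" "modulation (n - m) (\<tau> - \<mu>) <= modulation n \<tau>"
   using assms that by (auto simp: input_dominant_def)
  obtain R where R: "1 <= R" "R <= 3 * modulation n \<tau>" "freq_weight n m <= 2 powr \<rho> * R powr (2 * \<rho>)"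
   using resonance_bounds[OF n m order_refl L] by blast
  have "modulation n \<tau> powr (- a) <= 3 powr a * R powr (- a)"
   using R a_pos by (intro powr_neg_le_of_le_mult) auto
  then have "modulation n \<tau> powr (- a) * freq_weight n m <= (3 powr a * R powr (- a)) * (2 powr \<rho> * R powr (2 * \<rho>))"
   using R by (intro mult_mono) auto
  also have "... = (2 powr \<rho> * 3 powr a) * R powr (2 * \<rho> - a)"
   using R by (simp add: powr_diff powr_minus field_simps)
  also have "... <= (2 powr \<rho> * 3 powr a) * 1"
   using powr_mono[of "2 * \<rho> - a" 0 R] R two_rho_le by (intro mult_left_mono) auto
  finally show ?thesis by simp
 qed
 then show ?thesis unfolding ker_def by (auto intro!: mult_right_mono)
qed

definition branch_sq :: "real => int => real => int => real => real" where
 "branch_sq e n \<tau> m \<mu> =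
   bracket (\<tau> - e * (of_int n)\<^sup>2) powr (- (2 * a)) * bracket (\<tau> - \<mu> + e * (of_int (n - m))\<^sup>2) powr (- (2 * b))
  + bracket (\<tau> - e * (of_int n)\<^sup>2) powr (- (2 * a)) * bracket (\<tau> - \<mu> - e * (of_int (n - m))\<^sup>2) powr (- (2 * b))
   * (bracket (of_int n) powr (- (2 * kap)) + bracket (of_int (n - m)) powr (- (2 * kap)))"

lemma branch_sq_nonneg [simp]: "branch_sq e n \<tau> m \<mu> >= 0"
 unfolding branch_sq_def by simp

lemma ker_le_input:
 assumes "input_dominant n \<tau> m \<mu>"
 shows "(ker n \<tau> m \<mu>)\<^sup>2 <= (2 powr \<rho> * 3 powr b)\<^sup>2 * (branch_sq 1 n \<tau> m \<mu> + branch_sq (- 1) n \<tau> m \<mu>)"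
proof -
 have nz: "n \<noteq> 0" "m \<noteq> 0" "n \<noteq> m" and L: "modulation n \<tau> <= modulation m \<mu>" "modulation (n - m) (\<tau> - \<mu>) <= modulation m \<mu>"
  using assms by (auto simp: input_dominant_def)
 obtain R e0 e2 where R: "1 <= R" "R <= 3 * modulation m \<mu>" "freq_weight n m <= 2 powr \<rho> * R powr (2 * \<rho>)"
  and e: "e0 \<in> {1, -1}" "e2 \<in> {1, -1}" "modulation n \<tau> = bracket (\<tau> - e0 * (of_int n)\<^sup>2)"
  "modulation (n - m) (\<tau> - \<mu>) = bracket (\<tau> - \<mu> - e2 * (of_int (n - m))\<^sup>2)"
  and Rk: "e0 = e2 ==> bracket (of_int (n - m)) <= R \<or> bracket (of_int n) <= R"
  using resonance_bounds[OF nz L(1) order_refl L(2)] by blast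
 define c where "c = 2 powr \<rho> * 3 powr b"
 define X where "X = modulation n \<tau> powr (- a) * modulation (n - m) (\<tau> - \<mu>) powr (- b)"
 have "modulation m \<mu> powr (- b) <= 3 powr b * R powr (- b)"
  using R b_pos by (intro powr_neg_le_of_le_mult) auto
 then have "freq_weight n m * modulation m \<mu> powr (- b) <= (2 powr \<rho> * R powr (2 * \<rho>)) * (3 powr b * R powr (- b))"
  using R by (intro mult_mono) auto
 also have "... = c * R powr (- kap)"
  using R by (simp add: c_def kap_def powr_diff powr_minus field_simps)
 finally have "X * (freq_weight n m * modulation m \<mu> powr (- b)) <= X * (c * R powr (- kap))"
  by (intro mult_left_mono) (auto simp: X_def)
 then have "ker n \<tau> m \<mu> <= c * (X * R powr (- kap))"
  using nz by (simp add: ker_def X_def ac_simps)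
 then have "(ker n \<tau> m \<mu>)\<^sup>2 <= (c * (X * R powr (- kap)))\<^sup>2"
  by (intro power_mono) auto
 also have "... = c\<^sup>2 * (X\<^sup>2 * R powr (- (2 * kap)))"
  by (simp add: power_mult_distrib powr_neg_square)
 also have "... <= c\<^sup>2 * branch_sq e0 n \<tau> m \<mu>"
 proof (intro mult_left_mono)
  have X2: "X\<^sup>2 = bracket (\<tau> - e0 * (of_int n)\<^sup>2) powr (- (2 * a)) * bracket (\<tau> - \<mu> - e2 * (of_int (n - m))\<^sup>2) powr (- (2 * b))"
   unfolding X_def e(3,4) by (simp add: power_mult_distrib powr_neg_square)
  show "X\<^sup>2 * R powr (- (2 * kap)) <= branch_sq e0 n \<tau> m \<mu>"
  proof (cases "e0 = e2")
   case True
   have "R powr (- (2 * kap)) <= bracket (of_int (n - m)) powr (- (2 * kap)) \<or> R powr (- (2 * kap)) <= bracket (of_int n) powr (- (2 * kap))"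
    using Rk[OF True] kap_pos by (auto intro!: powr_mono2')
   then have "R powr (- (2 * kap)) <= bracket (of_int n) powr (- (2 * kap)) + bracket (of_int (n - m)) powr (- (2 * kap))"
    by (smt (verit) powr_ge_zero)
   then have "X\<^sup>2 * R powr (- (2 * kap)) <= X\<^sup>2 * (bracket (of_int n) powr (- (2 * kap)) + bracket (of_int (n - m)) powr (- (2 * kap)))"
    by (intro mult_left_mono) auto
   also have "... <= branch_sq e0 n \<tau> m \<mu>"
    unfolding branch_sq_def X2 True by simp
   finally show ?thesis .
  next
   case False
   then have e2: "e2 = - e0" using e(1,2) by auto
   have "R powr (- (2 * kap)) <= 1" using powr_mono[of "- (2 * kap)" 0 R] R kap_pos by simp
   then have "X\<^sup>2 * R powr (- (2 * kap)) <= X\<^sup>2 * 1" by (intro mult_left_mono) auto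
   also have "... <= branch_sq e0 n \<tau> m \<mu>"
    unfolding branch_sq_def X2 e2 by simp
   finally show ?thesis .
  qed
 qed auto
 also have "... <= c\<^sup>2 * (branch_sq 1 n \<tau> m \<mu> + branch_sq (- 1) n \<tau> m \<mu>)"
  using e(1) by (intro mult_left_mono) auto
 finally show ?thesis unfolding c_def .
qed

lemma branch_convolution_le:
 assumes "0 <= p" "p <= q" "q > 1"
 shows "(nnint (%\<tau>. ennreal (bracket (\<tau> - \<alpha>) powr (- p) * bracket (\<tau> - \<beta>) powr (- q))))
   <= (ennreal (3 * 2 powr p) * bracket_integral q) * ennreal (bracket (\<alpha> - \<beta>) powr (- p))"
 using bracket_convolution_le[OF assms(1,2), of \<alpha> \<beta>] by (simp add: ennreal_mult' ac_simps)

lemma branch_sq_sum_bounded: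
 obtains S where "S < \<infinity>"
  "!!m \<mu> e. m \<noteq> 0 ==> e \<in> {1, -1} ==> nint2 (%n \<tau>. ennreal (branch_sq e n \<tau> m \<mu>)) <= S"
proof -
 define c where "c = ennreal (3 * 2 powr (2 * a)) * bracket_integral (2 * b)"
 define SC where "SC = ennreal (2 powr (2 * a + 2 * kap)) * bracket_integral (2 * a + 2 * kap)"
 have cfin: "c < \<infinity>"
  unfolding c_def using bracket_integral_finite[of "2 * b"] b_gt by (simp add: ennreal_mult_less_top)
 have SCfin: "SC < \<infinity>" unfolding SC_def by (rule bracket_sum_finite[OF kap_a])
 have main: "nint2 (%n \<tau>. ennreal (branch_sq e n \<tau> m \<mu>)) <= c * quadratic_sum_bound (2 * a) + c * (SC + SC + (SC + SC))"
  if m: "m \<noteq> 0" and e: "e \<in> {1, -1}" for m \<mu> e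
 proof -
  define q where "q n = bracket (real_of_int n) powr (- (2 * kap)) + bracket (real_of_int (n - m)) powr (- (2 * kap))" for n
  have q_nonneg: "q n >= 0" for n by (simp add: q_def)
  define A where "A n = bracket ((of_int n)\<^sup>2 + (of_int n - of_int m)\<^sup>2 - e * \<mu>) powr (- (2 * a))" for n
  define B where "B n = bracket (2 * of_int m * of_int n - ((of_int m)\<^sup>2 + e * \<mu>)) powr (- (2 * a))" for n
  have inner: "(nnint (%\<tau>. ennreal (branch_sq e n \<tau> m \<mu>))) <= c * ennreal (A n) + c * ennreal (B n * q n)" for n
  proof -
   have eq: "ennreal (branch_sq e n \<tau> m \<mu>)
    = ennreal (bracket (\<tau> - e * (of_int n)\<^sup>2) powr (- (2 * a)) * bracket (\<tau> - (\<mu> - e * (of_int (n - m))\<^sup>2)) powr (- (2 * b)))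
    + ennreal (q n) * ennreal (bracket (\<tau> - e * (of_int n)\<^sup>2) powr (- (2 * a)) * bracket (\<tau> - (\<mu> + e * (of_int (n - m))\<^sup>2)) powr (- (2 * b)))" for \<tau>
    unfolding branch_sq_def q_def[symmetric]
    by (subst ennreal_plus) (auto simp: q_nonneg ennreal_mult' ac_simps algebra_simps simp del: ennreal_plus)
   have brA: "bracket (e * (of_int n)\<^sup>2 - (\<mu> - e * (of_int (n - m))\<^sup>2)) powr (- (2 * a)) = A n"
   proof -
    have "\<bar>e * (of_int n)\<^sup>2 - (\<mu> - e * (of_int (n - m))\<^sup>2)\<bar> = \<bar>(of_int n)\<^sup>2 + (of_int n - of_int m)\<^sup>2 - e * \<mu>\<bar>"
     using e by auto
    then show ?thesis by (simp add: A_def bracket_def)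
   qed
   have brB: "bracket (e * (of_int n)\<^sup>2 - (\<mu> + e * (of_int (n - m))\<^sup>2)) powr (- (2 * a)) = B n"
   proof -
    have "(of_int n)\<^sup>2 - (real_of_int (n - m))\<^sup>2 = 2 * of_int m * of_int n - (of_int m)\<^sup>2"
     by (simp add: power2_eq_square algebra_simps)
    then have "\<bar>e * (of_int n)\<^sup>2 - (\<mu> + e * (of_int (n - m))\<^sup>2)\<bar> = \<bar>2 * of_int m * of_int n - ((of_int m)\<^sup>2 + e * \<mu>)\<bar>"
     using e by auto
    then show ?thesis by (simp add: B_def bracket_def)
   qed
   have "(nnint (%\<tau>. ennreal (branch_sq e n \<tau> m \<mu>))) =
     (nnint (%\<tau>. ennreal (bracket (\<tau> - e * (of_int n)\<^sup>2) powr (- (2 * a)) * bracket (\<tau> - (\<mu> - e * (of_int (n - m))\<^sup>2)) powr (- (2 * b)))))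
    + ennreal (q n) * (nnint (%\<tau>. ennreal (bracket (\<tau> - e * (of_int n)\<^sup>2) powr (- (2 * a)) * bracket (\<tau> - (\<mu> + e * (of_int (n - m))\<^sup>2)) powr (- (2 * b)))))"
    unfolding eq by (subst nn_integral_add) (auto simp: nn_integral_cmult)
   also have "... <= c * ennreal (A n) + ennreal (q n) * (c * ennreal (B n))"
    unfolding c_def brA[symmetric] brB[symmetric]
    by (intro add_mono mult_left_mono branch_convolution_le) (use a_pos ab_less b_gt in auto)
   also have "ennreal (q n) * (c * ennreal (B n)) = c * ennreal (B n * q n)"
    using q_nonneg by (simp add: ennreal_mult'' ac_simps)
   finally show ?thesis .
  qed
  have sumB: "(nsum (%n. ennreal (B n * q n))) <= SC + SC + (SC + SC)"
  proof -
   define x0 where "x0 = ((of_int m)\<^sup>2 + e * \<mu>) / (2 * of_int m)"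
   let ?r = "- (2 * a + 2 * kap)"
   have absm: "\<bar>real_of_int m\<bar> >= 1" using m by linarith
   have "B n * q n <= bracket (of_int n - x0) powr ?r + bracket (of_int n - 0) powr ?r
     + (bracket (of_int n - x0) powr ?r + bracket (of_int n - of_int m) powr ?r)" for n
   proof -
    have "B n <= bracket (of_int n - x0) powr (- (2 * a))"
     unfolding B_def x0_def by (intro powr_mono2' bracket_linear_ge absm) (use a_pos in auto)
    then have "B n * q n <= bracket (of_int n - x0) powr (- (2 * a)) * q n"
     by (intro mult_right_mono q_nonneg)
    also have "... = bracket (of_int n - x0) powr (- (2 * a)) * bracket (of_int n) powr (- (2 * kap))
      + bracket (of_int n - x0) powr (- (2 * a)) * bracket (of_int n - of_int m) powr (- (2 * kap))"
     by (simp add: q_def distrib_left)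
    also have "... <= (bracket (of_int n - x0) powr ?r + bracket (of_int n) powr ?r)
     + (bracket (of_int n - x0) powr ?r + bracket (of_int n - of_int m) powr ?r)"
     by (intro add_mono bracket_powr_Young) (use a_pos kap_pos in auto)
    finally show ?thesis by simp
   qed
   then have "(nsum (%n. ennreal (B n * q n))) <= (nsum (%n.
      ennreal (bracket (of_int n - x0) powr ?r) + ennreal (bracket (of_int n - 0) powr ?r)
     + (ennreal (bracket (of_int n - x0) powr ?r) + ennreal (bracket (of_int n - of_int m) powr ?r))))"
    by (intro nn_integral_mono) (simp flip: ennreal_plus)
   also have "... = (nsum (%n. ennreal (bracket (of_int n - x0) powr ?r)))
      + (nsum (%n. ennreal (bracket (of_int n - 0) powr ?r)))
     + ((nsum (%n. ennreal (bracket (of_int n - x0) powr ?r)))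
      + (nsum (%n. ennreal (bracket (of_int n - of_int m) powr ?r))))"
    by (simp add: nn_integral_add)
   also have "... <= SC + SC + (SC + SC)"
    unfolding SC_def by (intro add_mono bracket_sum_le) (use a_pos kap_pos in auto)
   finally show ?thesis .
  qed
  have "nint2 (%n \<tau>. ennreal (branch_sq e n \<tau> m \<mu>)) <= (nsum (%n. c * ennreal (A n) + c * ennreal (B n * q n)))"
   by (intro nn_integral_mono inner)
  also have "... = c * (nsum (%n. ennreal (A n))) + c * (nsum (%n. ennreal (B n * q n)))"
   by (simp add: nn_integral_add nn_integral_cmult)
  also have "... <= c * quadratic_sum_bound (2 * a) + c * (SC + SC + (SC + SC))"
   unfolding A_def by (intro add_mono mult_left_mono sumB bracket_quadratic_sum_le) (use a_pos in auto)
  finally show ?thesis .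
 qed
 show ?thesis
 proof (rule that[OF _ main])
  show "c * quadratic_sum_bound (2 * a) + c * (SC + SC + (SC + SC)) < \<infinity>"
   using cfin SCfin quadratic_sum_bound_finite[of "2 * a"] a_gt by (simp add: ennreal_mult_less_top)
 qed
qed

lemma modulation_powr_le_branches:
 "modulation n \<tau> powr p <= bracket (\<tau> - 1 * (of_int n)\<^sup>2) powr p + bracket (\<tau> - (-1) * (of_int n)\<^sup>2) powr p"
proof -
 obtain e where "e \<in> {1, -1}" "modulation n \<tau> = bracket (\<tau> - e * (of_int n)\<^sup>2)"
  by (rule modulation_branch)
 then show ?thesis by auto
qed

lemma output_sum_bounded:
 obtains S where "S < \<infinity>"
  "!!n \<tau>. n \<noteq> 0 ==> nint2 (%m \<mu>. ennreal ((modulation m \<mu> powr (- b) * modulation (n - m) (\<tau> - \<mu>) powr (- b))\<^sup>2)) <= S"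
proof -
 define c where "c = ennreal (3 * 2 powr (2 * b)) * bracket_integral (2 * b)"
 define SC where "SC = ennreal (2 powr (2 * b)) * bracket_integral (2 * b)"
 define QC where "QC = quadratic_sum_bound (2 * b)"
 have main: "nint2 (%m \<mu>. ennreal ((modulation m \<mu> powr (- b) * modulation (n - m) (\<tau> - \<mu>) powr (- b))\<^sup>2))
   <= (c * QC + c * SC) + (c * SC + c * QC)" if n: "n \<noteq> 0" for n \<tau>
 proof -
  define T where "T e1 e2 m \<mu> = bracket (\<mu> - e1 * (of_int m)\<^sup>2) powr (- (2 * b)) * bracket (\<mu> - (\<tau> - e2 * (of_int (n - m))\<^sup>2)) powr (- (2 * b))" for e1 e2 m \<mu>
  have pw: "(modulation m \<mu> powr (- b) * modulation (n - m) (\<tau> - \<mu>) powr (- b))\<^sup>2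
    <= (T 1 1 m \<mu> + T 1 (-1) m \<mu>) + (T (-1) 1 m \<mu> + T (-1) (-1) m \<mu>)" for m \<mu>
  proof -
   have br: "bracket (\<mu> - (\<tau> - e * (of_int (n - m))\<^sup>2)) = bracket (\<tau> - \<mu> - e * (of_int (n - m))\<^sup>2)" for e
    by (simp add: bracket_def)
   have "(modulation m \<mu> powr (- b) * modulation (n - m) (\<tau> - \<mu>) powr (- b))\<^sup>2
    = modulation m \<mu> powr (- (2 * b)) * modulation (n - m) (\<tau> - \<mu>) powr (- (2 * b))"
    by (simp add: power_mult_distrib powr_neg_square)
   also have "... <= (bracket (\<mu> - 1 * (of_int m)\<^sup>2) powr (- (2 * b)) + bracket (\<mu> - (-1) * (of_int m)\<^sup>2) powr (- (2 * b)))
     * (bracket (\<tau> - \<mu> - 1 * (of_int (n - m))\<^sup>2) powr (- (2 * b)) + bracket (\<tau> - \<mu> - (-1) * (of_int (n - m))\<^sup>2) powr (- (2 * b)))"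
    by (intro mult_mono modulation_powr_le_branches) auto
   also have "... = (T 1 1 m \<mu> + T 1 (-1) m \<mu>) + (T (-1) 1 m \<mu> + T (-1) (-1) m \<mu>)"
    unfolding T_def br by (simp only: distrib_left distrib_right add_ac)
   finally show ?thesis .
  qed
  have T_nonneg: "T e1 e2 m \<mu> >= 0" for e1 e2 m \<mu> by (simp add: T_def)
  have T_meas [measurable]: "(%\<mu>. T e1 e2 m \<mu>) \<in> bmeas" for e1 e2 m
   unfolding T_def by measurable
  have T_int: "(nnint (%\<mu>. ennreal (T e1 e2 m \<mu>))) <= c * ennreal (bracket (e1 * (of_int m)\<^sup>2 - (\<tau> - e2 * (of_int (n - m))\<^sup>2)) powr (- (2 * b)))" for e1 e2 m
   unfolding T_def c_def by (intro branch_convolution_le) (use b_gt in auto)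
  have quad: "nint2 (%m \<mu>. ennreal (T e e m \<mu>)) <= c * QC" if e: "e \<in> {1, -1}" for e
  proof -
   have eq: "bracket (e * (of_int m)\<^sup>2 - (\<tau> - e * (of_int (n - m))\<^sup>2)) = bracket ((of_int m)\<^sup>2 + (of_int m - of_int n)\<^sup>2 - e * \<tau>)" for m :: int
   proof -
    have "(real_of_int (n - m))\<^sup>2 = (of_int m - of_int n)\<^sup>2" by (simp add: power2_commute)
    then have "\<bar>e * (of_int m)\<^sup>2 - (\<tau> - e * (of_int (n - m))\<^sup>2)\<bar> = \<bar>(of_int m)\<^sup>2 + (of_int m - of_int n)\<^sup>2 - e * \<tau>\<bar>"
     using e by auto
    then show ?thesis by (simp add: bracket_def)
   qed
   have "nint2 (%m \<mu>. ennreal (T e e m \<mu>)) <= (nsum (%m. c * ennreal (bracket ((of_int m)\<^sup>2 + (of_int m - of_int n)\<^sup>2 - e * \<tau>) powr (- (2 * b)))))"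
    using T_int[of e e] unfolding eq by (intro nn_integral_mono)
   also have "... = c * (nsum (%m. ennreal (bracket ((real_of_int m)\<^sup>2 + (of_int m - of_int n)\<^sup>2 - e * \<tau>) powr (- (2 * b)))))"
    by (simp add: nn_integral_cmult)
   also have "... <= c * QC"
    unfolding QC_def by (intro mult_left_mono bracket_quadratic_sum_le) (use b_gt in auto)
   finally show ?thesis .
  qed
  have lin: "nint2 (%m \<mu>. ennreal (T e (- e) m \<mu>)) <= c * SC" if e: "e \<in> {1, -1}" for e
  proof -
   have eq: "bracket (e * (of_int m)\<^sup>2 - (\<tau> - (- e) * (of_int (n - m))\<^sup>2)) = bracket (2 * of_int n * of_int m - ((of_int n)\<^sup>2 + e * \<tau>))" for m :: int
   proof -
    have "(of_int m)\<^sup>2 - (real_of_int (n - m))\<^sup>2 = 2 * of_int n * of_int m - (of_int n)\<^sup>2"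
     by (simp add: power2_eq_square algebra_simps)
    then have "\<bar>e * (of_int m)\<^sup>2 - (\<tau> - (- e) * (of_int (n - m))\<^sup>2)\<bar> = \<bar>2 * of_int n * of_int m - ((of_int n)\<^sup>2 + e * \<tau>)\<bar>"
     using e by auto
    then show ?thesis by (simp add: bracket_def)
   qed
   have "nint2 (%m \<mu>. ennreal (T e (- e) m \<mu>)) <= (nsum (%m. c * ennreal (bracket (2 * of_int n * of_int m - ((of_int n)\<^sup>2 + e * \<tau>)) powr (- (2 * b)))))"
    using T_int[of e "- e"] unfolding eq by (intro nn_integral_mono)
   also have "... = c * (nsum (%m. ennreal (bracket (2 * of_int n * real_of_int m - ((of_int n)\<^sup>2 + e * \<tau>)) powr (- (2 * b)))))"
    by (simp add: nn_integral_cmult)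
   also have "... <= c * SC"
   proof -
    have "\<bar>real_of_int n\<bar> >= 1" using n by linarith
    then show ?thesis
     unfolding SC_def using b_pos by (intro mult_left_mono bracket_linear_sum_le) auto
   qed
   finally show ?thesis .
  qed
  have "nint2 (%m \<mu>. ennreal ((modulation m \<mu> powr (- b) * modulation (n - m) (\<tau> - \<mu>) powr (- b))\<^sup>2))
   <= nint2 (%m \<mu>. (ennreal (T 1 1 m \<mu>) + ennreal (T 1 (-1) m \<mu>)) + (ennreal (T (-1) 1 m \<mu>) + ennreal (T (-1) (-1) m \<mu>)))"
  proof (intro nint2_mono)
   fix m \<mu>
   show "ennreal ((modulation m \<mu> powr (- b) * modulation (n - m) (\<tau> - \<mu>) powr (- b))\<^sup>2)
    <= (ennreal (T 1 1 m \<mu>) + ennreal (T 1 (-1) m \<mu>)) + (ennreal (T (-1) 1 m \<mu>) + ennreal (T (-1) (-1) m \<mu>))"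
    using ennreal_leI[OF pw[of m \<mu>]] T_nonneg by (simp flip: ennreal_plus)
  qed
  also have "... = (nint2 (%m \<mu>. ennreal (T 1 1 m \<mu>)) + nint2 (%m \<mu>. ennreal (T 1 (-1) m \<mu>)))
    + (nint2 (%m \<mu>. ennreal (T (-1) 1 m \<mu>)) + nint2 (%m \<mu>. ennreal (T (-1) (-1) m \<mu>)))"
   by (simp add: nn_integral_add)
  also have "... <= (c * QC + c * SC) + (c * SC + c * QC)"
   using lin[of 1] lin[of "-1"] by (intro add_mono quad) auto
  finally show ?thesis .
 qed
 show ?thesis
 proof (rule that[OF _ main])
  show "c * QC + c * SC + (c * SC + c * QC) < \<infinity>"
   using bracket_sum_finite[of "2 * b"] bracket_integral_finite[of "2 * b"] quadratic_sum_bound_finite[of "2 * b"] b_gt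
   unfolding c_def SC_def QC_def by (simp add: ennreal_mult_less_top)
 qed
qed

end

lemma ennreal_square_add_le: "(x + y)\<^sup>2 <= 2 * (x\<^sup>2 + y\<^sup>2)" for x y :: ennreal
proof -
 have "(x + y)\<^sup>2 = x\<^sup>2 + y\<^sup>2 + 2 * x * y" by (rule power2_sum)
 also have "... <= x\<^sup>2 + y\<^sup>2 + (x\<^sup>2 + y\<^sup>2)"
  by (intro add_left_mono sum_of_squares_ge_ennreal)
 also have "... = 2 * (x\<^sup>2 + y\<^sup>2)" by (rule mult_2[symmetric])
 finally show ?thesis .
qed

context exponents

begin

lemma ker_measurable [measurable]:
 "(%(\<tau>, \<mu>). ker n \<tau> m \<mu>) \<in> borel_measurable (borel \<Otimes>\<^sub>M borel)"
 unfolding ker_def by (cases "n = 0") auto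

lemma kernel_convolution_bounded:
 obtains C where "C < \<infinity>"
  "!!f g. (!!m. f m \<in> bmeas) ==> (!!m. g m \<in> bmeas) ==>
   nint2 (%n \<tau>. (nint2 (%m \<mu>. ennreal (ker n \<tau> m \<mu>) * (f m \<mu> * g (n - m) (\<tau> - \<mu>))))\<^sup>2)
   <= C * (nint2 (%n \<tau>. (f n \<tau>)\<^sup>2) * nint2 (%n \<tau>. (g n \<tau>)\<^sup>2))"
proof -
 define kA where "kA n \<tau> m \<mu> = (if \<not> input_dominant n \<tau> m \<mu> \<and> \<not> input_dominant n \<tau> (n - m) (\<tau> - \<mu>)
  then ennreal (ker n \<tau> m \<mu>) else 0)" for n \<tau> m \<mu>
 define kB where "kB n \<tau> m \<mu> = (if input_dominant n \<tau> m \<mu> then ennreal (ker n \<tau> m \<mu>) else 0)" for n \<tau> m \<mu>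
 have [measurable]: "Measurable.pred (borel \<Otimes>\<^sub>M borel) (%(\<tau>, \<mu>). input_dominant n \<tau> m \<mu>)" for n m
  unfolding input_dominant_def by measurable
 have [measurable]: "Measurable.pred (borel \<Otimes>\<^sub>M borel) (%(\<tau>, \<mu>). input_dominant n \<tau> (n - m) (\<tau> - \<mu>))" for n m
  unfolding input_dominant_def by measurable
 have kA_meas [measurable]: "(%(\<tau>, \<mu>). kA n \<tau> m \<mu>) \<in> borel_measurable (borel \<Otimes>\<^sub>M borel)" for n m
  unfolding kA_def by measurable
 have kB_meas [measurable]: "(%(\<tau>, \<mu>). kB n \<tau> m \<mu>) \<in> borel_measurable (borel \<Otimes>\<^sub>M borel)" for n m
  unfolding kB_def by measurable
 have [measurable]: "kA n \<tau> m \<in> bmeas" "kB n \<tau> m \<in> bmeas" for n \<tau> m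
  using measurable_compose[OF _ kA_meas[of n m], of "%\<mu>. (\<tau>, \<mu>)" borel]
   measurable_compose[OF _ kB_meas[of n m], of "%\<mu>. (\<tau>, \<mu>)" borel] by simp_all
 have ker_split: "ennreal (ker n \<tau> m \<mu>) <= kA n \<tau> m \<mu> + (kB n \<tau> m \<mu> + kB n \<tau> (n - m) (\<tau> - \<mu>))" for n \<tau> m \<mu>
  unfolding kA_def kB_def by (auto simp: ker_reflect)
 obtain SA where SA: "SA < \<infinity>"
  "!!n \<tau>. n \<noteq> 0 ==> nint2 (%m \<mu>. ennreal ((modulation m \<mu> powr (- b) * modulation (n - m) (\<tau> - \<mu>) powr (- b))\<^sup>2)) <= SA"
  using output_sum_bounded by blast
 obtain SB where SB: "SB < \<infinity>"
  "!!m \<mu> e. m \<noteq> 0 ==> e \<in> {1, -1} ==> nint2 (%n \<tau>. ennreal (branch_sq e n \<tau> m \<mu>)) <= SB"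
  using branch_sq_sum_bounded by blast
 define cA where "cA = ennreal ((2 powr \<rho> * 3 powr a)\<^sup>2) * SA"
 define cB where "cB = ennreal ((2 powr \<rho> * 3 powr b)\<^sup>2) * (SB + SB)"
 have kA_le: "nint2 (%m \<mu>. (kA n \<tau> m \<mu>)\<^sup>2) <= cA" for n \<tau>
 proof (cases "n = 0")
  case True
  then have "kA n \<tau> m \<mu> = 0" for m \<mu> by (simp add: kA_def ker_def)
  then show ?thesis by simp
 next
  case False
  let ?M = "%m \<mu>. modulation m \<mu> powr (- b) * modulation (n - m) (\<tau> - \<mu>) powr (- b)"
  have "(kA n \<tau> m \<mu>)\<^sup>2 <= ennreal ((2 powr \<rho> * 3 powr a)\<^sup>2) * ennreal ((?M m \<mu>)\<^sup>2)" for m \<mu>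
  proof (cases "\<not> input_dominant n \<tau> m \<mu> \<and> \<not> input_dominant n \<tau> (n - m) (\<tau> - \<mu>)")
   case True
   then have "(ker n \<tau> m \<mu>)\<^sup>2 <= ((2 powr \<rho> * 3 powr a) * ?M m \<mu>)\<^sup>2"
    by (intro power_mono ker_le_output) auto
   also have "... = (2 powr \<rho> * 3 powr a)\<^sup>2 * (?M m \<mu>)\<^sup>2" by (rule power_mult_distrib)
   finally have "ennreal ((ker n \<tau> m \<mu>)\<^sup>2) <= ennreal ((2 powr \<rho> * 3 powr a)\<^sup>2 * (?M m \<mu>)\<^sup>2)"
    by (rule ennreal_leI)
   then show ?thesis using True by (simp only: kA_def if_True simp_thms ennreal_power ker_nonneg ennreal_mult' zero_le_power2)
  qed (auto simp: kA_def)
  then have "nint2 (%m \<mu>. (kA n \<tau> m \<mu>)\<^sup>2) <= nint2 (%m \<mu>. ennreal ((2 powr \<rho> * 3 powr a)\<^sup>2) * ennreal ((?M m \<mu>)\<^sup>2))"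
   by (intro nint2_mono)
  also have "... = ennreal ((2 powr \<rho> * 3 powr a)\<^sup>2) * nint2 (%m \<mu>. ennreal ((?M m \<mu>)\<^sup>2))"
   by (rule nint2_cmult) measurable
  also have "... <= cA" unfolding cA_def by (intro mult_left_mono SA False) auto
  finally show ?thesis .
 qed
 have kB_le: "nint2 (%n \<tau>. (kB n \<tau> m \<mu>)\<^sup>2) <= cB" for m \<mu>
 proof (cases "m = 0")
  case True
  then have "kB n \<tau> m \<mu> = 0" for n \<tau> by (simp add: kB_def input_dominant_def)
  then show ?thesis by simp
 next
  case False
   have [measurable]: "(%\<tau>. branch_sq e n \<tau> m \<mu>) \<in> bmeas" for e n
   unfolding branch_sq_def by measurable
  have "(kB n \<tau> m \<mu>)\<^sup>2 <= ennreal ((2 powr \<rho> * 3 powr b)\<^sup>2) * (ennreal (branch_sq 1 n \<tau> m \<mu>) + ennreal (branch_sq (- 1) n \<tau> m \<mu>))" for n \<tau>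
  proof (cases "input_dominant n \<tau> m \<mu>")
   case True
   then have "(kB n \<tau> m \<mu>)\<^sup>2 = ennreal ((ker n \<tau> m \<mu>)\<^sup>2)"
    by (simp add: kB_def ennreal_power)
   also have "... <= ennreal ((2 powr \<rho> * 3 powr b)\<^sup>2 * (branch_sq 1 n \<tau> m \<mu> + branch_sq (- 1) n \<tau> m \<mu>))"
    by (intro ennreal_leI ker_le_input True)
   also have "... = ennreal ((2 powr \<rho> * 3 powr b)\<^sup>2) * (ennreal (branch_sq 1 n \<tau> m \<mu>) + ennreal (branch_sq (- 1) n \<tau> m \<mu>))"
    by (rule ennreal_mult_plus) auto
   finally show ?thesis .
  qed (auto simp: kB_def)
  then have "nint2 (%n \<tau>. (kB n \<tau> m \<mu>)\<^sup>2) <= nint2 (%n \<tau>. ennreal ((2 powr \<rho> * 3 powr b)\<^sup>2) * (ennreal (branch_sq 1 n \<tau> m \<mu>) + ennreal (branch_sq (- 1) n \<tau> m \<mu>)))"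
   by (intro nint2_mono)
  also have "... = ennreal ((2 powr \<rho> * 3 powr b)\<^sup>2) * nint2 (%n \<tau>. ennreal (branch_sq 1 n \<tau> m \<mu>) + ennreal (branch_sq (- 1) n \<tau> m \<mu>))"
   by (rule nint2_cmult) measurable
  also have "nint2 (%n \<tau>. ennreal (branch_sq 1 n \<tau> m \<mu>) + ennreal (branch_sq (- 1) n \<tau> m \<mu>))
   = nint2 (%n \<tau>. ennreal (branch_sq 1 n \<tau> m \<mu>)) + nint2 (%n \<tau>. ennreal (branch_sq (- 1) n \<tau> m \<mu>))"
   by (rule nint2_add) measurable
  also have "ennreal ((2 powr \<rho> * 3 powr b)\<^sup>2) * ... <= cB"
   unfolding cB_def by (intro mult_left_mono add_mono SB False) auto
  finally show ?thesis .
 qed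
 have main: "nint2 (%n \<tau>. (nint2 (%m \<mu>. ennreal (ker n \<tau> m \<mu>) * (f m \<mu> * g (n - m) (\<tau> - \<mu>))))\<^sup>2)
   <= (2 * cA + 4 * (cB + cB)) * (nint2 (%n \<tau>. (f n \<tau>)\<^sup>2) * nint2 (%n \<tau>. (g n \<tau>)\<^sup>2))"
  if f [measurable]: "!!m. f m \<in> bmeas" and g [measurable]: "!!m. g m \<in> bmeas"
  for f g
 proof -
  define A where "A n \<tau> = nint2 (%m \<mu>. kA n \<tau> m \<mu> * (f m \<mu> * g (n - m) (\<tau> - \<mu>)))" for n \<tau>
  define B where "B n \<tau> = nint2 (%m \<mu>. kB n \<tau> m \<mu> * (f m \<mu> * g (n - m) (\<tau> - \<mu>)))" for n \<tau>
  define B' where "B' n \<tau> = nint2 (%m \<mu>. kB n \<tau> m \<mu> * (g m \<mu> * f (n - m) (\<tau> - \<mu>)))" for n \<tau>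
  let ?F = "nint2 (%n \<tau>. (f n \<tau>)\<^sup>2)" and ?G = "nint2 (%n \<tau>. (g n \<tau>)\<^sup>2)"
  have [measurable]: "A n \<in> bmeas" "B n \<in> bmeas" "B' n \<in> bmeas" for n
   unfolding A_def B_def B'_def by measurable
  have pw: "(nint2 (%m \<mu>. ennreal (ker n \<tau> m \<mu>) * (f m \<mu> * g (n - m) (\<tau> - \<mu>))))\<^sup>2
    <= 2 * (A n \<tau>)\<^sup>2 + 4 * ((B n \<tau>)\<^sup>2 + (B' n \<tau>)\<^sup>2)" for n \<tau>
  proof -
   have "nint2 (%m \<mu>. ennreal (ker n \<tau> m \<mu>) * (f m \<mu> * g (n - m) (\<tau> - \<mu>)))
    <= nint2 (%m \<mu>. kA n \<tau> m \<mu> * (f m \<mu> * g (n - m) (\<tau> - \<mu>)) +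
      (kB n \<tau> m \<mu> * (f m \<mu> * g (n - m) (\<tau> - \<mu>)) + kB n \<tau> (n - m) (\<tau> - \<mu>) * (f m \<mu> * g (n - m) (\<tau> - \<mu>))))"
    unfolding distrib_right[symmetric] by (intro nint2_mono mult_right_mono ker_split) auto
   also have "... = A n \<tau> + (B n \<tau> + nint2 (%m \<mu>. kB n \<tau> (n - m) (\<tau> - \<mu>) * (f m \<mu> * g (n - m) (\<tau> - \<mu>))))"
    unfolding A_def B_def by (simp add: nint2_add)
   also have "nint2 (%m \<mu>. kB n \<tau> (n - m) (\<tau> - \<mu>) * (f m \<mu> * g (n - m) (\<tau> - \<mu>))) = B' n \<tau>"
    using nint2_reflect[of "%m \<mu>. kB n \<tau> m \<mu> * (g m \<mu> * f (n - m) (\<tau> - \<mu>))" n \<tau>]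
    by (simp add: B'_def mult.commute[of "g _ _"])
   finally have "(nint2 (%m \<mu>. ennreal (ker n \<tau> m \<mu>) * (f m \<mu> * g (n - m) (\<tau> - \<mu>))))\<^sup>2
     <= (A n \<tau> + (B n \<tau> + B' n \<tau>))\<^sup>2" by (intro power_mono) auto
   also have "... <= 2 * ((A n \<tau>)\<^sup>2 + (B n \<tau> + B' n \<tau>)\<^sup>2)" by (rule ennreal_square_add_le)
   also have "... <= 2 * ((A n \<tau>)\<^sup>2 + 2 * ((B n \<tau>)\<^sup>2 + (B' n \<tau>)\<^sup>2))"
    by (intro mult_left_mono add_left_mono ennreal_square_add_le) auto
   also have "... = 2 * (A n \<tau>)\<^sup>2 + 4 * ((B n \<tau>)\<^sup>2 + (B' n \<tau>)\<^sup>2)"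
    by (simp add: distrib_left mult.assoc[symmetric])
   finally show ?thesis .
  qed
  have "nint2 (%n \<tau>. (nint2 (%m \<mu>. ennreal (ker n \<tau> m \<mu>) * (f m \<mu> * g (n - m) (\<tau> - \<mu>))))\<^sup>2)
    <= nint2 (%n \<tau>. 2 * (A n \<tau>)\<^sup>2 + 4 * ((B n \<tau>)\<^sup>2 + (B' n \<tau>)\<^sup>2))"
   by (intro nint2_mono pw)
  also have "... = 2 * nint2 (%n \<tau>. (A n \<tau>)\<^sup>2) + 4 * (nint2 (%n \<tau>. (B n \<tau>)\<^sup>2) + nint2 (%n \<tau>. (B' n \<tau>)\<^sup>2))"
   by (simp add: nn_integral_add nn_integral_cmult)
  also have "... <= 2 * (cA * (?F * ?G)) + 4 * (cB * (?F * ?G) + cB * (?G * ?F))"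
   unfolding A_def B_def B'_def
   by (intro add_mono mult_left_mono Schur_bound_output Schur_bound_input kA_le kB_le) auto
  also have "... = (2 * cA + 4 * (cB + cB)) * (?F * ?G)"
   by (simp add: distrib_left distrib_right ac_simps)
  finally show ?thesis .
 qed
 show ?thesis
 proof (rule that[OF _ main])
  show "2 * cA + 4 * (cB + cB) < \<infinity>"
   using SA(1) SB(1) unfolding cA_def cB_def by (simp add: ennreal_mult_less_top)
 qed
qed

end

section \<open>Weighted norms\<close>

definition wnorm :: "(int => real) => real => (int => real => ennreal) => ennreal" where
 "wnorm w b g = nint2 (%n \<tau>. (ennreal (bracket (\<bar>\<tau>\<bar> - gam n) powr b * w n) * g n \<tau>)\<^sup>2)"

definition convol :: "(int => real => ennreal) => (int => real => ennreal) => int => real => ennreal" where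
 "convol f g n \<tau> = nint2 (%m \<mu>. f m \<mu> * g (n - m) (\<tau> - \<mu>))"

lemma convol_measurable [measurable]:
 assumes [measurable]: "!!n. f n \<in> bmeas" "!!n. g n \<in> bmeas"
 shows "convol f g n \<in> bmeas"
 unfolding convol_def by measurable

text \<open>Only submultiplicativity of \<open>om\<close> enters, so the constant does not depend on \<open>om\<close>: higher
 regularity costs nothing once it is measured in a submultiplicative weight.\<close>

definition submult :: "(int => real) => bool" where
 "submult om \<longleftrightarrow> (\<forall>n. om n > 0) \<and> (\<forall>n m. om n <= om m * om (n - m))"

context exponents

begin

definition wt :: "(int => real) => int => real" where
 "wt om n = bracket (of_int n) powr (- \<rho>) * om n"

lemma wt_pos: "submult om ==> wt om n > 0"
 by (simp add: wt_def submult_def)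

theorem bilinear_estimate:
 obtains C where "C < \<infinity>"
  "!!om f g. submult om ==> (!!m. f m \<in> bmeas) ==> (!!m. g m \<in> bmeas) ==>
   wnorm (wt om) (- a) (%n \<tau>. ennreal ((of_int n)\<^sup>2 / gam n) * convol f g n \<tau>)
   <= C * (wnorm (wt om) b f * wnorm (wt om) b g)"
proof -
 obtain C where C: "C < \<infinity>"
  "!!f g. (!!m. f m \<in> bmeas) ==> (!!m. g m \<in> bmeas) ==>
   nint2 (%n \<tau>. (nint2 (%m \<mu>. ennreal (ker n \<tau> m \<mu>) * (f m \<mu> * g (n - m) (\<tau> - \<mu>))))\<^sup>2)
   <= C * (nint2 (%n \<tau>. (f n \<tau>)\<^sup>2) * nint2 (%n \<tau>. (g n \<tau>)\<^sup>2))"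
  using kernel_convolution_bounded by blast
 define c where "c = 2 powr a * (2 powr b * 2 powr b)"
 have c_pos: "c > 0" by (simp add: c_def)
 have main: "wnorm (wt om) (- a) (%n \<tau>. ennreal ((of_int n)\<^sup>2 / gam n) * convol f g n \<tau>)
   <= (ennreal (c\<^sup>2) * C) * (wnorm (wt om) b f * wnorm (wt om) b g)"
  if om: "submult om" and [measurable]: "!!m. f m \<in> bmeas" "!!m. g m \<in> bmeas"
  for om f g
 proof -
  define L where "L n \<tau> = bracket (\<bar>\<tau>\<bar> - gam n)" for n \<tau>
  have L_ge: "L n \<tau> >= 1" and L_pos: "L n \<tau> > 0" for n \<tau> by (auto simp: L_def)
  define W where "W n \<tau> = ennreal (L n \<tau> powr b * wt om n)" for n \<tau>
  have [measurable]: "W n \<in> bmeas" for n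
   unfolding W_def L_def by measurable
  have wt0: "wt om n > 0" for n using om by (rule wt_pos)
  have mod_L: "modulation n \<tau> <= 2 * L n \<tau>" for n \<tau>
   unfolding modulation_def L_def by (rule bracket_le_gam)
  have pw: "L n \<tau> powr (- a) * wt om n * ((of_int n)\<^sup>2 / gam n)
   <= c * (ker n \<tau> m \<mu> * ((L m \<mu> powr b * wt om m) * (L (n - m) (\<tau> - \<mu>) powr b * wt om (n - m))))" for n \<tau> m \<mu>
  proof (cases "n = 0")
   case True
   then show ?thesis using c_pos wt0 by (simp add: less_imp_le)
  next
   case False
   have 1: "L n \<tau> powr (- a) <= 2 powr a * modulation n \<tau> powr (- a)"
    using mod_L[of n \<tau>] a_pos by (intro powr_neg_le_of_le_mult) auto
   have 2: "1 <= 2 powr b * (modulation k \<upsilon> powr (- b) * L k \<upsilon> powr b)" for k \<upsilon>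
   proof -
    have "modulation k \<upsilon> powr b <= (2 * L k \<upsilon>) powr b"
     using mod_L b_pos by (intro powr_mono2) auto
    then show ?thesis using L_pos by (simp add: powr_mult powr_minus field_simps)
   qed
   have 3: "wt om n <= freq_weight n m * (wt om m * wt om (n - m))"
   proof -
    have "freq_weight n m * (wt om m * wt om (n - m)) = bracket (of_int n) powr (- \<rho>) * (om m * om (n - m))"
     unfolding freq_weight_def wt_def
     by (simp add: powr_mult powr_divide powr_minus field_simps del: of_int_diff)
    moreover have "bracket (of_int n) powr (- \<rho>) * om n <= bracket (of_int n) powr (- \<rho>) * (om m * om (n - m))"
     using om by (intro mult_left_mono) (auto simp: submult_def)
    ultimately show ?thesis unfolding wt_def[of om n] by (metis (no_types))
   qed
   have 4: "(of_int n)\<^sup>2 / gam n <= 1"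
    using gam_ge_square[of n] gam_pos[OF False] by simp
   have "L n \<tau> powr (- a) * wt om n * ((of_int n)\<^sup>2 / gam n)
    <= (2 powr a * modulation n \<tau> powr (- a)) * (freq_weight n m * (wt om m * wt om (n - m))) * 1"
    using 1 3 4 wt0 by (intro mult_mono) (auto intro!: mult_nonneg_nonneg simp: less_imp_le)
   also have "... <= (2 powr a * modulation n \<tau> powr (- a)) * (freq_weight n m * (wt om m * wt om (n - m)))
    * ((2 powr b * (modulation m \<mu> powr (- b) * L m \<mu> powr b)) * (2 powr b * (modulation (n - m) (\<tau> - \<mu>) powr (- b) * L (n - m) (\<tau> - \<mu>) powr b)))"
    using mult_mono[OF 2[of m \<mu>] 2[of "n - m" "\<tau> - \<mu>"]] wt0
    by (intro mult_left_mono) (auto intro!: mult_nonneg_nonneg simp: less_imp_le)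
   also have "... = c * (ker n \<tau> m \<mu> * ((L m \<mu> powr b * wt om m) * (L (n - m) (\<tau> - \<mu>) powr b * wt om (n - m))))"
    using False unfolding c_def ker_def by (simp only: if_False mult_ac)
   finally show ?thesis .
  qed
  have pw2: "ennreal (L n \<tau> powr (- a) * wt om n) * (ennreal ((of_int n)\<^sup>2 / gam n) * convol f g n \<tau>)
    <= ennreal c * nint2 (%m \<mu>. ennreal (ker n \<tau> m \<mu>) * ((W m \<mu> * f m \<mu>) * (W (n - m) (\<tau> - \<mu>) * g (n - m) (\<tau> - \<mu>))))" for n \<tau>
  proof -
   have [measurable]: "(%\<mu>. ker n \<tau> m \<mu>) \<in> bmeas" for m
    using measurable_compose[OF _ ker_measurable[of n m], of "%\<mu>. (\<tau>, \<mu>)" borel] by simp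
   have "ennreal (L n \<tau> powr (- a) * wt om n) * (ennreal ((of_int n)\<^sup>2 / gam n) * convol f g n \<tau>)
    = ennreal (L n \<tau> powr (- a) * wt om n * ((of_int n)\<^sup>2 / gam n)) * convol f g n \<tau>"
    using wt0[of n] by (subst ennreal_mult[of "L n \<tau> powr (- a) * wt om n"]) (auto simp: mult.assoc less_imp_le)
   also have "... = nint2 (%m \<mu>. ennreal (L n \<tau> powr (- a) * wt om n * ((of_int n)\<^sup>2 / gam n)) * (f m \<mu> * g (n - m) (\<tau> - \<mu>)))"
    unfolding convol_def by (rule nint2_cmult[symmetric]) measurable
   also have "... <= nint2 (%m \<mu>. ennreal c * (ennreal (ker n \<tau> m \<mu>) * ((W m \<mu> * f m \<mu>) * (W (n - m) (\<tau> - \<mu>) * g (n - m) (\<tau> - \<mu>)))))"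
   proof (intro nint2_mono)
    fix m \<mu>
    have "ennreal (L n \<tau> powr (- a) * wt om n * ((of_int n)\<^sup>2 / gam n)) * (f m \<mu> * g (n - m) (\<tau> - \<mu>))
     <= ennreal (c * (ker n \<tau> m \<mu> * ((L m \<mu> powr b * wt om m) * (L (n - m) (\<tau> - \<mu>) powr b * wt om (n - m))))) * (f m \<mu> * g (n - m) (\<tau> - \<mu>))"
     by (intro mult_right_mono ennreal_leI pw) auto
    also have "... = ennreal c * (ennreal (ker n \<tau> m \<mu>) * ((W m \<mu> * f m \<mu>) * (W (n - m) (\<tau> - \<mu>) * g (n - m) (\<tau> - \<mu>))))"
     unfolding W_def using c_pos wt0
     by (subst ennreal_mult ennreal_mult[of "ker n \<tau> m \<mu>"] ennreal_mult[of "L m \<mu> powr b * wt om m"];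
       auto intro!: mult_nonneg_nonneg simp: less_imp_le mult_ac)+
    finally show "ennreal (L n \<tau> powr (- a) * wt om n * ((of_int n)\<^sup>2 / gam n)) * (f m \<mu> * g (n - m) (\<tau> - \<mu>))
     <= ennreal c * (ennreal (ker n \<tau> m \<mu>) * ((W m \<mu> * f m \<mu>) * (W (n - m) (\<tau> - \<mu>) * g (n - m) (\<tau> - \<mu>))))" .
   qed
   also have "... = ennreal c * nint2 (%m \<mu>. ennreal (ker n \<tau> m \<mu>) * ((W m \<mu> * f m \<mu>) * (W (n - m) (\<tau> - \<mu>) * g (n - m) (\<tau> - \<mu>))))"
    by (rule nint2_cmult) measurable
   finally show ?thesis .
  qed
  have "wnorm (wt om) (- a) (%n \<tau>. ennreal ((of_int n)\<^sup>2 / gam n) * convol f g n \<tau>)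
   <= nint2 (%n \<tau>. ennreal (c\<^sup>2) * (nint2 (%m \<mu>. ennreal (ker n \<tau> m \<mu>) * ((W m \<mu> * f m \<mu>) * (W (n - m) (\<tau> - \<mu>) * g (n - m) (\<tau> - \<mu>)))))\<^sup>2)"
  proof -
   have "(ennreal (L n \<tau> powr (- a) * wt om n) * (ennreal ((of_int n)\<^sup>2 / gam n) * convol f g n \<tau>))\<^sup>2
    <= ennreal (c\<^sup>2) * (nint2 (%m \<mu>. ennreal (ker n \<tau> m \<mu>) * ((W m \<mu> * f m \<mu>) * (W (n - m) (\<tau> - \<mu>) * g (n - m) (\<tau> - \<mu>)))))\<^sup>2" for n \<tau>
    using power_mono[OF pw2[of n \<tau>], of 2] c_pos
    by (simp add: power_mult_distrib ennreal_power less_imp_le)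
   then show ?thesis unfolding wnorm_def L_def[symmetric] by (intro nint2_mono)
  qed
  also have "... = ennreal (c\<^sup>2) * nint2 (%n \<tau>. (nint2 (%m \<mu>. ennreal (ker n \<tau> m \<mu>) * ((W m \<mu> * f m \<mu>) * (W (n - m) (\<tau> - \<mu>) * g (n - m) (\<tau> - \<mu>)))))\<^sup>2)"
   by (rule nint2_cmult) measurable
  also have "... <= ennreal (c\<^sup>2) * (C * (nint2 (%n \<tau>. (W n \<tau> * f n \<tau>)\<^sup>2) * nint2 (%n \<tau>. (W n \<tau> * g n \<tau>)\<^sup>2)))"
   by (intro mult_left_mono C(2)) auto
  also have "... = (ennreal (c\<^sup>2) * C) * (wnorm (wt om) b f * wnorm (wt om) b g)"
   unfolding wnorm_def W_def L_def by (simp add: mult.assoc)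
  finally show ?thesis .
 qed
 show ?thesis
  by (rule that[OF _ main]) (use C(1) in \<open>auto simp: ennreal_mult_less_top\<close>)
qed

end

section \<open>Fourier inversion\<close>

definition ft :: "(real => complex) => real => complex" where
 "ft f \<xi> = (LINT t|lborel. exp (- \<i> * cor (t * \<xi>)) * f t)"

definition ift :: "(real => complex) => real => complex" where
 "ift g t = cor (1 / (2 * pi)) * (LINT \<tau>|lborel. iexp (t * \<tau>) * g \<tau>)"

lemma norm_exp_i_real [simp]:
 "cmod (exp (\<i> * cor x)) = 1" "cmod (exp (- (\<i> * cor x))) = 1"
 by (simp_all add: norm_exp_eq_Re)

lemma integrable_exp_mult [intro]:
 assumes "integrable lborel g"
 shows "integrable lborel (%x. iexp (t * x) * g x)"
  "integrable lborel (%x. exp (- (\<i> * cor (t * x))) * g x)"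
  "integrable lborel (%x. exp (- (\<i> * cor (x * t))) * g x)"
proof -
 have [measurable]: "g \<in> bmeas" using assms by auto
 show "integrable lborel (%x. iexp (t * x) * g x)"
  by (rule Bochner_Integration.integrable_bound[OF assms]) (auto simp: norm_mult)
 show "integrable lborel (%x. exp (- (\<i> * cor (t * x))) * g x)"
  by (rule Bochner_Integration.integrable_bound[OF assms]) (auto simp: norm_mult)
 show "integrable lborel (%x. exp (- (\<i> * cor (x * t))) * g x)"
  by (rule Bochner_Integration.integrable_bound[OF assms]) (auto simp: norm_mult)
qed

lemma integrable_tensor:
 fixes g f :: "real => complex"
 assumes g: "integrable lborel g" and f: "integrable lborel f"
 shows "integrable (lborel \<Otimes>\<^sub>M lborel) (%(x, y). g x * f y)"
proof (rule lborel_pair.Fubini_integrable)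
 have [measurable]: "f \<in> bmeas" "g \<in> bmeas" using f g by auto
 show "(%(x, y). g x * f y) \<in> borel_measurable (lborel \<Otimes>\<^sub>M lborel)" by measurable
 show "integrable lborel (%x. LINT y|lborel. norm (case (x, y) of (x, y) => g x * f y))"
  using g by (simp add: norm_mult)
 show "AE x in lborel. integrable lborel (%y. case (x, y) of (x, y) => g x * f y)"
  using f by simp
qed

lemma gaussian_fourier:
 "(LINT x|lborel. iexp (t * x) * cor (std_normal_density x)) = cor (exp (- (t\<^sup>2) / 2))"
proof -
 have "char std_normal_distribution t = (LINT x|lborel. std_normal_density x *\<^sub>R iexp (t * x))"
  unfolding char_def by (subst integral_density) auto
 then show ?thesis
  by (simp add: char_std_normal_distribution scaleR_conv_of_real mult.commute)
qed

lemma integrable_std_normal_complex: "integrable lborel (%x. cor (std_normal_density x))"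
 by (rule integrable_of_real) simp

lemma gaussian_fourier_scaled:
 assumes "k > 0"
 shows "(LINT x|lborel. iexp (t * x) * cor (exp (- ((x / k)\<^sup>2) / 2)))
   = cor (2 * pi * (k * std_normal_density (k * t)))" (is "?L = _")
  and "integrable lborel (%x. cor (exp (- ((x / k)\<^sup>2) / 2)))"
proof -
 let ?d = "%x. cor (std_normal_density x)"
 have gd: "cor (exp (- ((x / k)\<^sup>2) / 2)) = cor (sqrt (2 * pi)) * ?d (x / k)" for x
 proof -
  have "exp (- ((x / k)\<^sup>2) / 2) = sqrt (2 * pi) * std_normal_density (x / k)"
   by (simp add: std_normal_density_def)
  then show ?thesis by (metis of_real_mult)
 qed
 have "integrable lborel (%x. ?d (0 + (1 / k) * x))"
  using integrable_std_normal_complex assms by (subst lborel_integrable_real_affine_iff) auto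
 then show "integrable lborel (%x. cor (exp (- ((x / k)\<^sup>2) / 2)))"
  unfolding gd by simp
 have "?L = cor (sqrt (2 * pi)) * (LINT x|lborel. iexp (t * x) * ?d (x / k))"
  unfolding gd by (subst integral_mult_right_zero[symmetric]) (simp add: mult.left_commute)
 also have "(LINT x|lborel. iexp (t * x) * ?d (x / k))
  = \<bar>k\<bar> *\<^sub>R (LINT x|lborel. iexp (t * (0 + k * x)) * ?d ((0 + k * x) / k))"
  by (rule lborel_integral_real_affine) (use assms in auto)
 also have "(LINT x|lborel. iexp (t * (0 + k * x)) * ?d ((0 + k * x) / k))
  = (LINT x|lborel. iexp (k * t * x) * ?d x)"
  using assms by (simp add: ac_simps)
 also have "... = cor (exp (- ((k * t)\<^sup>2) / 2))" by (rule gaussian_fourier)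
 also have "cor (sqrt (2 * pi)) * (\<bar>k\<bar> *\<^sub>R cor (exp (- ((k * t)\<^sup>2) / 2)))
  = cor (2 * pi * (k * std_normal_density (k * t)))"
 proof -
  have "sqrt (2 * pi) * (k * E) = 2 * pi * (k * (1 / sqrt (2 * pi) * E))" for E
   by (simp add: field_simps)
  then show ?thesis using assms
   by (simp add: std_normal_density_def scaleR_conv_of_real flip: of_real_mult)
 qed
 finally show "?L = cor (2 * pi * (k * std_normal_density (k * t)))" .
qed

text \<open>Inserting the factor \<open>e\<^bsup>-\<xi>\<^sup>2/2k\<^sup>2\<^esup>\<close> makes Fubini's theorem applicable and turns the inversion
 integral into the average of \<open>f\<close> against a Gaussian of width \<open>1/k\<close> about \<open>t\<close>.\<close>

lemma fourier_inversion:
 fixes f :: "real => complex"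
 assumes f: "integrable lborel f" and cont: "continuous_on UNIV f" and bnd: "!!x. cmod (f x) <= M"
  and ft: "integrable lborel (ft f)"
 shows "ift (ft f) t = f t"
proof -
 have [measurable]: "f \<in> bmeas" "ft f \<in> bmeas" using f ft by auto
 define g where "g k \<xi> = cor (exp (- ((\<xi> / real (Suc k))\<^sup>2) / 2))" for k \<xi>
 have g_meas [measurable]: "g k \<in> bmeas" for k unfolding g_def by measurable
 define I where "I k = cor (1 / (2 * pi)) * (LINT \<xi>|lborel. iexp (t * \<xi>) * (g k \<xi> * ft f \<xi>))" for k
 have lim1: "I \<longlonglongrightarrow> ift (ft f) t"
  unfolding I_def ift_def
 proof (intro tendsto_mult tendsto_const integral_dominated_convergence)
  show "integrable lborel (%\<xi>. cmod (ft f \<xi>))" using ft by simp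
  show "AE \<xi> in lborel. cmod (iexp (t * \<xi>) * (g k \<xi> * ft f \<xi>)) <= cmod (ft f \<xi>)" for k
   by (auto simp: norm_mult g_def intro!: mult_left_le_one_le)
  show "AE \<xi> in lborel. (%k. iexp (t * \<xi>) * (g k \<xi> * ft f \<xi>)) \<longlonglongrightarrow> iexp (t * \<xi>) * ft f \<xi>"
  proof (intro AE_I2)
   fix \<xi> :: real
   have "(%k. \<xi> / real (Suc k)) \<longlonglongrightarrow> 0"
    by (rule LIMSEQ_Suc[OF lim_const_over_n])
   then have "(%k. g k \<xi>) \<longlonglongrightarrow> cor (exp (- (0\<^sup>2) / 2))"
    unfolding g_def by (intro tendsto_intros) auto
   then have "(%k. iexp (t * \<xi>) * (g k \<xi> * ft f \<xi>)) \<longlonglongrightarrow> iexp (t * \<xi>) * (cor (exp (- (0\<^sup>2) / 2)) * ft f \<xi>)"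
    by (intro tendsto_intros)
   then show "(%k. iexp (t * \<xi>) * (g k \<xi> * ft f \<xi>)) \<longlonglongrightarrow> iexp (t * \<xi>) * ft f \<xi>" by simp
  qed
 qed measurable
 have I_eq: "I k = (LINT y|lborel. f (t - y / real (Suc k)) * cor (std_normal_density y))" for k
 proof -
  let ?k = "real (Suc k)"
  have k: "?k > 0" by simp
  have gint: "integrable lborel (g k)" unfolding g_def using gaussian_fourier_scaled(2)[OF k] by simp
  have prod_int: "integrable (lborel \<Otimes>\<^sub>M lborel) (%(\<xi>, x). (iexp (t * \<xi>) * g k \<xi>) * (exp (- \<i> * cor (x * \<xi>)) * f x))"
  proof (rule Bochner_Integration.integrable_bound)
   show "integrable (lborel \<Otimes>\<^sub>M lborel) (%(\<xi>, x). g k \<xi> * f x)"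
    by (rule integrable_tensor[OF gint f])
  qed (auto simp: norm_mult split_def)
  have "(LINT \<xi>|lborel. iexp (t * \<xi>) * (g k \<xi> * ft f \<xi>))
   = (LINT \<xi>|lborel. (LINT x|lborel. (iexp (t * \<xi>) * g k \<xi>) * (exp (- \<i> * cor (x * \<xi>)) * f x)))"
   unfolding ft_def by (simp add: mult.assoc)
  also have "... = (LINT x|lborel. (LINT \<xi>|lborel. (iexp (t * \<xi>) * g k \<xi>) * (exp (- \<i> * cor (x * \<xi>)) * f x)))"
   by (rule lborel_pair.Fubini_integral[symmetric]) (use prod_int in simp)
  also have "... = (LINT x|lborel. (cor (2 * pi * (?k * std_normal_density (?k * (t - x))))) * f x)"
  proof (rule Bochner_Integration.integral_cong[OF refl])
   fix x
   have "(LINT \<xi>|lborel. (iexp (t * \<xi>) * g k \<xi>) * (exp (- \<i> * cor (x * \<xi>)) * f x))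
    = (LINT \<xi>|lborel. (iexp ((t - x) * \<xi>) * g k \<xi>) * f x)"
    by (rule Bochner_Integration.integral_cong[OF refl])
      (simp add: left_diff_distrib right_diff_distrib exp_diff exp_minus field_simps)
   also have "... = (cor (2 * pi * (?k * std_normal_density (?k * (t - x))))) * f x"
    using gaussian_fourier_scaled(1)[OF k, of "t - x"] by (simp add: g_def)
   finally show "(LINT \<xi>|lborel. (iexp (t * \<xi>) * g k \<xi>) * (exp (- \<i> * cor (x * \<xi>)) * f x))
    = (cor (2 * pi * (?k * std_normal_density (?k * (t - x))))) * f x" .
  qed
  also have "... = \<bar>- 1 / ?k\<bar> *\<^sub>R (LINT y|lborel. (cor (2 * pi * (?k * std_normal_density (?k * (t - (t + (- 1 / ?k) * y)))))) * f (t + (- 1 / ?k) * y))"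
   by (rule lborel_integral_real_affine) simp
  also have "... = cor (1 / ?k) * (LINT y|lborel. cor (2 * pi * ?k) * (f (t - y / ?k) * cor (std_normal_density y)))"
  proof -
   have 1: "t + (- 1 / ?k) * y = t - y / ?k" for y by simp
   have 2: "?k * (t - (t - y / ?k)) = y" for y using k by (simp del: of_nat_Suc)
   have 3: "\<bar>- 1 / ?k\<bar> = 1 / ?k" using k by (simp del: of_nat_Suc)
   have 4: "cor (2 * pi * (?k * d)) * F = cor (2 * pi * ?k) * (F * cor d)" for d F
    by (simp del: of_nat_Suc)
   show ?thesis unfolding 1 2 3 4 scaleR_conv_of_real ..
  qed
  also have "... = cor (2 * pi) * (LINT y|lborel. f (t - y / ?k) * cor (std_normal_density y))"
  proof -
   have "cor (1 / ?k) * cor (2 * pi * ?k) = cor (2 * pi)"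
    using k unfolding of_real_mult[symmetric] by (simp del: of_nat_Suc)
   then have "cor (1 / ?k) * (cor (2 * pi * ?k) * J) = cor (2 * pi) * J" for J
    by (metis mult.assoc)
   then show ?thesis by (subst integral_mult_right_zero)
  qed
  finally have eq: "(LINT \<xi>|lborel. iexp (t * \<xi>) * (g k \<xi> * ft f \<xi>))
   = cor (2 * pi) * (LINT y|lborel. f (t - y / ?k) * cor (std_normal_density y))" .
  have "cor (1 / (2 * pi)) * cor (2 * pi) = 1"
   unfolding of_real_mult[symmetric] by simp
  then show ?thesis unfolding I_def eq by (simp only: mult.assoc[symmetric] mult_1_left)
 qed
 have lim2: "(%k. LINT y|lborel. f (t - y / real (Suc k)) * cor (std_normal_density y))
   \<longlonglongrightarrow> (LINT y|lborel. f t * cor (std_normal_density y))"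
 proof (intro integral_dominated_convergence)
  show "integrable lborel (%y. M * std_normal_density y)" by simp
  show "AE y in lborel. cmod (f (t - y / real (Suc k)) * cor (std_normal_density y)) <= M * std_normal_density y" for k
   using bnd by (auto simp: norm_mult intro!: mult_right_mono)
  show "AE y in lborel. (%k. f (t - y / real (Suc k)) * cor (std_normal_density y)) \<longlonglongrightarrow> f t * cor (std_normal_density y)"
  proof (intro AE_I2 tendsto_mult tendsto_const)
   fix y :: real
   have "(%k. y / real (Suc k)) \<longlonglongrightarrow> 0"
    by (rule LIMSEQ_Suc[OF lim_const_over_n])
   then have "(%k. t - y / real (Suc k)) \<longlonglongrightarrow> t - 0" by (intro tendsto_intros)
   then show "(%k. f (t - y / real (Suc k))) \<longlonglongrightarrow> f t"
    using continuous_on_tendsto_compose[OF cont] by simp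
  qed
 qed measurable
 have "(LINT y|lborel. f t * cor (std_normal_density y)) = f t"
  using gaussian_fourier[of 0] by simp
 with lim2 have "I \<longlonglongrightarrow> f t" by (simp add: I_eq[abs_def] del: of_nat_Suc)
 with lim1 show ?thesis by (rule LIMSEQ_unique)
qed

section \<open>A cutoff function\<close>

lemma DERIV_max_power:
 "((%x::real. (max 0 x) ^ Suc (Suc k)) has_real_derivative real (Suc (Suc k)) * (max 0 x) ^ Suc k) (at x)"
proof -
 consider "x > 0" | "x < 0" | "x = 0" by linarith
 then show ?thesis
 proof cases
  case 1
  have "((%x. x ^ Suc (Suc k)) has_real_derivative real (Suc (Suc k)) * x ^ Suc k) (at x)"
   using DERIV_pow[of "Suc (Suc k)" x] by simp
  then have "((%x. (max 0 x) ^ Suc (Suc k)) has_real_derivative real (Suc (Suc k)) * x ^ Suc k) (at x)"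
   by (rule has_field_derivative_transform_within_open[of _ _ _ "{0<..}"]) (use 1 in auto)
  then show ?thesis using 1 by simp
 next
  case 2
  have "((%x::real. 0) has_real_derivative 0) (at x)" by simp
  then have "((%x::real. (max 0 x) ^ Suc (Suc k)) has_real_derivative 0) (at x)"
   by (rule has_field_derivative_transform_within_open[of _ _ _ "{..<0}"]) (use 2 in auto)
  then show ?thesis using 2 by simp
 next
  case 3
  have "((%h::real. (max 0 h) ^ Suc (Suc k) / h) \<longlongrightarrow> 0) (at 0)"
  proof (rule tendsto_cong[THEN iffD1])
   show "((%h::real. (max 0 h) ^ Suc k) \<longlongrightarrow> 0) (at 0)"
    by (auto intro!: tendsto_eq_intros)
   have "(max 0 h) ^ Suc k = (max 0 h) ^ Suc (Suc k) / h" if "h \<noteq> 0" for h :: real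
    using that by (cases "h > 0") auto
   then show "\<forall>\<^sub>F h::real in at 0. (max 0 h) ^ Suc k = (max 0 h) ^ Suc (Suc k) / h"
    by (auto simp: eventually_at_filter)
  qed
  then show ?thesis using 3 by (simp add: DERIV_def)
 qed
qed

text \<open>The third difference of the truncated cubic is a spline of class \<open>C\<^sup>2\<close> that rises from \<open>0\<close>
 to \<open>1\<close> on \<open>[0,3]\<close>.\<close>

definition spline :: "nat => real => real" where
 "spline k x = ((max 0 x) ^ k - 3 * (max 0 (x - 1)) ^ k + 3 * (max 0 (x - 2)) ^ k - (max 0 (x - 3)) ^ k) / fact k"

definition cutoff :: "nat => real => real" where
 "cutoff j t = spline (3 - j) (t + 4) - spline (3 - j) (t - 1)"

lemma spline_deriv: "(spline (Suc (Suc k)) has_real_derivative spline (Suc k) x) (at x)"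
proof -
 have 1: "((%x. (max 0 (x - c)) ^ Suc (Suc k)) has_real_derivative real (Suc (Suc k)) * (max 0 (x - c)) ^ Suc k) (at x)" for c :: real
  using DERIV_max_power[of k "x + - c"] unfolding DERIV_shift by simp
 have "(spline (Suc (Suc k)) has_real_derivative
   (real (Suc (Suc k)) * (max 0 (x - 0)) ^ Suc k - 3 * (real (Suc (Suc k)) * (max 0 (x - 1)) ^ Suc k)
   + 3 * (real (Suc (Suc k)) * (max 0 (x - 2)) ^ Suc k) - real (Suc (Suc k)) * (max 0 (x - 3)) ^ Suc k) / fact (Suc (Suc k))) (at x)"
  unfolding spline_def using 1[of 0]
  by (intro DERIV_cdivide DERIV_diff DERIV_add DERIV_cmult 1) simp
 moreover have "(real (Suc (Suc k)) * A - 3 * (real (Suc (Suc k)) * B) + 3 * (real (Suc (Suc k)) * C) - real (Suc (Suc k)) * D) / fact (Suc (Suc k))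
   = (A - 3 * B + 3 * C - D) / fact (Suc k)" for A B C D :: real
 proof -
  have "(real (Suc (Suc k)) * A - 3 * (real (Suc (Suc k)) * B) + 3 * (real (Suc (Suc k)) * C) - real (Suc (Suc k)) * D)
   = real (Suc (Suc k)) * (A - 3 * B + 3 * C - D)" by (simp only: right_diff_distrib distrib_left mult_ac)
  then show ?thesis by (simp only: fact_Suc[of "Suc k"]) (simp del: of_nat_Suc fact_Suc)
 qed
 ultimately show ?thesis unfolding spline_def by simp
qed

lemma cutoff_deriv:
 "(cutoff 0 has_real_derivative cutoff 1 t) (at t)" "(cutoff 1 has_real_derivative cutoff 2 t) (at t)"
proof -
 have shift: "((%t. spline (Suc (Suc k)) (t + c)) has_real_derivative spline (Suc k) (t + c)) (at t)" for k c
  using spline_deriv[of k "t + c"] unfolding DERIV_shift .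
 show "(cutoff 0 has_real_derivative cutoff 1 t) (at t)"
  using DERIV_diff[OF shift[of 1 4] shift[of 1 "-1"]] by (simp add: cutoff_def[abs_def] numeral_3_eq_3 numeral_2_eq_2)
 show "(cutoff 1 has_real_derivative cutoff 2 t) (at t)"
  using DERIV_diff[OF shift[of 0 4] shift[of 0 "-1"]] by (simp add: cutoff_def[abs_def] numeral_3_eq_3 numeral_2_eq_2)
qed

lemma cutoff_continuous: "continuous_on A (cutoff j)"
 unfolding cutoff_def spline_def by (intro continuous_intros) auto

lemma cutoff_eq_1: "t \<in> {0..1} ==> cutoff 0 t = 1"
 unfolding cutoff_def spline_def by (simp add: fact_numeral power3_eq_cube algebra_simps)

lemma cutoff_outside: "\<bar>t\<bar> >= 4 ==> cutoff j t = 0"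
proof -
 assume t: "\<bar>t\<bar> >= 4"
 show "cutoff j t = 0"
 proof (cases "t <= -4")
  case True
  consider "j = 0" | "j = 1" | "j = 2" | "j >= 3" by linarith
  then show ?thesis using True unfolding cutoff_def spline_def
   by cases (auto simp: max_def numeral_3_eq_3)
 next
  case False
  then have "t >= 4" using t by linarith
  consider "j = 0" | "j = 1" | "j = 2" | "j >= 3" by linarith
  then show ?thesis using \<open>t >= 4\<close> unfolding cutoff_def spline_def
   by cases (auto simp: fact_numeral power3_eq_cube power2_eq_square algebra_simps)
 qed
qed

lemma cutoff_bounded:
 obtains K where "K >= 1" "!!j t. j <= 2 ==> \<bar>cutoff j t\<bar> <= K"
proof -
 have "\<exists>K. \<forall>t. \<bar>cutoff j t\<bar> <= K" for j
 proof -
  have "bounded (cutoff j ` {-4..4})"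
   by (intro compact_imp_bounded compact_continuous_image cutoff_continuous) auto
  then obtain K where K: "!!t. t \<in> {-4..4} ==> \<bar>cutoff j t\<bar> <= K"
   unfolding bounded_iff by fastforce
  have "\<bar>cutoff j t\<bar> <= K" for t
  proof (cases "\<bar>t\<bar> >= 4")
   case True
   then show ?thesis using cutoff_outside[OF True, of j] K[of 0] by auto
  next
   case False
   then have "t \<in> {-4..4}" by (auto simp: abs_if split: if_splits)
   then show ?thesis by (rule K)
  qed
  then show ?thesis by blast
 qed
 then obtain k where k: "!!j t. \<bar>cutoff j t\<bar> <= k j" by metis
 have "\<bar>cutoff j t\<bar> <= max 1 (max (k 0) (max (k 1) (k 2)))" if "j <= 2" for j t
 proof -
  consider "j = 0" | "j = 1" | "j = 2" using \<open>j <= 2\<close> by linarith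
  then show ?thesis using k[of j t] by cases auto
 qed
 then show ?thesis by (intro that[of "max 1 (max (k 0) (max (k 1) (k 2)))"]) auto
qed

lemma integrable_compact_support:
 fixes f :: "real => complex"
 assumes "continuous_on UNIV f" "!!t. \<bar>t\<bar> >= 4 ==> f t = 0"
 shows "integrable lborel f"
proof -
 have "set_integrable lborel {-4..4} f"
  by (intro borel_integrable_atLeastAtMost' continuous_on_subset[OF assms(1)]) auto
 moreover have "indicator {-4..4} t *\<^sub>R f t = f t" for t
  using assms(2)[of t] by (auto split: split_indicator)
 ultimately show ?thesis by (simp add: set_integrable_def)
qed

lemma ft_measurable [measurable]:
 assumes [measurable]: "f \<in> bmeas"
 shows "ft f \<in> bmeas"
 unfolding ft_def by measurable

text \<open>Two integrations by parts at once: \<open>e\<^bsup>-it\<xi>\<^esup> (f'(t) + i \<xi> f(t))\<close> has derivative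
 \<open>e\<^bsup>-it\<xi>\<^esup> (f''(t) + \<xi>\<^sup>2 f(t))\<close>.\<close>

lemma ft_decay:
 fixes f f1 f2 :: "real => complex"
 assumes d1: "!!t. (f has_vector_derivative f1 t) (at t)" and d2: "!!t. (f1 has_vector_derivative f2 t) (at t)"
  and c2: "continuous_on UNIV f2"
  and out: "!!t. \<bar>t\<bar> >= 4 ==> f t = 0" "!!t. \<bar>t\<bar> >= 4 ==> f1 t = 0" "!!t. \<bar>t\<bar> >= 4 ==> f2 t = 0"
  and bnd: "!!t. cmod (f t) <= M" "!!t. cmod (f2 t) <= M"
 shows "cmod (ft f \<xi>) <= 32 * M * bracket \<xi> powr (- 2)"
proof -
 have c0: "continuous_on UNIV f"
  by (intro continuous_at_imp_continuous_on ballI) (metis d1 has_vector_derivative_continuous)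
 have int: "integrable lborel f" "integrable lborel f2"
  by (rule integrable_compact_support; use c0 c2 out in simp)+
 have small: "cmod (LINT t|lborel. exp (- \<i> * cor (t * \<xi>)) * h t) <= 8 * M"
  if h: "integrable lborel h" "!!t. \<bar>t\<bar> >= 4 ==> h t = 0" "!!t. cmod (h t) <= M" for h
 proof -
  have "cmod (LINT t|lborel. exp (- \<i> * cor (t * \<xi>)) * h t) <= (LINT t|lborel. M * indicator {-4..4::real} t)"
  proof (rule Bochner_Integration.integral_norm_bound_integral)
   show "integrable lborel (%t. exp (- \<i> * cor (t * \<xi>)) * h t)"
    using integrable_exp_mult(3)[OF h(1)] by simp
   show "cmod (exp (- \<i> * cor (t * \<xi>)) * h t) <= M * indicator {-4..4::real} t" for t
    using h(2)[of t] h(3)[of t] by (auto simp: norm_mult split: split_indicator)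
  qed auto
  also have "... = 8 * M" by simp
  finally show ?thesis .
 qed
 define F where "F t = exp (- \<i> * cor (t * \<xi>)) * (f1 t + \<i> * \<xi> * f t)" for t
 define F' where "F' t = exp (- \<i> * cor (t * \<xi>)) * (f2 t + \<xi>\<^sup>2 * f t)" for t
 have dexp: "((%t. exp (- \<i> * cor (t * \<xi>))) has_vector_derivative (- \<i> * \<xi>) * exp (- \<i> * cor (t * \<xi>))) (at t)" for t
  by (auto intro!: derivative_eq_intros has_vector_derivative_real_field simp: mult.commute)
 have dF: "(F has_vector_derivative F' t) (at t)" for t
 proof -
  have "(F has_vector_derivative exp (- \<i> * cor (t * \<xi>)) * (f2 t + \<i> * \<xi> * f1 t)
    + ((- \<i> * \<xi>) * exp (- \<i> * cor (t * \<xi>))) * (f1 t + \<i> * \<xi> * f t)) (at t)"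
   unfolding F_def
   by (intro has_vector_derivative_mult dexp has_vector_derivative_add d2 has_vector_derivative_mult_right d1)
  moreover have "exp (- \<i> * cor (t * \<xi>)) * (f2 t + \<i> * \<xi> * f1 t)
    + ((- \<i> * \<xi>) * exp (- \<i> * cor (t * \<xi>))) * (f1 t + \<i> * \<xi> * f t) = F' t"
   unfolding F'_def by (simp add: algebra_simps power2_eq_square)
  ultimately show ?thesis by simp
 qed
 have "(LINT t|lborel. F' t * indicator {-4..4} t) = F 4 - F (-4)"
 proof -
  have "continuous_on {-4..4} F'"
   unfolding F'_def by (intro continuous_intros continuous_on_subset[OF c2] continuous_on_subset[OF c0]) auto
  then have "(LINT t|lborel. indicator {-4..4} t *\<^sub>R F' t) = F 4 - F (-4)"
   by (intro integral_FTC_atLeastAtMost has_vector_derivative_at_within[OF dF]) auto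
  then show ?thesis by (simp add: scaleR_conv_of_real mult.commute of_real_indicator)
 qed
 moreover have "F 4 = 0" "F (-4) = 0" using out(1,2)[of 4] out(1,2)[of "-4"] by (auto simp: F_def)
 moreover have "F' t * indicator {-4..4} t = F' t" for t
  using out(1,3)[of t] by (auto simp: F'_def split: split_indicator)
 ultimately have "(LINT t|lborel. F' t) = 0" by simp
 also have "(LINT t|lborel. F' t) = (LINT t|lborel. exp (- \<i> * cor (t * \<xi>)) * f2 t)
   + \<xi>\<^sup>2 * ft f \<xi>"
 proof -
  have "(LINT t|lborel. F' t) = (LINT t|lborel. exp (- \<i> * cor (t * \<xi>)) * f2 t + \<xi>\<^sup>2 * (exp (- \<i> * cor (t * \<xi>)) * f t))"
   unfolding F'_def by (intro Bochner_Integration.integral_cong) (auto simp: algebra_simps)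
  also have "... = (LINT t|lborel. exp (- \<i> * cor (t * \<xi>)) * f2 t) + (LINT t|lborel. \<xi>\<^sup>2 * (exp (- \<i> * cor (t * \<xi>)) * f t))"
   using integrable_exp_mult(3)[OF int(1), of \<xi>] integrable_exp_mult(3)[OF int(2), of \<xi>]
   by (intro Bochner_Integration.integral_add) auto
  finally show ?thesis by (simp add: ft_def)
 qed
 finally have "\<xi>\<^sup>2 * ft f \<xi> = - (LINT t|lborel. exp (- \<i> * cor (t * \<xi>)) * f2 t)"
  by (metis add_eq_0_iff)
 then have "cmod (\<xi>\<^sup>2 * ft f \<xi>) = cmod (LINT t|lborel. exp (- \<i> * cor (t * \<xi>)) * f2 t)"
  by (simp only: norm_minus_cancel)
 then have 1: "\<xi>\<^sup>2 * cmod (ft f \<xi>) <= 8 * M"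
  using small[OF int(2) out(3) bnd(2)] by (simp add: norm_mult norm_power)
 have 2: "cmod (ft f \<xi>) <= 8 * M"
  unfolding ft_def by (rule small[OF int(1) out(1) bnd(1)])
 have "(bracket \<xi>)\<^sup>2 <= 2 * (1 + \<xi>\<^sup>2)"
  using sum_squares_bound[of 1 "\<bar>\<xi>\<bar>"] by (simp add: bracket_def power2_sum)
 then have "(bracket \<xi>)\<^sup>2 * cmod (ft f \<xi>) <= (2 * (1 + \<xi>\<^sup>2)) * cmod (ft f \<xi>)"
  by (intro mult_right_mono) auto
 also have "... = 2 * (cmod (ft f \<xi>) + \<xi>\<^sup>2 * cmod (ft f \<xi>))" by (simp add: algebra_simps)
 also have "... <= 2 * (8 * M + 8 * M)" using 1 2 by (intro mult_left_mono add_mono) auto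
 finally have "(bracket \<xi>)\<^sup>2 * cmod (ft f \<xi>) <= 32 * M" by simp
 then show ?thesis
  by (simp add: powr_minus powr_numeral field_simps)
qed

lemma cutoff_vector_derivative:
 "((%t. cor (cutoff 0 t)) has_vector_derivative cor (cutoff 1 t)) (at t)"
 "((%t. cor (cutoff 1 t)) has_vector_derivative cor (cutoff 2 t)) (at t)"
 using cutoff_deriv by (auto intro!: has_vector_derivative_of_real simp: has_real_derivative_iff_has_vector_derivative)

lemma cutoff_measurable [measurable]: "cutoff j \<in> bmeas"
 by (rule borel_measurable_continuous_onI) (rule cutoff_continuous)

definition cutoff_ft :: "real => complex" where
 "cutoff_ft = ft (%t. cor (cutoff 0 t))"

lemma cutoff_ft_measurable [measurable]: "cutoff_ft \<in> bmeas"
 unfolding cutoff_ft_def by measurable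

lemma cutoff_ft_decay:
 obtains C where "C > 0" "!!\<xi>. cmod (cutoff_ft \<xi>) <= C * bracket \<xi> powr (- 2)"
proof -
 obtain K where K: "K >= 1" "!!j t. j <= 2 ==> \<bar>cutoff j t\<bar> <= K"
  using cutoff_bounded by blast
 have "cmod (cutoff_ft \<xi>) <= 32 * K * bracket \<xi> powr (- 2)" for \<xi>
  unfolding cutoff_ft_def
  by (rule ft_decay[OF cutoff_vector_derivative])
    (use K(2) in \<open>auto intro!: continuous_intros cutoff_continuous simp: cutoff_outside\<close>)
 then show ?thesis using K(1) by (intro that[of "32 * K"]) auto
qed

lemma integrable_bracket_decay:
 assumes [measurable]: "g \<in> bmeas" and g: "!!\<xi>. cmod (g \<xi>) <= C * bracket \<xi> powr (- 2)"
 shows "integrable lborel g"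
proof (rule integrableI_bounded)
 have C: "C >= 0"
  using g[of 0] by (simp add: bracket_def) (meson norm_ge_zero order_trans)
 have "(nnint (%\<xi>. ennreal (cmod (g \<xi>)))) <= (nnint (%\<xi>. ennreal C * ennreal (bracket \<xi> powr (- 2))))"
  by (intro nn_integral_mono) (simp add: C g flip: ennreal_mult)
 also have "... = ennreal C * bracket_integral 2"
  unfolding bracket_integral_def by (rule nn_integral_cmult) measurable
 also have "... < \<infinity>" using bracket_integral_finite[of 2] by (simp add: ennreal_mult_less_top)
 finally show "(nnint (%\<xi>. ennreal (cmod (g \<xi>)))) < \<infinity>" .
qed measurable

lemma cutoff_ft_integrable: "integrable lborel cutoff_ft"
 using cutoff_ft_decay by (metis integrable_bracket_decay cutoff_ft_measurable)

lemma ift_cutoff_ft: "t \<in> {0..1} ==> ift cutoff_ft t = 1"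
proof -
 assume t: "t \<in> {0..1}"
 obtain K where K: "K >= 1" "!!j t. j <= 2 ==> \<bar>cutoff j t\<bar> <= K"
  using cutoff_bounded by blast
 have "ift cutoff_ft t = cor (cutoff 0 t)"
  unfolding cutoff_ft_def
 proof (rule fourier_inversion)
  show "integrable lborel (%t. cor (cutoff 0 t))"
   by (intro integrable_compact_support continuous_intros cutoff_continuous) (simp add: cutoff_outside)
  show "continuous_on UNIV (%t. cor (cutoff 0 t))"
   by (intro continuous_intros cutoff_continuous)
  show "cmod (cor (cutoff 0 x)) <= K" for x using K(2)[of 0 x] by simp
  show "integrable lborel (ft (%t. cor (cutoff 0 t)))"
   using cutoff_ft_integrable by (simp add: cutoff_ft_def)
 qed
 then show ?thesis using cutoff_eq_1[OF t] by simp
qed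

section \<open>The localised Duhamel operator in time\<close>

definition osc :: "real => real => complex" where
 "osc t l = (if l = 0 then cor t else (iexp (t * l) - 1) / (\<i> * cor l))"

lemma osc_measurable [measurable (raw)]:
 assumes [measurable]: "f \<in> borel_measurable M" "g \<in> borel_measurable M"
 shows "(%x. osc (f x) (g x)) \<in> borel_measurable M"
 unfolding osc_def by measurable

lemma osc_0 [simp]: "osc 0 l = 0"
 by (simp add: osc_def)

lemma osc_deriv: "((%t. osc t l) has_vector_derivative iexp (t * l)) (at t)"
proof (cases "l = 0")
 case True
 then show ?thesis unfolding osc_def
  by (auto intro!: derivative_eq_intros has_vector_derivative_of_real)
next
 case False
 have "((%t. (iexp (t * l) - 1) / (\<i> * cor l)) has_vector_derivative
   (\<i> * cor l * iexp (t * l) - 0) / (\<i> * cor l)) (at t)"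
  by (intro has_vector_derivative_divide has_vector_derivative_diff has_vector_derivative_const)
    (auto intro!: derivative_eq_intros has_vector_derivative_real_field simp: mult.commute)
 then show ?thesis using False by (simp add: osc_def)
qed

lemma exp_deriv:
 "((%t. iexp (t * l)) has_vector_derivative \<i> * cor l * iexp (t * l)) (at t)"
 by (auto intro!: derivative_eq_intros has_vector_derivative_real_field simp: mult.commute)

lemma osc_integral:
 assumes "t >= 0"
 shows "(LINT t':{0..t}|lborel. iexp (t' * l)) = osc t l"
proof -
 have "(LINT t'|lborel. indicator {0..t} t' *\<^sub>R iexp (t' * l)) = osc t l - osc 0 l"
  by (intro integral_FTC_atLeastAtMost assms has_vector_derivative_at_within[OF osc_deriv] continuous_intros)
 then show ?thesis by (simp add: set_lebesgue_integral_def)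
qed

lemma osc_le_large: "cmod (osc t l) <= 2 / \<bar>l\<bar>" if "l \<noteq> 0"
proof -
 have "cmod (iexp (t * l) - 1) <= cmod (iexp (t * l)) + cmod 1"
  by (rule norm_triangle_ineq4)
 then have "cmod (iexp (t * l) - 1) <= 2" by simp
 then show ?thesis using that by (simp add: osc_def norm_divide norm_mult divide_right_mono)
qed

lemma osc_le: "cmod (osc t l) <= \<bar>t\<bar>"
proof (cases "l = 0")
 case False
 have "cmod (iexp (t * l) - 1) <= \<bar>t * l\<bar>"
  using iexp_approx1[of "t * l" 0] by simp
 then show ?thesis using False by (simp add: osc_def norm_divide norm_mult abs_mult field_simps)
qed (simp add: osc_def)

definition duh1 :: "real => real => complex" where
 "duh1 \<xi> l = ft (%t. cor (cutoff 0 t) * osc t l) \<xi>"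

lemma duh1_measurable [measurable (raw)]:
 assumes [measurable]: "f \<in> borel_measurable M" "g \<in> borel_measurable M"
 shows "(%x. duh1 (f x) (g x)) \<in> borel_measurable M"
 unfolding duh1_def ft_def by measurable

lemma cutoff_osc_continuous: "continuous_on UNIV (%t. cor (cutoff 0 t) * osc t l)"
proof -
 have "continuous_on UNIV (%t. osc t l)"
  by (intro continuous_at_imp_continuous_on ballI) (metis osc_deriv has_vector_derivative_continuous)
 then show ?thesis by (intro continuous_intros cutoff_continuous)
qed

text \<open>For \<open>|l| <= 1\<close> the function \<open>\<theta>(t) \<integral>\<^sub>0\<^sup>t e\<^bsup>it'l\<^esup> dt'\<close> is bounded in \<open>C\<^sup>2\<close>; for \<open>|l| >= 1\<close> its
 transform is \<open>(\<theta>\<^sup>^(\<xi> - l) - \<theta>\<^sup>^(\<xi>)) / (i l)\<close>.\<close>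

lemma duh1_bound:
 obtains C where "C > 0"
  "!!\<xi> l. cmod (duh1 \<xi> l) <= C * bracket l powr (- 1) * (bracket (\<xi> - l) powr (- 2) + bracket \<xi> powr (- 2))"
proof -
 obtain K where K: "K >= 1" "!!j t. j <= 2 ==> \<bar>cutoff j t\<bar> <= K"
  using cutoff_bounded by blast
 obtain C0 where C0: "C0 > 0" "!!\<xi>. cmod (cutoff_ft \<xi>) <= C0 * bracket \<xi> powr (- 2)"
  using cutoff_ft_decay by blast
 define C where "C = 2 * C0 + 2 * (32 * (7 * K))"
 have C: "C > 0" using C0(1) K(1) by (simp add: C_def)
 have main: "cmod (duh1 \<xi> l) <= C * bracket l powr (- 1) * (bracket (\<xi> - l) powr (- 2) + bracket \<xi> powr (- 2))" for \<xi> l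
 proof (cases "\<bar>l\<bar> <= 1")
  case True
  define f1 where "f1 t = cor (cutoff 0 t) * iexp (t * l) + cor (cutoff 1 t) * osc t l" for t
  define f2 where "f2 t = (cor (cutoff 0 t) * (\<i> * cor l * iexp (t * l)) + cor (cutoff 1 t) * iexp (t * l))
    + (cor (cutoff 1 t) * iexp (t * l) + cor (cutoff 2 t) * osc t l)" for t
  have osc_cont: "continuous_on UNIV (%t. osc t l)"
   by (intro continuous_at_imp_continuous_on ballI) (metis osc_deriv has_vector_derivative_continuous)
  have prod_le: "cmod (cor (cutoff j t) * osc t l) <= 4 * K" if "j <= 2" for j t
  proof (cases "\<bar>t\<bar> >= 4")
   case True
   then show ?thesis using K(1) by (simp add: cutoff_outside)
  next
   case False
   then have "cmod (osc t l) <= 4" using osc_le[of t l] by linarith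
   then have "\<bar>cutoff j t\<bar> * cmod (osc t l) <= K * 4" using K that by (intro mult_mono) auto
   then show ?thesis by (simp add: norm_mult)
  qed
  have "cmod (ft (%t. cor (cutoff 0 t) * osc t l) \<xi>) <= 32 * (7 * K) * bracket \<xi> powr (- 2)"
  proof (rule ft_decay)
   show "((%t. cor (cutoff 0 t) * osc t l) has_vector_derivative f1 t) (at t)" for t
    unfolding f1_def by (intro has_vector_derivative_mult cutoff_vector_derivative osc_deriv)
   show "(f1 has_vector_derivative f2 t) (at t)" for t
    unfolding f1_def f2_def
    by (intro has_vector_derivative_add has_vector_derivative_mult cutoff_vector_derivative osc_deriv exp_deriv)
   show "continuous_on UNIV f2"
    unfolding f2_def by (intro continuous_intros cutoff_continuous osc_cont)
   show "cmod (cor (cutoff 0 t) * osc t l) <= 7 * K" for t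
    using prod_le[of 0 t] K(1) by linarith
   show "cmod (f2 t) <= 7 * K" for t
   proof -
    have "cmod (cor (cutoff 0 t) * (\<i> * cor l * iexp (t * l))) <= K * 1"
     using mult_mono[OF K(2)[of 0 t] True] K(1) by (simp add: norm_mult)
    moreover have "cmod (cor (cutoff 1 t) * iexp (t * l)) <= K"
     using K(2)[of 1 t] by (simp add: norm_mult)
    ultimately have "cmod (f2 t) <= (K * 1 + K) + (K + 4 * K)"
     unfolding f2_def by (intro norm_triangle_le add_mono prod_le) auto
    then show ?thesis by simp
   qed
  qed (auto simp: f1_def f2_def cutoff_outside)
  then have "cmod (duh1 \<xi> l) <= 1 * (32 * (7 * K) * bracket \<xi> powr (- 2))" by (simp add: duh1_def)
  also have "... <= (2 * bracket l powr (- 1)) * (32 * (7 * K) * bracket \<xi> powr (- 2))"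
  proof (intro mult_right_mono)
   show "1 <= 2 * bracket l powr (- 1)"
    using True by (simp add: powr_minus field_simps bracket_def)
  qed (use K(1) in auto)
  also have "... = (2 * (32 * (7 * K))) * bracket l powr (- 1) * bracket \<xi> powr (- 2)" by simp
  also have "... <= C * bracket l powr (- 1) * (bracket (\<xi> - l) powr (- 2) + bracket \<xi> powr (- 2))"
   using C0(1) K(1) by (intro mult_mono) (auto simp: C_def)
  finally show ?thesis .
 next
  case False
  then have l: "l \<noteq> 0" "\<bar>l\<bar> >= 1" by auto
  have int: "integrable lborel (%t. cor (cutoff 0 t))"
   by (intro integrable_compact_support continuous_intros cutoff_continuous) (simp add: cutoff_outside)
  have "duh1 \<xi> l = (LINT t|lborel. (exp (- \<i> * cor (t * (\<xi> - l))) * cor (cutoff 0 t)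
    - exp (- \<i> * cor (t * \<xi>)) * cor (cutoff 0 t)) / (\<i> * cor l))"
   unfolding duh1_def ft_def osc_def using l(1)
   by (intro Bochner_Integration.integral_cong)
     (auto simp: right_diff_distrib exp_diff exp_minus field_simps)
  also have "... = (cutoff_ft (\<xi> - l) - cutoff_ft \<xi>) / (\<i> * cor l)"
   unfolding cutoff_ft_def ft_def
   using integrable_exp_mult(3)[OF int, of "\<xi> - l"] integrable_exp_mult(3)[OF int, of \<xi>]
   by (simp add: Bochner_Integration.integral_diff)
  finally have "cmod (duh1 \<xi> l) = cmod (cutoff_ft (\<xi> - l) - cutoff_ft \<xi>) / \<bar>l\<bar>"
   by (simp add: norm_divide norm_mult)
  also have "... <= (C0 * bracket (\<xi> - l) powr (- 2) + C0 * bracket \<xi> powr (- 2)) / \<bar>l\<bar>"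
   by (intro divide_right_mono norm_triangle_le_diff add_mono C0) auto
  also have "... = (1 / \<bar>l\<bar>) * (C0 * (bracket (\<xi> - l) powr (- 2) + bracket \<xi> powr (- 2)))"
   by (simp only: distrib_left times_divide_eq_left mult_1_left add_divide_distrib)
  also have "... <= (2 * bracket l powr (- 1)) * (C0 * (bracket (\<xi> - l) powr (- 2) + bracket \<xi> powr (- 2)))"
  proof (intro mult_right_mono)
   show "1 / \<bar>l\<bar> <= 2 * bracket l powr (- 1)"
    using l by (simp add: powr_minus field_simps bracket_def)
  qed (use C0(1) in auto)
  also have "... = (2 * C0) * bracket l powr (- 1) * (bracket (\<xi> - l) powr (- 2) + bracket \<xi> powr (- 2))" by simp
  also have "... <= C * bracket l powr (- 1) * (bracket (\<xi> - l) powr (- 2) + bracket \<xi> powr (- 2))"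
   using K(1) by (intro mult_right_mono) (auto simp: C_def)
  finally show ?thesis .
 qed
 show ?thesis by (rule that[OF C main])
qed

lemma duh1_integrable: "integrable lborel (%\<xi>. duh1 \<xi> l)"
proof -
 obtain C where C: "C > 0"
  "!!\<xi> l. cmod (duh1 \<xi> l) <= C * bracket l powr (- 1) * (bracket (\<xi> - l) powr (- 2) + bracket \<xi> powr (- 2))"
  using duh1_bound by blast
 have "cmod (duh1 \<xi> l) <= (C * bracket l powr (- 1) * (bracket l powr 2 + 1)) * bracket \<xi> powr (- 2)" for \<xi>
 proof -
  have "bracket \<xi> <= bracket l * bracket (\<xi> - l)" using bracket_add_le_mult[of l "\<xi> - l"] by simp
  then have "bracket (\<xi> - l) powr (- 2) <= bracket l powr 2 * bracket \<xi> powr (- 2)"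
   by (intro powr_neg_le_of_le_mult) auto
  then have "bracket (\<xi> - l) powr (- 2) + bracket \<xi> powr (- 2) <= (bracket l powr 2 + 1) * bracket \<xi> powr (- 2)"
   by (simp add: distrib_right)
  then have "C * bracket l powr (- 1) * (bracket (\<xi> - l) powr (- 2) + bracket \<xi> powr (- 2))
   <= C * bracket l powr (- 1) * ((bracket l powr 2 + 1) * bracket \<xi> powr (- 2))"
   using C(1) by (intro mult_left_mono) auto
  then show ?thesis using C(2)[of \<xi> l] by (simp only: mult.assoc)
 qed
 then show ?thesis by (intro integrable_bracket_decay) measurable
qed

lemma ift_duh1: "t \<in> {0..1} ==> ift (%\<xi>. duh1 \<xi> l) t = osc t l"
proof -
 assume t: "t \<in> {0..1}"
 obtain K where K: "K >= 1" "!!j t. j <= 2 ==> \<bar>cutoff j t\<bar> <= K"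
  using cutoff_bounded by blast
 let ?f = "%t. cor (cutoff 0 t) * osc t l"
 have eq: "(%\<xi>. duh1 \<xi> l) = ft ?f" by (simp add: duh1_def)
 have "ift (ft ?f) t = ?f t"
 proof (rule fourier_inversion)
  show "integrable lborel ?f"
   by (intro integrable_compact_support cutoff_osc_continuous) (simp add: cutoff_outside)
  show "cmod (?f x) <= K * 4" for x
  proof (cases "\<bar>x\<bar> >= 4")
   case True
   then show ?thesis using K(1) by (simp add: cutoff_outside)
  next
   case False
   then have "cmod (osc x l) <= 4" using osc_le[of x l] by linarith
   then show ?thesis using K by (auto simp: norm_mult intro!: mult_mono)
  qed
  show "integrable lborel (ft ?f)" using duh1_integrable[of l] unfolding eq .
 qed (rule cutoff_osc_continuous)
 then show ?thesis using cutoff_eq_1[OF t] by (simp add: eq)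
qed

definition duh :: "real => real => real => complex" where
 "duh \<delta> \<xi> l = cor (\<delta>\<^sup>2) * duh1 (\<delta> * \<xi>) (\<delta> * l)"

lemma duh_measurable [measurable (raw)]:
 assumes [measurable]: "f \<in> borel_measurable M" "g \<in> borel_measurable M"
 shows "(%x. duh \<delta> (f x) (g x)) \<in> borel_measurable M"
 unfolding duh_def by measurable

lemma duh_integrable:
 assumes "\<delta> > 0"
 shows "integrable lborel (%\<xi>. duh \<delta> \<xi> l)"
 using lborel_integrable_real_affine[OF duh1_integrable, of \<delta> 0 "\<delta> * l"] assms
 unfolding duh_def by (intro integrable_mult_right) auto

lemma ift_duh:
 assumes "\<delta> > 0" "t \<in> {0..\<delta>}"
 shows "ift (%\<xi>. duh \<delta> \<xi> l) t = osc t l"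
proof -
 have "(LINT \<eta>|lborel. iexp (t / \<delta> * \<eta>) * duh1 \<eta> (\<delta> * l))
   = \<bar>\<delta>\<bar> *\<^sub>R (LINT \<xi>|lborel. iexp (t / \<delta> * (0 + \<delta> * \<xi>)) * duh1 (0 + \<delta> * \<xi>) (\<delta> * l))"
  by (rule lborel_integral_real_affine) (use assms in auto)
 also have "... = cor \<delta> * (LINT \<xi>|lborel. iexp (t * \<xi>) * duh1 (\<delta> * \<xi>) (\<delta> * l))"
  using assms by (simp add: scaleR_conv_of_real)
 finally have eq: "(LINT \<eta>|lborel. iexp (t / \<delta> * \<eta>) * duh1 \<eta> (\<delta> * l))
   = cor \<delta> * (LINT \<xi>|lborel. iexp (t * \<xi>) * duh1 (\<delta> * \<xi>) (\<delta> * l))" .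
 have "ift (%\<xi>. duh \<delta> \<xi> l) t = cor (1 / (2 * pi)) * (LINT \<xi>|lborel. cor (\<delta>\<^sup>2) * (iexp (t * \<xi>) * duh1 (\<delta> * \<xi>) (\<delta> * l)))"
  unfolding ift_def duh_def by (simp only: mult.left_commute)
 also have "... = cor \<delta> * (cor (1 / (2 * pi)) * (cor \<delta> * (LINT \<xi>|lborel. iexp (t * \<xi>) * duh1 (\<delta> * \<xi>) (\<delta> * l))))"
  by (simp add: power2_eq_square)
 also have "... = cor \<delta> * ift (%\<xi>. duh1 \<xi> (\<delta> * l)) (t / \<delta>)"
  unfolding ift_def eq ..
 also have "... = cor \<delta> * osc (t / \<delta>) (\<delta> * l)"
  using assms by (subst ift_duh1) auto
 also have "... = osc t l"
  using assms by (auto simp: osc_def)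
 finally show ?thesis .
qed

context exponents

begin

lemma duh1_estimate:
 obtains C where "C < \<infinity>" "!!h. h \<in> bmeas ==>
  (nnint (%\<xi>. (ennreal (bracket \<xi> powr b) * (nnint (%l. ennreal (cmod (duh1 \<xi> l)) * h l)))\<^sup>2))
  <= C * (nnint (%l. (ennreal (bracket l powr (- a)) * h l)\<^sup>2))"
proof -
 obtain c where c: "c > 0"
  "!!\<xi> l. cmod (duh1 \<xi> l) <= c * bracket l powr (- 1) * (bracket (\<xi> - l) powr (- 2) + bracket \<xi> powr (- 2))"
  using duh1_bound by blast
 define k1 where "k1 x = bracket x powr (- (2 - b))" for x
 define k2 where "k2 x = bracket x powr (- (1 - a))" for x
 have [measurable]: "k1 \<in> bmeas" "k2 \<in> bmeas"
  unfolding k1_def k2_def by measurable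
 have k0: "k1 x >= 0" "k2 x >= 0" for x by (auto simp: k1_def k2_def)
 \<comment> \<open>Here \<open>a + b < 1\<close> enters: the factor \<open>\<langle>l\<rangle>\<^bsup>-1\<^esup>\<close> pays for both weights.\<close>
 have kernel: "bracket \<xi> powr b * cmod (duh1 \<xi> l) <= c * (k1 (\<xi> - l) + k1 \<xi> * k2 l) * bracket l powr (- a)" for \<xi> l
 proof -
  have "bracket \<xi> powr b * bracket l powr (- 1) * bracket (\<xi> - l) powr (- 2) <= k1 (\<xi> - l) * bracket l powr (- a)"
  proof -
   have "bracket \<xi> <= bracket (\<xi> - l) * bracket l" using bracket_add_le_mult[of "\<xi> - l" l] by simp
   then have "bracket \<xi> powr b <= (bracket (\<xi> - l) * bracket l) powr b" using b_pos by (intro powr_mono2) auto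
   then have "bracket \<xi> powr b * bracket l powr (- 1) * bracket (\<xi> - l) powr (- 2)
     <= (bracket (\<xi> - l) powr b * bracket l powr b) * bracket l powr (- 1) * bracket (\<xi> - l) powr (- 2)"
    by (intro mult_right_mono) (auto simp: powr_mult)
   also have "... = (bracket (\<xi> - l) powr b * bracket (\<xi> - l) powr (- 2)) * (bracket l powr b * bracket l powr (- 1))" by simp
   also have "bracket (\<xi> - l) powr b * bracket (\<xi> - l) powr (- 2) = k1 (\<xi> - l)"
    by (subst powr_add[symmetric]) (simp add: k1_def)
   also have "bracket l powr b * bracket l powr (- 1) = bracket l powr (b - 1)"
    by (subst powr_add[symmetric]) simp
   also have "k1 (\<xi> - l) * bracket l powr (b - 1) <= k1 (\<xi> - l) * bracket l powr (- a)"
    using ab k0 by (intro mult_left_mono powr_mono) auto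
   finally show ?thesis .
  qed
  moreover have "bracket \<xi> powr b * bracket l powr (- 1) * bracket \<xi> powr (- 2) = k1 \<xi> * k2 l * bracket l powr (- a)"
  proof -
   have "bracket \<xi> powr b * bracket \<xi> powr (- 2) = k1 \<xi>" by (simp add: k1_def flip: powr_add)
   moreover have "k2 l * bracket l powr (- a) = bracket l powr (- 1)" by (simp add: k2_def flip: powr_add)
   ultimately show ?thesis by (simp add: mult_ac)
  qed
  ultimately have "bracket \<xi> powr b * bracket l powr (- 1) * (bracket (\<xi> - l) powr (- 2) + bracket \<xi> powr (- 2))
    <= (k1 (\<xi> - l) + k1 \<xi> * k2 l) * bracket l powr (- a)"
   by (simp add: distrib_left distrib_right)
  then have "c * (bracket \<xi> powr b * bracket l powr (- 1) * (bracket (\<xi> - l) powr (- 2) + bracket \<xi> powr (- 2)))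
    <= c * ((k1 (\<xi> - l) + k1 \<xi> * k2 l) * bracket l powr (- a))"
   using c(1) by (intro mult_left_mono) auto
  moreover have "bracket \<xi> powr b * cmod (duh1 \<xi> l) <= bracket \<xi> powr b * (c * bracket l powr (- 1) * (bracket (\<xi> - l) powr (- 2) + bracket \<xi> powr (- 2)))"
   by (intro mult_left_mono c(2)) auto
  ultimately show ?thesis by (simp add: mult_ac)
 qed
 define B1 where "B1 = bracket_integral (2 - b)"
 define B2 where "B2 = bracket_integral (2 * (2 - b))"
 define B3 where "B3 = bracket_integral (2 * (1 - a))"
 have fin: "B1 < \<infinity>" "B2 < \<infinity>" "B3 < \<infinity>"
 proof -
  have *: "2 - b > 1" "2 * (2 - b) > 1" "2 * (1 - a) > 1"
   using ab a_pos a_less unfolding right_diff_distrib by linarith+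
  show "B1 < \<infinity>" "B2 < \<infinity>" "B3 < \<infinity>"
   unfolding B1_def B2_def B3_def by (rule bracket_integral_finite *)+
 qed
 have main: "(nnint (%\<xi>. (ennreal (bracket \<xi> powr b) * (nnint (%l. ennreal (cmod (duh1 \<xi> l)) * h l)))\<^sup>2))
  <= (ennreal (c\<^sup>2) * (2 * (B1 * B1 + B2 * B3))) * (nnint (%l. (ennreal (bracket l powr (- a)) * h l)\<^sup>2))"
  if [measurable]: "h \<in> bmeas" for h
 proof -
  define H where "H l = ennreal (bracket l powr (- a)) * h l" for l
  have [measurable]: "H \<in> bmeas" unfolding H_def by measurable
  let ?HH = "nnint (%l. (H l)\<^sup>2)"
  define X where "X \<xi> = (nnint (%l. ennreal (k1 (\<xi> - l)) * H l))" for \<xi>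
  define Y where "Y = (nnint (%l. ennreal (k2 l) * H l))"
  have [measurable]: "X \<in> bmeas" unfolding X_def by measurable
  have pw: "ennreal (bracket \<xi> powr b) * (nnint (%l. ennreal (cmod (duh1 \<xi> l)) * h l)) <= ennreal c * (X \<xi> + ennreal (k1 \<xi>) * Y)" for \<xi>
  proof -
   have "ennreal (bracket \<xi> powr b) * (nnint (%l. ennreal (cmod (duh1 \<xi> l)) * h l))
     = (nnint (%l. ennreal (bracket \<xi> powr b * cmod (duh1 \<xi> l)) * h l))"
    by (subst nn_integral_cmult[symmetric]) (auto simp: ennreal_mult mult.assoc)
   also have "... <= (nnint (%l. ennreal (c * (k1 (\<xi> - l) + k1 \<xi> * k2 l) * bracket l powr (- a)) * h l))"
    by (intro nn_integral_mono mult_right_mono ennreal_leI kernel) auto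
   also have "... = (nnint (%l. ennreal c * (ennreal (k1 (\<xi> - l)) * H l + ennreal (k1 \<xi>) * (ennreal (k2 l) * H l))))"
   proof (intro nn_integral_cong)
    fix l
    have "ennreal (c * (k1 (\<xi> - l) + k1 \<xi> * k2 l) * bracket l powr (- a))
     = ennreal c * (ennreal (k1 (\<xi> - l)) + ennreal (k1 \<xi>) * ennreal (k2 l)) * ennreal (bracket l powr (- a))"
     using c(1) k0
     by (simp only: ennreal_mult[of "c * (k1 (\<xi> - l) + k1 \<xi> * k2 l)"] ennreal_mult_plus[of c]
       ennreal_mult[of "k1 \<xi>"] mult_nonneg_nonneg add_nonneg_nonneg less_imp_le powr_ge_zero)
    then show "ennreal (c * (k1 (\<xi> - l) + k1 \<xi> * k2 l) * bracket l powr (- a)) * h l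
     = ennreal c * (ennreal (k1 (\<xi> - l)) * H l + ennreal (k1 \<xi>) * (ennreal (k2 l) * H l))"
     unfolding H_def by (simp add: distrib_left distrib_right mult_ac)
   qed
   also have "... = ennreal c * (X \<xi> + ennreal (k1 \<xi>) * Y)"
    unfolding X_def Y_def by (simp add: nn_integral_cmult nn_integral_add)
   finally show ?thesis .
  qed
  have X_sq: "(X \<xi>)\<^sup>2 <= B1 * (nnint (%l. ennreal (k1 (\<xi> - l)) * (H l)\<^sup>2))" for \<xi>
  proof -
   have sq: "(ennreal (sqrt (k1 x)))\<^sup>2 = ennreal (k1 x)" for x
    using k0 by (simp add: ennreal_power)
   have "(X \<xi>)\<^sup>2 = (nnint (%l. ennreal (sqrt (k1 (\<xi> - l))) * (ennreal (sqrt (k1 (\<xi> - l))) * H l)))\<^sup>2"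
    unfolding X_def by (simp add: mult.assoc[symmetric] power2_eq_square[symmetric] sq)
   also have "... <= (nnint (%l. (ennreal (sqrt (k1 (\<xi> - l))))\<^sup>2)) * (nnint (%l. (ennreal (sqrt (k1 (\<xi> - l))) * H l)\<^sup>2))"
    by (rule Cauchy_Schwarz_nn_integral) measurable
   also have "(nnint (%l. (ennreal (sqrt (k1 (\<xi> - l))))\<^sup>2)) = B1"
    unfolding sq unfolding B1_def k1_def bracket_minus_commute[of \<xi>] by (rule bracket_integral_translate)
   also have "(nnint (%l. (ennreal (sqrt (k1 (\<xi> - l))) * H l)\<^sup>2)) = (nnint (%l. ennreal (k1 (\<xi> - l)) * (H l)\<^sup>2))"
    by (simp add: power_mult_distrib sq)
   finally show ?thesis .
  qed
  have Y_sq: "Y\<^sup>2 <= B3 * ?HH"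
  proof -
   have "Y\<^sup>2 <= (nnint (%l. (ennreal (k2 l))\<^sup>2)) * ?HH"
    unfolding Y_def by (rule Cauchy_Schwarz_nn_integral) measurable
   also have "(nnint (%l. (ennreal (k2 l))\<^sup>2)) = B3"
    unfolding B3_def bracket_integral_def k2_def by (simp add: ennreal_power powr_neg_square del: minus_diff_eq)
   finally show ?thesis .
  qed
  have "(nnint (%\<xi>. (ennreal (bracket \<xi> powr b) * (nnint (%l. ennreal (cmod (duh1 \<xi> l)) * h l)))\<^sup>2))
    <= (nnint (%\<xi>. ennreal (c\<^sup>2) * (2 * (B1 * (nnint (%l. ennreal (k1 (\<xi> - l)) * (H l)\<^sup>2)) + (ennreal (k1 \<xi>))\<^sup>2 * (B3 * ?HH)))))"
  proof (intro nn_integral_mono)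
   fix \<xi>
   have "(ennreal (bracket \<xi> powr b) * (nnint (%l. ennreal (cmod (duh1 \<xi> l)) * h l)))\<^sup>2
     <= (ennreal c * (X \<xi> + ennreal (k1 \<xi>) * Y))\<^sup>2"
    by (intro power_mono pw) auto
   also have "... = ennreal (c\<^sup>2) * (X \<xi> + ennreal (k1 \<xi>) * Y)\<^sup>2"
    using c(1) by (simp add: power_mult_distrib ennreal_power)
   also have "... <= ennreal (c\<^sup>2) * (2 * ((X \<xi>)\<^sup>2 + (ennreal (k1 \<xi>) * Y)\<^sup>2))"
    by (intro mult_left_mono ennreal_square_add_le) auto
   also have "... <= ennreal (c\<^sup>2) * (2 * (B1 * (nnint (%l. ennreal (k1 (\<xi> - l)) * (H l)\<^sup>2)) + (ennreal (k1 \<xi>))\<^sup>2 * (B3 * ?HH)))"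
    unfolding power_mult_distrib by (intro mult_left_mono add_mono X_sq Y_sq) auto
   finally show "(ennreal (bracket \<xi> powr b) * (nnint (%l. ennreal (cmod (duh1 \<xi> l)) * h l)))\<^sup>2
     <= ennreal (c\<^sup>2) * (2 * (B1 * (nnint (%l. ennreal (k1 (\<xi> - l)) * (H l)\<^sup>2)) + (ennreal (k1 \<xi>))\<^sup>2 * (B3 * ?HH)))" .
  qed
  also have "... = ennreal (c\<^sup>2) * (2 * (B1 * (nnint (%\<xi>. (nnint (%l. ennreal (k1 (\<xi> - l)) * (H l)\<^sup>2)))) + (nnint (%\<xi>. (ennreal (k1 \<xi>))\<^sup>2)) * (B3 * ?HH)))"
   by (simp add: nn_integral_cmult nn_integral_add nn_integral_multc)
  also have "(nnint (%\<xi>. (nnint (%l. ennreal (k1 (\<xi> - l)) * (H l)\<^sup>2))))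
    = (nnint (%l. (nnint (%\<xi>. ennreal (k1 (\<xi> - l)) * (H l)\<^sup>2))))"
   by (rule lborel_pair.Fubini') measurable
  also have "... = B1 * ?HH"
   unfolding B1_def k1_def by (simp add: nn_integral_multc nn_integral_cmult bracket_integral_translate del: minus_diff_eq)
  also have "(nnint (%\<xi>. (ennreal (k1 \<xi>))\<^sup>2)) = B2"
   unfolding B2_def bracket_integral_def k1_def by (simp add: ennreal_power powr_neg_square del: minus_diff_eq)
  also have "ennreal (c\<^sup>2) * (2 * (B1 * (B1 * ?HH) + B2 * (B3 * ?HH))) = (ennreal (c\<^sup>2) * (2 * (B1 * B1 + B2 * B3))) * ?HH"
   by (simp only: distrib_left distrib_right mult.assoc)
  finally show ?thesis unfolding H_def .
 qed
 show ?thesis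
  by (rule that[OF _ main]) (use fin in \<open>auto simp: ennreal_mult_less_top\<close>)
qed

text \<open>Rescaling time by \<open>\<delta>\<close> turns the estimate on the unit interval into one on \<open>[0,\<delta>]\<close>, with the
 gain \<open>\<delta>\<^bsup>1-a-b\<^esup>\<close> that makes the nonlinear map a contraction.\<close>

lemma duh_estimate:
 obtains C where "C < \<infinity>" "!!h \<delta>. h \<in> bmeas ==> 0 < \<delta> ==> \<delta> <= 1 ==>
  (nnint (%\<xi>. (ennreal (bracket \<xi> powr b) * (nnint (%l. ennreal (cmod (duh \<delta> \<xi> l)) * h l)))\<^sup>2))
  <= C * ennreal (\<delta> powr (2 * (1 - a - b))) * (nnint (%l. (ennreal (bracket l powr (- a)) * h l)\<^sup>2))"
proof -
 obtain C where C: "C < \<infinity>" "!!h. h \<in> bmeas ==>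
  (nnint (%\<xi>. (ennreal (bracket \<xi> powr b) * (nnint (%l. ennreal (cmod (duh1 \<xi> l)) * h l)))\<^sup>2))
  <= C * (nnint (%l. (ennreal (bracket l powr (- a)) * h l)\<^sup>2))"
  using duh1_estimate by blast
 have main: "(nnint (%\<xi>. (ennreal (bracket \<xi> powr b) * (nnint (%l. ennreal (cmod (duh \<delta> \<xi> l)) * h l)))\<^sup>2))
  <= C * ennreal (\<delta> powr (2 * (1 - a - b))) * (nnint (%l. (ennreal (bracket l powr (- a)) * h l)\<^sup>2))"
  if [measurable]: "h \<in> bmeas" and \<delta>: "0 < \<delta>" "\<delta> <= 1" for h \<delta>
 proof -
  define g where "g m = h (m / \<delta>)" for m
  have [measurable]: "g \<in> bmeas" unfolding g_def by measurable
  define P where "P \<eta> = (nnint (%m. ennreal (cmod (duh1 \<eta> m)) * g m))" for \<eta>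
  have [measurable]: "P \<in> bmeas" unfolding P_def by measurable
  have br: "bracket y <= (1 / \<delta>) * bracket (\<delta> * y)" "bracket y >= bracket (\<delta> * y)" for y
   using \<delta> mult_right_mono[OF \<delta>(2), of "\<bar>y\<bar>"] by (auto simp: bracket_def abs_mult field_simps)
  have inner: "(nnint (%l. ennreal (cmod (duh \<delta> \<xi> l)) * h l)) = ennreal \<delta> * P (\<delta> * \<xi>)" for \<xi>
  proof -
   have "P (\<delta> * \<xi>) = ennreal \<bar>\<delta>\<bar> * (nnint (%l. ennreal (cmod (duh1 (\<delta> * \<xi>) (0 + \<delta> * l))) * g (0 + \<delta> * l)))"
    unfolding P_def by (rule nn_integral_real_affine) (use \<delta> in auto)
   also have "... = ennreal \<delta> * (nnint (%l. ennreal (cmod (duh1 (\<delta> * \<xi>) (\<delta> * l))) * h l))"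
    using \<delta> by (simp add: g_def)
   finally have "ennreal \<delta> * P (\<delta> * \<xi>) = (nnint (%l. ennreal (\<delta> * \<delta>) * (ennreal (cmod (duh1 (\<delta> * \<xi>) (\<delta> * l))) * h l)))"
    using \<delta> by (simp add: nn_integral_cmult ennreal_mult mult.assoc)
   also have "... = (nnint (%l. ennreal (cmod (duh \<delta> \<xi> l)) * h l))"
    using \<delta> by (intro nn_integral_cong) (simp add: duh_def norm_mult power2_eq_square ennreal_mult mult.assoc)
   finally show ?thesis ..
  qed
  have "(nnint (%\<xi>. (ennreal (bracket \<xi> powr b) * (nnint (%l. ennreal (cmod (duh \<delta> \<xi> l)) * h l)))\<^sup>2))
   <= (nnint (%\<xi>. ennreal (\<delta>\<^sup>2 * \<delta> powr (- (2 * b))) * (ennreal (bracket (\<delta> * \<xi>) powr b) * P (\<delta> * \<xi>))\<^sup>2))"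
  proof (intro nn_integral_mono)
   fix \<xi>
   have "bracket \<xi> powr b <= ((1 / \<delta>) * bracket (\<delta> * \<xi>)) powr b"
    using br(1) b_pos by (intro powr_mono2) auto
   also have "... = \<delta> powr (- b) * bracket (\<delta> * \<xi>) powr b"
    using \<delta> by (simp add: powr_mult powr_minus powr_divide field_simps)
   finally have le: "bracket \<xi> powr b <= \<delta> powr (- b) * bracket (\<delta> * \<xi>) powr b" .
   have "ennreal (bracket \<xi> powr b) * (nnint (%l. ennreal (cmod (duh \<delta> \<xi> l)) * h l))
     <= ennreal (\<delta> powr (- b) * bracket (\<delta> * \<xi>) powr b) * (ennreal \<delta> * P (\<delta> * \<xi>))"
    unfolding inner by (intro mult_right_mono ennreal_leI le) auto
   also have "... = ennreal (\<delta> * \<delta> powr (- b)) * (ennreal (bracket (\<delta> * \<xi>) powr b) * P (\<delta> * \<xi>))"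
    using \<delta> by (simp add: ennreal_mult mult_ac)
   finally have "(ennreal (bracket \<xi> powr b) * (nnint (%l. ennreal (cmod (duh \<delta> \<xi> l)) * h l)))\<^sup>2
     <= (ennreal (\<delta> * \<delta> powr (- b)) * (ennreal (bracket (\<delta> * \<xi>) powr b) * P (\<delta> * \<xi>)))\<^sup>2"
    by (intro power_mono) auto
   also have "... = ennreal (\<delta>\<^sup>2 * \<delta> powr (- (2 * b))) * (ennreal (bracket (\<delta> * \<xi>) powr b) * P (\<delta> * \<xi>))\<^sup>2"
    using \<delta> by (subst power_mult_distrib) (simp add: ennreal_power power_mult_distrib powr_neg_square)
   finally show "(ennreal (bracket \<xi> powr b) * (nnint (%l. ennreal (cmod (duh \<delta> \<xi> l)) * h l)))\<^sup>2
     <= ennreal (\<delta>\<^sup>2 * \<delta> powr (- (2 * b))) * (ennreal (bracket (\<delta> * \<xi>) powr b) * P (\<delta> * \<xi>))\<^sup>2" .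
  qed
  also have "... = ennreal (\<delta>\<^sup>2 * \<delta> powr (- (2 * b))) * (nnint (%\<xi>. (ennreal (bracket (\<delta> * \<xi>) powr b) * P (\<delta> * \<xi>))\<^sup>2))"
   by (rule nn_integral_cmult) measurable
  also have "... = ennreal (\<delta> * \<delta> powr (- (2 * b))) * (ennreal \<delta> * (nnint (%\<xi>. (ennreal (bracket (\<delta> * \<xi>) powr b) * P (\<delta> * \<xi>))\<^sup>2)))"
   using \<delta> by (simp add: power2_eq_square ennreal_mult mult_ac)
  also have "ennreal \<delta> * (nnint (%\<xi>. (ennreal (bracket (\<delta> * \<xi>) powr b) * P (\<delta> * \<xi>))\<^sup>2))
   = (nnint (%\<eta>. (ennreal (bracket \<eta> powr b) * P \<eta>)\<^sup>2))"
   using nn_integral_real_affine[of "%\<eta>. (ennreal (bracket \<eta> powr b) * P \<eta>)\<^sup>2" \<delta> 0] \<delta> by simp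
  also have "... <= C * (nnint (%m. (ennreal (bracket m powr (- a)) * g m)\<^sup>2))"
   unfolding P_def by (rule C(2)) measurable
  also have "(nnint (%m. (ennreal (bracket m powr (- a)) * g m)\<^sup>2))
    = ennreal \<delta> * (nnint (%l. (ennreal (bracket (\<delta> * l) powr (- a)) * h l)\<^sup>2))"
   using nn_integral_real_affine[of "%m. (ennreal (bracket m powr (- a)) * g m)\<^sup>2" \<delta> 0] \<delta> by (simp add: g_def)
  also have "(nnint (%l. (ennreal (bracket (\<delta> * l) powr (- a)) * h l)\<^sup>2))
    <= (nnint (%l. ennreal (\<delta> powr (- (2 * a))) * (ennreal (bracket l powr (- a)) * h l)\<^sup>2))"
  proof (intro nn_integral_mono)
   fix l
   have "bracket (\<delta> * l) powr (- a) <= (1 / \<delta>) powr a * bracket l powr (- a)"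
    using \<delta> a_pos br(1)[of l] by (intro powr_neg_le_of_le_mult) auto
   then have "bracket (\<delta> * l) powr (- a) <= \<delta> powr (- a) * bracket l powr (- a)"
    using \<delta> by (simp add: powr_divide powr_minus field_simps)
   then have "ennreal (bracket (\<delta> * l) powr (- a)) * h l <= ennreal (\<delta> powr (- a) * bracket l powr (- a)) * h l"
    by (intro mult_right_mono ennreal_leI) auto
   then have "(ennreal (bracket (\<delta> * l) powr (- a)) * h l)\<^sup>2 <= (ennreal (\<delta> powr (- a)) * (ennreal (bracket l powr (- a)) * h l))\<^sup>2"
    by (intro power_mono) (auto simp: ennreal_mult mult.assoc)
   then show "(ennreal (bracket (\<delta> * l) powr (- a)) * h l)\<^sup>2 <= ennreal (\<delta> powr (- (2 * a))) * (ennreal (bracket l powr (- a)) * h l)\<^sup>2"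
    by (subst (asm) power_mult_distrib) (simp add: ennreal_power powr_neg_square)
  qed
  also have "... = ennreal (\<delta> powr (- (2 * a))) * (nnint (%l. (ennreal (bracket l powr (- a)) * h l)\<^sup>2))"
   by (rule nn_integral_cmult) measurable
  finally have "(nnint (%\<xi>. (ennreal (bracket \<xi> powr b) * (nnint (%l. ennreal (cmod (duh \<delta> \<xi> l)) * h l)))\<^sup>2))
   <= ennreal (\<delta> * \<delta> powr (- (2 * b))) * (C * (ennreal \<delta> * (ennreal (\<delta> powr (- (2 * a))) * (nnint (%l. (ennreal (bracket l powr (- a)) * h l)\<^sup>2)))))"
   by (simp add: mult_left_mono)
  also have "... = C * ennreal (\<delta> * \<delta> powr (- (2 * b)) * (\<delta> * \<delta> powr (- (2 * a)))) * (nnint (%l. (ennreal (bracket l powr (- a)) * h l)\<^sup>2))"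
   using \<delta> by (simp add: ennreal_mult mult_ac)
  also have "\<delta> * \<delta> powr (- (2 * b)) * (\<delta> * \<delta> powr (- (2 * a))) = \<delta> powr (2 * (1 - a - b))"
  proof -
   have "\<delta> * \<delta> powr (- (2 * b)) * (\<delta> * \<delta> powr (- (2 * a))) = \<delta> powr (1 + - (2 * b) + (1 + - (2 * a)))"
    using \<delta> by (simp only: powr_add powr_one)
   also have "1 + - (2 * b) + (1 + - (2 * a)) = 2 * (1 - a - b)" by simp
   finally show ?thesis .
  qed
  finally show ?thesis .
 qed
 show ?thesis by (rule that[OF C(1) main])
qed

end

section \<open>Time slices\<close>

abbreviation cn :: "(int => real => complex) => int => real => ennreal" where
 "cn G \<equiv> (%n \<tau>. ennreal (cmod (G n \<tau>)))"

lemma time_slice_eq_ift: "time_slice G t n = ift (G n) t"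
 by (simp add: time_slice_def ift_def)

lemma ift_translate: "ift (%\<xi>. g (\<xi> - c)) t = iexp (t * c) * ift g t"
proof -
 have "(LINT \<xi>|lborel. iexp (t * \<xi>) * g (\<xi> - c))
   = \<bar>1\<bar> *\<^sub>R (LINT \<xi>|lborel. iexp (t * (c + 1 * \<xi>)) * g ((c + 1 * \<xi>) - c))"
  by (rule lborel_integral_real_affine) simp
 also have "... = (LINT \<xi>|lborel. iexp (t * c) * (iexp (t * \<xi>) * g \<xi>))"
  by (simp add: distrib_left exp_add mult.assoc)
 also have "... = iexp (t * c) * (LINT \<xi>|lborel. iexp (t * \<xi>) * g \<xi>)"
  by (rule integral_mult_right_zero)
 finally show ?thesis by (simp add: ift_def)
qed

lemma ift_cmult: "ift (%\<xi>. c * g \<xi>) t = c * ift g t"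
 by (simp add: ift_def mult.left_commute)

lemma ift_add: "integrable lborel f ==> integrable lborel g ==> ift (%\<xi>. f \<xi> + g \<xi>) t = ift f t + ift g t"
 unfolding ift_def using integrable_exp_mult(1)[of f t] integrable_exp_mult(1)[of g t]
 by (simp add: distrib_left)

lemma ift_diff: "integrable lborel f ==> integrable lborel g ==> ift (%\<xi>. f \<xi> - g \<xi>) t = ift f t - ift g t"
 unfolding ift_def using integrable_exp_mult(1)[of f t] integrable_exp_mult(1)[of g t]
 by (simp add: right_diff_distrib)

lemma norm_ift_le: "ennreal (cmod (ift g t)) <= (nnint (%\<tau>. ennreal (cmod (g \<tau>))))"
proof (cases "integrable lborel g")
 case True
 have "cmod (ift g t) <= 1 * cmod (LINT \<tau>|lborel. iexp (t * \<tau>) * g \<tau>)"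
 proof -
  have "cmod (cor (1 / (2 * pi))) <= 1"
   using pi_gt3 by (simp add: norm_divide)
  then show ?thesis unfolding ift_def norm_mult by (intro mult_right_mono) auto
 qed
 then have "ennreal (cmod (ift g t)) <= ennreal (cmod (LINT \<tau>|lborel. iexp (t * \<tau>) * g \<tau>))"
  by (intro ennreal_leI) simp
 also have "... <= (nnint (%\<tau>. ennreal (cmod (iexp (t * \<tau>) * g \<tau>))))"
  by (rule integral_norm_bound_ennreal[OF integrable_exp_mult(1)[OF True]])
 finally show ?thesis by (simp add: norm_mult)
next
 case False
 have "\<not> integrable lborel (%\<tau>. iexp (t * \<tau>) * g \<tau>)"
 proof
  assume "integrable lborel (%\<tau>. iexp (t * \<tau>) * g \<tau>)"
  then have "integrable lborel (%\<tau>. exp (- (\<i> * cor (t * \<tau>))) * (iexp (t * \<tau>) * g \<tau>))"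
   by (rule integrable_exp_mult(2))
  then have "integrable lborel g" by (simp add: mult.assoc[symmetric] flip: exp_add)
  with False show False ..
 qed
 then show ?thesis by (simp add: ift_def not_integrable_integral_eq)
qed

lemma branch_le: "bracket (\<bar>\<tau>\<bar> - gam n) <= bracket (\<tau> - gam n)" "bracket (\<bar>\<tau>\<bar> - gam n) <= bracket (\<tau> + gam n)"
 using gam_nonneg[of n] unfolding bracket_def by arith+

lemma branch_cases:
 "bracket (\<bar>\<tau>\<bar> - gam n) = bracket (\<tau> - gam n) \<or> bracket (\<bar>\<tau>\<bar> - gam n) = bracket (\<tau> + gam n)"
 unfolding bracket_def by arith

lemma nn_integral_branch_le:
 "(nnint (%\<tau>. ennreal (bracket (\<bar>\<tau>\<bar> - gam n) powr (- p)))) <= 2 * bracket_integral p"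
proof -
 have "(nnint (%\<tau>. ennreal (bracket (\<bar>\<tau>\<bar> - gam n) powr (- p))))
   <= (nnint (%\<tau>. ennreal (bracket (\<tau> - gam n) powr (- p)) + ennreal (bracket (\<tau> - (- gam n)) powr (- p))))"
  using branch_cases by (intro nn_integral_mono) (metis add_increasing add_increasing2 diff_minus_eq_add order_refl zero_le)
 also have "... = bracket_integral p + bracket_integral p"
  by (subst nn_integral_add) (simp_all only: bracket_integral_translate, measurable)
 finally show ?thesis by (simp only: mult_2)
qed

lemma slice_integral_bound:
 assumes [measurable]: "g \<in> bmeas"
 shows "(ennreal (w n) * (nnint (%\<tau>. g \<tau>)))\<^sup>2 <=
  2 * bracket_integral (2 * b) * (nnint (%\<tau>. (ennreal (bracket (\<bar>\<tau>\<bar> - gam n) powr b * w n) * g \<tau>)\<^sup>2))"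
proof -
 let ?L = "%\<tau>. bracket (\<bar>\<tau>\<bar> - gam n)"
 have "ennreal (w n) * (nnint (%\<tau>. g \<tau>)) = (nnint (%\<tau>. ennreal (?L \<tau> powr (- b)) * (ennreal (?L \<tau> powr b * w n) * g \<tau>)))"
 proof -
  have "ennreal (?L \<tau> powr (- b)) * (ennreal (?L \<tau> powr b * w n) * g \<tau>) = ennreal (w n) * g \<tau>" for \<tau>
   by (simp add: mult.assoc[symmetric] ennreal_mult'[symmetric] flip: powr_add)
  then show ?thesis by (simp add: nn_integral_cmult)
 qed
 then have "(ennreal (w n) * (nnint (%\<tau>. g \<tau>)))\<^sup>2
   <= (nnint (%\<tau>. (ennreal (?L \<tau> powr (- b)))\<^sup>2)) * (nnint (%\<tau>. (ennreal (?L \<tau> powr b * w n) * g \<tau>)\<^sup>2))"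
  using Cauchy_Schwarz_nn_integral[of "%\<tau>. ennreal (?L \<tau> powr (- b))" lborel "%\<tau>. ennreal (?L \<tau> powr b * w n) * g \<tau>"] by simp
 also have "(nnint (%\<tau>. (ennreal (?L \<tau> powr (- b)))\<^sup>2)) <= 2 * bracket_integral (2 * b)"
  using nn_integral_branch_le[of n "2 * b"] by (simp add: ennreal_power powr_neg_square)
 finally show ?thesis by (simp add: mult_right_mono)
qed

lemma wnorm_component_le:
 "(nnint (%\<tau>. (ennreal (bracket (\<bar>\<tau>\<bar> - gam n) powr b * w n) * g n \<tau>)\<^sup>2)) <= wnorm w b g"
proof -
 have "(nnint (%\<tau>. (ennreal (bracket (\<bar>\<tau>\<bar> - gam n) powr b * w n) * g n \<tau>)\<^sup>2))
   = (nsum (%m. (nnint (%\<tau>. (ennreal (bracket (\<bar>\<tau>\<bar> - gam m) powr b * w m) * g m \<tau>)\<^sup>2)) * indicator {n} m))"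
  by simp
 also have "... <= wnorm w b g"
  unfolding wnorm_def by (intro nn_integral_mono) (auto split: split_indicator)
 finally show ?thesis .
qed

lemma wnorm_mono:
 assumes "!!n \<tau>. f n \<tau> <= g n \<tau>"
 shows "wnorm w b f <= wnorm w b g"
 unfolding wnorm_def by (intro nint2_mono power_mono mult_left_mono assms) auto

lemma wnorm_mono_AE:
 assumes "!!n. AE \<tau> in lborel. f n \<tau> <= g n \<tau>"
 shows "wnorm w b f <= wnorm w b g"
 unfolding wnorm_def
proof (rule nn_integral_mono, rule nn_integral_mono_AE)
 fix n
 show "AE \<tau> in lborel. (ennreal (bracket (\<bar>\<tau>\<bar> - gam n) powr b * w n) * f n \<tau>)\<^sup>2
   <= (ennreal (bracket (\<bar>\<tau>\<bar> - gam n) powr b * w n) * g n \<tau>)\<^sup>2"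
  using assms[of n] by eventually_elim (intro power_mono mult_left_mono, auto)
qed

lemma wnorm_add_le:
 assumes [measurable]: "!!n. f n \<in> bmeas" "!!n. g n \<in> bmeas"
 shows "wnorm w b (%n \<tau>. f n \<tau> + g n \<tau>) <= 2 * (wnorm w b f + wnorm w b g)"
proof -
 let ?W = "%n \<tau>. ennreal (bracket (\<bar>\<tau>\<bar> - gam n) powr b * w n)"
 have "wnorm w b (%n \<tau>. f n \<tau> + g n \<tau>) <= nint2 (%n \<tau>. 2 * ((?W n \<tau> * f n \<tau>)\<^sup>2 + (?W n \<tau> * g n \<tau>)\<^sup>2))"
  unfolding wnorm_def distrib_left[of "ennreal r" for r] by (intro nint2_mono ennreal_square_add_le)
 also have "... = 2 * (wnorm w b f + wnorm w b g)"
  unfolding wnorm_def by (simp add: nn_integral_cmult nn_integral_add)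
 finally show ?thesis .
qed

lemma wnorm_integral_finite:
 assumes [measurable]: "g n \<in> bmeas"
  and fin: "wnorm w b g < \<infinity>" and w: "w n > 0" and b: "b > 1 / 2"
 shows "(nnint (%\<tau>. g n \<tau>)) < \<infinity>"
proof -
 have "(ennreal (w n) * (nnint (%\<tau>. g n \<tau>)))\<^sup>2 <= 2 * bracket_integral (2 * b) * wnorm w b g"
  by (rule order_trans[OF slice_integral_bound]) (auto intro!: mult_left_mono wnorm_component_le)
 also have "... < \<infinity>"
  using fin b bracket_integral_finite[of "2 * b"] by (simp add: ennreal_mult_less_top)
 finally show ?thesis using w
  by (auto simp: power2_eq_square ennreal_mult_less_top ennreal_mult_eq_top_iff less_top)
qed

lemma wnorm_AE_finite:
 assumes [measurable]: "g n \<in> bmeas"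
  and fin: "wnorm w b g < \<infinity>" and w: "w n > 0"
 shows "AE \<tau> in lborel. g n \<tau> < \<infinity>"
proof -
 have "(nnint (%\<tau>. (ennreal (bracket (\<bar>\<tau>\<bar> - gam n) powr b * w n) * g n \<tau>)\<^sup>2)) \<noteq> \<infinity>"
  using le_less_trans[OF wnorm_component_le[where n = n and w = w and b = b and g = g] fin] by auto
 then have "AE \<tau> in lborel. (ennreal (bracket (\<bar>\<tau>\<bar> - gam n) powr b * w n) * g n \<tau>)\<^sup>2 \<noteq> \<infinity>"
  by (intro nn_integral_PInf_AE) auto
 then show ?thesis
 proof eventually_elim
  case (elim \<tau>)
  have "bracket (\<bar>\<tau>\<bar> - gam n) powr b * w n > 0" using w by simp
  then show ?case using elim by (auto simp: power2_eq_square ennreal_mult_eq_top_iff less_top)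
 qed
qed

lemma wnorm_integrable:
 assumes [measurable]: "G n \<in> bmeas"
  and "wnorm w b (cn G) < \<infinity>" "w n > 0" "b > 1 / 2"
 shows "integrable lborel (G n)"
 using wnorm_integral_finite[of "cn G" n w b] assms by (intro integrableI_bounded) auto

text \<open>The embedding of \<open>X\<^sub>s\<^sub>,\<^sub>b\<close> into bounded functions of time, one spatial frequency at a time.\<close>

lemma slice_bound:
 assumes [measurable]: "G n \<in> bmeas" and w: "w n >= 0"
 shows "ennreal ((w n * cmod (time_slice G t n))\<^sup>2) <=
  2 * bracket_integral (2 * b) * (nnint (%\<tau>. (ennreal (bracket (\<bar>\<tau>\<bar> - gam n) powr b * w n) * cn G n \<tau>)\<^sup>2))"
proof -
 have "ennreal ((w n * cmod (time_slice G t n))\<^sup>2) = (ennreal (w n) * ennreal (cmod (ift (G n) t)))\<^sup>2"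
  unfolding time_slice_eq_ift
  by (simp only: ennreal_mult[symmetric] ennreal_power mult_nonneg_nonneg w norm_ge_zero)
 also have "... <= (ennreal (w n) * (nnint (%\<tau>. cn G n \<tau>)))\<^sup>2"
  by (intro power_mono mult_left_mono norm_ift_le) auto
 also have "... <= 2 * bracket_integral (2 * b) * (nnint (%\<tau>. (ennreal (bracket (\<bar>\<tau>\<bar> - gam n) powr b * w n) * cn G n \<tau>)\<^sup>2))"
  by (rule slice_integral_bound) measurable
 finally show ?thesis .
qed

section \<open>The free evolution\<close>

definition lin_ext :: "(int => complex) => (int => complex) => int => real => complex" where
 "lin_ext \<phi> \<psi> n \<xi> = (\<phi> n + of_int n * \<psi> n / gam n) / 2 * cutoff_ft (\<xi> - gam n)
   + (\<phi> n - of_int n * \<psi> n / gam n) / 2 * cutoff_ft (\<xi> + gam n)"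

definition data_norm :: "(int => real) => (int => complex) => (int => complex) => ennreal" where
 "data_norm w \<phi> \<psi> = (nsum (%n. ennreal ((w n * cmod (\<phi> n))\<^sup>2 + (w n * (cmod (\<psi> n) / bracket (of_int n)))\<^sup>2)))"

lemma lin_ext_measurable [measurable]: "lin_ext \<phi> \<psi> n \<in> bmeas"
 unfolding lin_ext_def by measurable

lemma lin_ext_diff:
 "lin_ext \<phi> \<psi> n \<xi> - lin_ext \<phi>' \<psi>' n \<xi> = lin_ext (%n. \<phi> n - \<phi>' n) (%n. \<psi> n - \<psi>' n) n \<xi>"
 unfolding lin_ext_def by (simp add: diff_divide_distrib add_divide_distrib algebra_simps)

lemma lin_ext_slice:
 assumes "t \<in> {0..1}"
 shows "time_slice (lin_ext \<phi> \<psi>) t n = Vc t n * \<phi> n + Vs t n * dx \<psi> n"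
proof -
 let ?e = "iexp (t * gam n)" and ?e' = "exp (- (\<i> * cor (t * gam n)))"
 have int: "integrable lborel (%\<xi>. cutoff_ft (\<xi> - gam n))" "integrable lborel (%\<xi>. cutoff_ft (\<xi> + gam n))"
  using lborel_integrable_real_affine[OF cutoff_ft_integrable, of 1 "- gam n"]
   lborel_integrable_real_affine[OF cutoff_ft_integrable, of 1 "gam n"] by (simp_all add: add.commute)
 have s1: "ift (%\<xi>. cutoff_ft (\<xi> - gam n)) t = ?e"
  using ift_cutoff_ft[OF assms] by (simp add: ift_translate)
 have s2: "ift (%\<xi>. cutoff_ft (\<xi> + gam n)) t = ?e'"
  using ift_cutoff_ft[OF assms] ift_translate[of cutoff_ft "- gam n" t] by simp
 have "time_slice (lin_ext \<phi> \<psi>) t n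
   = (\<phi> n + of_int n * \<psi> n / gam n) / 2 * ?e + (\<phi> n - of_int n * \<psi> n / gam n) / 2 * ?e'"
  unfolding time_slice_eq_ift lin_ext_def using int
  by (subst ift_add) (simp_all only: ift_cmult s1 s2 integrable_mult_right)
 also have "... = Vc t n * \<phi> n + Vs t n * dx \<psi> n"
 proof (cases "n = 0")
  case False
  have "(p + x / g) / 2 * e + (p - x / g) / 2 * e' = (e + e') / 2 * p + (e - e') / (2 * \<i> * g) * (\<i> * x)"
   if "g \<noteq> 0" for p x g e e' :: complex
   using that by (simp add: field_simps)
  from this[of "cor (gam n)" "\<phi> n" "of_int n * \<psi> n" ?e ?e'] show ?thesis
   using gam_pos[OF False] by (simp add: Vc_def Vs_def dx_def mult.assoc)
 qed (simp add: Vc_def Vs_def dx_def)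
 finally show ?thesis .
qed

lemma gam_frequency: "\<bar>of_int n\<bar> / gam n <= 2 / bracket (of_int n)"
proof (cases "n = 0")
 case False
 let ?x = "\<bar>real_of_int n\<bar>"
 have "?x * bracket (of_int n) <= 2 * gam n"
 proof -
  have "?x >= 1" using False by linarith
  then have "?x * 1 <= ?x * ?x" by (intro mult_left_mono) auto
  then have "?x * bracket (of_int n) <= 2 * (real_of_int n)\<^sup>2"
   by (simp add: bracket_def distrib_left power2_eq_square flip: abs_mult)
  then show ?thesis using gam_ge_square[of n] by linarith
 qed
 then show ?thesis using gam_pos[OF False] by (simp add: field_simps)
qed simp

context exponents

begin

lemma lin_ext_norm:
 obtains C where "C < \<infinity>" "!!w \<phi> \<psi>. (!!n. w n >= 0) ==> wnorm w b (cn (lin_ext \<phi> \<psi>)) <= C * data_norm w \<phi> \<psi>"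
proof -
 obtain c where c: "c > 0" "!!\<xi>. cmod (cutoff_ft \<xi>) <= c * bracket \<xi> powr (- 2)"
  using cutoff_ft_decay by blast
 define BI where "BI = bracket_integral (2 * (2 - b))"
 have BI: "BI < \<infinity>"
 proof -
  have "2 * (2 - b) > 1" using ab a_pos unfolding right_diff_distrib by linarith
  then show ?thesis unfolding BI_def by (rule bracket_integral_finite)
 qed
 have main: "wnorm w b (cn (lin_ext \<phi> \<psi>)) <= (ennreal (c\<^sup>2 * 8) * (2 * (BI + BI))) * data_norm w \<phi> \<psi>"
  if w: "!!n. w n >= 0" for w \<phi> \<psi>
 proof -
  define A where "A n = cmod (\<phi> n) + 2 * (cmod (\<psi> n) / bracket (of_int n))" for n
  have A0: "A n >= 0" for n by (simp add: A_def)
  define D where "D n = (w n * cmod (\<phi> n))\<^sup>2 + (w n * (cmod (\<psi> n) / bracket (of_int n)))\<^sup>2" for n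
  have D0: "D n >= 0" for n by (simp add: D_def)
  have coeff: "cmod ((\<phi> n + of_int n * \<psi> n / gam n) / 2) <= A n" "cmod ((\<phi> n - of_int n * \<psi> n / gam n) / 2) <= A n" for n
  proof -
   have "cmod (of_int n * \<psi> n / gam n) = (\<bar>of_int n\<bar> / gam n) * cmod (\<psi> n)"
    by (simp add: norm_divide norm_mult)
   also have "... <= (2 / bracket (of_int n)) * cmod (\<psi> n)"
    by (intro mult_right_mono gam_frequency) auto
   finally have q: "cmod (of_int n * \<psi> n / gam n) <= 2 * (cmod (\<psi> n) / bracket (of_int n))" by simp
   have "cmod (\<phi> n + of_int n * \<psi> n / gam n) <= A n" "cmod (\<phi> n - of_int n * \<psi> n / gam n) <= A n"
    unfolding A_def using q by (auto intro: order_trans[OF norm_triangle_ineq] order_trans[OF norm_triangle_ineq4])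
   then show "cmod ((\<phi> n + of_int n * \<psi> n / gam n) / 2) <= A n" "cmod ((\<phi> n - of_int n * \<psi> n / gam n) / 2) <= A n"
    using A0[of n] unfolding norm_divide by simp_all
  qed
  have pw: "bracket (\<bar>\<xi>\<bar> - gam n) powr b * cmod (lin_ext \<phi> \<psi> n \<xi>)
    <= c * A n * (bracket (\<xi> - gam n) powr (- (2 - b)) + bracket (\<xi> - (- gam n)) powr (- (2 - b)))" for n \<xi>
  proof -
   have br: "bracket (\<bar>\<xi>\<bar> - gam n) powr b * bracket x powr (- 2) <= bracket x powr (- (2 - b))"
    if "bracket (\<bar>\<xi>\<bar> - gam n) <= bracket x" for x
   proof -
    have "bracket (\<bar>\<xi>\<bar> - gam n) powr b * bracket x powr (- 2) <= bracket x powr b * bracket x powr (- 2)"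
     using that b_pos by (intro mult_right_mono powr_mono2) auto
    also have "... = bracket x powr (- (2 - b))" by (subst powr_add[symmetric]) simp
    finally show ?thesis .
   qed
   have "cmod (lin_ext \<phi> \<psi> n \<xi>) <= A n * (c * bracket (\<xi> - gam n) powr (- 2)) + A n * (c * bracket (\<xi> + gam n) powr (- 2))"
    unfolding lin_ext_def
    by (rule order_trans[OF norm_triangle_ineq]) (auto simp only: norm_mult intro!: add_mono mult_mono coeff c(2) A0 norm_ge_zero)
   also have "... = c * A n * (bracket (\<xi> - gam n) powr (- 2) + bracket (\<xi> + gam n) powr (- 2))"
    by (simp only: distrib_left mult_ac)
   finally have "bracket (\<bar>\<xi>\<bar> - gam n) powr b * cmod (lin_ext \<phi> \<psi> n \<xi>)
    <= bracket (\<bar>\<xi>\<bar> - gam n) powr b * (c * A n * (bracket (\<xi> - gam n) powr (- 2) + bracket (\<xi> + gam n) powr (- 2)))"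
    by (intro mult_left_mono) auto
   also have "... = c * A n * (bracket (\<bar>\<xi>\<bar> - gam n) powr b * bracket (\<xi> - gam n) powr (- 2) + bracket (\<bar>\<xi>\<bar> - gam n) powr b * bracket (\<xi> + gam n) powr (- 2))"
    by (simp only: distrib_left mult_ac)
   also have "... <= c * A n * (bracket (\<xi> - gam n) powr (- (2 - b)) + bracket (\<xi> + gam n) powr (- (2 - b)))"
    using c(1) A0 branch_le by (intro mult_left_mono add_mono br) auto
   finally show ?thesis by simp
  qed
  have Aw: "(w n * A n)\<^sup>2 <= 8 * D n" for n
  proof -
   let ?x = "w n * cmod (\<phi> n)" and ?y = "w n * (cmod (\<psi> n) / bracket (of_int n))"
   have "(w n * A n)\<^sup>2 = (?x + 2 * ?y)\<^sup>2"
    by (simp only: A_def distrib_left mult.left_commute[of "w n" 2])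
   also have "... <= 8 * (?x\<^sup>2 + ?y\<^sup>2)"
   proof -
    have "(x + 2 * y)\<^sup>2 <= 8 * (x\<^sup>2 + y\<^sup>2)" for x y :: real
    proof -
     have "0 <= 2 * (x - y)\<^sup>2 + 5 * x\<^sup>2 + 2 * y\<^sup>2" by simp
     then show ?thesis by (simp add: power2_eq_square algebra_simps)
    qed
    then show ?thesis .
   qed
   finally show ?thesis by (simp add: D_def)
  qed
  let ?k = "%n \<xi>. ennreal ((bracket (\<xi> - gam n) powr (- (2 * (2 - b)))) ) + ennreal (bracket (\<xi> - (- gam n)) powr (- (2 * (2 - b))))"
  have pw2: "(ennreal (bracket (\<bar>\<xi>\<bar> - gam n) powr b * w n) * cn (lin_ext \<phi> \<psi>) n \<xi>)\<^sup>2
    <= ennreal (c\<^sup>2 * 8 * D n) * (2 * ?k n \<xi>)" for n \<xi>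
  proof -
   let ?x = "bracket (\<xi> - gam n) powr (- (2 - b))" and ?y = "bracket (\<xi> - (- gam n)) powr (- (2 - b))"
   have "w n * (bracket (\<bar>\<xi>\<bar> - gam n) powr b * cmod (lin_ext \<phi> \<psi> n \<xi>)) <= w n * (c * A n * (?x + ?y))"
    by (intro mult_left_mono pw w)
   then have "(w n * (bracket (\<bar>\<xi>\<bar> - gam n) powr b * cmod (lin_ext \<phi> \<psi> n \<xi>)))\<^sup>2 <= (w n * (c * A n * (?x + ?y)))\<^sup>2"
    using w by (intro power_mono) auto
   also have "... = c\<^sup>2 * (w n * A n)\<^sup>2 * (?x + ?y)\<^sup>2" by (simp add: power_mult_distrib)
   also have "... <= c\<^sup>2 * (8 * D n) * (2 * (?x\<^sup>2 + ?y\<^sup>2))"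
   proof (intro mult_mono)
    show "(?x + ?y)\<^sup>2 <= 2 * (?x\<^sup>2 + ?y\<^sup>2)"
     using sum_squares_bound[of ?x ?y] by (simp add: power2_sum)
   qed (use Aw[of n] D0[of n] in auto)
   finally have "ennreal ((w n * (bracket (\<bar>\<xi>\<bar> - gam n) powr b * cmod (lin_ext \<phi> \<psi> n \<xi>)))\<^sup>2)
     <= ennreal (c\<^sup>2 * (8 * D n) * (2 * (?x\<^sup>2 + ?y\<^sup>2)))" by (rule ennreal_leI)
   also have "... = ennreal (c\<^sup>2 * 8 * D n) * (2 * ?k n \<xi>)"
   proof -
    have "ennreal (X * (2 * (A + B))) = ennreal X * (2 * (ennreal A + ennreal B))"
     if "X >= 0" "A >= 0" "B >= 0" for X A B :: real
     using that by (simp only: ennreal_mult[of X] ennreal_mult_plus[of 2] ennreal_numeral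
       mult_nonneg_nonneg add_nonneg_nonneg zero_le_numeral)
    then have "ennreal (c\<^sup>2 * (8 * D n) * (2 * (?x\<^sup>2 + ?y\<^sup>2))) = ennreal (c\<^sup>2 * (8 * D n)) * (2 * (ennreal (?x\<^sup>2) + ennreal (?y\<^sup>2)))"
     using D0[of n] by simp
    then show ?thesis by (simp only: powr_neg_square mult.assoc)
   qed
   finally show ?thesis using w[of n]
    by (simp add: ennreal_power power_mult_distrib ennreal_mult' mult_ac)
  qed
  have "wnorm w b (cn (lin_ext \<phi> \<psi>)) <= nint2 (%n \<xi>. ennreal (c\<^sup>2 * 8 * D n) * (2 * ?k n \<xi>))"
   unfolding wnorm_def by (intro nint2_mono pw2)
  also have "... = (nsum (%n. ennreal (c\<^sup>2 * 8 * D n) * (2 * (BI + BI))))"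
  proof (intro nn_integral_cong)
   fix n
   have "(nnint (%\<xi>. ?k n \<xi>)) = BI + BI"
    unfolding BI_def by (subst nn_integral_add) (simp_all only: bracket_integral_translate, measurable)
   moreover have "(nnint (%\<xi>. ennreal (c\<^sup>2 * 8 * D n) * (2 * ?k n \<xi>))) = ennreal (c\<^sup>2 * 8 * D n) * (nnint (%\<xi>. 2 * ?k n \<xi>))"
    by (rule nn_integral_cmult) measurable
   moreover have "(nnint (%\<xi>. 2 * ?k n \<xi>)) = 2 * (nnint (%\<xi>. ?k n \<xi>))"
    by (rule nn_integral_cmult) measurable
   ultimately show "(nnint (%\<xi>. ennreal (c\<^sup>2 * 8 * D n) * (2 * ?k n \<xi>))) = ennreal (c\<^sup>2 * 8 * D n) * (2 * (BI + BI))"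
    by (simp only:)
  qed
  also have "... = (nsum (%n. ennreal (D n))) * (ennreal (c\<^sup>2 * 8) * (2 * (BI + BI)))"
   by (subst nn_integral_multc[symmetric]) (auto simp: ennreal_mult' D0 mult_ac)
  also have "... = (ennreal (c\<^sup>2 * 8) * (2 * (BI + BI))) * data_norm w \<phi> \<psi>"
   unfolding data_norm_def D_def by (rule mult.commute)
  finally show ?thesis .
 qed
 show ?thesis
  by (rule that[OF _ main]) (use BI in \<open>auto simp: ennreal_mult_less_top\<close>)
qed

end

section \<open>The Duhamel term\<close>

definition duh_coeff :: "real => int => real => complex" where
 "duh_coeff t n \<tau> = (iexp (t * gam n) * osc t (\<tau> - gam n)
   - exp (- (\<i> * cor (t * gam n))) * osc t (\<tau> + gam n)) / (2 * \<i> * cor (gam n))"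

definition duhamel_of :: "(int => real => complex) => real => int => complex" where
 "duhamel_of F t n = cor (1 / (2 * pi)) *
   (LINT \<tau>|lborel. duh_coeff t n \<tau> * (- (of_int n)\<^sup>2 * F n \<tau>))"

definition duh_kernel :: "real => int => real => real => complex" where
 "duh_kernel \<delta> n \<xi> \<tau> = (duh \<delta> (\<xi> - gam n) (\<tau> - gam n) - duh \<delta> (\<xi> + gam n) (\<tau> + gam n)) / (2 * \<i> * cor (gam n))"

definition Duh :: "real => (int => real => complex) => int => real => complex" where
 "Duh \<delta> F n \<xi> = cor (1 / (2 * pi)) *
   (LINT \<tau>|lborel. duh_kernel \<delta> n \<xi> \<tau> * (- (of_int n)\<^sup>2 * F n \<tau>))"

definition duh_major :: "real => (int => real => ennreal) => int => real => ennreal" where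
 "duh_major \<delta> h n \<xi> = (nnint (%\<tau>. (ennreal (cmod (duh \<delta> (\<xi> - gam n) (\<tau> - gam n)))
   + ennreal (cmod (duh \<delta> (\<xi> + gam n) (\<tau> + gam n)))) * h n \<tau>))"

abbreviation forcing :: "(int => real => ennreal) => int => real => ennreal" where
 "forcing f \<equiv> (%n \<tau>. ennreal ((of_int n)\<^sup>2 / gam n) * f n \<tau>)"

lemma duh_coeff_measurable [measurable]: "duh_coeff t n \<in> bmeas"
 unfolding duh_coeff_def by measurable

lemma duh_kernel_measurable [measurable (raw)]:
 assumes [measurable]: "f \<in> borel_measurable M" "g \<in> borel_measurable M"
 shows "(%x. duh_kernel \<delta> n (f x) (g x)) \<in> borel_measurable M"
 unfolding duh_kernel_def by measurable

lemma Duh_measurable [measurable]: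
 assumes [measurable]: "F n \<in> bmeas"
 shows "Duh \<delta> F n \<in> bmeas"
 unfolding Duh_def by measurable

lemma duh_major_measurable [measurable]:
 assumes [measurable]: "h n \<in> bmeas"
 shows "duh_major \<delta> h n \<in> bmeas"
 unfolding duh_major_def by measurable

lemma duh_kernel_le:
 "cmod (duh_kernel \<delta> n \<xi> \<tau> * (- (of_int n)\<^sup>2 * z))
  <= (cmod (duh \<delta> (\<xi> - gam n) (\<tau> - gam n)) + cmod (duh \<delta> (\<xi> + gam n) (\<tau> + gam n))) * ((of_int n)\<^sup>2 / gam n * cmod z)"
proof -
 let ?d = "duh \<delta> (\<xi> - gam n) (\<tau> - gam n) - duh \<delta> (\<xi> + gam n) (\<tau> + gam n)"
 have "cmod (duh_kernel \<delta> n \<xi> \<tau> * (- (of_int n)\<^sup>2 * z)) = cmod ?d * ((of_int n)\<^sup>2 / gam n * cmod z) / 2"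
  by (simp add: duh_kernel_def norm_mult norm_divide norm_power)
 also have "... <= cmod ?d * ((of_int n)\<^sup>2 / gam n * cmod z)"
 proof -
  have half: "X / 2 <= X" if "X >= 0" for X :: real using that by simp
  show ?thesis by (rule half) simp
 qed
 also have "... <= (cmod (duh \<delta> (\<xi> - gam n) (\<tau> - gam n)) + cmod (duh \<delta> (\<xi> + gam n) (\<tau> + gam n))) * ((of_int n)\<^sup>2 / gam n * cmod z)"
  by (intro mult_right_mono norm_triangle_ineq4) auto
 finally show ?thesis .
qed

lemma duh_kernel_le_major:
 assumes [measurable]: "F n \<in> bmeas"
 shows "(nnint (%\<tau>. ennreal (cmod (duh_kernel \<delta> n \<xi> \<tau> * (- (of_int n)\<^sup>2 * F n \<tau>))))) <= duh_major \<delta> (forcing (cn F)) n \<xi>"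
 unfolding duh_major_def
proof (intro nn_integral_mono)
 fix \<tau>
 show "ennreal (cmod (duh_kernel \<delta> n \<xi> \<tau> * (- (of_int n)\<^sup>2 * F n \<tau>)))
  <= (ennreal (cmod (duh \<delta> (\<xi> - gam n) (\<tau> - gam n))) + ennreal (cmod (duh \<delta> (\<xi> + gam n) (\<tau> + gam n)))) * (ennreal ((of_int n)\<^sup>2 / gam n) * cn F n \<tau>)"
 proof -
  have "ennreal ((A + B) * (q * z)) = (ennreal A + ennreal B) * (ennreal q * ennreal z)"
   if "A >= 0" "B >= 0" "q >= 0" "z >= 0" for A B q z :: real
   using that by (simp only: ennreal_mult ennreal_plus add_nonneg_nonneg mult_nonneg_nonneg)
  from this[of "cmod (duh \<delta> (\<xi> - gam n) (\<tau> - gam n))" "cmod (duh \<delta> (\<xi> + gam n) (\<tau> + gam n))" "(of_int n)\<^sup>2 / gam n" "cmod (F n \<tau>)"]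
  have eq: "ennreal ((cmod (duh \<delta> (\<xi> - gam n) (\<tau> - gam n)) + cmod (duh \<delta> (\<xi> + gam n) (\<tau> + gam n))) * ((of_int n)\<^sup>2 / gam n * cmod (F n \<tau>)))
   = (ennreal (cmod (duh \<delta> (\<xi> - gam n) (\<tau> - gam n))) + ennreal (cmod (duh \<delta> (\<xi> + gam n) (\<tau> + gam n)))) * (ennreal ((of_int n)\<^sup>2 / gam n) * cn F n \<tau>)"
   by simp
  show ?thesis unfolding eq[symmetric] by (rule ennreal_leI[OF duh_kernel_le])
 qed
qed

lemma duh_kernel_integrable:
 assumes [measurable]: "F n \<in> bmeas" and "duh_major \<delta> (forcing (cn F)) n \<xi> < \<infinity>"
 shows "integrable lborel (%\<tau>. duh_kernel \<delta> n \<xi> \<tau> * (- (of_int n)\<^sup>2 * F n \<tau>))"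
 using le_less_trans[OF duh_kernel_le_major[where F = F and n = n, OF assms(1)] assms(2)]
 by (intro integrableI_bounded) auto

lemma Duh_le_major:
 assumes [measurable]: "F n \<in> bmeas"
 shows "cn (Duh \<delta> F) n \<xi> <= duh_major \<delta> (forcing (cn F)) n \<xi>"
proof (cases "integrable lborel (%\<tau>. duh_kernel \<delta> n \<xi> \<tau> * (- (of_int n)\<^sup>2 * F n \<tau>))")
 case True
 let ?I = "LINT \<tau>|lborel. duh_kernel \<delta> n \<xi> \<tau> * (- (of_int n)\<^sup>2 * F n \<tau>)"
 have "cmod (Duh \<delta> F n \<xi>) <= 1 * cmod ?I"
 proof -
  have "cmod (cor (1 / (2 * pi))) <= 1" using pi_gt3 by (simp add: norm_divide)
  then show ?thesis unfolding Duh_def norm_mult by (intro mult_right_mono) auto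
 qed
 then have "cn (Duh \<delta> F) n \<xi> <= ennreal (cmod ?I)" by (intro ennreal_leI) simp
 also have "... <= (nnint (%\<tau>. ennreal (cmod (duh_kernel \<delta> n \<xi> \<tau> * (- (of_int n)\<^sup>2 * F n \<tau>)))))"
  by (rule integral_norm_bound_ennreal[OF True])
 also have "... <= duh_major \<delta> (forcing (cn F)) n \<xi>"
  by (rule duh_kernel_le_major) measurable
 finally show ?thesis .
next
 case False
 then show ?thesis by (simp add: Duh_def not_integrable_integral_eq)
qed

lemma duh_coeff_eq_integral:
 assumes "t >= 0"
 shows "(LINT t':{0..t}|lborel. Vs (t - t') n * iexp (t' * \<tau>)) = duh_coeff t n \<tau>"
proof -
 let ?e = "iexp (t * gam n)" and ?e' = "exp (- (\<i> * cor (t * gam n)))"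
 have int: "set_integrable lborel {0..t} (%t'. iexp (t' * l))" for l
  by (intro borel_integrable_atLeastAtMost' continuous_intros)
 have "(LINT t':{0..t}|lborel. Vs (t - t') n * iexp (t' * \<tau>))
   = (LINT t':{0..t}|lborel. (?e * iexp (t' * (\<tau> - gam n)) - ?e' * iexp (t' * (\<tau> + gam n))) / (2 * \<i> * cor (gam n)))"
  unfolding set_lebesgue_integral_def
 proof (intro Bochner_Integration.integral_cong refl arg_cong2[where f = scaleR])
  fix t'
  have "iexp ((t - t') * gam n) * iexp (t' * \<tau>) = ?e * iexp (t' * (\<tau> - gam n))"
   unfolding exp_add[symmetric] by (simp add: algebra_simps)
  moreover have "exp (- \<i> * cor ((t - t') * gam n)) * iexp (t' * \<tau>) = ?e' * iexp (t' * (\<tau> + gam n))"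
   unfolding exp_add[symmetric] by (simp add: algebra_simps)
  ultimately show "Vs (t - t') n * iexp (t' * \<tau>)
   = (?e * iexp (t' * (\<tau> - gam n)) - ?e' * iexp (t' * (\<tau> + gam n))) / (2 * \<i> * cor (gam n))"
   unfolding Vs_def times_divide_eq_left left_diff_distrib by (simp only:)
 qed
 also have "... = duh_coeff t n \<tau>"
  unfolding duh_coeff_def osc_integral[OF assms, symmetric]
  using int[of "\<tau> - gam n"] int[of "\<tau> + gam n"] by (simp add: set_integral_diff(2))
 finally show ?thesis .
qed

lemma dx_dx: "dx (dx f) n = - (of_int n)\<^sup>2 * f n"
proof -
 have "dx (dx f) n = (\<i> * \<i>) * (of_int n * of_int n * f n)" unfolding dx_def by (simp only: mult_ac)
 then show ?thesis by (simp add: power2_eq_square)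
qed

lemma duhamel_integral_negative:
 assumes "s < 0" "t >= 0"
 shows "duhamel_integral s u G t n = duhamel_of (st_square G) t n"
 using assms(1) unfolding duhamel_integral_def duhamel_of_def dx_dx duh_coeff_eq_integral[OF assms(2)]
 by simp

lemma ift_duh_kernel:
 assumes "\<delta> > 0" "t \<in> {0..\<delta>}"
 shows "ift (%\<xi>. duh_kernel \<delta> n \<xi> \<tau>) t = duh_coeff t n \<tau>"
proof -
 have int: "integrable lborel (%\<xi>. duh \<delta> (\<xi> - c) l)" for c l
  using lborel_integrable_real_affine[OF duh_integrable[OF assms(1)], of 1 "- c" l] by simp
 have 1: "ift (%\<xi>. duh \<delta> (\<xi> - c) l) t = iexp (t * c) * osc t l" for c l
  using ift_duh[OF assms, of l] ift_translate[of "%\<xi>. duh \<delta> \<xi> l" c t] by simp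
 have "ift (%\<xi>. duh_kernel \<delta> n \<xi> \<tau>) t
   = (1 / (2 * \<i> * cor (gam n))) * ift (%\<xi>. duh \<delta> (\<xi> - gam n) (\<tau> - gam n) - duh \<delta> (\<xi> - (- gam n)) (\<tau> + gam n)) t"
  unfolding ift_cmult[symmetric] duh_kernel_def by simp
 also have "... = duh_coeff t n \<tau>"
  unfolding duh_coeff_def using int[of "gam n" "\<tau> - gam n"] int[of "- gam n" "\<tau> + gam n"]
  by (subst ift_diff) (simp_all only: 1, simp)
 finally show ?thesis .
qed

context exponents

begin

lemma duh_major_norm:
 obtains C where "C < \<infinity>" "!!w h \<delta>. (!!n. w n >= 0) ==> (!!n. h n \<in> bmeas) ==> 0 < \<delta> ==> \<delta> <= 1 ==>
  wnorm w b (duh_major \<delta> h) <= C * ennreal (\<delta> powr (2 * (1 - a - b))) * wnorm w (- a) h"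
proof -
 obtain C where C: "C < \<infinity>" "!!h \<delta>. h \<in> bmeas ==> 0 < \<delta> ==> \<delta> <= 1 ==>
  (nnint (%\<xi>. (ennreal (bracket \<xi> powr b) * (nnint (%l. ennreal (cmod (duh \<delta> \<xi> l)) * h l)))\<^sup>2))
  <= C * ennreal (\<delta> powr (2 * (1 - a - b))) * (nnint (%l. (ennreal (bracket l powr (- a)) * h l)\<^sup>2))"
  using duh_estimate by blast
 have main: "wnorm w b (duh_major \<delta> h) <= (4 * C) * ennreal (\<delta> powr (2 * (1 - a - b))) * wnorm w (- a) h"
  if w: "!!n. w n >= 0" and [measurable]: "!!n. h n \<in> bmeas" and \<delta>: "0 < \<delta>" "\<delta> <= 1" for w h \<delta>
 proof -
  define D where "D = C * ennreal (\<delta> powr (2 * (1 - a - b)))"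
  define L where "L n \<tau> = bracket (\<bar>\<tau>\<bar> - gam n)" for n \<tau>
  have [measurable]: "L n \<in> bmeas" for n unfolding L_def by measurable
  have L_ge: "L n \<tau> >= 1" "L n \<tau> > 0" for n \<tau> by (auto simp: L_def)
  define X where "X c n \<xi> = (nnint (%\<tau>. ennreal (cmod (duh \<delta> (\<xi> - c) (\<tau> - c))) * h n \<tau>))" for c n \<xi>
  have [measurable]: "X c n \<in> bmeas" for c n unfolding X_def by measurable
  have major: "duh_major \<delta> h n \<xi> = X (gam n) n \<xi> + X (- gam n) n \<xi>" for n \<xi>
   unfolding duh_major_def X_def by (subst nn_integral_add[symmetric]) (auto simp: distrib_right)
  have X_le: "(nnint (%\<xi>. (ennreal (L n \<xi> powr b * w n) * X c n \<xi>)\<^sup>2))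
    <= D * (nnint (%\<tau>. (ennreal (L n \<tau> powr (- a) * w n) * h n \<tau>)\<^sup>2))" if c: "c = gam n \<or> c = - gam n" for c n
  proof -
   have Lc: "L n \<tau> <= bracket (\<tau> - c)" for \<tau> using c branch_le[of \<tau> n] by (auto simp: L_def)
   define g where "g l = ennreal (w n) * h n (l + c)" for l
   have [measurable]: "g \<in> bmeas" unfolding g_def by measurable
   define P where "P \<eta> = (nnint (%l. ennreal (cmod (duh \<delta> \<eta> l)) * g l))" for \<eta>
   have [measurable]: "P \<in> bmeas" unfolding P_def by measurable
   have XP: "ennreal (w n) * X c n \<xi> = P (\<xi> - c)" for \<xi>
   proof -
    have "P (\<xi> - c) = (nnint (%\<tau>. ennreal (cmod (duh \<delta> (\<xi> - c) (\<tau> - c))) * g (\<tau> - c)))"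
     unfolding P_def
     by (rule nn_integral_lborel_translate[of "%l. ennreal (cmod (duh \<delta> (\<xi> - c) l)) * g l", symmetric]) measurable
    also have "... = (nnint (%\<tau>. ennreal (w n) * (ennreal (cmod (duh \<delta> (\<xi> - c) (\<tau> - c))) * h n \<tau>)))"
     by (simp add: g_def mult_ac)
    also have "... = ennreal (w n) * X c n \<xi>" unfolding X_def by (rule nn_integral_cmult) measurable
    finally show ?thesis ..
   qed
   have "(nnint (%\<xi>. (ennreal (L n \<xi> powr b * w n) * X c n \<xi>)\<^sup>2)) <= (nnint (%\<xi>. (ennreal (bracket (\<xi> - c) powr b) * P (\<xi> - c))\<^sup>2))"
   proof (intro nn_integral_mono power_mono)
    fix \<xi>
    have "ennreal (L n \<xi> powr b * w n) * X c n \<xi> = ennreal (L n \<xi> powr b) * P (\<xi> - c)"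
     unfolding XP[symmetric] by (simp add: ennreal_mult' mult.assoc w)
    also have "... <= ennreal (bracket (\<xi> - c) powr b) * P (\<xi> - c)"
     using Lc b_pos L_ge by (intro mult_right_mono ennreal_leI powr_mono2) (auto simp: less_imp_le)
    finally show "ennreal (L n \<xi> powr b * w n) * X c n \<xi> <= ennreal (bracket (\<xi> - c) powr b) * P (\<xi> - c)" .
   qed auto
   also have "... = (nnint (%\<xi>. (ennreal (bracket \<xi> powr b) * P \<xi>)\<^sup>2))"
    by (rule nn_integral_lborel_translate[of "%\<xi>. (ennreal (bracket \<xi> powr b) * P \<xi>)\<^sup>2"]) measurable
   also have "... <= D * (nnint (%l. (ennreal (bracket l powr (- a)) * g l)\<^sup>2))"
    unfolding P_def D_def by (rule C(2)) (use \<delta> in auto)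
   also have "(nnint (%l. (ennreal (bracket l powr (- a)) * g l)\<^sup>2)) = (nnint (%\<tau>. (ennreal (bracket (\<tau> - c) powr (- a)) * g (\<tau> - c))\<^sup>2))"
    by (rule nn_integral_lborel_translate[of "%l. (ennreal (bracket l powr (- a)) * g l)\<^sup>2", symmetric]) measurable
   also have "... <= (nnint (%\<tau>. (ennreal (L n \<tau> powr (- a) * w n) * h n \<tau>)\<^sup>2))"
   proof (intro nn_integral_mono power_mono)
    fix \<tau>
    have "ennreal (bracket (\<tau> - c) powr (- a)) * g (\<tau> - c) <= ennreal (L n \<tau> powr (- a)) * g (\<tau> - c)"
     using Lc a_pos L_ge by (intro mult_right_mono ennreal_leI powr_mono2') auto
    also have "... = ennreal (L n \<tau> powr (- a) * w n) * h n \<tau>"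
     by (simp add: g_def ennreal_mult' mult.assoc w)
    finally show "ennreal (bracket (\<tau> - c) powr (- a)) * g (\<tau> - c) <= ennreal (L n \<tau> powr (- a) * w n) * h n \<tau>" .
   qed auto
   finally show ?thesis by (simp add: mult_left_mono)
  qed
  have "wnorm w b (duh_major \<delta> h) <= nint2 (%n \<xi>. 2 * ((ennreal (L n \<xi> powr b * w n) * X (gam n) n \<xi>)\<^sup>2 + (ennreal (L n \<xi> powr b * w n) * X (- gam n) n \<xi>)\<^sup>2))"
   unfolding wnorm_def major distrib_left[of "ennreal r" for r] L_def[symmetric] by (intro nint2_mono ennreal_square_add_le)
  also have "... <= (nsum (%n. 2 * (D * (nnint (%\<tau>. (ennreal (L n \<tau> powr (- a) * w n) * h n \<tau>)\<^sup>2))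
     + D * (nnint (%\<tau>. (ennreal (L n \<tau> powr (- a) * w n) * h n \<tau>)\<^sup>2)))))"
  proof (intro nn_integral_mono)
   fix n
   have "(nnint (%\<xi>. 2 * ((ennreal (L n \<xi> powr b * w n) * X (gam n) n \<xi>)\<^sup>2 + (ennreal (L n \<xi> powr b * w n) * X (- gam n) n \<xi>)\<^sup>2)))
     = 2 * ((nnint (%\<xi>. (ennreal (L n \<xi> powr b * w n) * X (gam n) n \<xi>)\<^sup>2)) + (nnint (%\<xi>. (ennreal (L n \<xi> powr b * w n) * X (- gam n) n \<xi>)\<^sup>2)))"
    by (subst nn_integral_cmult, measurable) (subst nn_integral_add, auto)
   also have "... <= 2 * (D * (nnint (%\<tau>. (ennreal (L n \<tau> powr (- a) * w n) * h n \<tau>)\<^sup>2))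
     + D * (nnint (%\<tau>. (ennreal (L n \<tau> powr (- a) * w n) * h n \<tau>)\<^sup>2)))"
    by (intro mult_left_mono add_mono X_le) auto
   finally show "(nnint (%\<xi>. 2 * ((ennreal (L n \<xi> powr b * w n) * X (gam n) n \<xi>)\<^sup>2 + (ennreal (L n \<xi> powr b * w n) * X (- gam n) n \<xi>)\<^sup>2)))
    <= 2 * (D * (nnint (%\<tau>. (ennreal (L n \<tau> powr (- a) * w n) * h n \<tau>)\<^sup>2))
     + D * (nnint (%\<tau>. (ennreal (L n \<tau> powr (- a) * w n) * h n \<tau>)\<^sup>2)))" .
  qed
  also have "... = 2 * (D * wnorm w (- a) h + D * wnorm w (- a) h)"
   unfolding wnorm_def L_def by (simp add: nn_integral_cmult nn_integral_add)
  also have "... = (4 * C) * ennreal (\<delta> powr (2 * (1 - a - b))) * wnorm w (- a) h"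
   unfolding D_def by (simp add: mult_2[symmetric] mult.assoc[symmetric] del: mult_2)
  finally show ?thesis .
 qed
 show ?thesis
  by (rule that[OF _ main]) (use C(1) in \<open>auto simp: ennreal_mult_less_top\<close>)
qed

lemma slice_Duh:
 assumes F [measurable]: "!!n. F n \<in> bmeas" and w: "!!n. w n > 0"
  and fin: "wnorm w (- a) (forcing (cn F)) < \<infinity>" and \<delta>: "0 < \<delta>" "\<delta> <= 1" and t: "t \<in> {0..\<delta>}"
 shows "time_slice (Duh \<delta> F) t n = duhamel_of F t n"
proof -
 obtain C where C: "C < \<infinity>" "!!w h \<delta>. (!!n. w n >= 0) ==> (!!n. h n \<in> bmeas) ==> 0 < \<delta> ==> \<delta> <= 1 ==>
  wnorm w b (duh_major \<delta> h) <= C * ennreal (\<delta> powr (2 * (1 - a - b))) * wnorm w (- a) h"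
  using duh_major_norm by blast
 let ?h = "forcing (cn F)"
 have "wnorm w b (duh_major \<delta> ?h) <= C * ennreal (\<delta> powr (2 * (1 - a - b))) * wnorm w (- a) ?h"
  by (rule C(2)) (use w \<delta> in \<open>auto simp: less_imp_le\<close>)
 also have "... < \<infinity>" using C(1) fin by (simp add: ennreal_mult_less_top)
 finally have major_fin: "(nnint (%\<xi>. duh_major \<delta> ?h n \<xi>)) < \<infinity>"
  by (intro wnorm_integral_finite[where w = w and b = b]) (use w b_gt in auto)
 let ?g = "%\<xi> \<tau>. iexp (t * \<xi>) * (duh_kernel \<delta> n \<xi> \<tau> * (- (of_int n)\<^sup>2 * F n \<tau>))"
 have prod_int: "integrable (lborel \<Otimes>\<^sub>M lborel) (case_prod ?g)"
 proof (rule integrableI_bounded)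
  have "(\<integral>\<^sup>+p. ennreal (cmod (case_prod ?g p)) \<partial>(lborel \<Otimes>\<^sub>M lborel))
    = (nnint (%\<xi>. (nnint (%\<tau>. ennreal (cmod (duh_kernel \<delta> n \<xi> \<tau> * (- (of_int n)\<^sup>2 * F n \<tau>)))))))"
   by (subst lborel.nn_integral_fst[symmetric]) (auto simp: norm_mult)
  also have "... <= (nnint (%\<xi>. duh_major \<delta> ?h n \<xi>))"
   by (intro nn_integral_mono duh_kernel_le_major) measurable
  finally show "(\<integral>\<^sup>+p. ennreal (cmod (case_prod ?g p)) \<partial>(lborel \<Otimes>\<^sub>M lborel)) < \<infinity>"
   using major_fin by (rule le_less_trans)
 qed measurable
 have "(LINT \<xi>|lborel. iexp (t * \<xi>) * (LINT \<tau>|lborel. duh_kernel \<delta> n \<xi> \<tau> * (- (of_int n)\<^sup>2 * F n \<tau>)))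
   = (LINT \<xi>|lborel. (LINT \<tau>|lborel. ?g \<xi> \<tau>))"
  by (simp only: integral_mult_right_zero)
 also have "... = (LINT \<tau>|lborel. (LINT \<xi>|lborel. ?g \<xi> \<tau>))"
  by (rule lborel_pair.Fubini_integral[symmetric, OF prod_int])
 also have "... = (LINT \<tau>|lborel. (LINT \<xi>|lborel. iexp (t * \<xi>) * duh_kernel \<delta> n \<xi> \<tau>) * (- (of_int n)\<^sup>2 * F n \<tau>))"
  by (simp only: mult.assoc[symmetric] integral_mult_left_zero)
 finally have eq: "(LINT \<xi>|lborel. iexp (t * \<xi>) * (LINT \<tau>|lborel. duh_kernel \<delta> n \<xi> \<tau> * (- (of_int n)\<^sup>2 * F n \<tau>)))
   = (LINT \<tau>|lborel. (LINT \<xi>|lborel. iexp (t * \<xi>) * duh_kernel \<delta> n \<xi> \<tau>) * (- (of_int n)\<^sup>2 * F n \<tau>))" .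
 have "time_slice (Duh \<delta> F) t n = cor (1 / (2 * pi)) * ift (%\<xi>. LINT \<tau>|lborel. duh_kernel \<delta> n \<xi> \<tau> * (- (of_int n)\<^sup>2 * F n \<tau>)) t"
  unfolding time_slice_eq_ift ift_cmult[symmetric] by (simp add: Duh_def[abs_def])
 also have "... = cor (1 / (2 * pi)) * (cor (1 / (2 * pi)) * (LINT \<tau>|lborel. (LINT \<xi>|lborel. iexp (t * \<xi>) * duh_kernel \<delta> n \<xi> \<tau>) * (- (of_int n)\<^sup>2 * F n \<tau>)))"
  unfolding ift_def eq ..
 also have "... = cor (1 / (2 * pi)) * (LINT \<tau>|lborel. ift (%\<xi>. duh_kernel \<delta> n \<xi> \<tau>) t * (- (of_int n)\<^sup>2 * F n \<tau>))"
  unfolding ift_def by (simp only: mult.assoc integral_mult_right_zero)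
 also have "... = duhamel_of F t n"
  unfolding duhamel_of_def ift_duh_kernel[OF \<delta>(1) t] ..
 finally show ?thesis .
qed

lemma Duh_diff_norm:
 obtains C where "C < \<infinity>" "!!w F1 F2 \<delta>. (!!n. w n > 0) ==>
  (!!n. F1 n \<in> bmeas) ==> (!!n. F2 n \<in> bmeas) ==>
  wnorm w (- a) (forcing (cn F1)) < \<infinity> ==> wnorm w (- a) (forcing (cn F2)) < \<infinity> ==> 0 < \<delta> ==> \<delta> <= 1 ==>
  wnorm w b (cn (%n \<xi>. Duh \<delta> F1 n \<xi> - Duh \<delta> F2 n \<xi>))
   <= C * ennreal (\<delta> powr (2 * (1 - a - b))) * wnorm w (- a) (forcing (cn (%n \<tau>. F1 n \<tau> - F2 n \<tau>)))"
proof -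
 obtain C where C: "C < \<infinity>" "!!w h \<delta>. (!!n. w n >= 0) ==> (!!n. h n \<in> bmeas) ==> 0 < \<delta> ==> \<delta> <= 1 ==>
  wnorm w b (duh_major \<delta> h) <= C * ennreal (\<delta> powr (2 * (1 - a - b))) * wnorm w (- a) h"
  using duh_major_norm by blast
 show ?thesis
 proof (rule that[OF C(1)])
  fix w :: "int => real" and F1 F2 and \<delta> :: real
  assume w: "!!n. w n > 0" and [measurable]: "!!n. F1 n \<in> bmeas" "!!n. F2 n \<in> bmeas"
   and fin: "wnorm w (- a) (forcing (cn F1)) < \<infinity>" "wnorm w (- a) (forcing (cn F2)) < \<infinity>" and \<delta>: "0 < \<delta>" "\<delta> <= 1"
  have m: "!!n. F1 n \<in> bmeas" "!!n. F2 n \<in> bmeas" by measurable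
  have AE_fin: "AE \<xi> in lborel. duh_major \<delta> (forcing (cn F)) n \<xi> < \<infinity>"
   if [measurable]: "!!n. F n \<in> bmeas" and fin: "wnorm w (- a) (forcing (cn F)) < \<infinity>" for F n
  proof -
   have "wnorm w b (duh_major \<delta> (forcing (cn F))) <= C * ennreal (\<delta> powr (2 * (1 - a - b))) * wnorm w (- a) (forcing (cn F))"
    by (rule C(2)) (use w \<delta> in \<open>auto simp: less_imp_le\<close>)
   also have "... < \<infinity>" using C(1) fin by (simp add: ennreal_mult_less_top)
   finally show ?thesis
    by (intro wnorm_AE_finite[where w = w and b = b]) (use w in auto)
  qed
  have "wnorm w b (cn (%n \<xi>. Duh \<delta> F1 n \<xi> - Duh \<delta> F2 n \<xi>)) <= wnorm w b (duh_major \<delta> (forcing (cn (%n \<tau>. F1 n \<tau> - F2 n \<tau>))))"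
  proof (rule wnorm_mono_AE)
   fix n
   show "AE \<xi> in lborel. cn (%n \<xi>. Duh \<delta> F1 n \<xi> - Duh \<delta> F2 n \<xi>) n \<xi> <= duh_major \<delta> (forcing (cn (%n \<tau>. F1 n \<tau> - F2 n \<tau>))) n \<xi>"
    using AE_fin[OF m(1) fin(1), of n] AE_fin[OF m(2) fin(2), of n]
   proof eventually_elim
    case (elim \<xi>)
    have "Duh \<delta> F1 n \<xi> - Duh \<delta> F2 n \<xi> = Duh \<delta> (%n \<tau>. F1 n \<tau> - F2 n \<tau>) n \<xi>"
    proof -
     have int: "integrable lborel (%\<tau>. duh_kernel \<delta> n \<xi> \<tau> * (- (of_int n)\<^sup>2 * F1 n \<tau>))"
      "integrable lborel (%\<tau>. duh_kernel \<delta> n \<xi> \<tau> * (- (of_int n)\<^sup>2 * F2 n \<tau>))"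
      by (rule duh_kernel_integrable; use m elim in simp)+
     show ?thesis unfolding Duh_def right_diff_distrib[symmetric]
      by (subst Bochner_Integration.integral_diff[OF int, symmetric]) (simp only: right_diff_distrib)
    qed
    then show ?case using Duh_le_major[of "%n \<tau>. F1 n \<tau> - F2 n \<tau>" n \<delta> \<xi>] by simp
   qed
  qed
  also have "... <= C * ennreal (\<delta> powr (2 * (1 - a - b))) * wnorm w (- a) (forcing (cn (%n \<tau>. F1 n \<tau> - F2 n \<tau>)))"
   by (rule C(2)) (use w \<delta> in \<open>auto simp: less_imp_le\<close>)
  finally show "wnorm w b (cn (%n \<xi>. Duh \<delta> F1 n \<xi> - Duh \<delta> F2 n \<xi>))
   <= C * ennreal (\<delta> powr (2 * (1 - a - b))) * wnorm w (- a) (forcing (cn (%n \<tau>. F1 n \<tau> - F2 n \<tau>)))" .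
 qed
qed

end

section \<open>The space-time convolution, mode by mode\<close>

lemma summable_on_iff_integrable_count_space:
 fixes f :: "'a => complex"
 shows "f summable_on A \<longleftrightarrow> integrable (count_space A) f"
 unfolding summable_on_iff_abs_summable_on_complex abs_summable_equivalent abs_summable_on_def ..

lemma infsum_eq_integral_count_space:
 fixes f :: "'a => complex"
 shows "infsum f A = integral\<^sup>L (count_space A) f"
proof (cases "f summable_on A")
 case True
 then have "Infinite_Set_Sum.abs_summable_on f A"
  by (simp add: summable_on_iff_integrable_count_space abs_summable_on_def)
 then show ?thesis using infsetsum_infsum[of f A] by (simp add: infsetsum_def)
next
 case False
 then show ?thesis
  by (metis infsum_not_exists not_integrable_integral_eq summable_on_iff_integrable_count_space)
qed

lemma infsum_diff_complex:
 fixes f g :: "'a => complex"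
 assumes "f summable_on A" "g summable_on A"
 shows "(\<Sum>\<^sub>\<infinity>x\<in>A. f x - g x) = infsum f A - infsum g A"
 using assms unfolding infsum_eq_integral_count_space summable_on_iff_integrable_count_space
 by (rule Bochner_Integration.integral_diff)

interpretation count_int: sigma_finite_measure "count_space (UNIV :: int set)"
 by (rule sigma_finite_measure_count_space)

interpretation lborel_count: pair_sigma_finite lborel "count_space (UNIV :: int set)"
 by unfold_locales

lemma measurable_pair_count_space:
 assumes [measurable]: "!!m. F m \<in> borel_measurable M"
 shows "(%(x, m :: int). F m x) \<in> borel_measurable (M \<Otimes>\<^sub>M count_space UNIV)"
 unfolding split_beta
 by (rule measurable_compose_countable'[where f="%m p. F m (fst p)" and g=snd and I=UNIV]) auto

lemma borel_measurable_infsum_int [measurable (raw)]: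
 fixes F :: "int => 'a => complex"
 assumes "!!m. F m \<in> borel_measurable M"
 shows "(%x. \<Sum>\<^sub>\<infinity>m. F m x) \<in> borel_measurable M"
 unfolding infsum_eq_integral_count_space
 using measurable_pair_count_space[OF assms] by (rule count_int.borel_measurable_lebesgue_integral)

lemma integral_infsum_swap:
 fixes F :: "int => real => complex"
 assumes [measurable]: "!!m. F m \<in> bmeas"
  and fin: "(nsum (%m. (nnint (%x. ennreal (cmod (F m x)))))) < \<infinity>"
 shows "(LINT x|lborel. (\<Sum>\<^sub>\<infinity>m. F m x)) = (\<Sum>\<^sub>\<infinity>m. LINT x|lborel. F m x)"
  and "(%m. LINT x|lborel. F m x) summable_on UNIV"
proof -
 have meas: "(%(x, m). F m x) \<in> borel_measurable (lborel \<Otimes>\<^sub>M count_space UNIV)"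
  by (rule measurable_pair_count_space) simp
 have int: "integrable (lborel \<Otimes>\<^sub>M count_space UNIV) (%(x, m). F m x)"
 proof (rule integrableI_bounded[OF meas])
  have "(\<integral>\<^sup>+p. ennreal (cmod (case p of (x, m) => F m x)) \<partial>(lborel \<Otimes>\<^sub>M count_space UNIV))
   = (nnint (%x. (nsum (%m. ennreal (cmod (F m x))))))"
   using measurable_compose[OF meas, of "%z. ennreal (cmod z)"]
   by (subst count_int.nn_integral_fst[symmetric]) (auto simp: split_beta)
  also have "... = (nsum (%m. (nnint (%x. ennreal (cmod (F m x))))))"
   by (rule nn_integral_count_space_nn_integral) auto
  finally show "(\<integral>\<^sup>+p. ennreal (cmod (case p of (x, m) => F m x)) \<partial>(lborel \<Otimes>\<^sub>M count_space UNIV)) < \<infinity>"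
   using fin by simp
 qed
 show "(LINT x|lborel. (\<Sum>\<^sub>\<infinity>m. F m x)) = (\<Sum>\<^sub>\<infinity>m. LINT x|lborel. F m x)"
  unfolding infsum_eq_integral_count_space by (rule lborel_count.Fubini_integral[symmetric, OF int])
 show "(%m. LINT x|lborel. F m x) summable_on UNIV"
  unfolding summable_on_iff_integrable_count_space using lborel_count.integrable_snd[OF int] by simp
qed

definition conv_mode :: "(real => complex) => (real => complex) => real => complex" where
 "conv_mode f g \<tau> = (LINT \<mu>|lborel. f \<mu> * g (\<tau> - \<mu>))"

definition st_conv :: "(int => real => complex) => (int => real => complex) => int => real => complex" where
 "st_conv E P n \<tau> = cor (1 / (2 * pi)) * (\<Sum>\<^sub>\<infinity>m. conv_mode (E m) (P (n - m)) \<tau>)"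

lemma st_square_eq: "st_square G = st_conv G G"
 by (intro ext) (simp add: st_square_def st_conv_def conv_mode_def)

lemma conv_mode_measurable [measurable]:
 assumes [measurable]: "f \<in> bmeas" "g \<in> bmeas"
 shows "conv_mode f g \<in> bmeas"
 unfolding conv_mode_def by measurable

lemma st_conv_measurable [measurable]:
 assumes [measurable]: "!!n. E n \<in> bmeas" "!!n. P n \<in> bmeas"
 shows "st_conv E P n \<in> bmeas"
 unfolding st_conv_def by measurable

lemma norm_conv_mode_le:
 assumes [measurable]: "f \<in> bmeas" "g \<in> bmeas"
 shows "ennreal (cmod (conv_mode f g \<tau>)) <= (nnint (%\<mu>. ennreal (cmod (f \<mu>)) * ennreal (cmod (g (\<tau> - \<mu>)))))"
proof (cases "integrable lborel (%\<mu>. f \<mu> * g (\<tau> - \<mu>))")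
 case True
 have "ennreal (cmod (conv_mode f g \<tau>)) <= (nnint (%\<mu>. ennreal (cmod (f \<mu> * g (\<tau> - \<mu>)))))"
  unfolding conv_mode_def by (rule integral_norm_bound_ennreal[OF True])
 then show ?thesis by (simp add: norm_mult ennreal_mult)
qed (simp add: conv_mode_def not_integrable_integral_eq)

lemma norm_infsum_le:
 fixes f :: "int => complex"
 shows "ennreal (cmod (\<Sum>\<^sub>\<infinity>m. f m)) <= (nsum (%m. ennreal (cmod (f m))))"
proof (cases "integrable (count_space UNIV) f")
 case True
 then show ?thesis unfolding infsum_eq_integral_count_space by (rule integral_norm_bound_ennreal)
qed (simp add: infsum_eq_integral_count_space not_integrable_integral_eq)

lemma norm_st_conv_le_sum:
 "cn (st_conv E P) n \<tau> <= (nsum (%m. ennreal (cmod (conv_mode (E m) (P (n - m)) \<tau>))))"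
proof -
 have "cmod (st_conv E P n \<tau>) <= 1 * cmod (\<Sum>\<^sub>\<infinity>m. conv_mode (E m) (P (n - m)) \<tau>)"
 proof -
  have "cmod (cor (1 / (2 * pi))) <= 1" using pi_gt3 by (simp add: norm_divide)
  then show ?thesis unfolding st_conv_def norm_mult by (intro mult_right_mono) auto
 qed
 then have "cn (st_conv E P) n \<tau> <= ennreal (cmod (\<Sum>\<^sub>\<infinity>m. conv_mode (E m) (P (n - m)) \<tau>))"
  by (intro ennreal_leI) simp
 also have "... <= (nsum (%m. ennreal (cmod (conv_mode (E m) (P (n - m)) \<tau>))))"
  by (rule norm_infsum_le)
 finally show ?thesis .
qed

lemma sum_norm_conv_mode_le:
 assumes [measurable]: "!!n. E n \<in> bmeas" "!!n. P n \<in> bmeas"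
 shows "(nsum (%m. ennreal (cmod (conv_mode (E m) (P (n - m)) \<tau>)))) <= convol (cn E) (cn P) n \<tau>"
 unfolding convol_def by (intro nn_integral_mono norm_conv_mode_le) auto

lemma norm_st_conv_le:
 assumes "!!n. E n \<in> bmeas" "!!n. P n \<in> bmeas"
 shows "cn (st_conv E P) n \<tau> <= convol (cn E) (cn P) n \<tau>"
 using norm_st_conv_le_sum sum_norm_conv_mode_le[OF assms] by (rule order_trans)

lemma convol_finite_integrable:
 assumes [measurable]: "!!n. E n \<in> bmeas" "!!n. P n \<in> bmeas"
  and fin: "convol (cn E) (cn P) n \<tau> < \<infinity>"
 shows "integrable lborel (%\<mu>. E m \<mu> * P (n - m) (\<tau> - \<mu>))"
  and "(%m. conv_mode (E m) (P (n - m)) \<tau>) summable_on UNIV"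
proof -
 show "integrable lborel (%\<mu>. E m \<mu> * P (n - m) (\<tau> - \<mu>))"
 proof (rule integrableI_bounded)
  have "(nnint (%\<mu>. ennreal (cmod (E m \<mu> * P (n - m) (\<tau> - \<mu>)))))
    = (nsum (%k. (nnint (%\<mu>. cn E k \<mu> * cn P (n - k) (\<tau> - \<mu>))) * indicator {m} k))"
   by (simp add: norm_mult ennreal_mult)
  also have "... <= convol (cn E) (cn P) n \<tau>"
   unfolding convol_def by (intro nn_integral_mono) (auto split: split_indicator)
  finally show "(nnint (%\<mu>. ennreal (cmod (E m \<mu> * P (n - m) (\<tau> - \<mu>))))) < \<infinity>"
   using fin by (rule le_less_trans)
 qed measurable
 show "(%m. conv_mode (E m) (P (n - m)) \<tau>) summable_on UNIV"
  unfolding summable_on_iff_integrable_count_space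
  by (rule integrableI_bounded) (auto intro: le_less_trans[OF sum_norm_conv_mode_le[OF assms(1,2)] fin, simplified])
qed

lemma st_square_diff_le:
 assumes [measurable]: "!!n. G n \<in> bmeas" "!!n. H n \<in> bmeas"
  and fin: "convol (cn G) (cn G) n \<tau> < \<infinity>" "convol (cn H) (cn H) n \<tau> < \<infinity>"
 shows "cmod (st_conv G G n \<tau> - st_conv H H n \<tau>) <=
  convol (cn (%n \<tau>. G n \<tau> - H n \<tau>)) (cn G) n \<tau> + convol (cn H) (cn (%n \<tau>. G n \<tau> - H n \<tau>)) n \<tau>"
proof -
 let ?D = "%n \<tau>. G n \<tau> - H n \<tau>"
 let ?d = "%m. conv_mode (G m) (G (n - m)) \<tau> - conv_mode (H m) (H (n - m)) \<tau>"
 have m: "!!n. G n \<in> bmeas" "!!n. H n \<in> bmeas" by measurable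
 have "st_conv G G n \<tau> - st_conv H H n \<tau> = cor (1 / (2 * pi)) * (\<Sum>\<^sub>\<infinity>m. ?d m)"
  unfolding st_conv_def right_diff_distrib[symmetric]
  using convol_finite_integrable(2)[OF m(1) m(1) fin(1)] convol_finite_integrable(2)[OF m(2) m(2) fin(2)]
  by (subst infsum_diff_complex) auto
 moreover have "cmod (cor (1 / (2 * pi))) <= 1" using pi_gt3 by (simp add: norm_divide)
 ultimately have "cmod (st_conv G G n \<tau> - st_conv H H n \<tau>) <= 1 * cmod (\<Sum>\<^sub>\<infinity>m. ?d m)"
  by (simp only: norm_mult) (intro mult_right_mono, auto)
 then have "ennreal (cmod (st_conv G G n \<tau> - st_conv H H n \<tau>)) <= ennreal (cmod (\<Sum>\<^sub>\<infinity>m. ?d m))"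
  by (intro ennreal_leI) simp
 also have "... <= (nsum (%m. ennreal (cmod (?d m))))" by (rule norm_infsum_le)
 also have "... <= (nsum (%m. (nnint (%\<mu>. cn ?D m \<mu> * cn G (n - m) (\<tau> - \<mu>) + cn H m \<mu> * cn ?D (n - m) (\<tau> - \<mu>)))))"
 proof (intro nn_integral_mono)
  fix m
  have int: "integrable lborel (%\<mu>. G m \<mu> * G (n - m) (\<tau> - \<mu>))" "integrable lborel (%\<mu>. H m \<mu> * H (n - m) (\<tau> - \<mu>))"
   by (rule convol_finite_integrable(1)[OF m(1) m(1) fin(1)], rule convol_finite_integrable(1)[OF m(2) m(2) fin(2)])
  have "ennreal (cmod (?d m)) = ennreal (cmod (LINT \<mu>|lborel. G m \<mu> * G (n - m) (\<tau> - \<mu>) - H m \<mu> * H (n - m) (\<tau> - \<mu>)))"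
   unfolding conv_mode_def by (subst Bochner_Integration.integral_diff[OF int]) simp
  also have "... <= (nnint (%\<mu>. ennreal (cmod (G m \<mu> * G (n - m) (\<tau> - \<mu>) - H m \<mu> * H (n - m) (\<tau> - \<mu>)))))"
   using int by (intro integral_norm_bound_ennreal) auto
  also have "... <= (nnint (%\<mu>. cn ?D m \<mu> * cn G (n - m) (\<tau> - \<mu>) + cn H m \<mu> * cn ?D (n - m) (\<tau> - \<mu>)))"
  proof (intro nn_integral_mono)
   fix \<mu>
   have "G m \<mu> * G (n - m) (\<tau> - \<mu>) - H m \<mu> * H (n - m) (\<tau> - \<mu>)
     = ?D m \<mu> * G (n - m) (\<tau> - \<mu>) + H m \<mu> * ?D (n - m) (\<tau> - \<mu>)" by (simp add: algebra_simps)
   then have "cmod (G m \<mu> * G (n - m) (\<tau> - \<mu>) - H m \<mu> * H (n - m) (\<tau> - \<mu>))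
     <= cmod (?D m \<mu>) * cmod (G (n - m) (\<tau> - \<mu>)) + cmod (H m \<mu>) * cmod (?D (n - m) (\<tau> - \<mu>))"
    using norm_triangle_ineq[of "?D m \<mu> * G (n - m) (\<tau> - \<mu>)" "H m \<mu> * ?D (n - m) (\<tau> - \<mu>)"] by (simp only: norm_mult)
   then show "ennreal (cmod (G m \<mu> * G (n - m) (\<tau> - \<mu>) - H m \<mu> * H (n - m) (\<tau> - \<mu>)))
     <= cn ?D m \<mu> * cn G (n - m) (\<tau> - \<mu>) + cn H m \<mu> * cn ?D (n - m) (\<tau> - \<mu>)"
    by (simp add: ennreal_leI flip: ennreal_mult ennreal_plus)
  qed
  finally show "ennreal (cmod (?d m)) <= (nnint (%\<mu>. cn ?D m \<mu> * cn G (n - m) (\<tau> - \<mu>) + cn H m \<mu> * cn ?D (n - m) (\<tau> - \<mu>)))" .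
 qed
 also have "... = convol (cn ?D) (cn G) n \<tau> + convol (cn H) (cn ?D) n \<tau>"
  unfolding convol_def by (rule nint2_add) measurable
 finally show ?thesis .
qed

lemma conv_mode_product_integrable:
 fixes f g :: "real => complex"
 assumes f: "integrable lborel f" and g: "integrable lborel g"
 shows "integrable (lborel \<Otimes>\<^sub>M lborel) (%(\<tau>, \<mu>). f \<mu> * g (\<tau> - \<mu>))"
proof (rule integrableI_bounded)
 have [measurable]: "f \<in> bmeas" "g \<in> bmeas" using f g by auto
 show "(%(\<tau>, \<mu>). f \<mu> * g (\<tau> - \<mu>)) \<in> borel_measurable (lborel \<Otimes>\<^sub>M lborel)" by measurable
 have "(\<integral>\<^sup>+p. ennreal (cmod (case p of (\<tau>, \<mu>) => f \<mu> * g (\<tau> - \<mu>))) \<partial>(lborel \<Otimes>\<^sub>M lborel))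
   = (nnint (%\<tau>. (nnint (%\<mu>. ennreal (cmod (f \<mu>)) * ennreal (cmod (g (\<tau> - \<mu>)))))))"
  by (subst lborel.nn_integral_fst[symmetric]) (auto simp: norm_mult ennreal_mult)
 also have "... = (nnint (%\<mu>. (nnint (%\<tau>. ennreal (cmod (f \<mu>)) * ennreal (cmod (g (\<tau> - \<mu>)))))))"
  by (rule lborel_pair.Fubini') measurable
 also have "... = (nnint (%\<mu>. ennreal (cmod (f \<mu>)) * (nnint (%\<tau>. ennreal (cmod (g \<tau>))))))"
  using nn_integral_lborel_translate[of "%x. ennreal (cmod (g x))"] by (simp add: nn_integral_cmult)
 also have "... = (nnint (%\<mu>. ennreal (cmod (f \<mu>)))) * (nnint (%\<tau>. ennreal (cmod (g \<tau>))))"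
  by (rule nn_integral_multc) measurable
 also have "... < \<infinity>" using f g by (simp add: integrable_iff_bounded ennreal_mult_less_top)
 finally show "(\<integral>\<^sup>+p. ennreal (cmod (case p of (\<tau>, \<mu>) => f \<mu> * g (\<tau> - \<mu>))) \<partial>(lborel \<Otimes>\<^sub>M lborel)) < \<infinity>" .
qed

lemma conv_mode_integrable:
 assumes "integrable lborel f" "integrable lborel g"
 shows "integrable lborel (conv_mode f g)"
 using lborel_pair.integrable_fst[OF conv_mode_product_integrable[OF assms]]
 by (simp add: conv_mode_def[abs_def])

lemma ift_conv_mode:
 assumes f: "integrable lborel f" and g: "integrable lborel g"
 shows "ift (conv_mode f g) t = cor (2 * pi) * (ift f t * ift g t)"
proof -
 let ?e = "%x. iexp (t * x)"
 have [measurable]: "f \<in> bmeas" "g \<in> bmeas" using f g by auto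
 have int: "integrable (lborel \<Otimes>\<^sub>M lborel) (%(\<tau>, \<mu>). ?e \<tau> * (f \<mu> * g (\<tau> - \<mu>)))"
  by (rule Bochner_Integration.integrable_bound[OF conv_mode_product_integrable[OF f g]])
    (auto simp: norm_mult split_beta)
 have "(LINT \<tau>|lborel. ?e \<tau> * conv_mode f g \<tau>) = (LINT \<tau>|lborel. (LINT \<mu>|lborel. ?e \<tau> * (f \<mu> * g (\<tau> - \<mu>))))"
  unfolding conv_mode_def by (simp only: integral_mult_right_zero)
 also have "... = (LINT \<mu>|lborel. (LINT \<tau>|lborel. ?e \<tau> * (f \<mu> * g (\<tau> - \<mu>))))"
  by (rule lborel_pair.Fubini_integral[symmetric, OF int])
 also have "... = (LINT \<mu>|lborel. (?e \<mu> * f \<mu>) * (LINT \<tau>|lborel. ?e \<tau> * g \<tau>))"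
 proof (rule Bochner_Integration.integral_cong[OF refl])
  fix \<mu>
  have "(LINT \<tau>|lborel. ?e \<tau> * (f \<mu> * g (\<tau> - \<mu>))) = f \<mu> * (LINT \<tau>|lborel. ?e \<tau> * g (\<tau> - \<mu>))"
   by (simp only: mult.left_commute integral_mult_right_zero)
  also have "(LINT \<tau>|lborel. ?e \<tau> * g (\<tau> - \<mu>)) = ?e \<mu> * (LINT \<tau>|lborel. ?e \<tau> * g \<tau>)"
   using ift_translate[of g \<mu> t] by (simp add: ift_def)
  finally show "(LINT \<tau>|lborel. ?e \<tau> * (f \<mu> * g (\<tau> - \<mu>))) = (?e \<mu> * f \<mu>) * (LINT \<tau>|lborel. ?e \<tau> * g \<tau>)"
   by (simp only: mult_ac)
 qed
 also have "... = (LINT \<mu>|lborel. ?e \<mu> * f \<mu>) * (LINT \<tau>|lborel. ?e \<tau> * g \<tau>)"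
  by (rule integral_mult_left_zero)
 finally show ?thesis by (simp add: ift_def)
qed

definition mode_duhamel :: "(real => int => complex) => (real => int => complex) => real => int => int => complex" where
 "mode_duhamel e p t n m = (LINT t':{0..t}|lborel. Vs (t - t') n * (- (of_int n)\<^sup>2 * (e t' m * p t' (n - m))))"

lemma Vs_bounded: "cmod (Vs t n) <= 1 / gam n"
proof -
 have "cmod (iexp (t * gam n) - exp (- \<i> * cor (t * gam n))) <= 1 + 1"
  by (rule order_trans[OF norm_triangle_ineq4]) simp
 then have "cmod (Vs t n) <= (1 + 1) / (2 * gam n)"
  using divide_right_mono[of _ "1 + 1" "2 * gam n"] gam_nonneg[of n]
  unfolding Vs_def norm_divide norm_mult by simp
 then show ?thesis by simp
qed

lemma Vs_measurable [measurable (raw)]: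
 assumes [measurable]: "f \<in> borel_measurable M"
 shows "(%x. Vs (f x) n) \<in> borel_measurable M"
 unfolding Vs_def by measurable

lemma ift_measurable [measurable]:
 assumes [measurable]: "f \<in> bmeas"
 shows "ift f \<in> bmeas"
 unfolding ift_def by measurable

text \<open>For a single pair of spatial frequencies the Duhamel integral of a product is a genuine
 integral over \<open>[0,t]\<close>.\<close>

lemma single_mode_duhamel:
 assumes f: "integrable lborel f" and g: "integrable lborel g" and t: "t >= 0"
 shows "cor (1 / (2 * pi)) * (LINT \<tau>|lborel. duh_coeff t n \<tau> * (- (of_int n)\<^sup>2 * (cor (1 / (2 * pi)) * conv_mode f g \<tau>)))
  = (LINT t':{0..t}|lborel. Vs (t - t') n * (- (of_int n)\<^sup>2 * (ift f t' * ift g t')))"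
proof -
 define h where "h \<tau> = - (of_int n)\<^sup>2 * (cor (1 / (2 * pi)) * conv_mode f g \<tau>)" for \<tau>
 have hint: "integrable lborel h"
  unfolding h_def by (intro integrable_mult_right conv_mode_integrable f g)
 then have [measurable]: "h \<in> bmeas" by auto
 define k where "k \<tau> t' = indicator {0..t} t' *\<^sub>R (Vs (t - t') n * iexp (t' * \<tau>))" for \<tau> t'
 have [measurable]: "(%(\<tau>, t'). k \<tau> t') \<in> borel_measurable (lborel \<Otimes>\<^sub>M lborel)"
  unfolding k_def by measurable
 have k_le: "cmod (k \<tau> t') <= indicator {0..t} t' * (1 / gam n)" for \<tau> t'
  unfolding k_def using Vs_bounded[of "t - t'" n] by (auto simp: norm_mult split: split_indicator)
 have int: "integrable (lborel \<Otimes>\<^sub>M lborel) (%(\<tau>, t'). k \<tau> t' * h \<tau>)"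
 proof (rule Bochner_Integration.integrable_bound)
  have "integrable lborel (%t'. cor (indicator {0..t} t' * (1 / gam n)))"
   by (intro integrable_of_real integrable_mult_left) (use t in \<open>simp add: integrable_real_indicator\<close>)
  from integrable_tensor[OF hint this]
  show "integrable (lborel \<Otimes>\<^sub>M lborel) (%(\<tau>, t'). h \<tau> * cor (indicator {0..t} t' * (1 / gam n)))" .
  show "AE p in lborel \<Otimes>\<^sub>M lborel. cmod (case p of (\<tau>, t') => k \<tau> t' * h \<tau>)
   <= cmod (case p of (\<tau>, t') => h \<tau> * cor (indicator {0..t} t' * (1 / gam n)))"
  proof (intro AE_I2, clarify)
   fix \<tau> t'
   have "cmod (k \<tau> t' * h \<tau>) <= (indicator {0..t} t' * (1 / gam n)) * cmod (h \<tau>)"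
    unfolding norm_mult by (intro mult_right_mono k_le) auto
   then show "cmod (k \<tau> t' * h \<tau>) <= cmod (h \<tau> * cor (indicator {0..t} t' * (1 / gam n)))"
   proof -
    have "\<bar>indicator {0..t} t' * (1 / gam n)\<bar> = indicator {0..t} t' * (1 / gam n)" by simp
    then show ?thesis using \<open>cmod (k \<tau> t' * h \<tau>) <= _\<close>
     by (simp only: norm_mult norm_of_real mult.commute)
   qed
  qed
 qed measurable
 have "(LINT \<tau>|lborel. duh_coeff t n \<tau> * h \<tau>) = (LINT \<tau>|lborel. (LINT t'|lborel. k \<tau> t' * h \<tau>))"
  unfolding duh_coeff_eq_integral[OF t, symmetric] set_lebesgue_integral_def k_def
  by (simp only: integral_mult_left_zero)
 also have "... = (LINT t'|lborel. (LINT \<tau>|lborel. k \<tau> t' * h \<tau>))"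
  by (rule lborel_pair.Fubini_integral[symmetric, OF int])
 also have "... = (LINT t'|lborel. cor (2 * pi) * (indicator {0..t} t' *\<^sub>R (Vs (t - t') n * (- (of_int n)\<^sup>2 * (ift f t' * ift g t')))))"
 proof (rule Bochner_Integration.integral_cong[OF refl])
  fix t'
  let ?c = "indicator {0..t} t' *\<^sub>R (Vs (t - t') n)"
  have "(LINT \<tau>|lborel. k \<tau> t' * h \<tau>) = (LINT \<tau>|lborel. ?c * (iexp (t' * \<tau>) * h \<tau>))"
   by (simp add: k_def mult.assoc)
  also have "... = ?c * (LINT \<tau>|lborel. iexp (t' * \<tau>) * h \<tau>)"
   by (rule integral_mult_right_zero)
  also have "(LINT \<tau>|lborel. iexp (t' * \<tau>) * h \<tau>) = cor (2 * pi) * ift h t'"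
   by (simp add: ift_def)
  also have "ift h t' = - (of_int n)\<^sup>2 * (ift f t' * ift g t')"
   unfolding h_def ift_cmult ift_conv_mode[OF f g] by simp
  finally show "(LINT \<tau>|lborel. k \<tau> t' * h \<tau>) = cor (2 * pi) * (indicator {0..t} t' *\<^sub>R (Vs (t - t') n * (- (of_int n)\<^sup>2 * (ift f t' * ift g t'))))"
   by (simp add: mult_ac)
 qed
 also have "... = cor (2 * pi) * (LINT t':{0..t}|lborel. Vs (t - t') n * (- (of_int n)\<^sup>2 * (ift f t' * ift g t')))"
  unfolding set_lebesgue_integral_def by (rule integral_mult_right_zero)
 finally show ?thesis unfolding h_def by simp
qed

lemma osc_le_bracket:
 assumes "t >= 0"
 shows "cmod (osc t l) <= (t + 2) * bracket l powr (- 1)"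
proof -
 have "\<bar>l\<bar> * cmod (osc t l) <= 2"
  using osc_le_large[of l t] by (cases "l = 0") (auto simp: field_simps)
 then have "bracket l * cmod (osc t l) <= t + 2"
  using osc_le[of t l] assms by (simp add: bracket_def distrib_right)
 then show ?thesis by (simp add: powr_minus field_simps)
qed

lemma duh_coeff_le:
 assumes "t >= 0"
 shows "cmod (duh_coeff t n \<tau>) <= (t + 2) / gam n * bracket (\<bar>\<tau>\<bar> - gam n) powr (- 1)"
proof (cases "n = 0")
 case True
 then show ?thesis by (simp add: duh_coeff_def)
next
 case False
 let ?L = "bracket (\<bar>\<tau>\<bar> - gam n) powr (- 1)"
 have g: "gam n > 0" by (rule gam_pos[OF False])
 have br: "bracket (\<tau> - gam n) powr (- 1) <= ?L" "bracket (\<tau> + gam n) powr (- 1) <= ?L"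
  by (rule powr_mono2'; use branch_le[of \<tau> n] in simp)+
 have o: "cmod (osc t (\<tau> - gam n)) <= (t + 2) * ?L" "cmod (osc t (\<tau> + gam n)) <= (t + 2) * ?L"
  using assms
  by (intro order_trans[OF osc_le_bracket[OF assms] mult_left_mono[OF br(1)]] order_trans[OF osc_le_bracket[OF assms] mult_left_mono[OF br(2)]]; simp)+
 have "cmod (duh_coeff t n \<tau>) <= (cmod (osc t (\<tau> - gam n)) + cmod (osc t (\<tau> + gam n))) / (2 * gam n)"
 proof -
  have "cmod (iexp (t * gam n) * osc t (\<tau> - gam n) - exp (- (\<i> * cor (t * gam n))) * osc t (\<tau> + gam n))
   <= cmod (osc t (\<tau> - gam n)) + cmod (osc t (\<tau> + gam n))"
   by (rule order_trans[OF norm_triangle_ineq4]) (simp only: norm_mult norm_exp_i_real mult_1_left order_refl)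
  then show ?thesis using g unfolding duh_coeff_def norm_divide norm_mult
   by (simp add: divide_right_mono)
 qed
 also have "... <= ((t + 2) * ?L + (t + 2) * ?L) / (2 * gam n)"
  using g o by (intro divide_right_mono add_mono) auto
 also have "... = (t + 2) / gam n * ?L" using g by (simp add: field_simps)
 finally show ?thesis .
qed

definition XX :: "(int => real) => real => (int => real => complex) set" where
 "XX w b = {G. (\<forall>n. G n \<in> bmeas) \<and> wnorm w b (cn G) < \<infinity>}"

lemma XX_measurable [measurable_dest]: "G \<in> XX w b ==> G n \<in> bmeas"
 by (simp add: XX_def)

lemma XX_finite: "G \<in> XX w b ==> wnorm w b (cn G) < \<infinity>"
 by (simp add: XX_def)

lemma XX_integrable: "G \<in> XX w b ==> w n > 0 ==> b > 1 / 2 ==> integrable lborel (G n)"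
 by (rule wnorm_integrable) (auto simp: XX_def)

context exponents

begin

lemma forcing_finite:
 assumes "submult om" "E \<in> XX (wt om) b" "P \<in> XX (wt om) b"
 shows "wnorm (wt om) (- a) (forcing (convol (cn E) (cn P))) < \<infinity>"
proof -
 obtain C where C: "C < \<infinity>"
  "!!om f g. submult om ==> (!!m. f m \<in> bmeas) ==> (!!m. g m \<in> bmeas) ==>
   wnorm (wt om) (- a) (forcing (convol f g)) <= C * (wnorm (wt om) b f * wnorm (wt om) b g)"
  using bilinear_estimate by blast
 have "wnorm (wt om) (- a) (forcing (convol (cn E) (cn P))) <= C * (wnorm (wt om) b (cn E) * wnorm (wt om) b (cn P))"
 proof -
  note [measurable] = XX_measurable[OF assms(2)] XX_measurable[OF assms(3)]
  show ?thesis using assms(1) by (intro C(2)) measurable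
 qed
 also have "... < \<infinity>" using C(1) assms by (simp add: XX_def ennreal_mult_less_top)
 finally show ?thesis .
qed

lemma forcing_st_conv_finite:
 assumes "submult om" "E \<in> XX (wt om) b" "P \<in> XX (wt om) b"
 shows "wnorm (wt om) (- a) (forcing (cn (st_conv E P))) < \<infinity>"
proof -
 have "wnorm (wt om) (- a) (forcing (cn (st_conv E P))) <= wnorm (wt om) (- a) (forcing (convol (cn E) (cn P)))"
  using assms by (intro wnorm_mono mult_left_mono norm_st_conv_le) (auto simp: XX_def)
 then show ?thesis using forcing_finite[OF assms] by (rule le_less_trans)
qed

lemma AE_convol_finite:
 assumes om: "submult om" and E: "E \<in> XX (wt om) b" and P: "P \<in> XX (wt om) b" and n: "n \<noteq> 0"
 shows "AE \<tau> in lborel. convol (cn E) (cn P) n \<tau> < \<infinity>"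
proof -
 note [measurable] = XX_measurable[OF E] XX_measurable[OF P]
 have "AE \<tau> in lborel. forcing (convol (cn E) (cn P)) n \<tau> < \<infinity>"
  using forcing_finite[OF om E P] wt_pos[OF om] by (intro wnorm_AE_finite) auto
 then show ?thesis
 proof eventually_elim
  case (elim \<tau>)
  have "(of_int n)\<^sup>2 / gam n > 0" using n gam_pos[OF n] by simp
  then show ?case using elim by (auto simp: ennreal_mult_less_top)
 qed
qed

text \<open>The modulus of the Duhamel coefficient decays like \<open>1/\<langle>|\<tau>| - \<gamma>(n)\<rangle>\<close>, which is square
 integrable against the weight \<open>\<langle>|\<tau>| - \<gamma>(n)\<rangle>\<^bsup>a\<^esup>\<close> because \<open>a < 1/2\<close>.\<close>

lemma duh_coeff_convol_finite:
 assumes om: "submult om" and E: "E \<in> XX (wt om) b" and P: "P \<in> XX (wt om) b" and t: "t >= 0"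
 shows "(nnint (%\<tau>. ennreal (cmod (duh_coeff t n \<tau>) * (of_int n)\<^sup>2) * convol (cn E) (cn P) n \<tau>)) < \<infinity>"
proof -
 note [measurable] = XX_measurable[OF E] XX_measurable[OF P]
 let ?L = "%\<tau>. bracket (\<bar>\<tau>\<bar> - gam n)" and ?h = "forcing (convol (cn E) (cn P)) n"
 let ?g = "%\<tau>. ennreal (?L \<tau> powr (- 1)) * ?h \<tau>"
 have w: "wt om n > 0" by (rule wt_pos[OF om])
 have eq: "ennreal (?L \<tau> powr (1 - a) * wt om n) * ?g \<tau> = ennreal (?L \<tau> powr (- a) * wt om n) * ?h \<tau>" for \<tau>
 proof -
  have "?L \<tau> powr (1 - a) * ?L \<tau> powr (- 1) = ?L \<tau> powr (- a)" by (subst powr_add[symmetric]) simp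
  then have "ennreal (?L \<tau> powr (1 - a) * wt om n) * ennreal (?L \<tau> powr (- 1)) = ennreal (?L \<tau> powr (- a) * wt om n)"
   using w by (subst ennreal_mult[symmetric]) (auto simp: mult_ac simp del: powr_minus)
  then show ?thesis by (simp only: mult.assoc[symmetric])
 qed
 have "(ennreal (wt om n) * (nnint (%\<tau>. ?g \<tau>)))\<^sup>2
   <= 2 * bracket_integral (2 * (1 - a)) * (nnint (%\<tau>. (ennreal (?L \<tau> powr (1 - a) * wt om n) * ?g \<tau>)\<^sup>2))"
  by (rule slice_integral_bound) measurable
 also have "... <= 2 * bracket_integral (2 * (1 - a)) * wnorm (wt om) (- a) (forcing (convol (cn E) (cn P)))"
  unfolding eq by (intro mult_left_mono wnorm_component_le) auto
 also have "... < \<infinity>"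
 proof -
  have "2 * (1 - a) > 1" using a_less by simp
  then show ?thesis using forcing_finite[OF om E P] bracket_integral_finite[of "2 * (1 - a)"]
   by (simp add: ennreal_mult_less_top)
 qed
 finally have fin: "(nnint (%\<tau>. ?g \<tau>)) < \<infinity>"
  using w by (auto simp: power2_eq_square ennreal_mult_less_top ennreal_mult_eq_top_iff less_top)
 have "(nnint (%\<tau>. ennreal (cmod (duh_coeff t n \<tau>) * (of_int n)\<^sup>2) * convol (cn E) (cn P) n \<tau>))
   <= (nnint (%\<tau>. ennreal (t + 2) * ?g \<tau>))"
 proof (intro nn_integral_mono)
  fix \<tau>
  have "cmod (duh_coeff t n \<tau>) * (of_int n)\<^sup>2 <= ((t + 2) / gam n * ?L \<tau> powr (- 1)) * (of_int n)\<^sup>2"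
   by (intro mult_right_mono duh_coeff_le t) auto
  also have "... = (t + 2) * (?L \<tau> powr (- 1) * ((of_int n)\<^sup>2 / gam n))" by (simp only: times_divide_eq_left times_divide_eq_right mult_ac)
  finally have "ennreal (cmod (duh_coeff t n \<tau>) * (of_int n)\<^sup>2) * convol (cn E) (cn P) n \<tau>
   <= ennreal ((t + 2) * (?L \<tau> powr (- 1) * ((of_int n)\<^sup>2 / gam n))) * convol (cn E) (cn P) n \<tau>"
   by (intro mult_right_mono ennreal_leI) auto
  also have "... = ennreal (t + 2) * ?g \<tau>"
  proof -
   have "ennreal (x * (y * z)) = ennreal x * (ennreal y * ennreal z)" if "x >= 0" "y >= 0" "z >= 0" for x y z :: real
    using that by (simp add: ennreal_mult)
   from this[of "t + 2" "?L \<tau> powr (- 1)" "(of_int n)\<^sup>2 / gam n"] t show ?thesis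
    by (simp add: mult.assoc del: powr_minus)
  qed
  finally show "ennreal (cmod (duh_coeff t n \<tau>) * (of_int n)\<^sup>2) * convol (cn E) (cn P) n \<tau> <= ennreal (t + 2) * ?g \<tau>" .
 qed
 also have "... = ennreal (t + 2) * (nnint (%\<tau>. ?g \<tau>))" by (rule nn_integral_cmult) measurable
 also have "... < \<infinity>" using fin by (simp add: ennreal_mult_less_top)
 finally show ?thesis .
qed

text \<open>The Duhamel term of a product only sees the time slices of the factors on \<open>[0,t]\<close>.\<close>

lemma duhamel_of_st_conv:
 assumes om: "submult om" and E: "E \<in> XX (wt om) b" and P: "P \<in> XX (wt om) b" and t: "t >= 0"
 shows "duhamel_of (st_conv E P) t n = (\<Sum>\<^sub>\<infinity>m. mode_duhamel (time_slice E) (time_slice P) t n m)"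
  and "mode_duhamel (time_slice E) (time_slice P) t n summable_on UNIV"
proof -
 note [measurable] = XX_measurable[OF E] XX_measurable[OF P]
 define F where "F m \<tau> = duh_coeff t n \<tau> * (- (of_int n)\<^sup>2 * (cor (1 / (2 * pi)) * conv_mode (E m) (P (n - m)) \<tau>))" for m \<tau>
 have [measurable]: "F m \<in> bmeas" for m unfolding F_def by measurable
 have F_fin: "(nsum (%m. (nnint (%\<tau>. ennreal (cmod (F m \<tau>)))))) < \<infinity>"
 proof -
  have F_le: "ennreal (cmod (F m \<tau>)) <= ennreal (cmod (duh_coeff t n \<tau>) * (of_int n)\<^sup>2) * ennreal (cmod (conv_mode (E m) (P (n - m)) \<tau>))" for m \<tau>
  proof -
   have "cmod (cor (1 / (2 * pi)) * z) <= cmod z" for z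
   proof -
    have "cmod (cor (1 / (2 * pi))) <= 1" using pi_gt3 by (simp add: norm_divide)
    then show ?thesis unfolding norm_mult by (rule mult_left_le_one_le[rotated 2]) auto
   qed
   then have "cmod (F m \<tau>) <= cmod (duh_coeff t n \<tau>) * ((of_int n)\<^sup>2 * cmod (conv_mode (E m) (P (n - m)) \<tau>))"
    unfolding F_def norm_mult[of "duh_coeff t n \<tau>"] norm_mult[of "- (of_int n)\<^sup>2"]
    by (intro mult_left_mono) (auto simp: norm_power intro!: mult_left_mono)
   then have "ennreal (cmod (F m \<tau>)) <= ennreal ((cmod (duh_coeff t n \<tau>) * (of_int n)\<^sup>2) * cmod (conv_mode (E m) (P (n - m)) \<tau>))"
    by (intro ennreal_leI) (simp add: mult.assoc)
   then show ?thesis by (simp add: ennreal_mult)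
  qed
  have "(nsum (%m. (nnint (%\<tau>. ennreal (cmod (F m \<tau>)))))) = (nnint (%\<tau>. (nsum (%m. ennreal (cmod (F m \<tau>))))))"
   by (rule nn_integral_count_space_nn_integral[symmetric]) auto
  also have "... <= (nnint (%\<tau>. ennreal (cmod (duh_coeff t n \<tau>) * (of_int n)\<^sup>2) * convol (cn E) (cn P) n \<tau>))"
  proof (intro nn_integral_mono)
   fix \<tau>
   have "(nsum (%m. ennreal (cmod (F m \<tau>))))
    <= (nsum (%m. ennreal (cmod (duh_coeff t n \<tau>) * (of_int n)\<^sup>2) * ennreal (cmod (conv_mode (E m) (P (n - m)) \<tau>))))"
    by (intro nn_integral_mono F_le)
   also have "... = ennreal (cmod (duh_coeff t n \<tau>) * (of_int n)\<^sup>2) * (nsum (%m. ennreal (cmod (conv_mode (E m) (P (n - m)) \<tau>))))"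
    by (rule nn_integral_cmult) simp
   also have "... <= ennreal (cmod (duh_coeff t n \<tau>) * (of_int n)\<^sup>2) * convol (cn E) (cn P) n \<tau>"
    by (intro mult_left_mono sum_norm_conv_mode_le) auto
   finally show "(nsum (%m. ennreal (cmod (F m \<tau>)))) <= ennreal (cmod (duh_coeff t n \<tau>) * (of_int n)\<^sup>2) * convol (cn E) (cn P) n \<tau>" .
  qed
  also have "... < \<infinity>" by (rule duh_coeff_convol_finite[OF om E P t])
  finally show ?thesis .
 qed
 have mode: "cor (1 / (2 * pi)) * (LINT \<tau>|lborel. F m \<tau>) = mode_duhamel (time_slice E) (time_slice P) t n m" for m
  unfolding F_def mode_duhamel_def time_slice_eq_ift
  using XX_integrable[OF E wt_pos[OF om] b_gt] XX_integrable[OF P wt_pos[OF om] b_gt] t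
  by (rule single_mode_duhamel)
 note swap = integral_infsum_swap[OF _ F_fin]
 have "duhamel_of (st_conv E P) t n = cor (1 / (2 * pi)) * (LINT \<tau>|lborel. (\<Sum>\<^sub>\<infinity>m. F m \<tau>))"
  unfolding duhamel_of_def st_conv_def F_def by (simp only: infsum_cmult_right')
 also have "... = cor (1 / (2 * pi)) * (\<Sum>\<^sub>\<infinity>m. LINT \<tau>|lborel. F m \<tau>)"
  by (subst swap(1)) auto
 also have "... = (\<Sum>\<^sub>\<infinity>m. mode_duhamel (time_slice E) (time_slice P) t n m)"
  unfolding infsum_cmult_right'[symmetric] mode ..
 finally show "duhamel_of (st_conv E P) t n = (\<Sum>\<^sub>\<infinity>m. mode_duhamel (time_slice E) (time_slice P) t n m)" .
 have "(%m. cor (1 / (2 * pi)) * (LINT \<tau>|lborel. F m \<tau>)) summable_on UNIV"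
  by (intro summable_on_cmult_right swap(2)) auto
 then show "mode_duhamel (time_slice E) (time_slice P) t n summable_on UNIV"
  unfolding mode .
qed

end

lemma mode_duhamel_cong:
 assumes "!!t'. t' \<in> {0..t} ==> e t' = e' t'" "!!t'. t' \<in> {0..t} ==> p t' = p' t'"
 shows "mode_duhamel e p t n m = mode_duhamel e' p' t n m"
 unfolding mode_duhamel_def by (rule set_lebesgue_integral_cong) (use assms in auto)

lemma slice_l1:
 "ennreal (cmod (time_slice G t n)) <= (nnint (%\<tau>. cn G n \<tau>))"
 unfolding time_slice_eq_ift by (rule norm_ift_le)

text \<open>For \<open>s >= 0\<close> the slices lie in \<open>L\<^sup>2\<close>, uniformly in time, and the pointwise square may be
 integrated term by term.\<close>

lemma duhamel_integral_nonneg: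
 assumes s: "s >= 0" and G: "G \<in> XX w b" and w: "!!n. w n >= c" "c > 0" and b: "b > 1 / 2" and t: "t >= 0"
  and u: "!!t'. t' \<in> {0..t} ==> u t' = time_slice G t'"
 shows "duhamel_integral s u G t n = (\<Sum>\<^sub>\<infinity>m. mode_duhamel u u t n m)"
proof -
 note [measurable] = XX_measurable[OF G]
 define A where "A m = (nnint (%\<tau>. cn G m \<tau>))" for m
 let ?v = "time_slice G"
 have A_sq: "(nsum (%m. (A m)\<^sup>2)) < \<infinity>"
 proof -
  have "(ennreal c)\<^sup>2 * (A m)\<^sup>2 <= 2 * bracket_integral (2 * b) * (nnint (%\<tau>. (ennreal (bracket (\<bar>\<tau>\<bar> - gam m) powr b * w m) * cn G m \<tau>)\<^sup>2))" for m
  proof -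
   have "(ennreal c)\<^sup>2 * (A m)\<^sup>2 <= (ennreal (w m) * (nnint (%\<tau>. cn G m \<tau>)))\<^sup>2"
    unfolding A_def power_mult_distrib[symmetric] by (intro power_mono mult_right_mono ennreal_leI w) auto
   also have "... <= 2 * bracket_integral (2 * b) * (nnint (%\<tau>. (ennreal (bracket (\<bar>\<tau>\<bar> - gam m) powr b * w m) * cn G m \<tau>)\<^sup>2))"
    by (rule slice_integral_bound) measurable
   finally show ?thesis .
  qed
  then have "(nsum (%m. (ennreal c)\<^sup>2 * (A m)\<^sup>2)) <= (nsum (%m. 2 * bracket_integral (2 * b) * (nnint (%\<tau>. (ennreal (bracket (\<bar>\<tau>\<bar> - gam m) powr b * w m) * cn G m \<tau>)\<^sup>2))))"
   by (intro nn_integral_mono)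
  also have "... = 2 * bracket_integral (2 * b) * wnorm w b (cn G)"
   unfolding wnorm_def by (rule nn_integral_cmult) simp
  also have "... < \<infinity>" using XX_finite[OF G] bracket_integral_finite[of "2 * b"] b by (simp add: ennreal_mult_less_top)
  finally have "(ennreal c)\<^sup>2 * (nsum (%m. (A m)\<^sup>2)) < \<infinity>" by (subst (asm) nn_integral_cmult) auto
  then show ?thesis using w(2) by (auto simp: ennreal_mult_less_top)
 qed
 have A_conv: "(nsum (%m. A m * A (n - m))) < \<infinity>"
 proof -
  have "(nsum (%m. A m * A (n - m)))\<^sup>2 <= (nsum (%m. (A m)\<^sup>2)) * (nsum (%m. (A (n - m))\<^sup>2))"
   by (rule Cauchy_Schwarz_nn_integral) auto
  also have "(nsum (%m. (A (n - m))\<^sup>2)) = (nsum (%m. (A m)\<^sup>2))"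
   by (rule nn_integral_bij_count_space[of "%m. n - m" UNIV UNIV "%m. (A m)\<^sup>2"])
     (auto intro!: bij_betwI[of _ _ _ "%m. n - m"])
  also have "(nsum (%m. (A m)\<^sup>2)) * (nsum (%m. (A m)\<^sup>2)) < \<infinity>"
   using A_sq by (simp add: ennreal_mult_less_top)
  finally show ?thesis by (auto simp: power2_eq_square ennreal_mult_less_top)
 qed
 define F where "F m t' = indicator {0..t} t' *\<^sub>R (Vs (t - t') n * (- (of_int n)\<^sup>2 * (?v t' m * ?v t' (n - m))))" for m t'
 have v_meas [measurable]: "(%t'. ?v t' m) \<in> bmeas" for m
  unfolding time_slice_eq_ift using ift_measurable[of "G m"] by simp
 have F_meas [measurable]: "F m \<in> bmeas" for m unfolding F_def by measurable
 have F_fin: "(nsum (%m. (nnint (%t'. ennreal (cmod (F m t')))))) < \<infinity>"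
 proof -
  have F_le: "ennreal (cmod (F m t')) <= ennreal ((of_int n)\<^sup>2 / gam n) * (A m * A (n - m)) * indicator {0..t} t'" for m t'
  proof -
   have "cmod (F m t') <= ((1 / gam n) * ((of_int n)\<^sup>2 * (cmod (?v t' m) * cmod (?v t' (n - m))))) * indicator {0..t} t'"
    unfolding F_def using Vs_bounded[of "t - t'" n]
    by (auto simp: norm_mult norm_power split: split_indicator intro!: mult_right_mono simp del: times_divide_eq_left mult_1_left)
   then have "ennreal (cmod (F m t')) <= ennreal (((of_int n)\<^sup>2 / gam n) * (cmod (?v t' m) * cmod (?v t' (n - m))) * indicator {0..t} t')"
    by (intro ennreal_leI) simp
   also have "... = ennreal ((of_int n)\<^sup>2 / gam n) * (ennreal (cmod (?v t' m)) * ennreal (cmod (?v t' (n - m)))) * indicator {0..t} t'"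
   proof -
    have *: "ennreal (q * (x * y) * indicator {0..t} t') = ennreal q * (ennreal x * ennreal y) * indicator {0..t} t'"
     if "q >= 0" "x >= 0" "y >= 0" for q x y :: real
     using that by (auto simp: ennreal_mult split: split_indicator)
    show ?thesis by (rule *) auto
   qed
   also have "... <= ennreal ((of_int n)\<^sup>2 / gam n) * (A m * A (n - m)) * indicator {0..t} t'"
    unfolding A_def by (intro mult_right_mono mult_left_mono mult_mono slice_l1) auto
   finally show ?thesis .
  qed
  have "(nsum (%m. (nnint (%t'. ennreal (cmod (F m t'))))))
    <= (nsum (%m. (nnint (%t'. ennreal ((of_int n)\<^sup>2 / gam n) * (A m * A (n - m)) * indicator {0..t} t'))))"
   by (intro nn_integral_mono F_le)
  also have "... = ennreal ((of_int n)\<^sup>2 / gam n) * (nsum (%m. A m * A (n - m))) * ennreal t"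
   using t by (simp add: nn_integral_cmult_indicator nn_integral_cmult nn_integral_multc)
  also have "... < \<infinity>" using A_conv by (simp add: ennreal_mult_less_top)
  finally show ?thesis .
 qed
 have "duhamel_integral s u G t n = (LINT t':{0..t}|lborel. Vs (t - t') n * (- (of_int n)\<^sup>2 * (\<Sum>\<^sub>\<infinity>m. u t' m * u t' (n - m))))"
  using s by (simp add: duhamel_integral_def dx_dx square_def)
 also have "... = (LINT t'|lborel. (\<Sum>\<^sub>\<infinity>m. F m t'))"
  unfolding set_lebesgue_integral_def
 proof (rule Bochner_Integration.integral_cong[OF refl])
  fix t'
  show "indicator {0..t} t' *\<^sub>R (Vs (t - t') n * (- (of_int n)\<^sup>2 * (\<Sum>\<^sub>\<infinity>m. u t' m * u t' (n - m)))) = (\<Sum>\<^sub>\<infinity>m. F m t')"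
  proof (cases "t' \<in> {0..t}")
   case True
   then have "F m t' = Vs (t - t') n * (- (of_int n)\<^sup>2 * (u t' m * u t' (n - m)))" for m
    using u[OF True] by (simp add: F_def)
   then show ?thesis using True by (simp only: infsum_cmult_right') simp
  qed (simp add: F_def)
 qed
 also have "... = (\<Sum>\<^sub>\<infinity>m. LINT t'|lborel. F m t')"
  by (rule integral_infsum_swap(1)[OF F_meas F_fin])
 also have "... = (\<Sum>\<^sub>\<infinity>m. mode_duhamel u u t n m)"
 proof (rule infsum_cong)
  fix m
  have "mode_duhamel u u t n m = mode_duhamel ?v ?v t n m"
   by (rule mode_duhamel_cong) (use u in auto)
  then show "(LINT t'|lborel. F m t') = mode_duhamel u u t n m"
   by (simp add: mode_duhamel_def F_def set_lebesgue_integral_def)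
 qed
 finally show ?thesis .
qed

section \<open>Completeness\<close>

lemma power_commutes_square: "(x ^ i)\<^sup>2 = (x\<^sup>2) ^ i" for x :: real
 by (metis mult.commute power_mult)

lemma wnorm_sum_geometric:
 fixes d :: "nat => int => real => complex"
 assumes [measurable]: "!!i n. d i n \<in> bmeas" and r: "r >= 0"
  and d: "!!i. wnorm w b (cn (d i)) <= ennreal (r / 16 ^ i)"
 shows "wnorm w b (%n \<tau>. \<Sum>i. cn (d (k + i)) n \<tau>) <= ennreal (4 * r / 16 ^ k)"
proof -
 let ?W = "%n \<tau>. ennreal (bracket (\<bar>\<tau>\<bar> - gam n) powr b * w n)"
 have geo: "(\<Sum>i. ennreal (c * (1 / 4) ^ i)) = ennreal (c * (4 / 3))" if "c >= 0" for c :: real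
 proof -
  have "(%i. c * (1 / 4) ^ i) sums (c * (1 / (1 - 1 / 4)))"
   by (intro sums_mult geometric_sums) auto
  then show ?thesis using that by (intro suminf_ennreal_eq) auto
 qed
 have pw: "(?W n \<tau> * (\<Sum>i. cn (d (k + i)) n \<tau>))\<^sup>2 <= ennreal (4 / 3) * (\<Sum>i. ennreal (4 ^ i) * (?W n \<tau> * cn (d (k + i)) n \<tau>)\<^sup>2)" for n \<tau>
 proof -
  have "?W n \<tau> * (\<Sum>i. cn (d (k + i)) n \<tau>) = (nsum (%i. ennreal ((1 / 2) ^ i) * (ennreal (2 ^ i) * (?W n \<tau> * cn (d (k + i)) n \<tau>))))"
  proof -
   have "ennreal ((1 / 2) ^ i) * (ennreal (2 ^ i) * x) = x" for i x
    by (simp add: mult.assoc[symmetric] power_one_over flip: ennreal_mult)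
   then show ?thesis by (simp add: nn_integral_count_space_nat del: ennreal_power)
  qed
  then have "(?W n \<tau> * (\<Sum>i. cn (d (k + i)) n \<tau>))\<^sup>2
    <= (nsum (%i. (ennreal ((1 / 2) ^ i))\<^sup>2)) * (nsum (%i. (ennreal (2 ^ i) * (?W n \<tau> * cn (d (k + i)) n \<tau>))\<^sup>2))"
   using Cauchy_Schwarz_nn_integral[of "%i::nat. ennreal ((1 / 2) ^ i)" "count_space UNIV" "%i. ennreal (2 ^ i) * (?W n \<tau> * cn (d (k + i)) n \<tau>)"] by simp
  also have "(nsum (%i. (ennreal ((1 / 2) ^ i))\<^sup>2)) = ennreal (4 / 3)"
  proof -
   have sq: "(ennreal ((1 / 2) ^ i))\<^sup>2 = ennreal (1 * (1 / 4) ^ i)" for i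
   proof -
    have "((1 / 2 :: real) ^ i)\<^sup>2 = ((1 / 2)\<^sup>2) ^ i" by (rule power_commutes_square)
    then have "((1 / 2 :: real) ^ i)\<^sup>2 = (1 / 4) ^ i" by (simp only: power_divide power_one) (simp add: power2_eq_square)
    then show ?thesis by (subst ennreal_power) auto
   qed
   show ?thesis unfolding sq nn_integral_count_space_nat geo[OF zero_le_one] by (simp only: mult_1_left)
  qed
  also have "(nsum (%i. (ennreal (2 ^ i) * (?W n \<tau> * cn (d (k + i)) n \<tau>))\<^sup>2))
   = (\<Sum>i. ennreal (4 ^ i) * (?W n \<tau> * cn (d (k + i)) n \<tau>)\<^sup>2)"
  proof -
   have "(ennreal (2 ^ i))\<^sup>2 = ennreal (4 ^ i)" for i
   proof -
    have "((2 :: real) ^ i)\<^sup>2 = (2\<^sup>2) ^ i" by (rule power_commutes_square)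
    then have "((2 :: real) ^ i)\<^sup>2 = 4 ^ i" by simp
    then show ?thesis by (subst ennreal_power) auto
   qed
   then show ?thesis unfolding nn_integral_count_space_nat power_mult_distrib[of "ennreal (2 ^ i)" for i] by simp
  qed
  finally show ?thesis .
 qed
 have "wnorm w b (%n \<tau>. \<Sum>i. cn (d (k + i)) n \<tau>)
   <= nint2 (%n \<tau>. ennreal (4 / 3) * (\<Sum>i. ennreal (4 ^ i) * (?W n \<tau> * cn (d (k + i)) n \<tau>)\<^sup>2))"
  unfolding wnorm_def by (intro nint2_mono pw)
 also have "... = ennreal (4 / 3) * (\<Sum>i. ennreal (4 ^ i) * wnorm w b (cn (d (k + i))))"
  unfolding wnorm_def by (simp add: nn_integral_cmult nn_integral_suminf)
 also have "... <= ennreal (4 / 3) * (\<Sum>i. ennreal (r / 16 ^ k * (1 / 4) ^ i))"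
 proof (intro mult_left_mono suminf_le)
  fix i
  have "ennreal (4 ^ i) * wnorm w b (cn (d (k + i))) <= ennreal (4 ^ i) * ennreal (r / 16 ^ (k + i))"
   by (intro mult_left_mono d) auto
  also have "... = ennreal (4 ^ i * (r / 16 ^ (k + i)))"
   using r by (subst ennreal_mult) auto
  also have "4 ^ i * (r / 16 ^ (k + i)) = r / 16 ^ k * (1 / 4) ^ i"
  proof -
   have "(16 :: real) ^ i = 4 ^ i * 4 ^ i" using power_mult_distrib[of "4::real" 4 i] by simp
   then show ?thesis by (simp add: power_add power_one_over field_simps)
  qed
  finally show "ennreal (4 ^ i) * wnorm w b (cn (d (k + i))) <= ennreal (r / 16 ^ k * (1 / 4) ^ i)" .
 qed auto
 also have "... = ennreal (4 / 3) * ennreal (r / 16 ^ k * (4 / 3))"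
  by (subst geo) (use r in \<open>auto intro: divide_nonneg_nonneg\<close>)
 also have "... = ennreal (4 / 3 * (r / 16 ^ k * (4 / 3)))"
  using r by (subst ennreal_mult) auto
 also have "... <= ennreal (4 * r / 16 ^ k)"
 proof (rule ennreal_leI)
  have "4 / 3 * (x * (4 / 3)) <= 4 * x" if "x >= 0" for x :: real using that by simp
  from this[of "r / 16 ^ k"] show "4 / 3 * (r / 16 ^ k * (4 / 3)) <= 4 * r / 16 ^ k" using r by simp
 qed
 finally show ?thesis .
qed

text \<open>The distances are squared norms, so a ratio of \<open>1/16\<close> per step makes
 the increments summable, with room for the factors lost in the triangle inequality for
 squares.\<close>

lemma XX_complete:
 fixes G :: "nat => int => real => complex"
 assumes G [measurable]: "!!k n. G k n \<in> bmeas" and r: "r >= 0" and w: "!!n. w n > 0"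
  and d: "!!k. wnorm w b (cn (%n \<tau>. G (Suc k) n \<tau> - G k n \<tau>)) <= ennreal (r / 16 ^ k)"
 obtains L where "!!n. L n \<in> bmeas"
  "!!k. wnorm w b (cn (%n \<tau>. L n \<tau> - G k n \<tau>)) <= ennreal (4 * r / 16 ^ k)"
proof -
 define D where "D k n \<tau> = G (Suc k) n \<tau> - G k n \<tau>" for k n \<tau>
 have [measurable]: "D k n \<in> bmeas" for k n unfolding D_def by measurable
 define L where "L n \<tau> = G 0 n \<tau> + (\<Sum>i. D i n \<tau>)" for n \<tau>
 have L [measurable]: "L n \<in> bmeas" for n unfolding L_def by measurable
 have D: "wnorm w b (cn (D k)) <= ennreal (r / 16 ^ k)" for k using d[of k] by (simp add: D_def)
 have geo: "wnorm w b (%n \<tau>. \<Sum>i. cn (D (k + i)) n \<tau>) <= ennreal (4 * r / 16 ^ k)" for k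
  by (rule wnorm_sum_geometric) (use r D in auto)
 have fin: "AE \<tau> in lborel. (\<Sum>i. cn (D i) n \<tau>) < \<infinity>" for n
 proof -
  have "wnorm w b (%n \<tau>. \<Sum>i. cn (D i) n \<tau>) < \<infinity>"
   using le_less_trans[OF geo[of 0]] by simp
  then show ?thesis using w by (intro wnorm_AE_finite[where w = w and b = b]) auto
 qed
 have "wnorm w b (cn (%n \<tau>. L n \<tau> - G k n \<tau>)) <= wnorm w b (%n \<tau>. \<Sum>i. cn (D (k + i)) n \<tau>)" for k
 proof (rule wnorm_mono_AE)
  fix n
  show "AE \<tau> in lborel. cn (%n \<tau>. L n \<tau> - G k n \<tau>) n \<tau> <= (\<Sum>i. cn (D (k + i)) n \<tau>)"
   using fin[of n]
  proof eventually_elim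
   case (elim \<tau>)
   have nsum: "summable (%i. cmod (D i n \<tau>))"
    by (rule summable_suminf_not_top) (use elim in auto)
   then have sum: "summable (%i. D i n \<tau>)" by (rule summable_norm_cancel)
   have tele: "G 0 n \<tau> + (\<Sum>i<k. D i n \<tau>) = G k n \<tau>"
    unfolding D_def by (subst sum_lessThan_telescope) simp
   have "L n \<tau> - G k n \<tau> = (\<Sum>i. D (i + k) n \<tau>)"
    unfolding L_def tele[symmetric] using suminf_split_initial_segment[OF sum, of k] by simp
   then have "cmod (L n \<tau> - G k n \<tau>) <= (\<Sum>i. cmod (D (i + k) n \<tau>))"
    using summable_norm[of "%i. D (i + k) n \<tau>"] summable_ignore_initial_segment[OF nsum, of k] by simp
   then have "ennreal (cmod (L n \<tau> - G k n \<tau>)) <= ennreal (\<Sum>i. cmod (D (i + k) n \<tau>))" by (rule ennreal_leI)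
   also have "... = (\<Sum>i. ennreal (cmod (D (i + k) n \<tau>)))"
    using summable_ignore_initial_segment[OF nsum, of k] by (intro suminf_ennreal2[symmetric]) auto
   finally show ?case by (simp add: add.commute)
  qed
 qed
 then have "wnorm w b (cn (%n \<tau>. L n \<tau> - G k n \<tau>)) <= ennreal (4 * r / 16 ^ k)" for k
  using geo[of k] by (rule order_trans)
 with L show ?thesis by (rule that)
qed

lemma wnorm_triangle:
 assumes [measurable]: "!!n. A n \<in> bmeas" "!!n. B n \<in> bmeas" "!!n. D n \<in> bmeas"
 shows "wnorm w b (cn (%n \<tau>. A n \<tau> - D n \<tau>)) <= 2 * (wnorm w b (cn (%n \<tau>. A n \<tau> - B n \<tau>)) + wnorm w b (cn (%n \<tau>. B n \<tau> - D n \<tau>)))"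
proof -
 have "wnorm w b (cn (%n \<tau>. A n \<tau> - D n \<tau>)) <= wnorm w b (%n \<tau>. cn (%n \<tau>. A n \<tau> - B n \<tau>) n \<tau> + cn (%n \<tau>. B n \<tau> - D n \<tau>) n \<tau>)"
 proof (rule wnorm_mono)
  fix n \<tau>
  have "cmod (A n \<tau> - D n \<tau>) <= cmod (A n \<tau> - B n \<tau>) + cmod (B n \<tau> - D n \<tau>)"
   using norm_triangle_ineq[of "A n \<tau> - B n \<tau>" "B n \<tau> - D n \<tau>"] by simp
  then show "ennreal (cmod (A n \<tau> - D n \<tau>)) <= ennreal (cmod (A n \<tau> - B n \<tau>)) + ennreal (cmod (B n \<tau> - D n \<tau>))"
   by (simp add: ennreal_leI flip: ennreal_plus)
 qed
 also have "... <= 2 * (wnorm w b (cn (%n \<tau>. A n \<tau> - B n \<tau>)) + wnorm w b (cn (%n \<tau>. B n \<tau> - D n \<tau>)))"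
  by (rule wnorm_add_le) auto
 finally show ?thesis .
qed

lemma wnorm_diff_le:
 assumes [measurable]: "!!n. A n \<in> bmeas" "!!n. B n \<in> bmeas"
 shows "wnorm w b (cn (%n \<tau>. A n \<tau> - B n \<tau>)) <= 2 * (wnorm w b (cn A) + wnorm w b (cn B))"
 using wnorm_triangle[of A "%_ _. 0" B w b] by simp

lemma XX_diff:
 assumes "A \<in> XX w b" "B \<in> XX w b"
 shows "(%n \<tau>. A n \<tau> - B n \<tau>) \<in> XX w b"
proof -
 note [measurable] = XX_measurable[OF assms(1)] XX_measurable[OF assms(2)]
 have "wnorm w b (cn (%n \<tau>. A n \<tau> - B n \<tau>)) <= 2 * (wnorm w b (cn A) + wnorm w b (cn B))"
  by (rule wnorm_diff_le) auto
 also have "... < \<infinity>" using assms by (simp add: XX_def ennreal_mult_less_top)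
 finally show ?thesis by (simp add: XX_def)
qed

lemma XX_uminus: "A \<in> XX w b ==> (%n \<tau>. - A n \<tau>) \<in> XX w b"
 by (simp add: XX_def)

lemma time_slice_diff:
 assumes "A \<in> XX w b" "B \<in> XX w b" "!!n. w n > 0" "b > 1 / 2"
 shows "time_slice (%n \<tau>. A n \<tau> - B n \<tau>) t n = time_slice A t n - time_slice B t n"
 unfolding time_slice_eq_ift using assms by (intro ift_diff XX_integrable) auto

lemma time_slice_uminus: "time_slice (%n \<tau>. - A n \<tau>) t n = - time_slice A t n"
 unfolding time_slice_eq_ift using ift_cmult[of "-1" "A n" t] by simp

lemma slice_bound_wnorm:
 assumes "!!n. G n \<in> bmeas" "!!n. w n > 0"
 shows "ennreal ((w n * cmod (time_slice G t n))\<^sup>2) <= 2 * bracket_integral (2 * b) * wnorm w b (cn G)"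
 by (rule order_trans[OF slice_bound[where b = b]]) (use assms in \<open>auto simp: less_imp_le intro!: mult_left_mono wnorm_component_le\<close>)

context exponents

begin

definition contraction_const :: "ennreal => bool" where
 "contraction_const C \<longleftrightarrow> C < \<infinity> \<and>
  (\<forall>om E P \<delta>. submult om \<longrightarrow> E \<in> XX (wt om) b \<longrightarrow> P \<in> XX (wt om) b \<longrightarrow> 0 < \<delta> \<longrightarrow> \<delta> <= 1 \<longrightarrow>
   wnorm (wt om) b (cn (Duh \<delta> (st_conv E P))) <= C * ennreal (\<delta> powr (2 * (1 - a - b))) * (wnorm (wt om) b (cn E) * wnorm (wt om) b (cn P))) \<and>
  (\<forall>om G H \<delta>. submult om \<longrightarrow> G \<in> XX (wt om) b \<longrightarrow> H \<in> XX (wt om) b \<longrightarrow> 0 < \<delta> \<longrightarrow> \<delta> <= 1 \<longrightarrow>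
   wnorm (wt om) b (cn (%n \<xi>. Duh \<delta> (st_conv G G) n \<xi> - Duh \<delta> (st_conv H H) n \<xi>))
   <= C * ennreal (\<delta> powr (2 * (1 - a - b))) * (wnorm (wt om) b (cn (%n \<tau>. G n \<tau> - H n \<tau>)) * (wnorm (wt om) b (cn G) + wnorm (wt om) b (cn H))))"

lemma contraction_constD:
 assumes "contraction_const C"
 shows "C < \<infinity>"
  "!!om E P \<delta>. submult om ==> E \<in> XX (wt om) b ==> P \<in> XX (wt om) b ==> 0 < \<delta> ==> \<delta> <= 1 ==>
   wnorm (wt om) b (cn (Duh \<delta> (st_conv E P))) <= C * ennreal (\<delta> powr (2 * (1 - a - b))) * (wnorm (wt om) b (cn E) * wnorm (wt om) b (cn P))"
  "!!om G H \<delta>. submult om ==> G \<in> XX (wt om) b ==> H \<in> XX (wt om) b ==> 0 < \<delta> ==> \<delta> <= 1 ==>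
   wnorm (wt om) b (cn (%n \<xi>. Duh \<delta> (st_conv G G) n \<xi> - Duh \<delta> (st_conv H H) n \<xi>))
   <= C * ennreal (\<delta> powr (2 * (1 - a - b))) * (wnorm (wt om) b (cn (%n \<tau>. G n \<tau> - H n \<tau>)) * (wnorm (wt om) b (cn G) + wnorm (wt om) b (cn H)))"
 using assms unfolding contraction_const_def by simp_all

lemma contraction_const_exists: "\<exists>C. contraction_const C"
proof -
 obtain C1 where C1: "C1 < \<infinity>" "!!w h \<delta>. (!!n. w n >= 0) ==> (!!n. h n \<in> bmeas) ==> 0 < \<delta> ==> \<delta> <= 1 ==>
  wnorm w b (duh_major \<delta> h) <= C1 * ennreal (\<delta> powr (2 * (1 - a - b))) * wnorm w (- a) h"
  using duh_major_norm by blast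
 obtain C2 where C2: "C2 < \<infinity>" "!!w F1 F2 \<delta>. (!!n. w n > 0) ==>
  (!!n. F1 n \<in> bmeas) ==> (!!n. F2 n \<in> bmeas) ==>
  wnorm w (- a) (forcing (cn F1)) < \<infinity> ==> wnorm w (- a) (forcing (cn F2)) < \<infinity> ==> 0 < \<delta> ==> \<delta> <= 1 ==>
  wnorm w b (cn (%n \<xi>. Duh \<delta> F1 n \<xi> - Duh \<delta> F2 n \<xi>))
   <= C2 * ennreal (\<delta> powr (2 * (1 - a - b))) * wnorm w (- a) (forcing (cn (%n \<tau>. F1 n \<tau> - F2 n \<tau>)))"
  using Duh_diff_norm by blast
 obtain C3 where C3: "C3 < \<infinity>"
  "!!om f g. submult om ==> (!!m. f m \<in> bmeas) ==> (!!m. g m \<in> bmeas) ==>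
   wnorm (wt om) (- a) (forcing (convol f g)) <= C3 * (wnorm (wt om) b f * wnorm (wt om) b g)"
  using bilinear_estimate by blast
 show ?thesis
  unfolding contraction_const_def
 proof (rule exI[of _ "C1 * C3 + C2 * (2 * C3)"], intro conjI allI impI)
  show "C1 * C3 + C2 * (2 * C3) < \<infinity>" using C1(1) C2(1) C3(1) by (simp add: ennreal_mult_less_top)
 next
  fix om :: "int => real" and E P :: "int => real => complex" and \<delta> :: real
  assume om: "submult om" and E: "E \<in> XX (wt om) b" and P: "P \<in> XX (wt om) b" and \<delta>: "0 < \<delta>" "\<delta> <= 1"
  let ?N = "%A. wnorm (wt om) b (cn A)" and ?d = "ennreal (\<delta> powr (2 * (1 - a - b)))"
  have w: "wt om n > 0" "wt om n >= 0" for n using wt_pos[OF om, of n] by auto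
   note [measurable] = XX_measurable[OF E] XX_measurable[OF P]
   have "?N (Duh \<delta> (st_conv E P)) <= wnorm (wt om) b (duh_major \<delta> (forcing (convol (cn E) (cn P))))"
   proof (rule wnorm_mono)
    fix n \<tau>
    have "cn (Duh \<delta> (st_conv E P)) n \<tau> <= duh_major \<delta> (forcing (cn (st_conv E P))) n \<tau>"
     by (rule Duh_le_major) measurable
    also have "... <= duh_major \<delta> (forcing (convol (cn E) (cn P))) n \<tau>"
     unfolding duh_major_def by (intro nn_integral_mono mult_left_mono norm_st_conv_le) auto
    finally show "cn (Duh \<delta> (st_conv E P)) n \<tau> <= duh_major \<delta> (forcing (convol (cn E) (cn P))) n \<tau>" .
   qed
   also have "... <= C1 * ?d * wnorm (wt om) (- a) (forcing (convol (cn E) (cn P)))"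
    by (rule C1(2)) (use w \<delta> in auto)
   also have "... <= C1 * ?d * (C3 * (?N E * ?N P))"
    using om by (intro mult_left_mono C3(2)) auto
   also have "... = (C1 * C3) * ?d * (?N E * ?N P)" by (simp only: mult_ac)
   also have "... <= (C1 * C3 + C2 * (2 * C3)) * ?d * (?N E * ?N P)" by (intro mult_right_mono) auto
   finally show "?N (Duh \<delta> (st_conv E P)) <= (C1 * C3 + C2 * (2 * C3)) * ?d * (?N E * ?N P)" .
 next
  fix om :: "int => real" and G H :: "int => real => complex" and \<delta> :: real
  assume om: "submult om" and G: "G \<in> XX (wt om) b" and H: "H \<in> XX (wt om) b" and \<delta>: "0 < \<delta>" "\<delta> <= 1"
  let ?N = "%A. wnorm (wt om) b (cn A)" and ?d = "ennreal (\<delta> powr (2 * (1 - a - b)))"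
  have w: "wt om n > 0" "wt om n >= 0" for n using wt_pos[OF om, of n] by auto
   note [measurable] = XX_measurable[OF G] XX_measurable[OF H]
   let ?D = "%n \<tau>. G n \<tau> - H n \<tau>"
   let ?cGD = "convol (cn ?D) (cn G)" and ?cHD = "convol (cn H) (cn ?D)"
   have "?N (%n \<xi>. Duh \<delta> (st_conv G G) n \<xi> - Duh \<delta> (st_conv H H) n \<xi>)
     <= C2 * ?d * wnorm (wt om) (- a) (forcing (cn (%n \<tau>. st_conv G G n \<tau> - st_conv H H n \<tau>)))"
    using forcing_st_conv_finite[OF om G G] forcing_st_conv_finite[OF om H H] w \<delta> by (intro C2(2)) auto
   also have "wnorm (wt om) (- a) (forcing (cn (%n \<tau>. st_conv G G n \<tau> - st_conv H H n \<tau>)))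
     <= wnorm (wt om) (- a) (%n \<tau>. forcing ?cGD n \<tau> + forcing ?cHD n \<tau>)"
   proof (rule wnorm_mono_AE)
    fix n
    show "AE \<tau> in lborel. forcing (cn (%n \<tau>. st_conv G G n \<tau> - st_conv H H n \<tau>)) n \<tau> <= forcing ?cGD n \<tau> + forcing ?cHD n \<tau>"
    proof (cases "n = 0")
     case False
     show ?thesis using AE_convol_finite[OF om G G False] AE_convol_finite[OF om H H False]
     proof eventually_elim
      case (elim \<tau>)
      show ?case unfolding distrib_left[symmetric]
       by (intro mult_left_mono st_square_diff_le) (use elim in auto)
     qed
    qed simp
   qed
   also have "... <= 2 * (wnorm (wt om) (- a) (forcing ?cGD) + wnorm (wt om) (- a) (forcing ?cHD))"
    by (rule wnorm_add_le) measurable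
   also have "... <= 2 * (C3 * (?N ?D * ?N G) + C3 * (?N H * ?N ?D))"
    using om by (intro mult_left_mono add_mono C3(2)) auto
   also have "... = (2 * C3) * (?N ?D * (?N G + ?N H))" by (simp only: distrib_left mult_ac)
   finally have "?N (%n \<xi>. Duh \<delta> (st_conv G G) n \<xi> - Duh \<delta> (st_conv H H) n \<xi>)
     <= C2 * ?d * ((2 * C3) * (?N ?D * (?N G + ?N H)))" by (simp add: mult_left_mono)
   also have "... = (C2 * (2 * C3)) * ?d * (?N ?D * (?N G + ?N H))" by (simp only: mult_ac)
   also have "... <= (C1 * C3 + C2 * (2 * C3)) * ?d * (?N ?D * (?N G + ?N H))" by (intro mult_right_mono) auto
   finally show "?N (%n \<xi>. Duh \<delta> (st_conv G G) n \<xi> - Duh \<delta> (st_conv H H) n \<xi>)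
     <= (C1 * C3 + C2 * (2 * C3)) * ?d * (?N ?D * (?N G + ?N H))" .
 qed
qed

lemma Duh_XX:
 assumes om: "submult om" and E: "E \<in> XX (wt om) b" and P: "P \<in> XX (wt om) b" and \<delta>: "0 < \<delta>" "\<delta> <= 1"
 shows "Duh \<delta> (st_conv E P) \<in> XX (wt om) b"
  and "t \<in> {0..\<delta>} ==> time_slice (Duh \<delta> (st_conv E P)) t n = (\<Sum>\<^sub>\<infinity>m. mode_duhamel (time_slice E) (time_slice P) t n m)"
proof -
 note [measurable] = XX_measurable[OF E] XX_measurable[OF P]
 obtain C where C: "contraction_const C" using contraction_const_exists by blast
 have "wnorm (wt om) b (cn (Duh \<delta> (st_conv E P))) < \<infinity>"
  by (rule le_less_trans[OF contraction_constD(2)[OF C om E P \<delta>]])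
    (use contraction_constD(1)[OF C] XX_finite[OF E] XX_finite[OF P] in \<open>simp add: ennreal_mult_less_top\<close>)
 then show "Duh \<delta> (st_conv E P) \<in> XX (wt om) b" by (simp add: XX_def)
 assume t: "t \<in> {0..\<delta>}"
 have "time_slice (Duh \<delta> (st_conv E P)) t n = duhamel_of (st_conv E P) t n"
  by (rule slice_Duh[OF _ wt_pos[OF om] forcing_st_conv_finite[OF om E P] \<delta> t]) measurable
 then show "time_slice (Duh \<delta> (st_conv E P)) t n = (\<Sum>\<^sub>\<infinity>m. mode_duhamel (time_slice E) (time_slice P) t n m)"
  using duhamel_of_st_conv(1)[OF om E P] t by simp
qed

lemma lin_ext_XX:
 assumes om: "submult om" and fin: "data_norm (wt om) \<phi> \<psi> < \<infinity>"
 shows "lin_ext \<phi> \<psi> \<in> XX (wt om) b"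
proof -
 obtain C where C: "C < \<infinity>" "!!w \<phi> \<psi>. (!!n. w n >= 0) ==> wnorm w b (cn (lin_ext \<phi> \<psi>)) <= C * data_norm w \<phi> \<psi>"
  using lin_ext_norm by blast
 have "wnorm (wt om) b (cn (lin_ext \<phi> \<psi>)) < \<infinity>"
  by (rule le_less_trans[OF C(2)]) (use C(1) fin wt_pos[OF om] in \<open>auto simp: less_imp_le ennreal_mult_less_top\<close>)
 then show ?thesis by (simp add: XX_def)
qed

end

section \<open>The contraction argument\<close>

lemma small_power:
 fixes C :: ennreal and p e :: real
 assumes "C < \<infinity>" "p > 0" "e > 0"
 obtains d where "0 < d" "d <= 1" "!!\<delta>. 0 < \<delta> ==> \<delta> <= d ==> C * ennreal (\<delta> powr p) <= ennreal e"
proof -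
 define c where "c = enn2real C"
 have C: "C = ennreal c" "c >= 0" using assms(1) by (auto simp: c_def)
 define q where "q = e / (c + 1)"
 have q: "q > 0" using assms C by (simp add: q_def)
 define d where "d = min 1 (q powr (1 / p))"
 have "C * ennreal (\<delta> powr p) <= ennreal e" if \<delta>: "0 < \<delta>" "\<delta> <= d" for \<delta>
 proof -
  have "\<delta> powr p <= (q powr (1 / p)) powr p"
   using \<delta> assms by (intro powr_mono2) (auto simp: d_def)
  also have "... = q" using q assms by (simp add: powr_powr)
  finally have "c * \<delta> powr p <= c * q" using C by (intro mult_left_mono)
  also have "... <= (c + 1) * q" using q by (intro mult_right_mono) auto
  also have "... = e" using C by (simp add: q_def)
  finally show ?thesis using C by (simp add: ennreal_leI flip: ennreal_mult)
 qed
 then show ?thesis using q by (intro that[of d]) (auto simp: d_def)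
qed

lemma ennreal_geometric_zero:
 fixes x :: ennreal
 assumes "!!k. x <= ennreal (c / 16 ^ k)"
 shows "x = 0"
proof -
 have "(%k. c * (1 / 16) ^ k) \<longlonglongrightarrow> c * 0"
  by (intro tendsto_intros LIMSEQ_power_zero) auto
 then have "(%k. ennreal (c / 16 ^ k)) \<longlonglongrightarrow> ennreal 0"
  by (intro tendsto_ennrealI) (simp add: power_one_over)
 then have "x <= ennreal 0" by (rule LIMSEQ_le_const) (use assms in auto)
 then show ?thesis by simp
qed

lemma ennreal_absorb:
 fixes x y :: ennreal
 assumes "x < \<infinity>" "x <= y + ennreal (1 / 2) * x"
 shows "x <= 2 * y"
proof (cases "y = \<infinity>")
 case True
 then show ?thesis by (simp add: ennreal_mult_top)
next
 case False
 then obtain r s where rs: "x = ennreal r" "y = ennreal s" "r >= 0" "s >= 0"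
  using assms(1) by (cases x; cases y) auto
 have "ennreal s + ennreal (1 / 2) * ennreal r = ennreal (s + 1 / 2 * r)"
  using rs by (simp only: ennreal_plus ennreal_mult mult_nonneg_nonneg zero_le_divide_1_iff zero_le_numeral)
 with assms(2) have "ennreal r <= ennreal (s + 1 / 2 * r)" unfolding rs by simp
 then have "r <= s + 1 / 2 * r" using rs by (subst (asm) ennreal_le_iff) auto
 then have "ennreal r <= ennreal (2 * s)" by (intro ennreal_leI) simp
 also have "... = 2 * ennreal s" using rs by (subst ennreal_mult) auto
 finally show ?thesis unfolding rs .
qed

context exponents

begin

abbreviation N :: "(int => real) => (int => real => complex) => ennreal" where
 "N om G \<equiv> wnorm (wt om) b (cn G)"

definition Phi :: "real => (int => complex) => (int => complex) => (int => real => complex) => int => real => complex" where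
 "Phi \<delta> \<phi> \<psi> G n \<tau> = lin_ext \<phi> \<psi> n \<tau> - Duh \<delta> (st_conv G G) n \<tau>"

text \<open>Equality up to null sets, which is all that the norm sees.\<close>

definition fixed :: "real => (int => real) => (int => complex) => (int => complex) => (int => real => complex) => bool" where
 "fixed \<delta> om \<phi> \<psi> G \<longleftrightarrow> G \<in> XX (wt om) b \<and> N om (%n \<tau>. G n \<tau> - Phi \<delta> \<phi> \<psi> G n \<tau>) = 0"

lemma Phi_XX:
 assumes "submult om" "data_norm (wt om) \<phi> \<psi> < \<infinity>" "G \<in> XX (wt om) b" "0 < \<delta>" "\<delta> <= 1"
 shows "Phi \<delta> \<phi> \<psi> G \<in> XX (wt om) b"
 using XX_diff[OF lin_ext_XX[OF assms(1,2)] Duh_XX(1)[OF assms(1,3,3,4,5)]]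
 by (simp add: Phi_def[abs_def])

lemma fixed_slice:
 assumes om: "submult om" and fin: "data_norm (wt om) \<phi> \<psi> < \<infinity>" and G: "fixed \<delta> om \<phi> \<psi> G"
  and \<delta>: "0 < \<delta>" "\<delta> <= 1" and t: "t \<in> {0..\<delta>}"
 shows "time_slice G t n = Vc t n * \<phi> n + Vs t n * dx \<psi> n - (\<Sum>\<^sub>\<infinity>m. mode_duhamel (time_slice G) (time_slice G) t n m)"
proof -
 have GX: "G \<in> XX (wt om) b" and zero: "N om (%n \<tau>. G n \<tau> - Phi \<delta> \<phi> \<psi> G n \<tau>) = 0"
  using G by (auto simp: fixed_def)
 note PX = Phi_XX[OF om fin GX \<delta>] and LX = lin_ext_XX[OF om fin] and DX = Duh_XX[OF om GX GX \<delta>]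
 note w = wt_pos[OF om]
 have "ennreal ((wt om n * cmod (time_slice (%n \<tau>. G n \<tau> - Phi \<delta> \<phi> \<psi> G n \<tau>) t n))\<^sup>2) <= 2 * bracket_integral (2 * b) * 0"
  unfolding zero[symmetric] by (rule slice_bound_wnorm) (use XX_diff[OF GX PX] w in \<open>auto simp: XX_def\<close>)
 then have "time_slice (%n \<tau>. G n \<tau> - Phi \<delta> \<phi> \<psi> G n \<tau>) t n = 0"
  using w[of n] by (simp add: ennreal_eq_0_iff)
 then have "time_slice G t n = time_slice (Phi \<delta> \<phi> \<psi> G) t n"
  using time_slice_diff[OF GX PX w b_gt] by simp
 also have "... = time_slice (lin_ext \<phi> \<psi>) t n - time_slice (Duh \<delta> (st_conv G G)) t n"
  unfolding Phi_def[abs_def] by (rule time_slice_diff[OF LX DX(1) w b_gt])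
 also have "... = Vc t n * \<phi> n + Vs t n * dx \<psi> n - (\<Sum>\<^sub>\<infinity>m. mode_duhamel (time_slice G) (time_slice G) t n m)"
  using lin_ext_slice[of t \<phi> \<psi> n] DX(2)[OF t, of n] t \<delta> by simp
 finally show ?thesis .
qed

text \<open>The size of \<open>\<delta>\<close> depends on \<open>om\<close> only through the bound \<open>M\<close> on the data.\<close>

lemma local_theory:
 obtains K :: real where "K >= 0"
  "!!M. M >= 0 ==> \<exists>r d. 0 < d \<and> d <= 1 \<and> (\<forall>\<delta> om. 0 < \<delta> \<longrightarrow> \<delta> <= d \<longrightarrow> submult om \<longrightarrow>
   (\<forall>\<phi> \<psi>. data_norm (wt om) \<phi> \<psi> <= ennreal M \<longrightarrow> (\<exists>G. fixed \<delta> om \<phi> \<psi> G \<and> N om G <= ennreal r)) \<and>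
   (\<forall>\<phi> \<psi> \<phi>' \<psi>' G H. data_norm (wt om) \<phi> \<psi> <= ennreal M \<longrightarrow> data_norm (wt om) \<phi>' \<psi>' <= ennreal M \<longrightarrow>
    fixed \<delta> om \<phi> \<psi> G \<longrightarrow> fixed \<delta> om \<phi>' \<psi>' H \<longrightarrow> N om G <= ennreal r \<longrightarrow> N om H <= ennreal r \<longrightarrow>
    N om (%n \<tau>. G n \<tau> - H n \<tau>) <= ennreal K * data_norm (wt om) (%n. \<phi> n - \<phi>' n) (%n. \<psi> n - \<psi>' n)))"
proof -
 obtain Cl where Cl: "Cl < \<infinity>" "!!w \<phi> \<psi>. (!!n. w n >= 0) ==> wnorm w b (cn (lin_ext \<phi> \<psi>)) <= Cl * data_norm w \<phi> \<psi>"
  using lin_ext_norm by blast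
 define cl where "cl = enn2real Cl"
 have cl: "Cl = ennreal cl" "cl >= 0" using Cl(1) by (auto simp: cl_def)
 obtain C where C: "contraction_const C" using contraction_const_exists by blast
 have theta: "2 * (1 - a - b) > 0" using ab by simp
 have main: "\<exists>r d. 0 < d \<and> d <= 1 \<and> (\<forall>\<delta> om. 0 < \<delta> \<longrightarrow> \<delta> <= d \<longrightarrow> submult om \<longrightarrow>
   (\<forall>\<phi> \<psi>. data_norm (wt om) \<phi> \<psi> <= ennreal M \<longrightarrow> (\<exists>G. fixed \<delta> om \<phi> \<psi> G \<and> N om G <= ennreal r)) \<and>
   (\<forall>\<phi> \<psi> \<phi>' \<psi>' G H. data_norm (wt om) \<phi> \<psi> <= ennreal M \<longrightarrow> data_norm (wt om) \<phi>' \<psi>' <= ennreal M \<longrightarrow>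
    fixed \<delta> om \<phi> \<psi> G \<longrightarrow> fixed \<delta> om \<phi>' \<psi>' H \<longrightarrow> N om G <= ennreal r \<longrightarrow> N om H <= ennreal r \<longrightarrow>
    N om (%n \<tau>. G n \<tau> - H n \<tau>) <= ennreal (16 * cl) * data_norm (wt om) (%n. \<phi> n - \<phi>' n) (%n. \<psi> n - \<psi>' n)))"
  if M: "M >= 0" for M
 proof -
  define r where "r = 4 * cl * M + 1"
  have r: "r >= 1" "2 * (cl * M) <= r / 2" using M cl by (auto simp: r_def)
  define e where "e = 1 / (1000 * r)"
  have e: "e > 0" "e * r = 1 / 1000" using r by (auto simp: e_def)
  obtain d where d: "0 < d" "d <= 1" "!!\<delta>. 0 < \<delta> ==> \<delta> <= d ==> C * ennreal (\<delta> powr (2 * (1 - a - b))) <= ennreal e"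
   using small_power[OF contraction_constD(1)[OF C] theta e(1)] by blast
  have step: "N om (%n \<tau>. Phi \<delta> \<phi> \<psi> A n \<tau> - Phi \<delta> \<phi> \<psi> B n \<tau>) <= ennreal (e * R) * N om (%n \<tau>. A n \<tau> - B n \<tau>)"
   if "0 < \<delta>" "\<delta> <= d" "submult om" "A \<in> XX (wt om) b" "B \<in> XX (wt om) b" "N om A + N om B <= ennreal R" "R >= 0"
   for \<delta> om A B R \<phi> \<psi>
  proof -
   have "N om (%n \<tau>. Phi \<delta> \<phi> \<psi> A n \<tau> - Phi \<delta> \<phi> \<psi> B n \<tau>) = N om (%n \<tau>. Duh \<delta> (st_conv A A) n \<tau> - Duh \<delta> (st_conv B B) n \<tau>)"
    by (simp add: Phi_def norm_minus_commute)
   also have "... <= C * ennreal (\<delta> powr (2 * (1 - a - b))) * (N om (%n \<tau>. A n \<tau> - B n \<tau>) * (N om A + N om B))"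
    using that d(2) by (intro contraction_constD(3)[OF C]) auto
   also have "... <= ennreal e * (N om (%n \<tau>. A n \<tau> - B n \<tau>) * ennreal R)"
    using that d(3) by (intro mult_mono) auto
   also have "... = ennreal (e * R) * N om (%n \<tau>. A n \<tau> - B n \<tau>)"
    using e that by (simp add: ennreal_mult mult_ac)
   finally show ?thesis .
  qed
  have exist: "\<exists>G. fixed \<delta> om \<phi> \<psi> G \<and> N om G <= ennreal (4 * r)"
   if \<delta>: "0 < \<delta>" "\<delta> <= d" and om: "submult om" and data: "data_norm (wt om) \<phi> \<psi> <= ennreal M" for \<delta> om \<phi> \<psi>
  proof -
   have fin: "data_norm (wt om) \<phi> \<psi> < \<infinity>" using data by (rule le_less_trans) simp
   have w: "wt om n > 0" for n by (rule wt_pos[OF om])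
   have \<delta>1: "\<delta> <= 1" using \<delta> d by simp
   define G where "G k = ((Phi \<delta> \<phi> \<psi>) ^^ k) (%_ _. 0)" for k
   have G0: "G 0 = (%_ _. 0)" and GS: "G (Suc k) = Phi \<delta> \<phi> \<psi> (G k)" for k by (simp_all add: G_def)
   have ball: "N om (Phi \<delta> \<phi> \<psi> A) <= ennreal r" if A: "A \<in> XX (wt om) b" "N om A <= ennreal r" for A
   proof -
    note [measurable] = XX_measurable[OF lin_ext_XX[OF om fin]] XX_measurable[OF Duh_XX(1)[OF om A(1) A(1) \<delta>(1) \<delta>1]]
    have "N om (Phi \<delta> \<phi> \<psi> A) <= 2 * (N om (lin_ext \<phi> \<psi>) + N om (Duh \<delta> (st_conv A A)))"
     unfolding Phi_def[abs_def] by (rule wnorm_diff_le) auto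
    also have "... <= 2 * (ennreal cl * ennreal M + ennreal e * (ennreal r * ennreal r))"
    proof (intro mult_left_mono add_mono)
     show "N om (lin_ext \<phi> \<psi>) <= ennreal cl * ennreal M"
      by (rule order_trans[OF Cl(2)]) (use w data in \<open>auto simp: less_imp_le cl intro!: mult_left_mono\<close>)
     have "N om (Duh \<delta> (st_conv A A)) <= C * ennreal (\<delta> powr (2 * (1 - a - b))) * (N om A * N om A)"
      by (rule contraction_constD(2)[OF C om A(1) A(1) \<delta>(1) \<delta>1])
     also have "... <= ennreal e * (ennreal r * ennreal r)"
      by (intro mult_mono d(3) \<delta> A) auto
     finally show "N om (Duh \<delta> (st_conv A A)) <= ennreal e * (ennreal r * ennreal r)" .
    qed auto
    also have "... = ennreal (2 * (cl * M + e * (r * r)))"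
    proof -
     have "ennreal (2 * (x * y + z * (u * u))) = 2 * (ennreal x * ennreal y + ennreal z * (ennreal u * ennreal u))"
      if "x >= 0" "y >= 0" "z >= 0" "u >= 0" for x y z u :: real
      using that by (simp only: ennreal_mult_plus[of 2] ennreal_mult mult_nonneg_nonneg zero_le_numeral ennreal_numeral)
     from this[of cl M e r] show ?thesis using cl M e r by simp
    qed
    also have "... <= ennreal r"
    proof (rule ennreal_leI)
     have er: "e * (r * r) = r / 1000" using e(2) by (simp add: mult.assoc[symmetric])
     show "2 * (cl * M + e * (r * r)) <= r" unfolding er distrib_left using r by linarith
    qed
    finally show ?thesis .
   qed
   have GX: "G k \<in> XX (wt om) b \<and> N om (G k) <= ennreal r" for k
   proof (induction k)
    case 0
    have "wnorm (wt om) b (cn (%_ _. 0)) = 0" by (simp add: wnorm_def)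
    then show ?case by (simp add: G0 XX_def)
   next
    case (Suc k)
    then show ?case using Phi_XX[OF om fin _ \<delta>(1) \<delta>1] ball by (simp add: GS)
   qed
   have twice: "N om A + N om B <= ennreal (R1 + R2)" if "N om A <= ennreal R1" "N om B <= ennreal R2" "R1 >= 0" "R2 >= 0" for A B R1 R2
    using add_mono[OF that(1,2)] that(3,4) by simp
   have diff: "N om (%n \<tau>. G (Suc k) n \<tau> - G k n \<tau>) <= ennreal (r / 16 ^ k)" for k
   proof (induction k)
    case 0
    then show ?case using GX[of 1] by (simp add: G0)
   next
    case (Suc k)
    have "N om (%n \<tau>. G (Suc (Suc k)) n \<tau> - G (Suc k) n \<tau>) <= ennreal (e * (r + r)) * N om (%n \<tau>. G (Suc k) n \<tau> - G k n \<tau>)"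
     using GX[of k] GX[of "Suc k"] r
     unfolding GS[of "Suc k"] by (subst (2) GS) (intro step \<delta> om twice; simp)
    also have "... <= ennreal (1 / 16) * ennreal (r / 16 ^ k)"
     using e r by (intro mult_mono Suc ennreal_leI) (auto simp: distrib_left)
    also have "... = ennreal (1 / 16 * (r / 16 ^ k))" using r by (subst ennreal_mult) auto
    finally show ?case by simp
   qed
   obtain L where L [measurable]: "!!n. L n \<in> bmeas"
    and LG: "!!k. N om (%n \<tau>. L n \<tau> - G k n \<tau>) <= ennreal (4 * r / 16 ^ k)"
    using XX_complete[of G r "wt om" b] GX r w diff by (auto simp: XX_def)
   have LN: "N om L <= ennreal (4 * r)" using LG[of 0] by (simp add: G0)
   then have LX: "L \<in> XX (wt om) b" using L by (auto simp: XX_def intro: le_less_trans)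
   note PX = Phi_XX[OF om fin _ \<delta>(1) \<delta>1]
   have "N om (%n \<tau>. L n \<tau> - Phi \<delta> \<phi> \<psi> L n \<tau>) <= ennreal (r / 16 ^ k)" for k
   proof -
    note [measurable] = XX_measurable[OF PX[OF LX]] XX_measurable[OF conjunct1[OF GX[of "Suc k"]]]
    have "N om (%n \<tau>. L n \<tau> - Phi \<delta> \<phi> \<psi> L n \<tau>)
     <= 2 * (N om (%n \<tau>. L n \<tau> - G (Suc k) n \<tau>) + N om (%n \<tau>. G (Suc k) n \<tau> - Phi \<delta> \<phi> \<psi> L n \<tau>))"
     by (rule wnorm_triangle) auto
    also have "... <= 2 * (ennreal (4 * r / 16 ^ Suc k) + ennreal (e * (r + 4 * r)) * ennreal (4 * r / 16 ^ k))"
    proof (intro mult_left_mono add_mono LG)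
     have "N om (%n \<tau>. G (Suc k) n \<tau> - Phi \<delta> \<phi> \<psi> L n \<tau>) <= ennreal (e * (r + 4 * r)) * N om (%n \<tau>. G k n \<tau> - L n \<tau>)"
      unfolding GS using GX[of k] LX LN r by (intro step \<delta> om twice) auto
     also have "N om (%n \<tau>. G k n \<tau> - L n \<tau>) <= ennreal (4 * r / 16 ^ k)"
      using LG[of k] by (simp add: norm_minus_commute)
     finally show "N om (%n \<tau>. G (Suc k) n \<tau> - Phi \<delta> \<phi> \<psi> L n \<tau>) <= ennreal (e * (r + 4 * r)) * ennreal (4 * r / 16 ^ k)"
      by (simp add: mult_left_mono)
    qed auto
    also have "... = ennreal (2 * (4 * r / 16 ^ Suc k + (e * (r + 4 * r)) * (4 * r / 16 ^ k)))"
    proof -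
     have "ennreal (2 * (x + y * z)) = 2 * (ennreal x + ennreal y * ennreal z)" if "x >= 0" "y >= 0" "z >= 0" for x y z :: real
      using that by (simp only: ennreal_mult_plus[of 2] ennreal_mult[of y] mult_nonneg_nonneg zero_le_numeral ennreal_numeral)
     from this[of "4 * r / 16 ^ Suc k" "e * (r + 4 * r)" "4 * r / 16 ^ k"] show ?thesis using r e(1) by simp
    qed
    also have "... <= ennreal (r / 16 ^ k)"
    proof (rule ennreal_leI)
     define q where "q = r / 16 ^ k"
     have q: "q >= 0" using r by (simp add: q_def)
     have 1: "e * (r + 4 * r) = 5 / 1000" using e(2) by (simp add: distrib_left)
     have 2: "4 * r / 16 ^ Suc k = q / 4" "4 * r / 16 ^ k = 4 * q" by (simp_all add: q_def)
     show "2 * (4 * r / 16 ^ Suc k + e * (r + 4 * r) * (4 * r / 16 ^ k)) <= r / 16 ^ k"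
      unfolding 1 2 q_def[symmetric] using q by simp
    qed
    finally show ?thesis .
   qed
   then have "N om (%n \<tau>. L n \<tau> - Phi \<delta> \<phi> \<psi> L n \<tau>) = 0" by (rule ennreal_geometric_zero)
   then show ?thesis using LX LN by (auto simp: fixed_def)
  qed
  have lip: "N om (%n \<tau>. G n \<tau> - H n \<tau>) <= ennreal (16 * cl) * data_norm (wt om) (%n. \<phi> n - \<phi>' n) (%n. \<psi> n - \<psi>' n)"
   if \<delta>: "0 < \<delta>" "\<delta> <= d" and om: "submult om" and data: "data_norm (wt om) \<phi> \<psi> <= ennreal M" "data_norm (wt om) \<phi>' \<psi>' <= ennreal M"
    and G: "fixed \<delta> om \<phi> \<psi> G" and H: "fixed \<delta> om \<phi>' \<psi>' H" and NG: "N om G <= ennreal (4 * r)" and NH: "N om H <= ennreal (4 * r)"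
   for \<delta> om \<phi> \<psi> \<phi>' \<psi>' G H
  proof -
   have fin: "data_norm (wt om) \<phi> \<psi> < \<infinity>" "data_norm (wt om) \<phi>' \<psi>' < \<infinity>" using data by (auto intro: le_less_trans)
   have \<delta>1: "\<delta> <= 1" using \<delta> d by simp
   have w: "wt om n > 0" for n by (rule wt_pos[OF om])
   have GX: "G \<in> XX (wt om) b" "N om (%n \<tau>. G n \<tau> - Phi \<delta> \<phi> \<psi> G n \<tau>) = 0"
    and HX: "H \<in> XX (wt om) b" "N om (%n \<tau>. H n \<tau> - Phi \<delta> \<phi>' \<psi>' H n \<tau>) = 0"
    using G H by (auto simp: fixed_def)
   note PG = Phi_XX[OF om fin(1) GX(1) \<delta>(1) \<delta>1] and PH = Phi_XX[OF om fin(2) HX(1) \<delta>(1) \<delta>1]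
   note DG = Duh_XX(1)[OF om GX(1) GX(1) \<delta>(1) \<delta>1] and DH = Duh_XX(1)[OF om HX(1) HX(1) \<delta>(1) \<delta>1]
   note [measurable] = XX_measurable[OF GX(1)] XX_measurable[OF HX(1)] XX_measurable[OF PG] XX_measurable[OF PH]
    XX_measurable[OF DG] XX_measurable[OF DH]
   let ?x = "N om (%n \<tau>. G n \<tau> - H n \<tau>)" and ?A = "data_norm (wt om) (%n. \<phi> n - \<phi>' n) (%n. \<psi> n - \<psi>' n)"
   let ?y = "N om (%n \<tau>. Phi \<delta> \<phi> \<psi> G n \<tau> - Phi \<delta> \<phi>' \<psi>' H n \<tau>)"
   have "?x <= 2 * (N om (%n \<tau>. G n \<tau> - Phi \<delta> \<phi> \<psi> G n \<tau>) + N om (%n \<tau>. Phi \<delta> \<phi> \<psi> G n \<tau> - H n \<tau>))"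
    by (rule wnorm_triangle) auto
   also have "N om (%n \<tau>. Phi \<delta> \<phi> \<psi> G n \<tau> - H n \<tau>) <= 2 * (?y + N om (%n \<tau>. Phi \<delta> \<phi>' \<psi>' H n \<tau> - H n \<tau>))"
    by (rule wnorm_triangle) auto
   also have "N om (%n \<tau>. Phi \<delta> \<phi>' \<psi>' H n \<tau> - H n \<tau>) = 0"
    using HX(2) by (simp add: norm_minus_commute)
   finally have x_y: "?x <= 4 * ?y" unfolding GX(2) by (simp add: mult_left_mono mult.assoc[symmetric])
   let ?u = "%n \<tau>. lin_ext (%n. \<phi> n - \<phi>' n) (%n. \<psi> n - \<psi>' n) n \<tau>"
   let ?v = "%n \<tau>. Duh \<delta> (st_conv G G) n \<tau> - Duh \<delta> (st_conv H H) n \<tau>"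
   have "?y = N om (%n \<tau>. ?u n \<tau> - ?v n \<tau>)"
    unfolding lin_ext_diff[symmetric] Phi_def by (simp add: algebra_simps)
   also have "... <= 2 * (N om ?u + N om ?v)"
    by (rule wnorm_diff_le) auto
   also have "... <= 2 * (ennreal cl * ?A + ennreal (8 / 1000) * ?x)"
   proof (intro mult_left_mono add_mono)
    show "N om ?u <= ennreal cl * ?A"
     unfolding cl(1)[symmetric] by (rule Cl(2)) (use w in \<open>simp add: less_imp_le\<close>)
    have "N om ?v <= C * ennreal (\<delta> powr (2 * (1 - a - b))) * (?x * (N om G + N om H))"
     by (rule contraction_constD(3)[OF C om GX(1) HX(1) \<delta>(1) \<delta>1])
    also have "... <= ennreal e * (?x * (ennreal (4 * r) + ennreal (4 * r)))"
     by (intro mult_mono add_mono d(3) \<delta> NG NH order_refl) auto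
    also have "... = ennreal (e * (8 * r)) * ?x"
    proof -
     have "ennreal (4 * r) + ennreal (4 * r) = ennreal (8 * r)"
      using r ennreal_plus[of "4 * r" "4 * r"] by simp
     then have "ennreal e * (x * (ennreal (4 * r) + ennreal (4 * r))) = ennreal (e * (8 * r)) * x" for x
     proof -
      have "ennreal (e * (8 * r)) = ennreal e * ennreal (8 * r)"
       by (rule ennreal_mult) (use e r in auto)
      then show ?thesis using \<open>ennreal (4 * r) + ennreal (4 * r) = ennreal (8 * r)\<close> by (simp only: mult_ac)
     qed
     then show ?thesis .
    qed
    also have "e * (8 * r) = 8 / 1000" using e(2) by simp
    finally show "N om ?v <= ennreal (8 / 1000) * ?x" .
   qed auto
   finally have "?x <= 4 * (2 * (ennreal cl * ?A + ennreal (8 / 1000) * ?x))"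
    using x_y by (meson mult_left_mono order_trans zero_le)
   also have "... = 8 * (ennreal cl * ?A) + ennreal (64 / 1000) * ?x"
   proof -
    have "8 * ennreal (8 / 1000) = ennreal (64 / 1000)"
     using ennreal_mult[of 8 "8 / 1000"] by simp
    then show ?thesis by (simp add: distrib_left mult.assoc[symmetric])
   qed
   also have "... <= 8 * (ennreal cl * ?A) + ennreal (1 / 2) * ?x"
    by (intro add_left_mono mult_right_mono ennreal_leI) auto
   finally have "?x <= 2 * (8 * (ennreal cl * ?A))"
    using XX_finite[OF XX_diff[OF GX(1) HX(1)]] by (intro ennreal_absorb)
   also have "... = ennreal (16 * cl) * ?A"
    using cl by (simp add: ennreal_mult mult.assoc[symmetric])
   finally show ?thesis .
  qed
  show ?thesis
   by (rule exI[of _ "4 * r"], rule exI[of _ d], intro conjI allI impI d(1,2); (rule exist | rule lip); assumption)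
 qed
 show ?thesis by (rule that[OF _ main]) (use cl in simp)
qed

end

section \<open>Uniqueness\<close>

text \<open>Multiplication by \<open>e\<^bsup>it\<^sub>0\<tau>\<^esup>\<close> translates the time slices by \<open>t\<^sub>0\<close> and preserves all norms.\<close>

definition time_shift :: "real => (int => real => complex) => int => real => complex" where
 "time_shift t0 G n \<tau> = iexp (t0 * \<tau>) * G n \<tau>"

lemma time_shift_norm: "cn (time_shift t0 G) = cn G"
 by (intro ext) (simp add: time_shift_def norm_mult)

lemma time_shift_measurable [measurable]:
 assumes [measurable]: "G n \<in> bmeas"
 shows "time_shift t0 G n \<in> bmeas"
 unfolding time_shift_def[abs_def] by measurable

lemma time_shift_XX: "G \<in> XX w b ==> time_shift t0 G \<in> XX w b"
 unfolding XX_def mem_Collect_eq time_shift_norm by (auto intro: time_shift_measurable)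

lemma time_shift_slice: "time_slice (time_shift t0 G) r n = time_slice G (t0 + r) n"
 unfolding time_slice_def time_shift_def
 by (simp add: mult.assoc[symmetric] distrib_right distrib_left add.commute flip: exp_add)

lemma mode_duhamel_shift:
 assumes vanish: "!!t'. t' \<in> {0..t0} ==> e t' m * p t' (n - m) = 0" and t0: "t0 >= 0"
 shows "mode_duhamel e p (t0 + r) n m = mode_duhamel (%t. e (t0 + t)) (%t. p (t0 + t)) r n m"
proof -
 let ?f = "%t'. Vs (t0 + r - t') n * (- (of_int n)\<^sup>2 * (e t' m * p t' (n - m)))"
 have "mode_duhamel e p (t0 + r) n m = (LINT t'|lborel. indicator {0..t0 + r} t' *\<^sub>R ?f t')"
  by (simp add: mode_duhamel_def set_lebesgue_integral_def)
 also have "... = \<bar>1\<bar> *\<^sub>R (LINT t'|lborel. indicator {0..t0 + r} (t0 + 1 * t') *\<^sub>R ?f (t0 + 1 * t'))"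
  by (rule lborel_integral_real_affine) simp
 also have "... = (LINT t'|lborel. indicator {0..r} t' *\<^sub>R (Vs (r - t') n * (- (of_int n)\<^sup>2 * (e (t0 + t') m * p (t0 + t') (n - m)))))"
 proof -
  have "indicator {0..t0 + r} (t0 + 1 * t') *\<^sub>R ?f (t0 + 1 * t')
   = indicator {0..r} t' *\<^sub>R (Vs (r - t') n * (- (of_int n)\<^sup>2 * (e (t0 + t') m * p (t0 + t') (n - m))))" for t'
  proof (cases "t' >= 0")
   case True
   then show ?thesis using t0 by (auto split: split_indicator)
  next
   case False
   then show ?thesis using vanish[of "t0 + t'"] by (auto split: split_indicator)
  qed
  then show ?thesis by (simp only: abs_one scaleR_one)
 qed
 also have "... = mode_duhamel (%t. e (t0 + t)) (%t. p (t0 + t)) r n m"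
  by (simp add: mode_duhamel_def set_lebesgue_integral_def)
 finally show ?thesis .
qed

context exponents

begin

text \<open>One step of length \<open>\<delta>\<close>.  Starting from any extension of the difference, the linearised Duhamel
 operator produces extensions of the same function on \<open>[t\<^sub>0, t\<^sub>0 + \<delta>]\<close> whose norms tend to zero.\<close>

lemma difference_vanishes_step:
 assumes om: "submult om" and E: "E \<in> XX (wt om) b" and G: "G \<in> XX (wt om) b" and H: "H \<in> XX (wt om) b"
  and C: "contraction_const C" and \<delta>: "0 < \<delta>" "\<delta> <= 1" and t0: "t0 >= 0"
  and small: "C * ennreal (\<delta> powr (2 * (1 - a - b))) * (N om G + N om H) <= ennreal (1 / 32)"
  and vanish: "!!t n. t \<in> {0..t0} ==> time_slice E t n = 0"
  and eq: "!!t n. t \<in> {0..t0 + \<delta>} ==> time_slice E t n =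
   - ((\<Sum>\<^sub>\<infinity>m. mode_duhamel (time_slice E) (time_slice G) t n m) + (\<Sum>\<^sub>\<infinity>m. mode_duhamel (time_slice H) (time_slice E) t n m))"
  and t: "t \<in> {t0..t0 + \<delta>}"
 shows "time_slice E t n = 0"
proof -
 note w = wt_pos[OF om]
 define G' where "G' = time_shift t0 G"
 define H' where "H' = time_shift t0 H"
 have G': "G' \<in> XX (wt om) b" "N om G' = N om G" and H': "H' \<in> XX (wt om) b" "N om H' = N om H"
  using time_shift_XX[OF G] time_shift_XX[OF H] by (auto simp: G'_def H'_def time_shift_norm)
 define T where "T A = (%n \<tau>. - Duh \<delta> (st_conv A G') n \<tau> - Duh \<delta> (st_conv H' A) n \<tau>)" for A
 define X where "X k = (T ^^ k) (time_shift t0 E)" for k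
 have TX: "T A \<in> XX (wt om) b" if A: "A \<in> XX (wt om) b" for A
  unfolding T_def by (intro XX_diff XX_uminus Duh_XX(1) om A G' H' \<delta>)
 have TN: "N om (T A) <= ennreal (1 / 16) * N om A" if A: "A \<in> XX (wt om) b" for A
 proof -
  note D1 = Duh_XX(1)[OF om A G'(1) \<delta>] and D2 = Duh_XX(1)[OF om H'(1) A \<delta>]
  note [measurable] = XX_measurable[OF D1] XX_measurable[OF D2]
  let ?c = "C * ennreal (\<delta> powr (2 * (1 - a - b)))"
  have "N om (T A) <= 2 * (N om (%n \<tau>. - Duh \<delta> (st_conv A G') n \<tau>) + N om (Duh \<delta> (st_conv H' A)))"
   unfolding T_def by (rule wnorm_diff_le) auto
  also have "... = 2 * (N om (Duh \<delta> (st_conv A G')) + N om (Duh \<delta> (st_conv H' A)))" by simp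
  also have "... <= 2 * (?c * (N om A * N om G') + ?c * (N om H' * N om A))"
   by (intro mult_left_mono add_mono contraction_constD(2)[OF C] om A G'(1) H'(1) \<delta>) auto
  also have "... = 2 * ((?c * (N om G + N om H)) * N om A)"
   unfolding G'(2) H'(2) by (simp only: distrib_left distrib_right mult_ac)
  also have "... <= 2 * (ennreal (1 / 32) * N om A)"
   by (intro mult_left_mono mult_right_mono small) auto
  also have "... = ennreal (1 / 16) * N om A"
  proof -
   have "2 * ennreal (1 / 32) = ennreal (1 / 16)" using ennreal_mult[of 2 "1 / 32"] by simp
   then show ?thesis by (simp only: mult.assoc[symmetric])
  qed
  finally show ?thesis .
 qed
 have inv: "X k \<in> XX (wt om) b \<and> (\<forall>r\<in>{0..\<delta>}. \<forall>n. time_slice (X k) r n = time_slice E (t0 + r) n)" for k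
 proof (induction k)
  case 0
  show ?case using time_shift_XX[OF E] by (simp add: X_def time_shift_slice)
 next
  case (Suc k)
  then have Xk: "X k \<in> XX (wt om) b" and sl: "!!r n. r \<in> {0..\<delta>} ==> time_slice (X k) r n = time_slice E (t0 + r) n" by auto
  have XS: "X (Suc k) = T (X k)" by (simp add: X_def)
  have "time_slice (X (Suc k)) r n = time_slice E (t0 + r) n" if r: "r \<in> {0..\<delta>}" for r n
  proof -
   note D1 = Duh_XX[OF om Xk G'(1) \<delta>] and D2 = Duh_XX[OF om H'(1) Xk \<delta>]
   have "time_slice (X (Suc k)) r n = - time_slice (Duh \<delta> (st_conv (X k) G')) r n - time_slice (Duh \<delta> (st_conv H' (X k))) r n"
    unfolding XS T_def time_slice_diff[OF XX_uminus[OF D1(1)] D2(1) w b_gt] time_slice_uminus ..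
   also have "... = - (\<Sum>\<^sub>\<infinity>m. mode_duhamel (time_slice (X k)) (time_slice G') r n m) - (\<Sum>\<^sub>\<infinity>m. mode_duhamel (time_slice H') (time_slice (X k)) r n m)"
    unfolding D1(2)[OF r] D2(2)[OF r] ..
   also have "(%m. mode_duhamel (time_slice (X k)) (time_slice G') r n m) = (%m. mode_duhamel (time_slice E) (time_slice G) (t0 + r) n m)"
   proof
    fix m
    have "mode_duhamel (time_slice (X k)) (time_slice G') r n m = mode_duhamel (%t. time_slice E (t0 + t)) (%t. time_slice G (t0 + t)) r n m"
     by (rule mode_duhamel_cong) (use sl r in \<open>auto simp: G'_def time_shift_slice\<close>)
    also have "... = mode_duhamel (time_slice E) (time_slice G) (t0 + r) n m"
     by (rule mode_duhamel_shift[symmetric]) (use vanish t0 in auto)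
    finally show "mode_duhamel (time_slice (X k)) (time_slice G') r n m = mode_duhamel (time_slice E) (time_slice G) (t0 + r) n m" .
   qed
   also have "(%m. mode_duhamel (time_slice H') (time_slice (X k)) r n m) = (%m. mode_duhamel (time_slice H) (time_slice E) (t0 + r) n m)"
   proof
    fix m
    have "mode_duhamel (time_slice H') (time_slice (X k)) r n m = mode_duhamel (%t. time_slice H (t0 + t)) (%t. time_slice E (t0 + t)) r n m"
     by (rule mode_duhamel_cong) (use sl r in \<open>auto simp: H'_def time_shift_slice\<close>)
    also have "... = mode_duhamel (time_slice H) (time_slice E) (t0 + r) n m"
     by (rule mode_duhamel_shift[symmetric]) (use vanish t0 in auto)
    finally show "mode_duhamel (time_slice H') (time_slice (X k)) r n m = mode_duhamel (time_slice H) (time_slice E) (t0 + r) n m" .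
   qed
   also have "- (\<Sum>\<^sub>\<infinity>m. mode_duhamel (time_slice E) (time_slice G) (t0 + r) n m) - (\<Sum>\<^sub>\<infinity>m. mode_duhamel (time_slice H) (time_slice E) (t0 + r) n m)
     = time_slice E (t0 + r) n"
    using eq[of "t0 + r" n] r t0 by simp
   finally show ?thesis .
  qed
  then show ?case using TX[OF Xk] by (simp add: XS)
 qed
 define c where "c = enn2real (N om E)"
 have c: "N om E = ennreal c" "c >= 0" using XX_finite[OF E] by (auto simp: c_def)
 have XN: "N om (X k) <= ennreal (c / 16 ^ k)" for k
 proof (induction k)
  case 0
  then show ?case by (simp add: X_def time_shift_norm c)
 next
  case (Suc k)
  have "N om (X (Suc k)) <= ennreal (1 / 16) * N om (X k)" using TN inv[of k] by (simp add: X_def)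
  also have "... <= ennreal (1 / 16) * ennreal (c / 16 ^ k)" by (intro mult_left_mono Suc) auto
  also have "... = ennreal (1 / 16 * (c / 16 ^ k))" using c by (subst ennreal_mult) auto
  finally show ?case by simp
 qed
 define B where "B = enn2real (2 * bracket_integral (2 * b))"
 have B: "2 * bracket_integral (2 * b) = ennreal B" "B >= 0"
  using bracket_integral_finite[of "2 * b"] b_gt by (auto simp: B_def ennreal_mult_less_top)
 define r where "r = t - t0"
 have r: "r \<in> {0..\<delta>}" using t by (auto simp: r_def)
 have "ennreal ((wt om n * cmod (time_slice E t n))\<^sup>2) <= ennreal (B * c / 16 ^ k)" for k
 proof -
  have "time_slice E t n = time_slice (X k) r n" using inv[of k] r by (simp add: r_def)
  then have "ennreal ((wt om n * cmod (time_slice E t n))\<^sup>2) <= 2 * bracket_integral (2 * b) * N om (X k)"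
   using slice_bound_wnorm[of "X k" "wt om" n r b] inv[of k] w by (auto simp: XX_def)
  also have "... <= ennreal B * ennreal (c / 16 ^ k)" unfolding B by (intro mult_left_mono XN) auto
  also have "... = ennreal (B * (c / 16 ^ k))" using B c by (subst ennreal_mult) auto
  finally show ?thesis by simp
 qed
 then have "ennreal ((wt om n * cmod (time_slice E t n))\<^sup>2) = 0" by (rule ennreal_geometric_zero)
 then show ?thesis using w[of n] by (simp add: ennreal_eq_0_iff)
qed

text \<open>The interval is covered by steps of fixed length, which depends only on the norms of
 the two extensions; each step starts where the difference is already known to vanish.\<close>

lemma difference_vanishes:
 assumes om: "submult om" and E: "E \<in> XX (wt om) b" and G: "G \<in> XX (wt om) b" and H: "H \<in> XX (wt om) b"
  and eq: "!!t n. t \<in> {0..T} ==> time_slice E t n =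
   - ((\<Sum>\<^sub>\<infinity>m. mode_duhamel (time_slice E) (time_slice G) t n m) + (\<Sum>\<^sub>\<infinity>m. mode_duhamel (time_slice H) (time_slice E) t n m))"
  and t: "t \<in> {0..T}"
 shows "time_slice E t n = 0"
proof -
 obtain C where C: "contraction_const C" using contraction_const_exists by blast
 have theta: "2 * (1 - a - b) > 0" using ab by simp
 have "C * (N om G + N om H) < \<infinity>"
  using contraction_constD(1)[OF C] XX_finite[OF G] XX_finite[OF H] by (simp add: ennreal_mult_less_top)
 then obtain d where d: "0 < d" "d <= 1" "!!\<delta>. 0 < \<delta> ==> \<delta> <= d ==> C * (N om G + N om H) * ennreal (\<delta> powr (2 * (1 - a - b))) <= ennreal (1 / 32)"
  using small_power[OF _ theta, of "C * (N om G + N om H)" "1 / 32"] by auto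
 have zero: "time_slice E 0 n = 0" if "T >= 0" for n
 proof -
  have "mode_duhamel e p 0 n m = 0" for e p :: "real => int => complex" and m
  proof -
   have "AE t' in lborel. indicator {0..0} t' *\<^sub>R (Vs (0 - t') n * (- (of_int n)\<^sup>2 * (e t' m * p t' (n - m)))) = 0"
    by (rule AE_mp[OF AE_lborel_singleton[of 0]]) (auto split: split_indicator)
   then show ?thesis unfolding mode_duhamel_def set_lebesgue_integral_def by (rule integral_eq_zero_AE)
  qed
  then show ?thesis using eq[of 0 n] that by simp
 qed
 have claim: "\<forall>t n. t \<in> {0..T} \<longrightarrow> t <= real k * d \<longrightarrow> time_slice E t n = 0" for k
 proof (induction k)
  case 0
  then show ?case using zero by auto
 next
  case (Suc k)
  show ?case
  proof (intro allI impI)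
   fix t n assume t: "t \<in> {0..T}" "t <= real (Suc k) * d"
   show "time_slice E t n = 0"
   proof (cases "t <= real k * d")
    case True
    then show ?thesis using Suc t by blast
   next
    case False
    define t0 where "t0 = real k * d"
    define \<delta> where "\<delta> = t - t0"
    have \<delta>: "0 < \<delta>" "\<delta> <= d" "\<delta> <= 1" using False t d by (auto simp: \<delta>_def t0_def algebra_simps)
    have t0: "t0 >= 0" using d by (simp add: t0_def)
    show ?thesis
    proof (rule difference_vanishes_step[OF om E G H C \<delta>(1) \<delta>(3) t0])
     show "C * ennreal (\<delta> powr (2 * (1 - a - b))) * (N om G + N om H) <= ennreal (1 / 32)"
      using d(3)[OF \<delta>(1,2)] by (simp only: mult_ac)
     show "time_slice E t' n' = 0" if "t' \<in> {0..t0}" for t' n'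
      using Suc that t \<delta> by (auto simp: t0_def \<delta>_def)
     show "t \<in> {t0..t0 + \<delta>}" using \<delta> by (simp add: \<delta>_def)
    qed (rule eq, use t in \<open>auto simp: \<delta>_def\<close>)
   qed
  qed
 qed
 obtain k where "t / d <= real k" using real_arch_simple by blast
 then have "t <= real k * d" using d by (simp add: field_simps)
 then show ?thesis using claim t by blast
qed

end

section \<open>Density of smooth functions in \<open>X\<^sub>s\<^sub>,\<^sub>b\<close>\<close>

text \<open>A class of Schwartz functions that is closed under differentiation and contains the
 Gaussian regularisations of inverse Fourier transforms of continuous functions with compact
 support.\<close>

definition cts_supp :: "real => (real => complex) => bool" where
 "cts_supp R h \<longleftrightarrow> continuous_on UNIV h \<and> (\<forall>\<mu>. \<bar>\<mu>\<bar> >= R \<longrightarrow> h \<mu> = 0)"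

definition gauss :: "real => real => complex" where
 "gauss k t = cor (exp (- ((t / k)\<^sup>2) / 2))"

inductive_set reg :: "(real => complex) set" where
 zero: "(%t. 0) \<in> reg"
| basic: "k > 0 ==> cts_supp R h ==> (%t. of_real (t ^ m) * (gauss k t * ift h t)) \<in> reg"
| add: "f \<in> reg ==> g \<in> reg ==> (%t. f t + g t) \<in> reg"

lemma cts_supp_cont: "cts_supp R h ==> continuous_on A h"
 unfolding cts_supp_def by (metis continuous_on_subset subset_UNIV)

lemma cts_supp_zero: "cts_supp R h ==> t \<notin> {-R..R} ==> h t = 0"
 unfolding cts_supp_def by (metis abs_le_iff atLeastAtMost_iff linorder_le_cases minus_le_iff)

lemma cts_supp_integrable:
 assumes "cts_supp R h"
 shows "integrable lborel h"
proof -
 have "set_integrable lborel {-R..R} h"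
  by (intro borel_integrable_atLeastAtMost' cts_supp_cont[OF assms])
 moreover have "indicator {-R..R} t *\<^sub>R h t = h t" for t
  using cts_supp_zero[OF assms, of t] by (cases "t \<in> {-R..R}") auto
 ultimately show ?thesis by (simp add: set_integrable_def)
qed

lemma cts_supp_mult: "cts_supp R h ==> continuous_on UNIV g ==> cts_supp R (%\<mu>. g \<mu> * h \<mu>)"
 by (auto simp: cts_supp_def intro!: continuous_intros)

lemma ift_deriv:
 assumes h: "cts_supp R h"
 shows "(ift h has_vector_derivative ift (%\<mu>. \<i> * of_real \<mu> * h \<mu>) t) (at t)"
proof -
 have cont: "continuous_on A h" for A by (rule cts_supp_cont[OF h])
 have as_integral: "ift g t = cor (1 / (2 * pi)) * integral (cbox (-R) R) (%\<mu>. iexp (t * \<mu>) * g \<mu>)"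
  if g: "cts_supp R g" for g t
 proof -
  have "set_integrable lborel {-R..R} (%\<mu>. iexp (t * \<mu>) * g \<mu>)"
   by (intro borel_integrable_atLeastAtMost' continuous_intros cts_supp_cont[OF g])
  from set_borel_integral_eq_integral(2)[OF this]
  have "(LINT \<mu>:{-R..R}|lborel. iexp (t * \<mu>) * g \<mu>) = integral {-R..R} (%\<mu>. iexp (t * \<mu>) * g \<mu>)" .
  moreover have "indicator {-R..R} \<mu> *\<^sub>R (iexp (t * \<mu>) * g \<mu>) = iexp (t * \<mu>) * g \<mu>" for \<mu>
   using cts_supp_zero[OF g, of \<mu>] by (cases "\<mu> \<in> {-R..R}") auto
  ultimately show ?thesis by (simp add: ift_def set_lebesgue_integral_def)
 qed
 have "((%t. integral (cbox (-R) R) (%\<mu>. iexp (t * \<mu>) * h \<mu>)) has_vector_derivative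
   integral (cbox (-R) R) (%\<mu>. iexp (t * \<mu>) * (\<i> * of_real \<mu> * h \<mu>))) (at t within UNIV)"
 proof (rule leibniz_rule_vector_derivative[where fx = "%t \<mu>. iexp (t * \<mu>) * (\<i> * of_real \<mu> * h \<mu>)"])
  show "((%t. iexp (t * \<mu>) * h \<mu>) has_vector_derivative iexp (t * \<mu>) * (\<i> * of_real \<mu> * h \<mu>)) (at t within UNIV)" for t \<mu>
   using has_vector_derivative_mult_left[OF exp_deriv[of \<mu> t], of "h \<mu>"] by (simp add: mult_ac)
  show "(%\<mu>. iexp (t * \<mu>) * h \<mu>) integrable_on cbox (-R) R" for t
   by (intro integrable_continuous continuous_intros cont)
  show "continuous_on (UNIV \<times> cbox (-R) R) (%(t, \<mu>). iexp (t * \<mu>) * (\<i> * of_real \<mu> * h \<mu>))"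
   unfolding split_beta by (intro continuous_intros continuous_on_compose2[OF cont[of UNIV]]) auto
 qed auto
 then have "((%t. cor (1 / (2 * pi)) * integral (cbox (-R) R) (%\<mu>. iexp (t * \<mu>) * h \<mu>)) has_vector_derivative
   cor (1 / (2 * pi)) * integral (cbox (-R) R) (%\<mu>. iexp (t * \<mu>) * (\<i> * of_real \<mu> * h \<mu>))) (at t)"
  by (intro has_vector_derivative_mult_right) simp
 moreover have "cts_supp R (%\<mu>. \<i> * of_real \<mu> * h \<mu>)" by (intro cts_supp_mult h continuous_intros)
 moreover have "ift h = (%t. cor (1 / (2 * pi)) * integral (cbox (-R) R) (%\<mu>. iexp (t * \<mu>) * h \<mu>))"
  by (intro ext as_integral h)
 ultimately show ?thesis by (simp only: as_integral)
qed

lemma gauss_deriv: "k > 0 ==> (gauss k has_vector_derivative - of_real (t / k\<^sup>2) * gauss k t) (at t)"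
proof -
 assume k: "k > 0"
 have "((%t. exp (- ((t / k)\<^sup>2) / 2)) has_real_derivative - (t / k\<^sup>2) * exp (- ((t / k)\<^sup>2) / 2)) (at t)"
  using k by (auto intro!: derivative_eq_intros simp: field_simps power2_eq_square)
 then have "((%t. cor (exp (- ((t / k)\<^sup>2) / 2))) has_vector_derivative cor (- (t / k\<^sup>2) * exp (- ((t / k)\<^sup>2) / 2))) (at t)"
  by (intro has_vector_derivative_of_real) (simp add: has_real_derivative_iff_has_vector_derivative)
 then show ?thesis by (simp add: gauss_def[abs_def])
qed

lemma reg_scale: "f \<in> reg ==> (%t. c * f t) \<in> reg"
proof (induction rule: reg.induct)
 case zero
 then show ?case using reg.zero by simp
next
 case (basic k R h m)
 have "(%t. of_real (t ^ m) * (gauss k t * ift (%\<mu>. c * h \<mu>) t)) \<in> reg"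
  by (rule reg.basic[OF basic(1) cts_supp_mult[OF basic(2)]]) (intro continuous_intros)
 then show ?case unfolding ift_cmult by (simp only: mult.left_commute)
next
 case (add f g)
 from reg.add[OF add.IH] show ?case by (simp add: distrib_left)
qed

lemma reg_derivative: "f \<in> reg ==> \<exists>f'\<in>reg. \<forall>t. (f has_vector_derivative f' t) (at t)"
proof (induction rule: reg.induct)
 case zero
 then show ?case using reg.zero by (intro bexI[of _ "%t. 0"]) auto
next
 case (basic k R h m)
 let ?h' = "%\<mu>. \<i> * of_real \<mu> * h \<mu>"
 define f' where "f' t = of_nat m * (of_real (t ^ (m - 1)) * (gauss k t * ift h t))
   + (of_real (- (1 / k\<^sup>2)) * (of_real (t ^ Suc m) * (gauss k t * ift h t)) + of_real (t ^ m) * (gauss k t * ift ?h' t))" for t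
 have h': "cts_supp R ?h'" by (rule cts_supp_mult[OF basic(2)]) (intro continuous_intros)
 have "f' \<in> reg"
  unfolding f'_def by (intro reg.add reg_scale reg.basic[OF basic(1) basic(2)] reg.basic[OF basic(1) h'])
 moreover have "((%t. of_real (t ^ m) * (gauss k t * ift h t)) has_vector_derivative f' t) (at t)" for t
 proof -
  have "((%t. t ^ m) has_real_derivative real m * t ^ (m - 1)) (at t)" using DERIV_pow[of m t] by simp
  then have p: "((%t. cor (t ^ m)) has_vector_derivative cor (real m * t ^ (m - 1))) (at t)"
   by (intro has_vector_derivative_of_real) (simp add: has_real_derivative_iff_has_vector_derivative)
  have "((%t. of_real (t ^ m) * (gauss k t * ift h t)) has_vector_derivative
   of_real (t ^ m) * (gauss k t * ift ?h' t + (- of_real (t / k\<^sup>2) * gauss k t) * ift h t) + cor (real m * t ^ (m - 1)) * (gauss k t * ift h t)) (at t)"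
   by (rule has_vector_derivative_mult[OF p has_vector_derivative_mult[OF gauss_deriv[OF basic(1)] ift_deriv[OF basic(2)]]])
  moreover have "of_real (t ^ m) * (gauss k t * ift ?h' t + (- of_real (t / k\<^sup>2) * gauss k t) * ift h t) + cor (real m * t ^ (m - 1)) * (gauss k t * ift h t) = f' t"
   unfolding f'_def by (simp add: algebra_simps)
  ultimately show ?thesis by simp
 qed
 ultimately show ?case by blast
next
 case (add f g)
 then obtain f' g' where "f' \<in> reg" "g' \<in> reg" "!!t. (f has_vector_derivative f' t) (at t)" "!!t. (g has_vector_derivative g' t) (at t)"
  by blast
 then show ?case by (intro bexI[of _ "%t. f' t + g' t"]) (auto intro!: has_vector_derivative_add reg.add)
qed

lemma power_gauss_bounded:
 assumes "k > 0"
 obtains B where "!!t. cmod (of_real (t ^ m) * gauss k t) <= B"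
proof -
 have exp_ge: "y ^ m <= fact m * exp y" if "y >= 0" for y :: real
 proof -
  have "y ^ m /\<^sub>R fact m <= exp y"
   using sums_le[OF _ sums_single[of m "%n. y ^ n /\<^sub>R fact n"] exp_converges[of y]] that by auto
  then show ?thesis by (simp add: field_simps)
 qed
 have "cmod (of_real (t ^ m) * gauss k t) <= 1 + (2 * k\<^sup>2) ^ m * fact m" for t
 proof -
  define y where "y = (t / k)\<^sup>2 / 2"
  have y: "y >= 0" "t\<^sup>2 = 2 * k\<^sup>2 * y" using assms by (auto simp: y_def power_divide)
  have "\<bar>t\<bar> ^ m <= 1 + (t\<^sup>2) ^ m"
  proof (cases "\<bar>t\<bar> <= 1")
   case True
   then have "\<bar>t\<bar> ^ m <= 1" by (intro power_le_one) auto
   then show ?thesis by (simp add: add_increasing2)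
  next
   case False
   then have "\<bar>t\<bar> <= t\<^sup>2" using self_le_power[of "\<bar>t\<bar>" 2] by simp
   then have "\<bar>t\<bar> ^ m <= (t\<^sup>2) ^ m" by (intro power_mono) auto
   then show ?thesis by simp
  qed
  then have "\<bar>t\<bar> ^ m * exp (- y) <= (1 + (t\<^sup>2) ^ m) * exp (- y)" by (intro mult_right_mono) auto
  also have "... = exp (- y) + (2 * k\<^sup>2) ^ m * (y ^ m * exp (- y))" unfolding y(2) by (simp add: distrib_right power_mult_distrib)
  also have "... <= 1 + (2 * k\<^sup>2) ^ m * fact m"
   using exp_ge[OF y(1)] y(1) by (intro add_mono mult_left_mono) (auto simp: exp_minus field_simps)
  finally show ?thesis by (simp add: norm_mult norm_power gauss_def y_def power_abs)
 qed
 then show ?thesis by (rule that)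
qed

lemma ift_bounded:
 assumes "integrable lborel h"
 obtains B where "B >= 0" "!!t. cmod (ift h t) <= B"
proof -
 have fin: "(nnint (%\<tau>. ennreal (cmod (h \<tau>)))) < \<infinity>" using assms by (simp add: integrable_iff_bounded)
 have "cmod (ift h t) <= enn2real (nnint (%\<tau>. ennreal (cmod (h \<tau>))))" for t
  using enn2real_mono[OF norm_ift_le[of h t] fin[unfolded infinity_ennreal_def]] by simp
 then show ?thesis using that[of "enn2real (nnint (%\<tau>. ennreal (cmod (h \<tau>))))"] by simp
qed

lemma reg_decay: "f \<in> reg ==> \<exists>B. \<forall>t. cmod (of_real (t ^ j) * f t) <= B"
proof (induction rule: reg.induct)
 case (basic k R h m)
 obtain B1 where B1: "!!t. cmod (of_real (t ^ (j + m)) * gauss k t) <= B1" using power_gauss_bounded[OF basic(1)] by blast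
 obtain B2 where B2: "B2 >= 0" "!!t. cmod (ift h t) <= B2" using ift_bounded[OF cts_supp_integrable[OF basic(2)]] by blast
 have "cmod (of_real (t ^ j) * (of_real (t ^ m) * (gauss k t * ift h t))) <= B1 * B2" for t
 proof -
  have "cmod (of_real (t ^ j) * (of_real (t ^ m) * (gauss k t * ift h t))) = cmod (of_real (t ^ (j + m)) * gauss k t) * cmod (ift h t)"
   by (simp add: norm_mult power_add mult_ac)
  also have "... <= B1 * B2" by (intro mult_mono B1 B2 order_trans[OF norm_ge_zero B1]) auto
  finally show ?thesis .
 qed
 then show ?case by blast
next
 case (add f g)
 then obtain B1 B2 where B: "!!t. cmod (of_real (t ^ j) * f t) <= B1" "!!t. cmod (of_real (t ^ j) * g t) <= B2" by blast
 have "cmod (of_real (t ^ j) * (f t + g t)) <= B1 + B2" for t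
  unfolding distrib_left by (rule norm_triangle_le[OF add_mono[OF B]])
 then show ?case by blast
qed auto

lemma reg_schwartz:
 assumes "f \<in> reg"
 shows "schwartz f"
proof -
 obtain nxt where nxt: "!!f. f \<in> reg ==> nxt f \<in> reg" "!!f t. f \<in> reg ==> (f has_vector_derivative nxt f t) (at t)"
  using reg_derivative by metis
 define D where "D k = (nxt ^^ k) f" for k
 have D: "D k \<in> reg" for k by (induction k) (simp_all add: D_def assms nxt(1))
 have "derivatives f D"
  unfolding derivatives_def using nxt(2)[OF D] by (auto simp: D_def)
 moreover have "bounded (range (%t. cor (t ^ j) * D k t))" for j k
  using reg_decay[OF D, of j k] by (auto simp: bounded_iff)
 ultimately show ?thesis unfolding schwartz_def by blast
qed

lemma reg_continuous: "f \<in> reg ==> continuous_on UNIV f"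
 using reg_derivative by (metis continuous_at_imp_continuous_on has_vector_derivative_continuous)

lemma reg_integrable:
 assumes "f \<in> reg"
 shows "integrable lborel f"
proof -
 have [measurable]: "f \<in> bmeas" using reg_continuous[OF assms] by (rule borel_measurable_continuous_onI)
 obtain B0 B2 where B: "!!t. cmod (of_real (t ^ 0) * f t) <= B0" "!!t. cmod (of_real (t ^ 2) * f t) <= B2"
  using reg_decay[OF assms] by meson
 have "cmod (f t) <= (2 * (B0 + B2)) * bracket t powr (- 2)" for t
 proof -
  have "(bracket t)\<^sup>2 <= 2 * (1 + t\<^sup>2)"
   using sum_squares_bound[of 1 "\<bar>t\<bar>"] by (simp add: bracket_def power2_sum)
  then have "(bracket t)\<^sup>2 * cmod (f t) <= 2 * (1 + t\<^sup>2) * cmod (f t)" by (intro mult_right_mono) auto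
  also have "... = 2 * (cmod (f t) + t\<^sup>2 * cmod (f t))" by (simp add: algebra_simps)
  also have "... <= 2 * (B0 + B2)"
   using B(1)[of t] B(2)[of t] by (intro mult_left_mono add_mono) (auto simp: norm_mult norm_power)
  finally show ?thesis by (simp add: powr_minus powr_numeral field_simps)
 qed
 then show ?thesis by (intro integrable_bracket_decay) measurable
qed

text \<open>The transform of the regularised function is the average of \<open>h\<close> against a Gaussian.\<close>

lemma ft_gauss_ift:
 assumes h: "cts_supp R h" and k: "k > 0"
 shows "ft (%t. gauss k t * ift h t) \<xi> = (LINT y|lborel. h (\<xi> - y / k) * cor (std_normal_density y))"
proof -
 note hint = cts_supp_integrable[OF h]
 have [measurable]: "h \<in> bmeas" using hint by auto
 have gint: "integrable lborel (gauss k)" unfolding gauss_def using gaussian_fourier_scaled(2)[OF k] by simp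
 then have [measurable]: "gauss k \<in> bmeas" by auto
 let ?F = "%t \<mu>. (iexp ((\<mu> - \<xi>) * t) * gauss k t) * h \<mu>"
 have int: "integrable (lborel \<Otimes>\<^sub>M lborel) (%(t, \<mu>). ?F t \<mu>)"
  by (rule Bochner_Integration.integrable_bound[OF integrable_tensor[OF gint hint]]) (auto simp: norm_mult split_beta)
 have "ft (%t. gauss k t * ift h t) \<xi> = (LINT t|lborel. cor (1 / (2 * pi)) * (LINT \<mu>|lborel. ?F t \<mu>))"
  unfolding ft_def
 proof (rule Bochner_Integration.integral_cong[OF refl])
  fix t
  have "(LINT \<mu>|lborel. ?F t \<mu>) = (LINT \<mu>|lborel. (exp (- \<i> * cor (t * \<xi>)) * gauss k t) * (iexp (t * \<mu>) * h \<mu>))"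
  proof (rule Bochner_Integration.integral_cong[OF refl])
   fix \<mu>
   have "iexp ((\<mu> - \<xi>) * t) = exp (- \<i> * cor (t * \<xi>)) * iexp (t * \<mu>)"
    unfolding exp_add[symmetric] by (simp add: algebra_simps)
   then show "?F t \<mu> = (exp (- \<i> * cor (t * \<xi>)) * gauss k t) * (iexp (t * \<mu>) * h \<mu>)"
    by (simp only: mult_ac)
  qed
  also have "... = (exp (- \<i> * cor (t * \<xi>)) * gauss k t) * (LINT \<mu>|lborel. iexp (t * \<mu>) * h \<mu>)"
   by (rule integral_mult_right_zero)
  finally show "exp (- \<i> * cor (t * \<xi>)) * (gauss k t * ift h t) = cor (1 / (2 * pi)) * (LINT \<mu>|lborel. ?F t \<mu>)"
   unfolding ift_def by (simp only: mult_ac)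
 qed
 also have "... = cor (1 / (2 * pi)) * (LINT \<mu>|lborel. (LINT t|lborel. ?F t \<mu>))"
  unfolding integral_mult_right_zero lborel_pair.Fubini_integral[OF int] ..
 also have "(LINT \<mu>|lborel. (LINT t|lborel. ?F t \<mu>)) = (LINT \<mu>|lborel. cor (2 * pi * (k * std_normal_density (k * (\<mu> - \<xi>)))) * h \<mu>)"
  unfolding integral_mult_left_zero gauss_def gaussian_fourier_scaled(1)[OF k] ..
 also have "... = \<bar>- 1 / k\<bar> *\<^sub>R (LINT y|lborel. cor (2 * pi * (k * std_normal_density (k * ((\<xi> + (- 1 / k) * y) - \<xi>)))) * h (\<xi> + (- 1 / k) * y))"
  by (rule lborel_integral_real_affine) (use k in simp)
 also have "... = cor (1 / k) * (LINT y|lborel. cor (2 * pi * k) * (h (\<xi> - y / k) * cor (std_normal_density y)))"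
 proof -
  have 1: "\<xi> + (- 1 / k) * y = \<xi> - y / k" for y by simp
  have 2: "std_normal_density (k * ((\<xi> - y / k) - \<xi>)) = std_normal_density y" for y
   using k by (simp add: std_normal_density_def)
  have 3: "\<bar>- 1 / k\<bar> = 1 / k" using k by simp
  have 4: "cor (2 * pi * (k * d)) * F = cor (2 * pi * k) * (F * cor d)" for d F by simp
  show ?thesis unfolding 1 2 3 4 scaleR_conv_of_real ..
 qed
 also have "cor (1 / (2 * pi)) * (cor (1 / k) * (LINT y|lborel. cor (2 * pi * k) * (h (\<xi> - y / k) * cor (std_normal_density y))))
  = (LINT y|lborel. h (\<xi> - y / k) * cor (std_normal_density y))"
 proof -
  have "cor (1 / (2 * pi)) * (cor (1 / k) * (cor (2 * pi * k) * J)) = J" for J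
   using k by simp
  then show ?thesis by (subst integral_mult_right_zero)
 qed
 finally show ?thesis .
qed

lemma cts_supp_bounded:
 assumes "cts_supp R h"
 obtains M where "M >= 0" "!!\<mu>. cmod (h \<mu>) <= M"
proof -
 have "bounded (h ` {-R..R})"
  by (intro compact_imp_bounded compact_continuous_image cts_supp_cont[OF assms]) auto
 then obtain M where M: "!!\<mu>. \<mu> \<in> {-R..R} ==> cmod (h \<mu>) <= M" unfolding bounded_iff by fastforce
 have "cmod (h \<mu>) <= max 0 M" for \<mu>
 proof (cases "\<mu> \<in> {-R..R}")
  case True
  then show ?thesis using M[of \<mu>] by simp
 next
  case False
  then have "h \<mu> = 0" by (rule cts_supp_zero[OF assms])
  then show ?thesis by simp
 qed
 then show ?thesis by (intro that[of "max 0 M"]) auto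
qed

lemma gauss_average_decay:
 assumes h: "cts_supp R h" and R: "R >= 0"
 obtains C where "!!\<xi> k. k >= 1 ==> cmod (LINT y|lborel. h (\<xi> - y / k) * cor (std_normal_density y)) <= C * bracket \<xi> powr (- 2)"
proof -
 obtain M where M: "M >= 0" "!!\<mu>. cmod (h \<mu>) <= M" using cts_supp_bounded[OF h] by blast
 have [measurable]: "h \<in> bmeas" using cts_supp_integrable[OF h] by auto
 define W where "W y = M * ((1 + R) * (1 + \<bar>y\<bar>))\<^sup>2 * std_normal_density y" for y
 have W_int: "integrable lborel W"
 proof -
  have W_eq: "W y = (M * (1 + R)\<^sup>2) * (std_normal_density y * \<bar>y\<bar> ^ 0 + 2 * (std_normal_density y * \<bar>y\<bar> ^ 1) + std_normal_density y * \<bar>y\<bar> ^ 2)" for y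
   unfolding W_def by (simp add: power2_eq_square algebra_simps)
  moreover have "integrable lborel (%y. (M * (1 + R)\<^sup>2) * (std_normal_density y * \<bar>y\<bar> ^ 0 + 2 * (std_normal_density y * \<bar>y\<bar> ^ 1) + std_normal_density y * \<bar>y\<bar> ^ 2))"
   by (intro integrable_mult_right Bochner_Integration.integrable_add integrable_std_normal_moment_abs)
  ultimately show ?thesis by (simp only: W_eq[abs_def])
 qed
 have "cmod (LINT y|lborel. h (\<xi> - y / k) * cor (std_normal_density y)) <= (LINT y|lborel. W y) * bracket \<xi> powr (- 2)" if k: "k >= 1" for \<xi> k
 proof -
  have W0: "W y >= 0" for y using M R by (simp add: W_def)
  have pw: "cmod (h (\<xi> - y / k) * cor (std_normal_density y)) <= W y * bracket \<xi> powr (- 2)" for y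
  proof (cases "\<bar>\<xi> - y / k\<bar> >= R")
   case True
   then have "h (\<xi> - y / k) = 0" using h by (simp add: cts_supp_def)
   then show ?thesis using W0 by simp
  next
   case False
   have "bracket \<xi> <= bracket (\<xi> - y / k) * bracket (y / k)" using bracket_add_le_mult[of "\<xi> - y / k" "y / k"] by simp
   also have "... <= (1 + R) * (1 + \<bar>y\<bar>)"
   proof (intro mult_mono)
    show "bracket (\<xi> - y / k) <= 1 + R" using False by (simp add: bracket_def)
    have "\<bar>y\<bar> / k <= \<bar>y\<bar>" using k by (simp add: divide_le_eq mult_le_cancel_left1)
    then show "bracket (y / k) <= 1 + \<bar>y\<bar>" using k by (simp add: bracket_def abs_divide)
   qed (use R in auto)
   finally have "(bracket \<xi>)\<^sup>2 <= ((1 + R) * (1 + \<bar>y\<bar>))\<^sup>2" by (intro power_mono) auto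
   then have "1 <= ((1 + R) * (1 + \<bar>y\<bar>))\<^sup>2 * bracket \<xi> powr (- 2)"
    by (simp add: powr_minus powr_numeral field_simps)
   then have "M * std_normal_density y * 1 <= M * std_normal_density y * (((1 + R) * (1 + \<bar>y\<bar>))\<^sup>2 * bracket \<xi> powr (- 2))"
    using M by (intro mult_left_mono) auto
   moreover have "cmod (h (\<xi> - y / k) * cor (std_normal_density y)) <= M * std_normal_density y"
    using M(2)[of "\<xi> - y / k"] by (simp add: norm_mult mult_right_mono)
   ultimately show ?thesis unfolding W_def by (simp only: mult_ac mult_1_right)
  qed
  have "cmod (LINT y|lborel. h (\<xi> - y / k) * cor (std_normal_density y)) <= (LINT y|lborel. W y * bracket \<xi> powr (- 2))"
  proof (rule Bochner_Integration.integral_norm_bound_integral)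
   show I: "integrable lborel (%y. W y * bracket \<xi> powr (- 2))" using W_int by simp
   have "cmod (h (\<xi> - y / k) * cor (std_normal_density y)) <= norm (W y * bracket \<xi> powr (- 2))" for y
    using pw[of y] by simp
   then show "integrable lborel (%y. h (\<xi> - y / k) * cor (std_normal_density y))"
    by (intro Bochner_Integration.integrable_bound[OF I] AE_I2) auto
   show "cmod (h (\<xi> - y / k) * cor (std_normal_density y)) <= W y * bracket \<xi> powr (- 2)" for y
    by (rule pw)
  qed
  then show ?thesis by simp
 qed
 then show ?thesis by (rule that)
qed

definition approximable :: "(real => real) => (real => complex) => bool" where
 "approximable v g \<longleftrightarrow> (\<forall>\<epsilon>>0. \<exists>f\<in>reg. (nnint (%\<tau>. ennreal (v \<tau> * (cmod (g \<tau> - ft f \<tau>))\<^sup>2))) < ennreal \<epsilon>)"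

lemma ft_borel_measurable:
 assumes [measurable]: "f \<in> bmeas"
 shows "ft f \<in> bmeas"
 unfolding ft_def by measurable

lemma reg_measurable: "f \<in> reg ==> f \<in> bmeas"
 using reg_continuous by (rule borel_measurable_continuous_onI)

lemma dominated_small:
 fixes D :: "nat => real => complex"
 assumes [measurable]: "!!k. D k \<in> bmeas" "v \<in> bmeas" "B \<in> bmeas"
  and lim: "AE \<tau> in lborel. (%k. D k \<tau>) \<longlonglongrightarrow> 0"
  and bound: "!!k \<tau>. ennreal (v \<tau> * (cmod (D k \<tau>))\<^sup>2) <= B \<tau>" and fin: "(nnint (%\<tau>. B \<tau>)) < \<infinity>" and e: "\<epsilon> > 0"
 shows "\<exists>k. (nnint (%\<tau>. ennreal (v \<tau> * (cmod (D k \<tau>))\<^sup>2))) < ennreal \<epsilon>"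
proof -
 have "(%k. nnint (%\<tau>. ennreal (v \<tau> * (cmod (D k \<tau>))\<^sup>2))) \<longlonglongrightarrow> (\<integral>\<^sup>+\<tau>. 0 \<partial>(lborel :: real measure))"
 proof (rule nn_integral_dominated_convergence[where w = B])
  show "AE \<tau> in lborel. (%k. ennreal (v \<tau> * (cmod (D k \<tau>))\<^sup>2)) \<longlonglongrightarrow> 0"
   using lim
  proof eventually_elim
   case (elim \<tau>)
   have "(%k. v \<tau> * (cmod (D k \<tau>))\<^sup>2) \<longlonglongrightarrow> v \<tau> * (cmod 0)\<^sup>2" by (intro tendsto_intros elim)
   then have "(%k. ennreal (v \<tau> * (cmod (D k \<tau>))\<^sup>2)) \<longlonglongrightarrow> ennreal (v \<tau> * (cmod 0)\<^sup>2)" by (rule tendsto_ennrealI)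
   then show ?case by simp
  qed
 qed (use bound fin in auto)
 then have "(%k. nnint (%\<tau>. ennreal (v \<tau> * (cmod (D k \<tau>))\<^sup>2))) \<longlonglongrightarrow> 0" by simp
 from order_tendstoD(2)[OF this, of "ennreal \<epsilon>"] e show ?thesis
  by (auto simp: eventually_sequentially)
qed

lemma weighted_triangle:
 assumes [measurable]: "v \<in> bmeas" "g \<in> bmeas" "h \<in> bmeas" "k \<in> bmeas"
  and v: "!!\<tau>. v \<tau> >= 0"
 shows "(nnint (%\<tau>. ennreal (v \<tau> * (cmod (g \<tau> - k \<tau>))\<^sup>2))) <=
  2 * (nnint (%\<tau>. ennreal (v \<tau> * (cmod (g \<tau> - h \<tau>))\<^sup>2))) + 2 * (nnint (%\<tau>. ennreal (v \<tau> * (cmod (h \<tau> - k \<tau>))\<^sup>2)))"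
proof -
 have "v \<tau> * (cmod (g \<tau> - k \<tau>))\<^sup>2 <= 2 * (v \<tau> * (cmod (g \<tau> - h \<tau>))\<^sup>2) + 2 * (v \<tau> * (cmod (h \<tau> - k \<tau>))\<^sup>2)" for \<tau>
 proof -
  have "cmod (g \<tau> - k \<tau>) <= cmod (g \<tau> - h \<tau>) + cmod (h \<tau> - k \<tau>)"
   using norm_triangle_ineq[of "g \<tau> - h \<tau>" "h \<tau> - k \<tau>"] by simp
  then have "(cmod (g \<tau> - k \<tau>))\<^sup>2 <= (cmod (g \<tau> - h \<tau>) + cmod (h \<tau> - k \<tau>))\<^sup>2" by (intro power_mono) auto
  also have "... <= 2 * (cmod (g \<tau> - h \<tau>))\<^sup>2 + 2 * (cmod (h \<tau> - k \<tau>))\<^sup>2"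
   using sum_squares_bound[of "cmod (g \<tau> - h \<tau>)" "cmod (h \<tau> - k \<tau>)"] by (simp add: power2_sum)
  finally have "v \<tau> * (cmod (g \<tau> - k \<tau>))\<^sup>2 <= v \<tau> * (2 * (cmod (g \<tau> - h \<tau>))\<^sup>2 + 2 * (cmod (h \<tau> - k \<tau>))\<^sup>2)"
   using v by (rule mult_left_mono)
  then show ?thesis by (simp add: distrib_left mult_ac)
 qed
 note real_pw = this
 have pw: "ennreal (v \<tau> * (cmod (g \<tau> - k \<tau>))\<^sup>2) <= 2 * ennreal (v \<tau> * (cmod (g \<tau> - h \<tau>))\<^sup>2) + 2 * ennreal (v \<tau> * (cmod (h \<tau> - k \<tau>))\<^sup>2)" for \<tau>
 proof -
  have "ennreal (2 * x + 2 * y) = 2 * ennreal x + 2 * ennreal y" if "x >= 0" "y >= 0" for x y :: real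
   using ennreal_mult[of 2 x] ennreal_mult[of 2 y] ennreal_plus[of "2 * x" "2 * y"] that by simp
  from this[of "v \<tau> * (cmod (g \<tau> - h \<tau>))\<^sup>2" "v \<tau> * (cmod (h \<tau> - k \<tau>))\<^sup>2"] ennreal_leI[OF real_pw[of \<tau>]]
  show ?thesis using v[of \<tau>] by simp
 qed
 have "(nnint (%\<tau>. ennreal (v \<tau> * (cmod (g \<tau> - k \<tau>))\<^sup>2))) <=
  (nnint (%\<tau>. 2 * ennreal (v \<tau> * (cmod (g \<tau> - h \<tau>))\<^sup>2) + 2 * ennreal (v \<tau> * (cmod (h \<tau> - k \<tau>))\<^sup>2)))"
  by (intro nn_integral_mono pw)
 also have "... = 2 * (nnint (%\<tau>. ennreal (v \<tau> * (cmod (g \<tau> - h \<tau>))\<^sup>2))) + 2 * (nnint (%\<tau>. ennreal (v \<tau> * (cmod (h \<tau> - k \<tau>))\<^sup>2)))"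
  by (subst nn_integral_add) (auto simp: nn_integral_cmult)
 finally show ?thesis .
qed

lemma approximable_limit:
 assumes [measurable]: "!!k. h k \<in> bmeas" "g \<in> bmeas" "v \<in> bmeas" "B \<in> bmeas"
  and v: "!!\<tau>. v \<tau> >= 0" and lim: "AE \<tau> in lborel. (%k. h k \<tau>) \<longlonglongrightarrow> g \<tau>"
  and bound: "!!k \<tau>. ennreal (v \<tau> * (cmod (g \<tau> - h k \<tau>))\<^sup>2) <= B \<tau>" and fin: "(nnint (%\<tau>. B \<tau>)) < \<infinity>"
  and h: "!!k. approximable v (h k)"
 shows "approximable v g"
 unfolding approximable_def
proof (intro allI impI)
 fix \<epsilon> :: real assume e: "\<epsilon> > 0"
 have "\<exists>k. (nnint (%\<tau>. ennreal (v \<tau> * (cmod (g \<tau> - h k \<tau>))\<^sup>2))) < ennreal (\<epsilon> / 4)"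
 proof (rule dominated_small[OF _ _ _ _ bound fin])
  show "AE \<tau> in lborel. (%k. g \<tau> - h k \<tau>) \<longlonglongrightarrow> 0"
   using lim
  proof eventually_elim
   case (elim \<tau>)
   have "(%k. g \<tau> - h k \<tau>) \<longlonglongrightarrow> g \<tau> - g \<tau>" by (intro tendsto_intros elim)
   then show ?case by simp
  qed
 qed (use e in auto)
 then obtain k where k: "(nnint (%\<tau>. ennreal (v \<tau> * (cmod (g \<tau> - h k \<tau>))\<^sup>2))) < ennreal (\<epsilon> / 4)" by blast
 have "\<epsilon> / 4 > 0" using e by simp
 then obtain f where f: "f \<in> reg" "(nnint (%\<tau>. ennreal (v \<tau> * (cmod (h k \<tau> - ft f \<tau>))\<^sup>2))) < ennreal (\<epsilon> / 4)"
  using h[of k] unfolding approximable_def by blast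
 have [measurable]: "ft f \<in> bmeas" by (intro ft_borel_measurable reg_measurable f)
 have "(nnint (%\<tau>. ennreal (v \<tau> * (cmod (g \<tau> - ft f \<tau>))\<^sup>2)))
  <= 2 * (nnint (%\<tau>. ennreal (v \<tau> * (cmod (g \<tau> - h k \<tau>))\<^sup>2))) + 2 * (nnint (%\<tau>. ennreal (v \<tau> * (cmod (h k \<tau> - ft f \<tau>))\<^sup>2)))"
  by (rule weighted_triangle) (use v in auto)
 also have "... < 2 * ennreal (\<epsilon> / 4) + 2 * ennreal (\<epsilon> / 4)"
  using k f(2) by (intro add_strict_mono ennreal_mult_strict_left_mono) auto
 also have "... = ennreal \<epsilon>"
 proof -
  have "2 * ennreal (\<epsilon> / 4) = ennreal (\<epsilon> / 2)" using e ennreal_mult[of 2 "\<epsilon> / 4"] by simp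
  then show ?thesis using e by (simp flip: ennreal_plus)
 qed
 finally show "\<exists>f\<in>reg. (nnint (%\<tau>. ennreal (v \<tau> * (cmod (g \<tau> - ft f \<tau>))\<^sup>2))) < ennreal \<epsilon>" using f(1) by blast
qed

text \<open>The Fourier transforms of the Gaussian regularisations are averages of \<open>h\<close> over ever smaller
 scales, so they converge pointwise, with a common integrable bound.\<close>

lemma approximable_cts_supp:
 assumes h: "cts_supp R h" and R: "R >= 0" and [measurable]: "v \<in> bmeas"
  and v: "!!\<tau>. v \<tau> >= 0" "!!\<tau>. v \<tau> <= c * (bracket \<tau>)\<^sup>2"
 shows "approximable v h"
 unfolding approximable_def
proof (intro allI impI)
 fix \<epsilon> :: real assume e: "\<epsilon> > 0"
 have hm [measurable]: "h \<in> bmeas" using cts_supp_integrable[OF h] by auto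
 obtain M where M: "M >= 0" "!!\<mu>. cmod (h \<mu>) <= M" using cts_supp_bounded[OF h] by blast
 obtain C where C: "!!\<xi> k. k >= 1 ==> cmod (LINT y|lborel. h (\<xi> - y / k) * cor (std_normal_density y)) <= C * bracket \<xi> powr (- 2)"
  using gauss_average_decay[OF h R] by blast
 define f where "f k t = gauss (real (Suc k)) t * ift h t" for k t
 have f_reg: "f k \<in> reg" for k
  using reg.basic[of "real (Suc k)" R h 0] h by (simp add: f_def[abs_def])
 have [measurable]: "ft (f k) \<in> bmeas" for k by (intro ft_borel_measurable reg_measurable f_reg)
 have ft_f: "ft (f k) \<xi> = (LINT y|lborel. h (\<xi> - y / real (Suc k)) * cor (std_normal_density y))" for k \<xi>
  unfolding f_def by (rule ft_gauss_ift[OF h]) simp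
 have ft_le: "cmod (ft (f k) \<xi>) <= C * bracket \<xi> powr (- 2)" for k \<xi> unfolding ft_f by (rule C) simp
 have lim: "(%k. ft (f k) \<xi>) \<longlonglongrightarrow> h \<xi>" for \<xi>
 proof -
  have "(%k. LINT y|lborel. h (\<xi> - y / real (Suc k)) * cor (std_normal_density y)) \<longlonglongrightarrow> (LINT y|lborel. h \<xi> * cor (std_normal_density y))"
  proof (rule integral_dominated_convergence[where w = "%y. M * std_normal_density y"])
   show "AE y in lborel. (%k. h (\<xi> - y / real (Suc k)) * cor (std_normal_density y)) \<longlonglongrightarrow> h \<xi> * cor (std_normal_density y)"
   proof (rule AE_I2)
    fix y
    have "(%k. \<xi> - y * inverse (real (Suc k))) \<longlonglongrightarrow> \<xi> - y * 0"
     by (intro tendsto_intros LIMSEQ_inverse_real_of_nat)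
    then have "(%k. \<xi> - y / real (Suc k)) \<longlonglongrightarrow> \<xi>" by (simp add: divide_inverse)
    moreover have "isCont h \<xi>" using cts_supp_cont[OF h, of UNIV] by (simp add: continuous_on_eq_continuous_at)
    ultimately have "(%k. h (\<xi> - y / real (Suc k))) \<longlonglongrightarrow> h \<xi>" by (rule isCont_tendsto_compose[rotated])
    then show "(%k. h (\<xi> - y / real (Suc k)) * cor (std_normal_density y)) \<longlonglongrightarrow> h \<xi> * cor (std_normal_density y)"
     by (rule tendsto_mult_right)
   qed
   show "AE y in lborel. norm (h (\<xi> - y / real (Suc k)) * cor (std_normal_density y)) <= M * std_normal_density y" for k
    using M(2) by (intro AE_I2) (simp add: norm_mult mult_right_mono)
   show "integrable lborel (%y. M * std_normal_density y)"
    using integrable_std_normal_moment_abs[of 0] by simp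
  qed measurable
  moreover have "(LINT y|lborel. cor (std_normal_density y)) = 1"
   using integral_std_normal_moment_even[of 0] by (simp add: integral_complex_of_real)
  ultimately show ?thesis unfolding ft_f by simp
 qed
 have h_le: "cmod (h \<xi>) <= C * bracket \<xi> powr (- 2)" for \<xi>
  by (rule LIMSEQ_le_const2[OF tendsto_norm[OF lim]]) (use ft_le in blast)
 have c: "c >= 0" using order_trans[OF v(1)[of 0] v(2)[of 0]] by (simp add: bracket_def)
 have "\<exists>k. (nnint (%\<tau>. ennreal (v \<tau> * (cmod (h \<tau> - ft (f k) \<tau>))\<^sup>2))) < ennreal \<epsilon>"
 proof (rule dominated_small[where B = "%\<tau>. ennreal (4 * c * C\<^sup>2) * ennreal (bracket \<tau> powr (- 2))"])
  show "AE \<tau> in lborel. (%k. h \<tau> - ft (f k) \<tau>) \<longlonglongrightarrow> 0"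
  proof (rule AE_I2)
   fix \<tau>
   have "(%k. h \<tau> - ft (f k) \<tau>) \<longlonglongrightarrow> h \<tau> - h \<tau>" by (intro tendsto_intros lim)
   then show "(%k. h \<tau> - ft (f k) \<tau>) \<longlonglongrightarrow> 0" by simp
  qed
  show "ennreal (v \<tau> * (cmod (h \<tau> - ft (f k) \<tau>))\<^sup>2) <= ennreal (4 * c * C\<^sup>2) * ennreal (bracket \<tau> powr (- 2))" for k \<tau>
  proof -
   have "cmod (h \<tau> - ft (f k) \<tau>) <= 2 * (C * bracket \<tau> powr (- 2))"
    using norm_triangle_ineq4[of "h \<tau>" "ft (f k) \<tau>"] h_le[of \<tau>] ft_le[of k \<tau>] by simp
   then have "(cmod (h \<tau> - ft (f k) \<tau>))\<^sup>2 <= (2 * (C * bracket \<tau> powr (- 2)))\<^sup>2" by (intro power_mono) auto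
   then have "v \<tau> * (cmod (h \<tau> - ft (f k) \<tau>))\<^sup>2 <= (c * (bracket \<tau>)\<^sup>2) * (2 * (C * bracket \<tau> powr (- 2)))\<^sup>2"
    using v by (intro mult_mono) (auto simp: c)
   also have "... = (4 * c * C\<^sup>2) * bracket \<tau> powr (- 2)"
    by (simp add: powr_minus powr_numeral field_simps power2_eq_square)
   finally show ?thesis using c by (subst ennreal_mult[symmetric]) (auto intro: ennreal_leI)
  qed
  have "(nnint (%\<tau>. ennreal (4 * c * C\<^sup>2) * ennreal (bracket \<tau> powr (- 2)))) = ennreal (4 * c * C\<^sup>2) * bracket_integral 2"
   unfolding bracket_integral_def by (rule nn_integral_cmult) measurable
  also have "... < \<infinity>" using bracket_integral_finite[of 2] by (simp add: ennreal_mult_less_top)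
  finally show "(nnint (%\<tau>. ennreal (4 * c * C\<^sup>2) * ennreal (bracket \<tau> powr (- 2)))) < \<infinity>" .
 qed (use e in auto)
 then show "\<exists>f\<in>reg. (nnint (%\<tau>. ennreal (v \<tau> * (cmod (h \<tau> - ft f \<tau>))\<^sup>2))) < ennreal \<epsilon>" using f_reg by blast
qed

text \<open>A measurable function is a limit almost everywhere of continuous ones; these are truncated
 to keep the bound and the support.\<close>

lemma approximable_bounded_supp:
 assumes [measurable]: "g \<in> bmeas" and R: "R >= 0" and M: "M > 0"
  and g: "!!\<tau>. cmod (g \<tau>) <= M" "!!\<tau>. \<bar>\<tau>\<bar> > R ==> g \<tau> = 0" and [measurable]: "v \<in> bmeas"
  and v: "!!\<tau>. v \<tau> >= 0" "!!\<tau>. v \<tau> <= c * (bracket \<tau>)\<^sup>2"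
 shows "approximable v g"
proof -
 have "g \<in> borel_measurable lebesgue" by (rule measurable_completion) simp
 then have "g \<in> borel_measurable (lebesgue_on UNIV)" by (rule measurable_restrict_space1)
 then have "g measurable_on UNIV"
  using measurable_on_iff_borel_measurable[of UNIV g] by simp
 then obtain Z G where Z: "negligible Z" and G: "!!n. continuous_on UNIV (G n)" "!!x. x \<notin> Z ==> (%n. G n x) \<longlonglongrightarrow> g x"
  unfolding measurable_on_def by auto
 define cut :: "real => real" where "cut t = max 0 (min 1 (R + 1 - \<bar>t\<bar>))" for t
 define clip :: "complex => complex" where "clip z = of_real (M / max M (cmod z)) * z" for z
 define h where "h n t = of_real (cut t) * clip (G n t)" for n t
 have cut: "0 <= cut t" "cut t <= 1" "\<bar>t\<bar> >= R + 1 ==> cut t = 0" "\<bar>t\<bar> <= R ==> cut t = 1" for t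
  by (auto simp: cut_def)
 have clip_le: "cmod (clip z) <= M" for z
 proof -
  have "cmod (clip z) = M * (cmod z / max M (cmod z))" using M by (simp add: clip_def norm_mult norm_divide)
  also have "... <= M * 1"
  proof (rule mult_left_mono)
   have "max M (cmod z) > 0" by (rule less_le_trans[OF M]) simp
   then show "cmod z / max M (cmod z) <= 1" by (simp only: divide_le_eq_1_pos)
  qed (use M in simp)
  finally show ?thesis by simp
 qed
 have clip_id: "clip z = z" if "cmod z <= M" for z
  unfolding clip_def max_absorb1[OF that] using M by simp
 have max_ne: "max M (cmod z) \<noteq> 0" for z
  by (rule less_imp_neq[OF less_le_trans[OF M max.cobounded1], symmetric])
 have clip_cont: "continuous_on UNIV clip"
  unfolding clip_def using max_ne by (intro continuous_intros) auto
 have cut_cont: "continuous_on UNIV cut" unfolding cut_def by (intro continuous_intros)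
 have cmp: "continuous_on UNIV (%t. clip (G n t))" for n
  by (rule continuous_on_compose2[OF clip_cont G(1)]) auto
 have h: "cts_supp (R + 1) (h n)" for n
  unfolding cts_supp_def h_def using cut(3) by (auto intro!: continuous_intros cut_cont cmp)
 have hm: "h n \<in> bmeas" for n using cts_supp_integrable[OF h] by auto
 have hM: "cmod (h n t) <= M" for n t
  using mult_mono[OF cut(2)[of t] clip_le[of "G n t"]] cut(1)[of t] by (simp add: h_def norm_mult)
 have c: "c >= 0" using order_trans[OF v(1)[of 0] v(2)[of 0]] by (simp add: bracket_def)
 let ?B = "%\<tau>. ennreal (c * (2 + R)\<^sup>2 * (2 * M)\<^sup>2) * indicator {-(R+1)..R+1} \<tau>"
 show ?thesis
 proof (rule approximable_limit[where B = ?B and h = h])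
  show "approximable v (h k)" for k by (rule approximable_cts_supp[OF h]) (use R v in auto)
  have "AE \<tau> in lborel. \<tau> \<notin> Z"
  proof -
   have "Z \<in> null_sets lebesgue" using Z by (simp add: negligible_iff_null_sets)
   then have "AE \<tau> in lebesgue. \<tau> \<notin> Z" by (rule AE_not_in)
   then show ?thesis by (simp add: AE_completion_iff)
  qed
  then show "AE \<tau> in lborel. (%k. h k \<tau>) \<longlonglongrightarrow> g \<tau>"
  proof eventually_elim
   case (elim \<tau>)
   have "isCont clip (g \<tau>)" using clip_cont by (simp add: continuous_on_eq_continuous_at)
   from isCont_tendsto_compose[OF this G(2)[OF elim]]
   have "(%k. h k \<tau>) \<longlonglongrightarrow> of_real (cut \<tau>) * clip (g \<tau>)" unfolding h_def by (rule tendsto_mult_left)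
   moreover have "of_real (cut \<tau>) * clip (g \<tau>) = g \<tau>"
    using clip_id[OF g(1)[of \<tau>]] g(2)[of \<tau>] cut(4)[of \<tau>] by (cases "\<bar>\<tau>\<bar> <= R") auto
   ultimately show ?case by simp
  qed
  show "ennreal (v \<tau> * (cmod (g \<tau> - h k \<tau>))\<^sup>2) <= ?B \<tau>" for k \<tau>
  proof (cases "\<bar>\<tau>\<bar> <= R + 1")
   case True
   have "cmod (g \<tau> - h k \<tau>) <= 2 * M" using norm_triangle_ineq4[of "g \<tau>" "h k \<tau>"] g(1)[of \<tau>] hM[of k \<tau>] by simp
   then have "(cmod (g \<tau> - h k \<tau>))\<^sup>2 <= (2 * M)\<^sup>2" by (intro power_mono) auto
   moreover have "(bracket \<tau>)\<^sup>2 <= (2 + R)\<^sup>2" using True by (intro power_mono) (auto simp: bracket_def)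
   then have "v \<tau> <= c * (2 + R)\<^sup>2" by (intro order_trans[OF v(2)] mult_left_mono c)
   ultimately have "v \<tau> * (cmod (g \<tau> - h k \<tau>))\<^sup>2 <= c * (2 + R)\<^sup>2 * (2 * M)\<^sup>2" using c by (intro mult_mono) auto
   then show ?thesis using True by (auto intro!: ennreal_leI simp: indicator_def abs_le_iff)
  next
   case False
   then have "g \<tau> = 0" "h k \<tau> = 0" using g(2)[of \<tau>] cut(3)[of \<tau>] by (auto simp: h_def)
   then show ?thesis by simp
  qed
  have "(nnint (%\<tau>. ?B \<tau>)) = ennreal (c * (2 + R)\<^sup>2 * (2 * M)\<^sup>2) * emeasure lborel {-(R+1)..R+1}"
   by (rule nn_integral_cmult_indicator) auto
  also have "... < \<infinity>" using R by (simp add: ennreal_mult_less_top)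
  finally show "(nnint (%\<tau>. ?B \<tau>)) < \<infinity>" .
 qed (use hm v in auto)
qed

lemma approximable_L2:
 assumes [measurable]: "g \<in> bmeas" "v \<in> bmeas"
  and v: "!!\<tau>. v \<tau> >= 0" "!!\<tau>. v \<tau> <= c * (bracket \<tau>)\<^sup>2"
  and fin: "(nnint (%\<tau>. ennreal (v \<tau> * (cmod (g \<tau>))\<^sup>2))) < \<infinity>"
 shows "approximable v g"
proof -
 define h where "h j \<tau> = (if \<bar>\<tau>\<bar> <= real j \<and> cmod (g \<tau>) <= real j then g \<tau> else 0)" for j :: nat and \<tau>
 show ?thesis
 proof (rule approximable_limit[where h = h and B = "%\<tau>. ennreal (v \<tau> * (cmod (g \<tau>))\<^sup>2)"])
  show hm: "h k \<in> bmeas" for k unfolding h_def by measurable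
  show "approximable v (h k)" for k
   by (rule approximable_bounded_supp[where R = "real k" and M = "real k + 1" and c = c])
     (use hm v in \<open>auto simp: h_def\<close>)
  show "AE \<tau> in lborel. (%k. h k \<tau>) \<longlonglongrightarrow> g \<tau>"
  proof (intro AE_I2 tendsto_eventually)
   fix \<tau>
   obtain K where "max \<bar>\<tau>\<bar> (cmod (g \<tau>)) <= real K" using real_arch_simple by blast
   then show "\<forall>\<^sub>F k in sequentially. h k \<tau> = g \<tau>"
    unfolding eventually_sequentially by (intro exI[of _ K]) (auto simp: h_def)
  qed
  show "ennreal (v \<tau> * (cmod (g \<tau> - h k \<tau>))\<^sup>2) <= ennreal (v \<tau> * (cmod (g \<tau>))\<^sup>2)" for k \<tau>
   using v by (auto simp: h_def)
 qed (use v fin in auto)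
qed

lemma reg_sum: "finite A ==> (!!n. n \<in> A ==> f n \<in> reg) ==> (%t. \<Sum>n\<in>A. f n t) \<in> reg"
 by (induction A rule: finite_induct) (auto intro: reg.zero reg.add)

lemma osc_period: "osc (2 * pi) (real_of_int k) = (if k = 0 then cor (2 * pi) else 0)"
proof -
 have "iexp (2 * pi * real_of_int k) = 1"
  unfolding cis_conv_exp[symmetric] by (rule cis_multiple_2pi) simp
 then show ?thesis by (simp add: osc_def)
qed

lemma tensor_integral:
 fixes g f :: "real => complex"
 assumes "integrable lborel g" "integrable lborel f"
 shows "integrable lborel (%p. g (fst p) * f (snd p))"
  and "(LINT p|lborel. g (fst p) * f (snd p)) = (LINT x|lborel. g x) * (LINT y|lborel. f y)"
proof -
 have i: "integrable (lborel \<Otimes>\<^sub>M lborel) (%(x, y). g x * f y)" by (rule integrable_tensor[OF assms])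
 have eq: "(%(x, y). g x * f y) = (%p. g (fst p) * f (snd p))" by (simp add: fun_eq_iff)
 from i show "integrable lborel (%p. g (fst p) * f (snd p))" unfolding eq lborel_prod .
 have "(LINT x|lborel. LINT y|lborel. g x * f y) = (LINT p|(lborel \<Otimes>\<^sub>M lborel). (case p of (x, y) => g x * f y))"
  by (rule lborel_pair.integral_fst[OF i])
 then show "(LINT p|lborel. g (fst p) * f (snd p)) = (LINT x|lborel. g x) * (LINT y|lborel. f y)"
  unfolding eq lborel_prod by simp
qed

lemma trigonometric_in_Yspace:
 fixes K :: int
 assumes f: "!!n. f n \<in> reg"
 defines "F \<equiv> %x t. \<Sum>n=-K..K. iexp (x * real_of_int n) * f n t"
 shows "F \<in> Yspace"
  and "set_integrable lborel ({0..2*pi} \<times> UNIV) (%p. F (fst p) (snd p))"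
  and "st_fourier F n \<tau> = (if n \<in> {-K..K} then ft (f n) \<tau> else 0)"
proof -
 have e_per: "iexp ((x + 2 * pi) * real_of_int n) = iexp (x * real_of_int n)" for x n
 proof -
  have "iexp (2 * pi * real_of_int n) = 1"
   unfolding cis_conv_exp[symmetric] by (rule cis_multiple_2pi) simp
  moreover have "\<i> * cor ((x + 2 * pi) * real_of_int n) = \<i> * cor (x * real_of_int n) + \<i> * cor (2 * pi * real_of_int n)"
   by (simp add: algebra_simps)
  ultimately show ?thesis by (simp only: exp_add) simp
 qed
 have "F (x + 2 * pi) t = F x t" for x t unfolding F_def e_per ..
 moreover have "schwartz (F x)" for x
  unfolding F_def by (intro reg_schwartz reg_sum reg_scale f) simp
 moreover have "smooth (%x. F x t)" for t
 proof -
  define D where "D j x = (\<Sum>n=-K..K. (\<i> * cor (real_of_int n)) ^ j * f n t * iexp (x * real_of_int n))" for j x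
  have "(D j has_vector_derivative D (Suc j) x) (at x)" for j x
  proof -
   have "((%x. \<Sum>n=-K..K. (\<i> * cor (real_of_int n)) ^ j * f n t * iexp (x * real_of_int n)) has_vector_derivative
    (\<Sum>n=-K..K. (\<i> * cor (real_of_int n)) ^ j * f n t * (\<i> * cor (real_of_int n) * iexp (x * real_of_int n)))) (at x)"
    by (intro has_vector_derivative_sum has_vector_derivative_mult_right exp_deriv)
   moreover have "(\<Sum>n=-K..K. (\<i> * cor (real_of_int n)) ^ j * f n t * (\<i> * cor (real_of_int n) * iexp (x * real_of_int n))) = D (Suc j) x"
    unfolding D_def by (intro sum.cong refl) (simp add: mult_ac)
   ultimately show ?thesis by (simp add: D_def[abs_def])
  qed
  moreover have "D 0 = (%x. F x t)" by (simp add: D_def F_def fun_eq_iff mult.commute)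
  ultimately show ?thesis unfolding smooth_def derivatives_def by blast
 qed
 ultimately show "F \<in> Yspace" by (simp add: Yspace_def)
 let ?I = "%x. indicator {0..2*pi} x :: complex"
 have ind: "indicator ({0..2*pi} \<times> UNIV) p *\<^sub>R z = ?I (fst p) * z" for p :: "real \<times> real" and z :: complex
  by (cases p) (simp add: indicator_def)
 have e_int: "integrable lborel (%x. ?I x * iexp (x * l))"
  and e_val: "(LINT x|lborel. ?I x * iexp (x * l)) = osc (2 * pi) l" for l
 proof -
  have eq: "indicator {0..2*pi} x *\<^sub>R iexp (x * l) = ?I x * iexp (x * l)" for x
   by (simp add: indicator_def)
  have "set_integrable lborel {0..2*pi} (%x. iexp (x * l))"
   by (intro borel_integrable_atLeastAtMost' continuous_intros)
  then show "integrable lborel (%x. ?I x * iexp (x * l))"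
   unfolding set_integrable_def eq .
  have "(LINT x:{0..2*pi}|lborel. iexp (x * l)) = osc (2 * pi) l" by (rule osc_integral) simp
  then show "(LINT x|lborel. ?I x * iexp (x * l)) = osc (2 * pi) l"
   unfolding set_lebesgue_integral_def eq .
 qed
 have "integrable lborel (%p. \<Sum>m=-K..K. (?I (fst p) * iexp (fst p * real_of_int m)) * f m (snd p))"
  by (intro Bochner_Integration.integrable_sum tensor_integral(1)[OF e_int] reg_integrable f)
 then show "set_integrable lborel ({0..2*pi} \<times> UNIV) (%p. F (fst p) (snd p))"
  unfolding set_integrable_def ind F_def sum_distrib_left by (simp only: mult.assoc)
 have fm: "integrable lborel (%t. exp (- \<i> * cor (t * \<tau>)) * f m t)" for m
 proof -
  have [measurable]: "f m \<in> bmeas" by (rule reg_measurable[OF f])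
  have "cmod (exp (- \<i> * cor (t * \<tau>))) = 1" for t
   using norm_exp_i_times[of "- (t * \<tau>)"] by simp
  then show ?thesis
   by (intro Bochner_Integration.integrable_bound[OF reg_integrable[OF f[of m]]]) (auto simp: norm_mult)
 qed
 have "(LINT p:({0..2*pi} \<times> UNIV)|lborel. exp (- \<i> * cor (real_of_int n * fst p + \<tau> * snd p)) * F (fst p) (snd p))
  = (LINT p|lborel. (\<Sum>m=-K..K. (?I (fst p) * iexp (fst p * real_of_int (m - n))) * (exp (- \<i> * cor (snd p * \<tau>)) * f m (snd p))))"
  unfolding set_lebesgue_integral_def ind F_def sum_distrib_left
 proof (intro Bochner_Integration.integral_cong refl sum.cong)
  fix p :: "real \<times> real" and m
  have "exp (- \<i> * cor (real_of_int n * fst p + \<tau> * snd p)) * iexp (fst p * real_of_int m)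
   = iexp (fst p * real_of_int (m - n)) * exp (- \<i> * cor (snd p * \<tau>))"
   unfolding exp_add[symmetric] by (simp add: algebra_simps)
  then show "?I (fst p) * (exp (- \<i> * cor (real_of_int n * fst p + \<tau> * snd p)) * (iexp (fst p * real_of_int m) * f m (snd p)))
   = (?I (fst p) * iexp (fst p * real_of_int (m - n))) * (exp (- \<i> * cor (snd p * \<tau>)) * f m (snd p))"
   by (simp only: mult_ac)
 qed
 also have "... = (\<Sum>m=-K..K. osc (2 * pi) (real_of_int (m - n)) * ft (f m) \<tau>)"
  unfolding ft_def e_val[symmetric]
  by (subst Bochner_Integration.integral_sum)
    (auto simp only: tensor_integral(2)[OF e_int fm] intro!: tensor_integral(1)[OF e_int fm])
 also have "... = (\<Sum>m=-K..K. if m = n then cor (2 * pi) * ft (f m) \<tau> else 0)"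
  unfolding osc_period by (intro sum.cong) auto
 also have "... = (if n \<in> {-K..K} then cor (2 * pi) * ft (f n) \<tau> else 0)" by (simp add: sum.delta)
 finally show "st_fourier F n \<tau> = (if n \<in> {-K..K} then ft (f n) \<tau> else 0)"
  unfolding st_fourier_def by simp
qed

lemma Xsb_normsq_eq: "Xsb_normsq s b G = wnorm (%n. bracket (of_int n) powr s) b (cn G)"
 unfolding Xsb_normsq_def wnorm_def
 by (simp only: ennreal_mult[symmetric] ennreal_power mult_nonneg_nonneg norm_ge_zero powr_ge_zero)

text \<open>Finite norm suffices for membership: cut to finitely many spatial frequencies and regularise
 each of them in time.\<close>

lemma Xsb_density:
 assumes [measurable]: "!!n. G n \<in> bmeas" and fin: "Xsb_normsq s b G < \<infinity>" and b: "0 <= b" "b <= 1"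
 shows "G \<in> Xsb s b"
 unfolding Xsb_def
proof (intro CollectI conjI allI impI)
 fix \<epsilon> :: real assume e: "\<epsilon> > 0"
 define v where "v n \<tau> = (bracket (\<bar>\<tau>\<bar> - gam n) powr b * bracket (real_of_int n) powr s)\<^sup>2" for n \<tau>
 define A where "A H n = (nnint (%\<tau>. ennreal (v n \<tau> * (cmod (H n \<tau>))\<^sup>2)))" for H n
 have norm_A: "Xsb_normsq s b H = (nsum (%n. A H n))" for H
  unfolding Xsb_normsq_def A_def v_def by (simp only: power_mult_distrib)
 have vm [measurable]: "v n \<in> bmeas" for n unfolding v_def by measurable
 have v: "v n \<tau> >= 0" for n \<tau> by (simp add: v_def)
 have v_le: "v n \<tau> <= (bracket (gam n) * bracket (real_of_int n) powr s)\<^sup>2 * (bracket \<tau>)\<^sup>2" for n \<tau>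
 proof -
  have "bracket (\<bar>\<tau>\<bar> - gam n) powr b <= bracket (\<bar>\<tau>\<bar> - gam n) powr 1" using b by (intro powr_mono) auto
  also have "... <= bracket \<tau> * bracket (gam n)"
   using bracket_add_le_mult[of "\<bar>\<tau>\<bar>" "- gam n"] by (simp add: bracket_def)
  finally have "v n \<tau> <= ((bracket \<tau> * bracket (gam n)) * bracket (real_of_int n) powr s)\<^sup>2"
   unfolding v_def by (intro power_mono mult_right_mono) auto
  then show ?thesis by (simp add: power_mult_distrib mult_ac)
 qed
 have "(%K::nat. nsum (%n. A G n * indicator (- {- int K..int K}) n)) \<longlonglongrightarrow> (\<integral>\<^sup>+n. 0 \<partial>count_space (UNIV :: int set))"
 proof (rule nn_integral_dominated_convergence[where w = "A G"])
  show "AE n in count_space UNIV. (%K::nat. A G n * indicator (- {- int K..int K}) n) \<longlonglongrightarrow> 0"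
  proof (intro AE_I2 tendsto_eventually)
   fix n :: int
   show "\<forall>\<^sub>F K in sequentially. A G n * indicator (- {- int K..int K}) n = 0"
    unfolding eventually_sequentially by (intro exI[of _ "nat \<bar>n\<bar>"]) (auto simp: indicator_def)
  qed
  show "(nsum (%n. A G n)) < \<infinity>" using fin norm_A by simp
 qed (auto simp: indicator_def)
 then have "(%K::nat. nsum (%n. A G n * indicator (- {- int K..int K}) n)) \<longlonglongrightarrow> 0" by simp
 from order_tendstoD(2)[OF this, of "ennreal (\<epsilon> / 2)"] e obtain K :: nat
  where K: "(nsum (%n. A G n * indicator (- {- int K..int K}) n)) < ennreal (\<epsilon> / 2)"
  by (auto simp: eventually_sequentially)
 define \<delta> where "\<delta> = \<epsilon> / (2 * (2 * real K + 1))"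
 have d: "\<delta> > 0" using e by (simp add: \<delta>_def)
 have "\<exists>f\<in>reg. (nnint (%\<tau>. ennreal (v n \<tau> * (cmod (G n \<tau> - ft f \<tau>))\<^sup>2))) < ennreal \<delta>" for n
 proof -
  have "A G n = (nsum (%m. A G m * indicator {n} m))" by simp
  also have "... <= (nsum (%m. A G m))" by (intro nn_integral_mono) (auto simp: indicator_def)
  also have "... < \<infinity>" using fin norm_A by simp
  finally have "approximable (v n) (G n)"
   by (intro approximable_L2[OF _ vm v v_le]) (simp_all add: A_def)
  then show ?thesis using d unfolding approximable_def by blast
 qed
 then obtain f where f: "!!n. f n \<in> reg" "!!n. (nnint (%\<tau>. ennreal (v n \<tau> * (cmod (G n \<tau> - ft (f n) \<tau>))\<^sup>2))) < ennreal \<delta>"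
  by metis
 define F where "F x t = (\<Sum>n=-int K..int K. iexp (x * real_of_int n) * f n t)" for x t
 have F: "F \<in> Yspace" "set_integrable lborel ({0..2*pi} \<times> UNIV) (%p. F (fst p) (snd p))"
   "st_fourier F n \<tau> = (if n \<in> {- int K..int K} then ft (f n) \<tau> else 0)" for n \<tau>
  unfolding F_def[abs_def] using f(1) by (rule trigonometric_in_Yspace)+
 have [measurable]: "ft (f n) \<in> bmeas" for n by (intro ft_borel_measurable reg_measurable f)
 have stm [measurable]: "st_fourier F n \<in> bmeas" for n
 proof -
  have "st_fourier F n = (if n \<in> {-int K..int K} then ft (f n) else (%_. 0))" by (intro ext) (simp add: F(3))
  then show ?thesis by simp
 qed
 have "Xsb_normsq s b (%n \<tau>. G n \<tau> - st_fourier F n \<tau>)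
  <= (nsum (%n. ennreal \<delta> * indicator {- int K..int K} n + A G n * indicator (- {- int K..int K}) n))"
  unfolding norm_A
 proof (intro nn_integral_mono)
  fix n
  show "A (%n \<tau>. G n \<tau> - st_fourier F n \<tau>) n <= ennreal \<delta> * indicator {- int K..int K} n + A G n * indicator (- {- int K..int K}) n"
  proof (cases "n \<in> {- int K..int K}")
   case True
   then have "A (%n \<tau>. G n \<tau> - st_fourier F n \<tau>) n = (nnint (%\<tau>. ennreal (v n \<tau> * (cmod (G n \<tau> - ft (f n) \<tau>))\<^sup>2)))"
    unfolding A_def F(3) by simp
   then show ?thesis using True f(2)[of n] by simp
  next
   case False
   then have "A (%n \<tau>. G n \<tau> - st_fourier F n \<tau>) n = A G n" unfolding A_def F(3) by (simp only: if_not_P if_False diff_0_right)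
   then show ?thesis using False by simp
  qed
 qed
 also have "... = (nsum (%n. ennreal \<delta> * indicator {- int K..int K} n)) + (nsum (%n. A G n * indicator (- {- int K..int K}) n))"
  by (rule nn_integral_add) auto
 also have "(nsum (%n. ennreal \<delta> * indicator {- int K..int K} n)) = ennreal (\<epsilon> / 2)"
 proof -
  have "(nsum (%n. ennreal \<delta> * indicator {- int K..int K} n)) = ennreal \<delta> * emeasure (count_space UNIV) {- int K..int K}"
   by (rule nn_integral_cmult_indicator) simp
  also have "emeasure (count_space UNIV) {- int K..int K} = ennreal (2 * real K + 1)"
   by (subst emeasure_count_space_finite) (auto simp: ennreal_of_nat_eq_real_of_nat nat_add_distrib)
  also have "ennreal \<delta> * ennreal (2 * real K + 1) = ennreal (\<delta> * (2 * real K + 1))"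
   using d by (subst ennreal_mult) auto
  also have "\<delta> * (2 * real K + 1) = \<epsilon> / 2" by (simp add: \<delta>_def field_simps add_nonneg_eq_0_iff)
  finally show ?thesis .
 qed
 also have "ennreal (\<epsilon> / 2) + (nsum (%n. A G n * indicator (- {- int K..int K}) n)) < ennreal (\<epsilon> / 2) + ennreal (\<epsilon> / 2)"
  using K by (intro ennreal_add_left_cancel_less[THEN iffD2] conjI) auto
 also have "... = ennreal \<epsilon>" using e by (simp flip: ennreal_plus)
 finally have small: "Xsb_normsq s b (%n \<tau>. G n \<tau> - st_fourier F n \<tau>) < ennreal \<epsilon>" .
 have "Xsb_normsq s b (st_fourier F) <= 2 * (Xsb_normsq s b G + Xsb_normsq s b (%n \<tau>. G n \<tau> - st_fourier F n \<tau>))"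
  using wnorm_diff_le[of G "%n \<tau>. G n \<tau> - st_fourier F n \<tau>"] unfolding Xsb_normsq_eq by simp
 also have "... < \<infinity>" using fin order.strict_trans[OF small] by (simp add: ennreal_mult_less_top)
 finally show "\<exists>F\<in>Yspace. set_integrable lborel ({0..2*pi} \<times> UNIV) (%p. F (fst p) (snd p)) \<and>
    Xsb_normsq s b (st_fourier F) < \<infinity> \<and> Xsb_normsq s b (%n \<tau>. G n \<tau> - st_fourier F n \<tau>) < ennreal \<epsilon>"
  using F(1,2) small by blast
qed (use fin in auto)

lemma Xsb_iff:
 "0 <= b ==> b <= 1 ==> G \<in> Xsb s b \<longleftrightarrow> G \<in> XX (%n. bracket (of_int n) powr s) b"
 using Xsb_density[of G s b] unfolding XX_def Xsb_normsq_eq[symmetric] by (auto simp: Xsb_def)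

section \<open>Sobolev norms as sums\<close>

definition hs2 :: "real => (int => complex) => ennreal" where
 "hs2 s f = (nsum (%n. ennreal ((bracket (of_int n) powr s * cmod (f n))\<^sup>2)))"

text \<open>Links the unordered sums in the definition of the Sobolev norm with integrals for
 the counting measure, to which monotone and dominated convergence apply.\<close>

lemma infsum_nonneg_real:
 fixes g :: "'a => real"
 assumes g: "!!x. g x >= 0"
 shows "g summable_on UNIV \<longleftrightarrow> (nsum (%x. ennreal (g x))) < \<infinity>"
  and "infsum g UNIV = enn2real (nsum (%x. ennreal (g x)))"
proof -
 have int: "g summable_on UNIV \<longleftrightarrow> integrable (count_space UNIV) g"
  by (rule trans[OF summable_on_iff_abs_summable_on_real], rule trans[OF abs_summable_equivalent], rule abs_summable_on_def)
 then show "g summable_on UNIV \<longleftrightarrow> (nsum (%x. ennreal (g x))) < \<infinity>"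
  using g by (simp add: integrable_iff_bounded)
 have "infsum g UNIV = integral\<^sup>L (count_space UNIV) g"
 proof (cases "g summable_on UNIV")
  case True
  then have "Infinite_Set_Sum.abs_summable_on g UNIV" unfolding int abs_summable_on_def .
  then show ?thesis using infsetsum_infsum[of g UNIV] by (simp add: infsetsum_def)
 next
  case False
  then show ?thesis using int by (simp add: infsum_not_exists not_integrable_integral_eq)
 qed
 also have "... = enn2real (nsum (%x. ennreal (g x)))"
  using g by (intro integral_eq_nn_integral) auto
 finally show "infsum g UNIV = enn2real (nsum (%x. ennreal (g x)))" .
qed

lemma Hs_iff: "f \<in> Hs s \<longleftrightarrow> hs2 s f < \<infinity>"
 unfolding Hs_def hs2_def mem_Collect_eq by (rule infsum_nonneg_real(1)) simp

lemma Hs_norm_eq: "Hs_norm s f = sqrt (enn2real (hs2 s f))"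
 unfolding Hs_norm_def hs2_def by (subst infsum_nonneg_real(2)) simp_all

lemma hs2_eq: "f \<in> Hs s ==> hs2 s f = ennreal ((Hs_norm s f)\<^sup>2)"
 by (simp add: Hs_iff Hs_norm_eq)

lemma data_norm_bracket: "data_norm (%n. bracket (of_int n) powr s) \<phi> \<psi> = hs2 s \<phi> + hs2 (s - 1) \<psi>"
proof -
 have "bracket (of_int n) powr s * (c / bracket (of_int n)) = bracket (of_int n) powr (s - 1) * c" for n c
  by (simp add: powr_diff)
 then have "data_norm (%n. bracket (of_int n) powr s) \<phi> \<psi> = (nsum (%n. ennreal ((bracket (of_int n) powr s * cmod (\<phi> n))\<^sup>2) + ennreal ((bracket (of_int n) powr (s - 1) * cmod (\<psi> n))\<^sup>2)))"
  unfolding data_norm_def by (simp only: ennreal_plus zero_le_power2)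
 also have "... = hs2 s \<phi> + hs2 (s - 1) \<psi>"
  unfolding hs2_def by (rule nn_integral_add) auto
 finally show ?thesis .
qed

lemma data_norm_mono:
 assumes "!!n. 0 <= w n" "!!n. w n <= w' n"
 shows "data_norm w \<phi> \<psi> <= data_norm w' \<phi> \<psi>"
 unfolding data_norm_def using assms
 by (intro nn_integral_mono ennreal_leI add_mono power_mono mult_right_mono) auto

lemma data_norm_triangle:
 "data_norm w \<phi> \<psi> <= 2 * (data_norm w \<phi>' \<psi>' + data_norm w (%n. \<phi> n - \<phi>' n) (%n. \<psi> n - \<psi>' n))"
proof -
 have sq: "(x * cmod z)\<^sup>2 <= 2 * ((x * cmod z')\<^sup>2 + (x * cmod (z - z'))\<^sup>2)" for x z z'
 proof -
  have "(cmod z)\<^sup>2 <= (cmod z' + cmod (z - z'))\<^sup>2"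
   using norm_triangle_ineq[of z' "z - z'"] by (intro power_mono) auto
  also have "... <= 2 * ((cmod z')\<^sup>2 + (cmod (z - z'))\<^sup>2)"
   using sum_squares_bound[of "cmod z'" "cmod (z - z')"] by (simp add: power2_sum)
  finally have "x\<^sup>2 * (cmod z)\<^sup>2 <= x\<^sup>2 * (2 * ((cmod z')\<^sup>2 + (cmod (z - z'))\<^sup>2))" by (rule mult_left_mono) simp
  then show ?thesis by (simp add: power_mult_distrib distrib_left mult_ac)
 qed
 define A where "A \<phi> \<psi> n = (w n * cmod (\<phi> n))\<^sup>2 + (w n * (cmod (\<psi> n) / bracket (of_int n)))\<^sup>2" for \<phi> \<psi> :: "int => complex" and n
 have dn: "data_norm w \<phi> \<psi> = (nsum (%n. ennreal (A \<phi> \<psi> n)))" for \<phi> \<psi>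
  by (simp only: data_norm_def A_def)
 have A0: "A \<phi> \<psi> n >= 0" for \<phi> \<psi> n by (simp add: A_def)
 have "A \<phi> \<psi> n <= 2 * (A \<phi>' \<psi>' n + A (%n. \<phi> n - \<phi>' n) (%n. \<psi> n - \<psi>' n) n)" for n
  using sq[of "w n" "\<phi> n" "\<phi>' n"] sq[of "w n / bracket (of_int n)" "\<psi> n" "\<psi>' n"] by (simp add: A_def)
 then have "ennreal (A \<phi> \<psi> n) <= 2 * (ennreal (A \<phi>' \<psi>' n) + ennreal (A (%n. \<phi> n - \<phi>' n) (%n. \<psi> n - \<psi>' n) n))" for n
 proof -
  have e: "ennreal (2 * (x + y)) = 2 * (ennreal x + ennreal y)" if "x >= 0" "y >= 0" for x y
   using ennreal_mult[of 2 "x + y"] ennreal_plus[OF that] that by simp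
  from \<open>A \<phi> \<psi> n <= _\<close> show ?thesis unfolding e[OF A0 A0, symmetric] by (rule ennreal_leI)
 qed
 then have "data_norm w \<phi> \<psi> <= (nsum (%n. 2 * (ennreal (A \<phi>' \<psi>' n) + ennreal (A (%n. \<phi> n - \<phi>' n) (%n. \<psi> n - \<psi>' n) n))))"
  unfolding dn by (intro nn_integral_mono)
 also have "... = 2 * (data_norm w \<phi>' \<psi>' + data_norm w (%n. \<phi> n - \<phi>' n) (%n. \<psi> n - \<psi>' n))"
  unfolding dn by (subst nn_integral_cmult, simp, subst nn_integral_add) auto
 finally show ?thesis .
qed

lemma data_norm_Hs:
 assumes "\<phi> \<in> Hs s" "\<psi> \<in> Hs (s - 1)"
 shows "data_norm (%n. bracket (of_int n) powr s) \<phi> \<psi> = ennreal ((Hs_norm s \<phi>)\<^sup>2 + (Hs_norm (s - 1) \<psi>)\<^sup>2)"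
 unfolding data_norm_bracket hs2_eq[OF assms(1)] hs2_eq[OF assms(2)] by (rule ennreal_plus[symmetric]) auto

lemma data_norm_distsq:
 assumes "d \<in> Hs s \<times> Hs (s - 1)" "e \<in> Hs s \<times> Hs (s - 1)"
 shows "data_norm (%n. bracket (of_int n) powr s) (%n. fst d n - fst e n) (%n. snd d n - snd e n) = ennreal (data_distsq s d e)"
proof -
 let ?w = "%n. bracket (of_int n) powr s"
 have "data_norm ?w \<phi> \<psi> = data_norm ?w (%n. - \<phi> n) (%n. - \<psi> n)" for \<phi> \<psi> by (simp add: data_norm_def)
 from this[of "fst e" "snd e"] have "data_norm ?w (%n. fst d n - fst e n) (%n. snd d n - snd e n)
  <= 2 * (data_norm ?w (fst d) (snd d) + data_norm ?w (fst e) (snd e))"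
  using data_norm_triangle[of ?w "%n. fst d n - fst e n" "%n. snd d n - snd e n" "fst d" "snd d"] by simp
 also have "... < \<infinity>" using assms by (auto simp: data_norm_Hs ennreal_mult_less_top)
 finally have "hs2 s (%n. fst d n - fst e n) < \<infinity>" "hs2 (s - 1) (%n. snd d n - snd e n) < \<infinity>"
  unfolding data_norm_bracket by (auto simp: less_top)
 then show ?thesis unfolding data_distsq_def by (intro data_norm_Hs) (simp_all add: Hs_iff)
qed

lemma wnorm_weight_mono:
 assumes [measurable]: "!!n. G n \<in> bmeas" and w: "!!n. 0 <= w n" "!!n. w n <= c * w' n" and c: "c >= 0"
 shows "wnorm w b (cn G) <= ennreal (c\<^sup>2) * wnorm w' b (cn G)"
proof -
 have "(ennreal (x * w n) * z)\<^sup>2 <= ennreal (c\<^sup>2) * (ennreal (x * w' n) * z)\<^sup>2" if "x >= 0" for x z n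
 proof -
  have "ennreal (x * w n) <= ennreal (c * (x * w' n))"
   using mult_left_mono[OF w(2)[of n] that] by (intro ennreal_leI) (simp add: mult_ac)
  also have "... = ennreal c * ennreal (x * w' n)" by (rule ennreal_mult') (rule c)
  finally have "(ennreal (x * w n) * z)\<^sup>2 <= (ennreal c * ennreal (x * w' n) * z)\<^sup>2"
   by (intro power_mono mult_right_mono) auto
  also have "... = ennreal (c\<^sup>2) * (ennreal (x * w' n) * z)\<^sup>2"
   using c by (simp only: power_mult_distrib mult.assoc ennreal_power)
  finally show ?thesis .
 qed
 then have "wnorm w b (cn G) <= nint2 (%n \<tau>. ennreal (c\<^sup>2) * (ennreal (bracket (\<bar>\<tau>\<bar> - gam n) powr b * w' n) * cn G n \<tau>)\<^sup>2)"
  unfolding wnorm_def by (intro nn_integral_mono) simp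
 also have "... = ennreal (c\<^sup>2) * wnorm w' b (cn G)"
  unfolding wnorm_def by (simp add: nn_integral_cmult)
 finally show ?thesis .
qed

section \<open>Elements of \<open>X\<^sub>s\<^sub>,\<^sub>b\<close> are continuous in time\<close>

lemma slice_sum:
 assumes "!!n. G n \<in> bmeas" "!!n. w n >= 0"
 shows "(nsum (%n. ennreal ((w n * cmod (time_slice G t n))\<^sup>2))) <= 2 * bracket_integral (2 * b) * wnorm w b (cn G)"
proof -
 have "(nsum (%n. ennreal ((w n * cmod (time_slice G t n))\<^sup>2)))
  <= (nsum (%n. 2 * bracket_integral (2 * b) * (nnint (%\<tau>. (ennreal (bracket (\<bar>\<tau>\<bar> - gam n) powr b * w n) * cn G n \<tau>)\<^sup>2))))"
  by (intro nn_integral_mono slice_bound assms)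
 also have "... = 2 * bracket_integral (2 * b) * wnorm w b (cn G)"
  unfolding wnorm_def by (rule nn_integral_cmult) simp
 finally show ?thesis .
qed

lemma ift_continuous:
 assumes g: "integrable lborel g"
 shows "continuous_on UNIV (ift g)"
 unfolding continuous_on_eq_continuous_at[OF open_UNIV] continuous_at_sequentially
proof (intro ballI allI impI)
 fix t and X :: "nat => real" assume X: "X \<longlonglongrightarrow> t"
 have [measurable]: "g \<in> bmeas" using g by auto
 have "(%k. LINT \<tau>|lborel. iexp (X k * \<tau>) * g \<tau>) \<longlonglongrightarrow> (LINT \<tau>|lborel. iexp (t * \<tau>) * g \<tau>)"
 proof (rule integral_dominated_convergence[where w = "%\<tau>. cmod (g \<tau>)"])
  show "AE \<tau> in lborel. (%k. iexp (X k * \<tau>) * g \<tau>) \<longlonglongrightarrow> iexp (t * \<tau>) * g \<tau>"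
   by (intro AE_I2 tendsto_intros X)
 qed (use g in \<open>auto simp: norm_mult\<close>)
 then show "(ift g \<circ> X) \<longlonglongrightarrow> ift g t" unfolding ift_def o_def by (rule tendsto_mult_left)
qed

lemma slice_continuous:
 assumes "G \<in> XX w b" "w n > 0" "b > 1 / 2"
 shows "continuous_on A (%t. time_slice G t n)"
 unfolding time_slice_eq_ift using ift_continuous[OF XX_integrable[OF assms]] by (rule continuous_on_subset) simp

text \<open>Each mode is continuous as the transform of an integrable function, and the bound of
 the modes uniformly in time is summable; dominated convergence over the modes gives continuity
 in \<open>H\<^sup>s\<close>.\<close>

lemma slices_in_C_Hs:
 assumes G: "G \<in> XX (%n. bracket (of_int n) powr s) b" and b: "b > 1 / 2" and u: "!!t. t \<in> {0..T} ==> u t = time_slice G t"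
 shows "u \<in> C_Hs s T"
proof -
 note [measurable] = XX_measurable[OF G]
 define w where "w n = bracket (of_int n) powr s" for n :: int
 have w: "w n > 0" for n by (simp add: w_def)
 have BI: "bracket_integral (2 * b) < \<infinity>" using b by (intro bracket_integral_finite) simp
 define B where "B n = 2 * bracket_integral (2 * b) * (nnint (%\<tau>. (ennreal (bracket (\<bar>\<tau>\<bar> - gam n) powr b * w n) * cn G n \<tau>)\<^sup>2))" for n
 have B: "ennreal ((w n * cmod (time_slice G t n))\<^sup>2) <= B n" for t n
  unfolding B_def by (rule slice_bound) (use w in \<open>auto simp: less_imp_le\<close>)
 have "(nsum (%n. B n)) = 2 * bracket_integral (2 * b) * wnorm w b (cn G)"
  unfolding B_def wnorm_def by (rule nn_integral_cmult) simp
 also have "... < \<infinity>" using BI XX_finite[OF G] by (simp add: ennreal_mult_less_top w_def[abs_def])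
 finally have B_fin: "(nsum (%n. B n)) < \<infinity>" .
 have "u t \<in> Hs s" if "t \<in> {0..T}" for t
  unfolding Hs_iff hs2_def u[OF that] w_def[symmetric]
  by (rule le_less_trans[OF nn_integral_mono[OF B] B_fin])
 moreover have "((%t'. Hs_norm s (%n. u t' n - u t n)) \<longlongrightarrow> 0) (at t within {0..T})" if t: "t \<in> {0..T}" for t
  unfolding tendsto_at_iff_sequentially
 proof (intro allI impI)
  fix X :: "nat => real" assume XT: "\<forall>i. X i \<in> {0..T} - {t}" and X: "X \<longlonglongrightarrow> t"
  let ?D = "%k n. ennreal ((w n * cmod (time_slice G (X k) n - time_slice G t n))\<^sup>2)"
  have "(%k. nsum (%n. ?D k n)) \<longlonglongrightarrow> (\<integral>\<^sup>+n. 0 \<partial>count_space (UNIV :: int set))"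
  proof (rule nn_integral_dominated_convergence[where w = "%n. 4 * B n"])
   show "AE n in count_space UNIV. ?D k n <= 4 * B n" for k
   proof (rule AE_I2)
    fix n
    have "(w n * cmod (time_slice G (X k) n - time_slice G t n))\<^sup>2 <= 2 * ((w n * cmod (time_slice G (X k) n))\<^sup>2 + (w n * cmod (time_slice G t n))\<^sup>2)"
    proof -
     have "w n * cmod (time_slice G (X k) n - time_slice G t n) <= w n * cmod (time_slice G (X k) n) + w n * cmod (time_slice G t n)"
      unfolding distrib_left[symmetric] using w[of n] norm_triangle_ineq4 by (intro mult_left_mono) auto
     then have "(w n * cmod (time_slice G (X k) n - time_slice G t n))\<^sup>2 <= (w n * cmod (time_slice G (X k) n) + w n * cmod (time_slice G t n))\<^sup>2"
      using w[of n] by (intro power_mono) auto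
     also have "... <= 2 * ((w n * cmod (time_slice G (X k) n))\<^sup>2 + (w n * cmod (time_slice G t n))\<^sup>2)"
      using sum_squares_bound[of "w n * cmod (time_slice G (X k) n)" "w n * cmod (time_slice G t n)"] by (simp only: power2_sum) simp
     finally show ?thesis .
    qed
    then have "?D k n <= ennreal (2 * ((w n * cmod (time_slice G (X k) n))\<^sup>2 + (w n * cmod (time_slice G t n))\<^sup>2))" by (rule ennreal_leI)
    also have "... = 2 * (ennreal ((w n * cmod (time_slice G (X k) n))\<^sup>2) + ennreal ((w n * cmod (time_slice G t n))\<^sup>2))"
    proof -
     have "ennreal (2 * (x + y)) = 2 * (ennreal x + ennreal y)" if "x >= 0" "y >= 0" for x y
      using ennreal_mult[of 2 "x + y"] ennreal_plus[OF that] that by simp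
     then show ?thesis by simp
    qed
    also have "... <= 2 * (B n + B n)" by (intro mult_left_mono add_mono B) auto
    also have "... = 4 * B n"
    proof -
     have "2 * (B n + B n) = 2 * (2 * B n)" by (simp only: mult_2)
     then show ?thesis by (simp only: mult.assoc[symmetric]) simp
    qed
    finally show "?D k n <= 4 * B n" .
   qed
   show "AE n in count_space UNIV. (%k. ?D k n) \<longlonglongrightarrow> 0"
   proof (rule AE_I2)
    fix n
    have "isCont (%t. time_slice G t n) t"
     using slice_continuous[OF G _ b, of n UNIV] by (simp add: continuous_on_eq_continuous_at)
    from isCont_tendsto_compose[OF this X]
    have "(%k. (w n * cmod (time_slice G (X k) n - time_slice G t n))\<^sup>2) \<longlonglongrightarrow> (w n * cmod (time_slice G t n - time_slice G t n))\<^sup>2"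
     by (intro tendsto_intros)
    from tendsto_ennrealI[OF this] show "(%k. ?D k n) \<longlonglongrightarrow> 0" by simp
   qed
   show "(nsum (%n. 4 * B n)) < \<infinity>"
    using B_fin by (simp add: nn_integral_cmult ennreal_mult_less_top)
  qed auto
  then have "(%k. nsum (%n. ?D k n)) \<longlonglongrightarrow> ennreal 0" by simp
  then have "(%k. enn2real (nsum (%n. ?D k n))) \<longlonglongrightarrow> 0" by (rule tendsto_enn2real) simp
  then have "(%k. sqrt (enn2real (nsum (%n. ?D k n)))) \<longlonglongrightarrow> sqrt 0" by (rule tendsto_real_sqrt)
  moreover have "Hs_norm s (%n. u (X k) n - u t n) = sqrt (enn2real (nsum (%n. ?D k n)))" for k
  proof -
   have "u (X k) = time_slice G (X k)" "u t = time_slice G t" using XT t u by auto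
   then show ?thesis by (simp add: Hs_norm_eq hs2_def w_def)
  qed
  ultimately show "((%t'. Hs_norm s (%n. u t' n - u t n)) \<circ> X) \<longlonglongrightarrow> 0" by (simp add: o_def)
 qed
 ultimately show ?thesis by (simp add: C_Hs_def)
qed

section \<open>Solutions on an interval\<close>

lemma Vs_continuous: "continuous_on A (%t'. Vs (t - t') n)"
proof -
 define c where "c = inverse (2 * \<i> * cor (gam n))"
 have eq: "Vs x n = (iexp (x * gam n) - exp (- \<i> * cor (x * gam n))) * c" for x
  by (simp only: Vs_def c_def divide_inverse)
 show ?thesis unfolding eq by (intro continuous_intros)
qed

context exponents

begin

text \<open>The weight \<open>wt om\<close> is equivalent to the one of \<open>H\<^sup>s\<close>, with constants that may depend on \<open>om\<close>.\<close>

definition adapted :: "real => (int => real) => real => bool" where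
 "adapted s om C \<longleftrightarrow> submult om \<and> C > 0 \<and>
  (\<forall>n. wt om n <= bracket (of_int n) powr s \<and> bracket (of_int n) powr s <= C * wt om n)"

lemma adaptedD:
 assumes "adapted s om C"
 shows "submult om" "C > 0" "wt om n <= bracket (of_int n) powr s" "bracket (of_int n) powr s <= C * wt om n" "wt om n > 0"
 using assms wt_pos[of om n] by (auto simp: adapted_def)

lemma b_bounds: "0 <= b" "b <= 1"
 using a_gt b_gt ab by auto

lemma adapted_normsq:
 assumes "adapted s om C" "!!n. G n \<in> bmeas"
 shows "Xsb_normsq s b G <= ennreal (C\<^sup>2) * N om G"
 unfolding Xsb_normsq_eq
 by (rule wnorm_weight_mono) (use adaptedD[OF assms(1)] assms(2) in \<open>auto simp: less_imp_le\<close>)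

lemma adapted_XX:
 assumes "adapted s om C"
 shows "G \<in> Xsb s b \<longleftrightarrow> G \<in> XX (wt om) b"
 unfolding Xsb_iff[OF b_bounds]
proof
 assume G: "G \<in> XX (%n. bracket (of_int n) powr s) b"
 have "N om G <= ennreal (1\<^sup>2) * wnorm (%n. bracket (of_int n) powr s) b (cn G)"
  by (rule wnorm_weight_mono) (use XX_measurable[OF G] adaptedD[OF assms] in \<open>auto simp: less_imp_le\<close>)
 also have "... < \<infinity>" using XX_finite[OF G] by simp
 finally show "G \<in> XX (wt om) b" using XX_measurable[OF G] by (simp add: XX_def)
next
 assume G: "G \<in> XX (wt om) b"
 have "Xsb_normsq s b G <= ennreal (C\<^sup>2) * N om G"
  by (rule adapted_normsq[OF assms]) (rule XX_measurable[OF G])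
 also have "... < \<infinity>" using XX_finite[OF G] by (simp add: ennreal_mult_less_top)
 finally show "G \<in> XX (%n. bracket (of_int n) powr s) b"
  using XX_measurable[OF G] unfolding XX_def Xsb_normsq_eq by simp
qed

lemma mode_integrable:
 assumes om: "submult om" and G: "G \<in> XX (wt om) b" and H: "H \<in> XX (wt om) b"
 shows "set_integrable lborel {0..t} (%t'. Vs (t - t') n * (- (of_int n)\<^sup>2 * (time_slice G t' m * time_slice H t' (n - m))))"
 by (intro borel_integrable_atLeastAtMost' continuous_intros Vs_continuous slice_continuous[OF G wt_pos[OF om] b_gt] slice_continuous[OF H wt_pos[OF om] b_gt])

text \<open>The polarised identity \<open>g g' - h h' = (g - h) g' + h (g' - h')\<close>,
 integrated in time.\<close>

lemma mode_duhamel_difference: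
 assumes om: "submult om" and G: "G \<in> XX (wt om) b" and H: "H \<in> XX (wt om) b"
 defines "E \<equiv> %n \<tau>. G n \<tau> - H n \<tau>"
 shows "mode_duhamel (time_slice G) (time_slice G) t n m - mode_duhamel (time_slice H) (time_slice H) t n m
  = mode_duhamel (time_slice E) (time_slice G) t n m + mode_duhamel (time_slice H) (time_slice E) t n m"
proof -
 have E: "E \<in> XX (wt om) b" unfolding E_def by (rule XX_diff[OF G H])
 have e: "time_slice E t' k = time_slice G t' k - time_slice H t' k" for t' k
  unfolding E_def by (rule time_slice_diff[OF G H wt_pos[OF om] b_gt])
 note int = mode_integrable[OF om]
 show ?thesis
  unfolding mode_duhamel_def set_integral_diff(2)[OF int[OF G G] int[OF H H], symmetric]
   set_integral_add(2)[OF int[OF E G] int[OF H E], symmetric]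
  by (intro arg_cong[where f = "set_lebesgue_integral lborel {0..t}"] ext) (simp add: e algebra_simps)
qed

text \<open>The difference of two solutions solves a linear equation with coefficients in the
 same space.\<close>

lemma slices_unique:
 assumes om: "submult om" and G: "G \<in> XX (wt om) b" and H: "H \<in> XX (wt om) b"
  and eqG: "!!t n. t \<in> {0..T} ==> time_slice G t n = L t n - (\<Sum>\<^sub>\<infinity>m. mode_duhamel (time_slice G) (time_slice G) t n m)"
  and eqH: "!!t n. t \<in> {0..T} ==> time_slice H t n = L t n - (\<Sum>\<^sub>\<infinity>m. mode_duhamel (time_slice H) (time_slice H) t n m)"
  and t: "t \<in> {0..T}"
 shows "time_slice G t n = time_slice H t n"
proof -
 define E where "E = (%n \<tau>. G n \<tau> - H n \<tau>)"
 have E: "E \<in> XX (wt om) b" unfolding E_def by (rule XX_diff[OF G H])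
 have e: "time_slice E t n = time_slice G t n - time_slice H t n" for t n
  unfolding E_def by (rule time_slice_diff[OF G H wt_pos[OF om] b_gt])
 note summable = duhamel_of_st_conv(2)[OF om]
 have "time_slice E t n = - ((\<Sum>\<^sub>\<infinity>m. mode_duhamel (time_slice E) (time_slice G) t n m) + (\<Sum>\<^sub>\<infinity>m. mode_duhamel (time_slice H) (time_slice E) t n m))"
  if t: "t \<in> {0..T}" for t n
 proof -
  have t0: "t >= 0" using t by simp
  have "(\<Sum>\<^sub>\<infinity>m. mode_duhamel (time_slice G) (time_slice G) t n m) - (\<Sum>\<^sub>\<infinity>m. mode_duhamel (time_slice H) (time_slice H) t n m)
   = (\<Sum>\<^sub>\<infinity>m. mode_duhamel (time_slice G) (time_slice G) t n m - mode_duhamel (time_slice H) (time_slice H) t n m)"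
   by (rule infsum_diff_complex[symmetric]) (use summable[OF G G t0] summable[OF H H t0] in auto)
  also have "... = (\<Sum>\<^sub>\<infinity>m. mode_duhamel (time_slice E) (time_slice G) t n m + mode_duhamel (time_slice H) (time_slice E) t n m)"
   unfolding mode_duhamel_difference[OF om G H, folded E_def] ..
  also have "... = (\<Sum>\<^sub>\<infinity>m. mode_duhamel (time_slice E) (time_slice G) t n m) + (\<Sum>\<^sub>\<infinity>m. mode_duhamel (time_slice H) (time_slice E) t n m)"
   by (rule infsum_add) (use summable[OF E G t0] summable[OF H E t0] in auto)
  finally show ?thesis unfolding e eqG[OF t] eqH[OF t] by (simp add: algebra_simps)
 qed
 from difference_vanishes[OF om E G H this t, of n] show ?thesis using e[of t n] by simp
qed

text \<open>The form of the nonlinearity that does not depend on the sign of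
 \<open>s\<close>.\<close>

lemma duhamel_integral_modes:
 assumes ad: "adapted s om C" and G: "G \<in> XX (wt om) b" and u: "!!t'. t' \<in> {0..t} ==> u t' = time_slice G t'" and t: "t >= 0"
 shows "duhamel_integral s u G t n = (\<Sum>\<^sub>\<infinity>m. mode_duhamel (time_slice G) (time_slice G) t n m)"
proof (cases "s >= 0")
 case True
 have "wt om n >= 1 / C" for n
 proof -
  have "1 <= bracket (of_int n) powr s" using True by (simp add: ge_one_powr_ge_zero)
  also have "... <= C * wt om n" by (rule adaptedD(4)[OF ad])
  finally show ?thesis using adaptedD(2)[OF ad] by (simp add: divide_le_eq mult.commute)
 qed
 then have "duhamel_integral s u G t n = (\<Sum>\<^sub>\<infinity>m. mode_duhamel u u t n m)"
  using adaptedD(2)[OF ad] by (intro duhamel_integral_nonneg[OF True G _ _ b_gt t u, where c = "1 / C"]) auto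
 also have "mode_duhamel u u t n = mode_duhamel (time_slice G) (time_slice G) t n"
  by (intro ext mode_duhamel_cong u)
 finally show ?thesis .
next
 case False
 then have "duhamel_integral s u G t n = duhamel_of (st_square G) t n" using t by (intro duhamel_integral_negative) auto
 then show ?thesis unfolding st_square_eq using duhamel_of_st_conv(1)[OF adaptedD(1)[OF ad] G G t] by simp
qed

lemma solution_iff_modes:
 assumes ad: "adapted s om C"
 shows "solution s b T \<phi> \<psi> u \<longleftrightarrow> (\<exists>G\<in>XX (wt om) b. (\<forall>t\<in>{0..T}. u t = time_slice G t) \<and>
  (\<forall>t\<in>{0..T}. \<forall>n. time_slice G t n = (Vc t n * \<phi> n + Vs t n * dx \<psi> n)
    - (\<Sum>\<^sub>\<infinity>m. mode_duhamel (time_slice G) (time_slice G) t n m)))" (is "_ \<longleftrightarrow> ?R")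
proof
 assume "solution s b T \<phi> \<psi> u"
 then obtain G where G: "G \<in> Xsb s b" "!!t. t \<in> {0..T} ==> u t = time_slice G t"
  and eq: "!!t n. t \<in> {0..T} ==> u t n = Vc t n * \<phi> n + Vs t n * dx \<psi> n - duhamel_integral s u G t n"
  unfolding solution_def extensions_def by blast
 have GX: "G \<in> XX (wt om) b" using G(1) adapted_XX[OF ad] by simp
 have "time_slice G t n = (Vc t n * \<phi> n + Vs t n * dx \<psi> n) - (\<Sum>\<^sub>\<infinity>m. mode_duhamel (time_slice G) (time_slice G) t n m)"
  if t: "t \<in> {0..T}" for t n
 proof -
  have "duhamel_integral s u G t n = (\<Sum>\<^sub>\<infinity>m. mode_duhamel (time_slice G) (time_slice G) t n m)"
   using t by (intro duhamel_integral_modes[OF ad GX G(2)]) auto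
  then show ?thesis using eq[OF t, of n] G(2)[OF t] by simp
 qed
 then show ?R using GX G(2) by blast
next
 assume ?R
 then obtain G where GX: "G \<in> XX (wt om) b" and u: "!!t. t \<in> {0..T} ==> u t = time_slice G t"
  and eq: "!!t n. t \<in> {0..T} ==> time_slice G t n = (Vc t n * \<phi> n + Vs t n * dx \<psi> n)
    - (\<Sum>\<^sub>\<infinity>m. mode_duhamel (time_slice G) (time_slice G) t n m)" by blast
 have G: "G \<in> Xsb s b" using GX adapted_XX[OF ad] by simp
 then have ext: "G \<in> extensions s b T u" using u by (simp add: extensions_def)
 have "u \<in> C_Hs s T"
  by (rule slices_in_C_Hs[OF _ b_gt u]) (use G Xsb_iff[OF b_bounds] in auto)
 moreover have "u t n = Vc t n * \<phi> n + Vs t n * dx \<psi> n - duhamel_integral s u G t n" if t: "t \<in> {0..T}" for t n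
 proof -
  have "duhamel_integral s u G t n = (\<Sum>\<^sub>\<infinity>m. mode_duhamel (time_slice G) (time_slice G) t n m)"
   using t by (intro duhamel_integral_modes[OF ad GX u]) auto
  then show ?thesis using eq[OF t, of n] u[OF t] by simp
 qed
 ultimately show "solution s b T \<phi> \<psi> u" using ext unfolding solution_def XsbT_def by blast
qed

lemma solutions_agree:
 assumes ad: "adapted s om C" and "solution s b T \<phi> \<psi> u" "solution s b T \<phi> \<psi> v" and t: "t \<in> {0..T}"
 shows "u t = v t"
proof -
 from assms(2) obtain G where G: "G \<in> XX (wt om) b" "!!t. t \<in> {0..T} ==> u t = time_slice G t"
  "!!t n. t \<in> {0..T} ==> time_slice G t n = (Vc t n * \<phi> n + Vs t n * dx \<psi> n) - (\<Sum>\<^sub>\<infinity>m. mode_duhamel (time_slice G) (time_slice G) t n m)"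
  unfolding solution_iff_modes[OF ad] by blast
 from assms(3) obtain H where H: "H \<in> XX (wt om) b" "!!t. t \<in> {0..T} ==> v t = time_slice H t"
  "!!t n. t \<in> {0..T} ==> time_slice H t n = (Vc t n * \<phi> n + Vs t n * dx \<psi> n) - (\<Sum>\<^sub>\<infinity>m. mode_duhamel (time_slice H) (time_slice H) t n m)"
  unfolding solution_iff_modes[OF ad] by blast
 have "time_slice G t n = time_slice H t n" for n
  by (rule slices_unique[OF adaptedD(1)[OF ad] G(1) H(1) G(3) H(3) t])
 then show ?thesis using G(2)[OF t] H(2)[OF t] by auto
qed

text \<open>The interval length \<open>d\<close> and the radius \<open>r\<close> serve all
 submultiplicative weights at once; this is what decouples the time of existence from the
 regularity of the data.\<close>

definition good_time :: "real => real => real => real => bool" where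
 "good_time K M r d \<longleftrightarrow> 0 < d \<and> d <= 1 \<and> (\<forall>\<delta> om. 0 < \<delta> \<longrightarrow> \<delta> <= d \<longrightarrow> submult om \<longrightarrow>
   (\<forall>\<phi> \<psi>. data_norm (wt om) \<phi> \<psi> <= ennreal M \<longrightarrow> (\<exists>G. fixed \<delta> om \<phi> \<psi> G \<and> N om G <= ennreal r)) \<and>
   (\<forall>\<phi> \<psi> \<phi>' \<psi>' G H. data_norm (wt om) \<phi> \<psi> <= ennreal M \<longrightarrow> data_norm (wt om) \<phi>' \<psi>' <= ennreal M \<longrightarrow>
    fixed \<delta> om \<phi> \<psi> G \<longrightarrow> fixed \<delta> om \<phi>' \<psi>' H \<longrightarrow> N om G <= ennreal r \<longrightarrow> N om H <= ennreal r \<longrightarrow>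
    N om (%n \<tau>. G n \<tau> - H n \<tau>) <= ennreal K * data_norm (wt om) (%n. \<phi> n - \<phi>' n) (%n. \<psi> n - \<psi>' n)))"

lemma good_time_solution:
 assumes ad: "adapted s om C" and good: "good_time K M r d" and \<delta>: "0 < \<delta>" "\<delta> <= d" and data: "data_norm (wt om) \<phi> \<psi> <= ennreal M"
 obtains G where "fixed \<delta> om \<phi> \<psi> G" "N om G <= ennreal r" "solution s b \<delta> \<phi> \<psi> (time_slice G)"
proof -
 obtain G where G: "fixed \<delta> om \<phi> \<psi> G" "N om G <= ennreal r"
  using good[unfolded good_time_def, THEN conjunct2, THEN conjunct2, rule_format, OF \<delta> adaptedD(1)[OF ad], THEN conjunct1,
    rule_format, OF data] by blast
 have "\<delta> <= 1" using good \<delta> by (simp add: good_time_def)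
 moreover have "data_norm (wt om) \<phi> \<psi> < \<infinity>" using data by (rule le_less_trans) simp
 ultimately have "\<forall>t\<in>{0..\<delta>}. \<forall>n. time_slice G t n = (Vc t n * \<phi> n + Vs t n * dx \<psi> n)
    - (\<Sum>\<^sub>\<infinity>m. mode_duhamel (time_slice G) (time_slice G) t n m)"
  using fixed_slice[OF adaptedD(1)[OF ad] _ G(1) \<delta>(1)] by blast
 then have "solution s b \<delta> \<phi> \<psi> (time_slice G)"
  unfolding solution_iff_modes[OF ad] using G(1) by (auto simp: fixed_def)
 then show ?thesis using that G by blast
qed

lemma good_time_unique_solution:
 assumes "adapted s om C" "good_time K M r d" "0 < \<delta>" "\<delta> <= d" "data_norm (wt om) \<phi> \<psi> <= ennreal M"
 shows "unique_solution s b \<delta> \<phi> \<psi>"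
proof -
 obtain G where G: "solution s b \<delta> \<phi> \<psi> (time_slice G)" using good_time_solution[OF assms] by blast
 then show ?thesis unfolding unique_solution_def using solutions_agree[OF assms(1)] by blast
qed

text \<open>Any two solutions coincide with the constructed ones, whose extensions depend on the
 data in a Lipschitz way; both norms of the target are controlled by the norm of the difference
 of extensions.\<close>

lemma good_time_lipschitz:
 assumes ad: "adapted s om C" and good: "good_time K M r d" and K: "K >= 0" and \<delta>: "0 < \<delta>" "\<delta> <= d"
  and W: "W \<subseteq> Hs s \<times> Hs (s - 1)" and data: "!!e. e \<in> W ==> data_norm (wt om) (fst e) (snd e) <= ennreal M"
 shows "lipschitz_solution_map s b \<delta> W"
proof -
 define \<beta> where "\<beta> = enn2real (2 * bracket_integral (2 * b))"
 have "bracket_integral (2 * b) < \<infinity>" using b_gt by (intro bracket_integral_finite) simp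
 then have \<beta>: "2 * bracket_integral (2 * b) = ennreal \<beta>" "\<beta> >= 0"
  by (auto simp: \<beta>_def ennreal_mult_less_top)
 define A where "A = C\<^sup>2 * K"
 have A: "A >= 0" using K by (simp add: A_def)
 have est: "C_Hs_norm s \<delta> (%t n. u t n - v t n) + XsbT_norm s b \<delta> (%t n. u t n - v t n) <= (sqrt (\<beta> * A) + sqrt A) * sqrt (data_distsq s e f)"
  if e: "e \<in> W" and f: "f \<in> W" and u: "solution s b \<delta> (fst e) (snd e) u" and v: "solution s b \<delta> (fst f) (snd f) v" for e f u v
 proof -
  obtain G where G: "fixed \<delta> om (fst e) (snd e) G" "N om G <= ennreal r" "solution s b \<delta> (fst e) (snd e) (time_slice G)"
   using good_time_solution[OF ad good \<delta> data[OF e]] by blast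
  obtain H where H: "fixed \<delta> om (fst f) (snd f) H" "N om H <= ennreal r" "solution s b \<delta> (fst f) (snd f) (time_slice H)"
   using good_time_solution[OF ad good \<delta> data[OF f]] by blast
  define E where "E = (%n \<tau>. G n \<tau> - H n \<tau>)"
  have GX: "G \<in> XX (wt om) b" and HX: "H \<in> XX (wt om) b" using G(1) H(1) by (auto simp: fixed_def)
  have EX: "E \<in> XX (wt om) b" unfolding E_def by (rule XX_diff[OF GX HX])
  note Em = XX_measurable[OF EX]
  have dif: "(%n. u t n - v t n) = time_slice E t" if t: "t \<in> {0..\<delta>}" for t
   using solutions_agree[OF ad u G(3) t] solutions_agree[OF ad v H(3) t]
    time_slice_diff[OF GX HX wt_pos[OF adaptedD(1)[OF ad]] b_gt, of t] by (simp add: E_def fun_eq_iff)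
  define D where "D = data_distsq s e f"
  have D0: "D >= 0" by (simp add: D_def data_distsq_def)
  have "N om E <= ennreal K * data_norm (wt om) (%n. fst e n - fst f n) (%n. snd e n - snd f n)"
   unfolding E_def
   by (rule good[unfolded good_time_def, THEN conjunct2, THEN conjunct2, rule_format, OF \<delta> adaptedD(1)[OF ad], THEN conjunct2,
      rule_format, OF data[OF e] data[OF f] G(1) H(1) G(2) H(2)])
  also have "... <= ennreal K * data_norm (%n. bracket (of_int n) powr s) (%n. fst e n - fst f n) (%n. snd e n - snd f n)"
   by (intro mult_left_mono data_norm_mono) (use adaptedD[OF ad] in \<open>auto simp: less_imp_le\<close>)
  also have "... = ennreal K * ennreal D"
   unfolding D_def using subsetD[OF W e] subsetD[OF W f] by (simp only: data_norm_distsq)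
  also have "... = ennreal (K * D)" by (rule ennreal_mult'[symmetric]) (rule K)
  finally have NE: "N om E <= ennreal (K * D)" .
  have "Xsb_normsq s b E <= ennreal (C\<^sup>2) * N om E" by (rule adapted_normsq[OF ad Em])
  also have "... <= ennreal (C\<^sup>2) * ennreal (K * D)" by (intro mult_left_mono NE) simp
  also have "... = ennreal (A * D)"
   unfolding A_def mult.assoc by (rule ennreal_mult'[symmetric]) simp
  finally have XE: "Xsb_normsq s b E <= ennreal (A * D)" .
  then have "enn2real (Xsb_normsq s b E) <= A * D" using A D0 by (intro enn2real_leI) auto
  then have XEn: "Xsb_norm s b E <= sqrt A * sqrt D"
   unfolding Xsb_norm_def real_sqrt_mult[symmetric] by (rule real_sqrt_le_mono)
  have Eext: "E \<in> extensions s b \<delta> (%t n. u t n - v t n)"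
   using EX adapted_XX[OF ad] dif by (simp add: extensions_def)
  have "XsbT_norm s b \<delta> (%t n. u t n - v t n) <= Xsb_norm s b E"
   unfolding XsbT_norm_def
   by (rule cINF_lower[OF _ Eext], rule bdd_belowI[of _ 0]) (auto simp: Xsb_norm_def)
  then have part1: "XsbT_norm s b \<delta> (%t n. u t n - v t n) <= sqrt A * sqrt D" using XEn by simp
  have part2: "C_Hs_norm s \<delta> (%t n. u t n - v t n) <= sqrt (\<beta> * A) * sqrt D"
   unfolding C_Hs_norm_def
  proof (rule cSUP_least)
   show "{0..\<delta>} \<noteq> {}" using \<delta> by simp
   fix t assume t: "t \<in> {0..\<delta>}"
   have "hs2 s (time_slice E t) <= 2 * bracket_integral (2 * b) * Xsb_normsq s b E"
    unfolding hs2_def Xsb_normsq_eq by (rule slice_sum) (use Em in auto)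
   also have "... <= ennreal \<beta> * ennreal (A * D)" unfolding \<beta>(1) by (intro mult_left_mono XE) simp
   also have "... = ennreal (\<beta> * A * D)"
    unfolding mult.assoc by (rule ennreal_mult'[symmetric]) (rule \<beta>(2))
   finally have "enn2real (hs2 s (time_slice E t)) <= \<beta> * A * D" using \<beta>(2) A D0 by (intro enn2real_leI) auto
   then show "Hs_norm s (%n. u t n - v t n) <= sqrt (\<beta> * A) * sqrt D"
    unfolding dif[OF t] Hs_norm_eq real_sqrt_mult[symmetric] by (rule real_sqrt_le_mono)
  qed
  show ?thesis using part1 part2 by (simp add: D_def distrib_right)
 qed
 have "sqrt (\<beta> * A) + sqrt A >= 0" using \<beta>(2) A by simp
 moreover have "unique_solution s b \<delta> (fst e) (snd e)" if "e \<in> W" for e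
  by (rule good_time_unique_solution[OF ad good \<delta> data[OF that]])
 ultimately show ?thesis unfolding lipschitz_solution_map_def using est by blast
qed

section \<open>Persistence of regularity\<close>

text \<open>For \<open>K\<close> large this is close to
 \<open>\<langle>n\<rangle>\<^bsup>s+\<rho>\<^esup>\<close> on any given finite set of modes,
 and for every \<open>K\<close> it is equivalent to
 \<open>\<langle>n\<rangle>\<^bsup>s'+\<rho>\<^esup>\<close>.\<close>

definition reg_weight :: "real => real => real => int => real" where
 "reg_weight s s' K n = bracket (of_int n) powr (s + \<rho>) * bracket (of_int n / K) powr (s' - s)"

lemma wt_reg_weight: "wt (reg_weight s s' K) n = bracket (of_int n) powr s * bracket (of_int n / K) powr (s' - s)"
 by (simp add: wt_def reg_weight_def powr_add[symmetric] mult.assoc[symmetric])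

lemma bracket_scale:
 assumes "K >= 1"
 shows "bracket (x / K) <= bracket x" "bracket x <= K * bracket (x / K)"
proof -
 have "\<bar>x\<bar> / K <= \<bar>x\<bar> / 1" using assms by (intro divide_left_mono) auto
 then show "bracket (x / K) <= bracket x" using assms by (simp add: bracket_def abs_divide)
 show "bracket x <= K * bracket (x / K)" using assms by (simp add: bracket_def abs_divide distrib_left)
qed

lemma reg_weight_adapted:
 assumes s: "s + \<rho> >= 0" "s <= s'" and K: "K >= 1"
 shows "adapted s' (reg_weight s s' K) (K powr (s' - s))"
 unfolding adapted_def submult_def
proof (intro conjI allI)
 fix n m :: int
 show "reg_weight s s' K n > 0" by (simp add: reg_weight_def)
 have sub: "bracket (of_int n / L) <= bracket (of_int m / L) * bracket (of_int (n - m) / L)" for L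
  using bracket_add_le_mult[of "of_int m / L" "of_int (n - m) / L"] by (simp add: add_divide_distrib[symmetric])
 have "reg_weight s s' K n <= (bracket (of_int m) * bracket (of_int (n - m))) powr (s + \<rho>)
  * (bracket (of_int m / K) * bracket (of_int (n - m) / K)) powr (s' - s)"
  unfolding reg_weight_def using sub[of 1] sub[of K] s by (intro mult_mono powr_mono2) auto
 then show "reg_weight s s' K n <= reg_weight s s' K m * reg_weight s s' K (n - m)"
  unfolding reg_weight_def by (simp only: powr_mult bracket_nonneg mult_ac)
 have "bracket (of_int n) powr s * bracket (of_int n / K) powr (s' - s) <= bracket (of_int n) powr s * bracket (of_int n) powr (s' - s)"
  using bracket_scale(1)[OF K] s by (intro mult_left_mono powr_mono2) auto
 then show "wt (reg_weight s s' K) n <= bracket (of_int n) powr s'"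
  by (simp add: wt_reg_weight powr_add[symmetric])
 have upper: "bracket (of_int n) powr s * bracket (of_int n) powr (s' - s) <= bracket (of_int n) powr s * (K * bracket (of_int n / K)) powr (s' - s)"
  using bracket_scale(2)[OF K] s by (intro mult_left_mono powr_mono2) auto
 show "bracket (of_int n) powr s' <= K powr (s' - s) * wt (reg_weight s s' K) n"
 proof -
  have "bracket (of_int n) powr s * bracket (of_int n) powr (s' - s) = bracket (of_int n) powr s'"
   unfolding powr_add[symmetric] by simp
  moreover have "(K * bracket (of_int n / K)) powr (s' - s) = K powr (s' - s) * bracket (of_int n / K) powr (s' - s)"
   using K by (intro powr_mult)
  ultimately show ?thesis
   using upper by (simp only: wt_reg_weight mult.left_commute)
 qed
 show "0 < K powr (s' - s)" using K by simp
qed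

text \<open>Dominated convergence as \<open>K\<close> tends to infinity; the norm of the data in
 \<open>H\<^bsup>s'\<^esup>\<close> is the majorant.\<close>

lemma data_norm_limit:
 assumes s: "s + \<rho> >= 0" "s <= s'" and data: "\<phi> \<in> Hs s'" "\<psi> \<in> Hs (s' - 1)" and e: "\<epsilon> > 0"
 obtains K where "K >= 1" "data_norm (wt (reg_weight s s' K)) \<phi> \<psi> <= data_norm (%n. bracket (of_int n) powr s) \<phi> \<psi> + ennreal \<epsilon>"
proof -
 let ?d = "%w n. ennreal ((w n * cmod (\<phi> n))\<^sup>2 + (w n * (cmod (\<psi> n) / bracket (of_int n)))\<^sup>2)"
 let ?W = "%k. wt (reg_weight s s' (real (Suc k)))"
 let ?s = "%n :: int. bracket (of_int n) powr s" and ?s' = "%n :: int. bracket (of_int n) powr s'"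
 note ad = reg_weight_adapted[OF s]
 have fin: "data_norm ?s' \<phi> \<psi> < \<infinity>" by (simp add: data_norm_Hs[OF data])
 have "(%k. nsum (%n. ?d (?W k) n)) \<longlonglongrightarrow> (nsum (%n. ?d ?s n))"
 proof (rule nn_integral_dominated_convergence[where w = "?d ?s'"])
  show "AE n in count_space UNIV. ?d (?W k) n <= ?d ?s' n" for k
   using adaptedD(3,5)[OF ad[of "real (Suc k)"]]
   by (intro AE_I2 ennreal_leI add_mono power_mono mult_right_mono) (auto simp: less_imp_le)
  show "AE n in count_space UNIV. (%k. ?d (?W k) n) \<longlonglongrightarrow> ?d ?s n"
  proof (rule AE_I2)
   fix n :: int
   have "(%k. 1 + \<bar>of_int n\<bar> * inverse (real (Suc k))) \<longlonglongrightarrow> 1 + \<bar>of_int n\<bar> * 0"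
    by (intro tendsto_intros LIMSEQ_inverse_real_of_nat)
   then have "(%k. bracket (of_int n / real (Suc k))) \<longlonglongrightarrow> 1"
    by (simp add: bracket_def abs_mult divide_inverse)
   then have "(%k. bracket (of_int n / real (Suc k)) powr (s' - s)) \<longlonglongrightarrow> 1 powr (s' - s)"
    by (intro tendsto_powr tendsto_const) auto
   from tendsto_mult_left[OF this, of "?s n"] have "(%k. ?W k n) \<longlonglongrightarrow> ?s n" by (simp add: wt_reg_weight)
   then show "(%k. ?d (?W k) n) \<longlonglongrightarrow> ?d ?s n" by (intro tendsto_ennrealI tendsto_intros)
  qed
  show "(nsum (%n. ?d ?s' n)) < \<infinity>" using fin by (simp add: data_norm_def)
 qed auto
 then have lim: "(%k. data_norm (?W k) \<phi> \<psi>) \<longlonglongrightarrow> data_norm ?s \<phi> \<psi>" unfolding data_norm_def .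
 have "data_norm ?s \<phi> \<psi> <= data_norm ?s' \<phi> \<psi>"
  using s by (intro data_norm_mono powr_mono) auto
 then have "data_norm ?s \<phi> \<psi> < \<infinity>" using fin by (rule le_less_trans)
 then have "data_norm ?s \<phi> \<psi> < data_norm ?s \<phi> \<psi> + ennreal \<epsilon>"
  using e by (simp add: ennreal_add_left_cancel_less[of _ 0, simplified] less_top)
 from order_tendstoD(2)[OF lim this] obtain k where "data_norm (?W k) \<phi> \<psi> < data_norm ?s \<phi> \<psi> + ennreal \<epsilon>"
  by (auto simp: eventually_sequentially)
 then have "data_norm (?W k) \<phi> \<psi> <= data_norm ?s \<phi> \<psi> + ennreal \<epsilon>" by (rule less_imp_le)
 then show ?thesis by (rule that[rotated]) simp
qed

text \<open>The weight is chosen so that the data have norm at most \<open>Q + 1/4\<close>; data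
 at squared distance less than \<open>1/2\<close> then stay below \<open>2 Q + 2\<close>, the
 size for which the interval was chosen.\<close>

lemma wellposed:
 assumes good: "good_time K0 (2 * Q + 2) r d" and K0: "K0 >= 0" and Q: "Q >= 0" and s: "s + \<rho> >= 0" "s <= s'"
  and data: "\<phi> \<in> Hs s'" "\<psi> \<in> Hs (s' - 1)" and size: "data_norm (%n. bracket (of_int n) powr s) \<phi> \<psi> <= ennreal Q"
 shows "unique_solution s' b d \<phi> \<psi> \<and> (\<forall>T'\<in>{0<..<d}. \<exists>R>0. lipschitz_solution_map s' b T' (data_nbhd s' (\<phi>, \<psi>) R))"
proof -
 obtain K where K: "K >= 1" "data_norm (wt (reg_weight s s' K)) \<phi> \<psi> <= data_norm (%n. bracket (of_int n) powr s) \<phi> \<psi> + ennreal (1 / 4)"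
  using data_norm_limit[OF s data, of "1 / 4"] by auto
 define om where "om = reg_weight s s' K"
 have ad: "adapted s' om (K powr (s' - s))" unfolding om_def by (rule reg_weight_adapted[OF s K(1)])
 have "data_norm (wt om) \<phi> \<psi> <= ennreal Q + ennreal (1 / 4)"
  unfolding om_def by (rule order_trans[OF K(2)]) (intro add_mono size order_refl)
 also have "... = ennreal (Q + 1 / 4)" using Q by (intro ennreal_plus[symmetric]) auto
 finally have D: "data_norm (wt om) \<phi> \<psi> <= ennreal (Q + 1 / 4)" .
 have d: "0 < d" using good by (simp add: good_time_def)
 have "unique_solution s' b d \<phi> \<psi>"
  by (rule good_time_unique_solution[OF ad good d order_refl]) (rule order_trans[OF D], rule ennreal_leI, use Q in simp)
 moreover have "lipschitz_solution_map s' b T' (data_nbhd s' (\<phi>, \<psi>) (1 / 2))" if "T' \<in> {0<..<d}" for T'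
 proof (rule good_time_lipschitz[OF ad good K0])
  fix e assume e: "e \<in> data_nbhd s' (\<phi>, \<psi>) (1 / 2)"
  have "data_norm (wt om) (%n. fst e n - \<phi> n) (%n. snd e n - \<psi> n) <= data_norm (%n. bracket (of_int n) powr s') (%n. fst e n - \<phi> n) (%n. snd e n - \<psi> n)"
   by (intro data_norm_mono) (use adaptedD[OF ad] in \<open>auto simp: less_imp_le\<close>)
  also have "... = ennreal (data_distsq s' e (\<phi>, \<psi>))"
   using data_norm_distsq[of e s' "(\<phi>, \<psi>)"] e data by (simp add: data_nbhd_def)
  also have "... <= ennreal (1 / 2)" using e by (intro ennreal_leI) (simp add: data_nbhd_def)
  finally have near: "data_norm (wt om) (%n. fst e n - \<phi> n) (%n. snd e n - \<psi> n) <= ennreal (1 / 2)" .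
  have "data_norm (wt om) (fst e) (snd e) <= 2 * (data_norm (wt om) \<phi> \<psi> + data_norm (wt om) (%n. fst e n - \<phi> n) (%n. snd e n - \<psi> n))"
   by (rule data_norm_triangle)
  also have "... <= 2 * (ennreal (Q + 1 / 4) + ennreal (1 / 2))" by (intro mult_left_mono add_mono D near) simp
  also have "... = ennreal (2 * (Q + 1 / 4 + 1 / 2))"
   using Q ennreal_mult[of 2 "Q + 1 / 4 + 1 / 2"] ennreal_plus[of "Q + 1 / 4" "1 / 2"] by simp
  also have "... <= ennreal (2 * Q + 2)" by (intro ennreal_leI) simp
  finally show "data_norm (wt om) (fst e) (snd e) <= ennreal (2 * Q + 2)" .
 qed (use that in \<open>auto simp: data_nbhd_def\<close>)
 ultimately show ?thesis by (intro conjI ballI exI[of _ "1 / 2"]) auto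
qed

lemma good_times_exist:
 obtains K r d where "K >= 0" "!!M. M >= 0 ==> good_time K M (r M) (d M)"
proof (rule local_theory[folded good_time_def])
 fix K :: real assume K: "0 <= K" "!!M. 0 <= M ==> \<exists>r d. good_time K M r d"
 from K(2) have "\<forall>M. \<exists>p. M >= 0 \<longrightarrow> good_time K M (fst p) (snd p)" by auto
 from choice[OF this] obtain p where "\<forall>M. M >= 0 \<longrightarrow> good_time K M (fst (p M)) (snd (p M))" ..
 then show ?thesis by (intro that[OF K(1), of "fst \<circ> p" "snd \<circ> p"]) simp
qed

end

theorem theorem1p3:
  fixes s :: real
  assumes "s > - 1 / 4"
  shows "\<exists>b>1/2. \<exists>T :: real \<Rightarrow> real \<Rightarrow> real.
    \<forall>\<phi>\<in>Hs s. \<forall>\<psi>\<in>Hs (s - 1).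
     let T0 = T (Hs_norm s \<phi>) (Hs_norm (s - 1) \<psi>) in
      T0 > 0 \<and>
      unique_solution s b T0 \<phi> \<psi> \<and>
      (\<forall>T'\<in>{0<..<T0}. \<exists>R>0. lipschitz_solution_map s b T' (data_nbhd s (\<phi>, \<psi>) R)) \<and>
      (\<forall>s'>s. \<phi> \<in> Hs s' \<and> \<psi> \<in> Hs (s' - 1) \<longrightarrow>
         unique_solution s' b T0 \<phi> \<psi> \<and>
         (\<forall>T'\<in>{0<..<T0}. \<exists>R'>0. lipschitz_solution_map s' b T' (data_nbhd s' (\<phi>, \<psi>) R')))"
proof -
  define \<rho> where "\<rho> = max (- s) (1 / 8)"
  define a where "a = \<rho> + 1 / 4"
  define b where "b = 5 / 8 - \<rho> / 2"
  have \<rho>: "1 / 8 \<le> \<rho>" "\<rho> < 1 / 4" "s + \<rho> \<ge> 0" using assms by (auto simp: \<rho>_def)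
  interpret exponents \<rho> a b
    by unfold_locales (use \<rho> in \<open>auto simp: a_def b_def\<close>)
  obtain K r d where K: "K \<ge> 0" and good: "\<And>M. M \<ge> 0 \<Longrightarrow> good_time K M (r M) (d M)"
    using good_times_exist by blast
  define T where "T x y = d (2 * (x\<^sup>2 + y\<^sup>2) + 2)" for x y :: real
  have main: "T (Hs_norm s \<phi>) (Hs_norm (s - 1) \<psi>) > 0 \<and>
      (\<forall>s'\<ge>s. \<phi> \<in> Hs s' \<longrightarrow> \<psi> \<in> Hs (s' - 1) \<longrightarrow> unique_solution s' b (T (Hs_norm s \<phi>) (Hs_norm (s - 1) \<psi>)) \<phi> \<psi> \<and>
         (\<forall>T'\<in>{0<..<T (Hs_norm s \<phi>) (Hs_norm (s - 1) \<psi>)}. \<exists>R>0. lipschitz_solution_map s' b T' (data_nbhd s' (\<phi>, \<psi>) R)))"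
    if data: "\<phi> \<in> Hs s" "\<psi> \<in> Hs (s - 1)" for \<phi> \<psi>
  proof -
    define Q where "Q = (Hs_norm s \<phi>)\<^sup>2 + (Hs_norm (s - 1) \<psi>)\<^sup>2"
    have Q: "Q \<ge> 0" by (simp add: Q_def)
    have g: "good_time K (2 * Q + 2) (r (2 * Q + 2)) (d (2 * Q + 2))" using Q by (intro good) simp
    have Td: "T (Hs_norm s \<phi>) (Hs_norm (s - 1) \<psi>) = d (2 * Q + 2)" by (simp add: T_def Q_def)
    have size: "data_norm (\<lambda>n. bracket (of_int n) powr s) \<phi> \<psi> \<le> ennreal Q"
      unfolding Q_def by (rule eq_refl[OF data_norm_Hs[OF data]])
    show ?thesis unfolding Td
      using g wellposed[OF g K Q \<rho>(3) _ _ _ size] by (auto simp: good_time_def)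
  qed
  show ?thesis
  proof (intro exI[of _ b] exI[of _ T] conjI ballI)
    show "b > 1 / 2" by (rule b_gt)
    fix \<phi> \<psi> assume data: "\<phi> \<in> Hs s" "\<psi> \<in> Hs (s - 1)"
    note m = conjunct2[OF main[OF data], rule_format]
    show "let T0 = T (Hs_norm s \<phi>) (Hs_norm (s - 1) \<psi>) in
      T0 > 0 \<and>
      unique_solution s b T0 \<phi> \<psi> \<and>
      (\<forall>T'\<in>{0<..<T0}. \<exists>R>0. lipschitz_solution_map s b T' (data_nbhd s (\<phi>, \<psi>) R)) \<and>
      (\<forall>s'>s. \<phi> \<in> Hs s' \<and> \<psi> \<in> Hs (s' - 1) \<longrightarrow>
         unique_solution s' b T0 \<phi> \<psi> \<and>
         (\<forall>T'\<in>{0<..<T0}. \<exists>R'>0. lipschitz_solution_map s' b T' (data_nbhd s' (\<phi>, \<psi>) R')))"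
      unfolding Let_def
      using conjunct1[OF main[OF data]] conjunct1[OF m[OF order_refl data]] conjunct2[OF m[OF order_refl data]] conjunct2[OF main[OF data]]
      by (intro conjI allI impI) (assumption | (drule spec, drule mp, erule less_imp_le, simp))+
  qed
qed

end
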